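(* Let $\mu$ be an infinitely divisible distribution on $\mathbb{R}$ with characteristic triplet $(\sigma^2,\gamma,\nu)$, characteristic function $\varphi$ and symmetrized jump measure $\nu_s$. Assume that for some $\delta\in(0,1)$ the measure $x\,\nu_s(\mathrm{d}x)$ admits on $(0,\delta]$ a Lebesgue density $k_s$ with $k_s\in BV([\varepsilon,\delta])$ for all $\varepsilon\in(0,\delta)$, and that $\|(Dk_s)^+\|_{TV([0,\delta])}:=\lim_{\varepsilon\downarrow0}\|(Dk_s)^+\|_{TV([\varepsilon,\delta])}<\infty$. Consider the conditions (i) $\sigma^2=0$ and $\|k_s\|_{BV([0,\delta])}<\infty$; (ii) $\sigma^2=0$ and $\lim_{x\to0}k_s(x)<\infty$; (iii) there are some $\alpha>0$ and some constant $c>0$ such that $|\varphi(u)|\ge c(1+|u|)^{-\alpha}$ for all $u\in\mathbb{R}$. Then one (and thus all) of the conditions (i)–(iii) is satisfied if and only if $1/\varphi$ is a Fourier multiplier on Besov spaces in the following sense: there exists some $\alpha>0$ such that for all $s\in\mathbb{R}$ and all $1\le p,q\le\infty$ the linear map $$B^{s+\alpha}_{p,q}(\mathbb{R})\ni f\mapsto\mathcal{F}^{-1}\Big[\frac{\mathcal{F}f}{\varphi}\Big]\in B^{s}_{p,q}(\mathbb{R})$$ is bounded.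
   Context: An infinitely divisible distribution $\mu$ on $\mathbb{R}$ with characteristic triplet $(\sigma^2,\gamma,\nu)$ ($\sigma^2\ge0$, $\gamma\in\mathbb{R}$, $\nu$ a Lévy measure) has characteristic function $$\varphi(u)=\int e^{iux}\mu(\mathrm{d}x)=\exp\Big(-\tfrac{\sigma^2}{2}u^2+i\gamma u+\int\big(e^{iux}-1-iux\mathbf{1}_{[-1,1]}(x)\big)\nu(\mathrm{d}x)\Big),\quad u\in\mathbb{R}.$$ The symmetrized jump measure on $\mathbb{R}_+$ is $\nu_s(A):=\nu(A)+\nu(-A)$ for Borel sets $A\subseteq\mathbb{R}_+$ (note $\nu(\{0\})=0$). For a locally integrable function $f$ on an interval, if the distributional derivative of $f$ is a finite signed measure, this measure is denoted $Df$. $BV([a,b])$ is the space of such functions on $[a,b]$ (with $Df$ a finite signed measure on the interior of the interval), and $\|f\|_{BV([a,b])}:=\|Df\|_{TV([a,b])}$ is the total variation of $Df$ there. $(Df)^+$ and $(Df)^-$ denote the positive and negative parts of $Df$ in its Jordan decomposition. If $k_s$ is only in $BV([\varepsilon,\delta])$ for each $\varepsilon>0$, then $\|k_s\|_{BV([0,\delta])}:=\lim_{\varepsilon\downarrow0}\|k_s\|_{BV([\varepsilon,\delta])}\in[0,\infty]$. The limit of $k_s$ at $0$ is the limit from the right, taken for the right-continuous version of $k_s$. $\mathcal{F}$ is the Fourier transform with convention $\mathcal{F}f(u)=\int e^{iux}f(x)\,\mathrm{d}x$, extended to tempered distributions, and $B^s_{p,q}(\mathbb{R})$, $s\in\mathbb{R}$,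 $p,q\in[1,\infty]$, are the usual (inhomogeneous) Besov spaces defined by a Littlewood–Paley decomposition. The expression $\mathcal{F}^{-1}[\mathcal{F}f/\varphi]$ is understood in the usual Fourier multiplier sense: with a smooth dyadic partition of unity $(\psi_j)_{j\ge0}$ in frequency and $f=\sum_j f_j$, $f_j=\mathcal{F}^{-1}[\psi_j\mathcal{F}f]$, it is $\sum_j\mathcal{F}^{-1}[\tilde\psi_j/\varphi]\ast f_j$ (convergence in tempered distributions), where $\tilde\psi_j$ is smooth, compactly supported and equal to $1$ on $\operatorname{supp}\psi_j$ (here $\varphi$ never vanishes and $\mathcal{F}^{-1}[\tilde\psi_j/\varphi]\in L^1(\mathbb{R})$). *)

theory Defs
  imports "HOL-Probability.Probability"
begin

section \<open>Infinitely divisible distributions\<close>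

definition infinitely_divisible :: "real measure \<Rightarrow> bool" where
  "infinitely_divisible \<mu> \<longleftrightarrow> real_distribution \<mu> \<and>
     (\<forall>n\<ge>1. \<exists>\<rho>. real_distribution \<rho> \<and> \<mu> = ((\<lambda>\<kappa>. \<rho> \<star> \<kappa>) ^^ n) (return borel 0))"

definition levy_measure :: "real measure \<Rightarrow> bool" where
  "levy_measure \<nu> \<longleftrightarrow> sets \<nu> = sets borel \<and> emeasure \<nu> {0} = 0 \<and>
     (\<integral>\<^sup>+x. ennreal (min 1 (x\<^sup>2)) \<partial>\<nu>) < \<infinity>"

text \<open>The first argument \<open>v\<close> is the Gaussian variance \<open>\<sigma>\<^sup>2\<close>, not its square root.\<close>

definition characteristic_triplet :: "real measure \<Rightarrow> real \<Rightarrow> real \<Rightarrow> real measure \<Rightarrow> bool" where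
  "characteristic_triplet \<mu> v \<gamma> \<nu> \<longleftrightarrow> 0 \<le> v \<and> levy_measure \<nu> \<and>
     (\<forall>u. char \<mu> u = exp (- complex_of_real (v / 2 * u\<^sup>2) + \<i> * complex_of_real (\<gamma> * u)
        + (CLINT x|\<nu>. iexp (u * x) - 1 - \<i> * complex_of_real (u * x * indicator {-1..1} x))))"

definition sym_jump_measure :: "real measure \<Rightarrow> real measure" where
  "sym_jump_measure \<nu> = measure_of {0..} (sets (restrict_space borel {0..}))
     (\<lambda>A. emeasure \<nu> A + emeasure \<nu> (uminus ` A))"

lemma sym_jump_sets:
  "sigma_algebra {0::real..} (sets (restrict_space borel {0..}))"
  using sets.sigma_algebra_axioms[of "restrict_space borel {0::real..}"]
  by (simp add: space_restrict_space)

lemma sets_sym_jump_measure: "sets (sym_jump_measure \<nu>) = sets (restrict_space borel {0..})"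
  unfolding sym_jump_measure_def by (rule sigma_algebra.sets_measure_of_eq[OF sym_jump_sets])

lemma emeasure_sym_jump_measure:
  assumes \<nu>: "sets \<nu> = sets borel" and A: "A \<in> sets borel" "A \<subseteq> {0..}"
  shows "emeasure (sym_jump_measure \<nu>) A = emeasure \<nu> A + emeasure \<nu> (uminus ` A)"
proof -
  let ?S = "sets (restrict_space borel {0::real..})"
  let ?m = "\<lambda>A. emeasure \<nu> A + emeasure \<nu> (uminus ` A)"
  have S: "B \<in> ?S \<longleftrightarrow> B \<in> sets borel \<and> B \<subseteq> {0..}" for B
    by (auto simp: sets_restrict_space_iff)
  have neg: "uminus ` B \<in> sets \<nu>" if "B \<in> sets borel" for B :: "real set"
  proof -
    have "uminus -` B \<inter> space borel \<in> sets borel"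
      using that by measurable
    moreover have "uminus ` B = uminus -` B"
      by (force simp: image_iff)
    ultimately show ?thesis
      using \<nu> by simp
  qed
  have "countably_additive ?S ?m"
  proof (rule countably_additiveI)
    fix B :: "nat \<Rightarrow> real set"
    assume B: "range B \<subseteq> ?S" "disjoint_family B"
    have b: "B i \<in> sets borel" for i
      using B(1) S by blast
    have "(\<Sum>i. emeasure \<nu> (B i)) = emeasure \<nu> (\<Union>i. B i)"
      using B(2) b \<nu> by (intro suminf_emeasure) auto
    moreover have "(\<Sum>i. emeasure \<nu> (uminus ` B i)) = emeasure \<nu> (\<Union>i. uminus ` B i)"
    proof (rule suminf_emeasure)
      show "range (\<lambda>i. uminus ` B i) \<subseteq> sets \<nu>"
        using b neg by blast
      show "disjoint_family (\<lambda>i. uminus ` B i)"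
        using B(2) by (simp add: disjoint_family_on_def image_Int[symmetric])
    qed
    ultimately show "(\<Sum>i. ?m (B i)) = ?m (\<Union>i. B i)"
      by (simp add: suminf_add[OF summableI summableI, symmetric] image_UN)
  qed
  moreover have "positive ?S ?m"
    by (simp add: positive_def)
  moreover have "A \<in> ?S"
    using A S by blast
  ultimately show ?thesis
    unfolding sym_jump_measure_def by (intro emeasure_measure_of_sigma[OF sym_jump_sets])
qed

text \<open>\<open>f\<close> is a Lebesgue density on \<open>S\<close> of the (nonnegative) measure \<open>M\<close>. Only the values of \<open>f\<close>
  on \<open>S\<close> matter. Nonnegativity is required explicitly because \<open>ennreal\<close> truncates.\<close>

definition lebesgue_density_on :: "real measure \<Rightarrow> real set \<Rightarrow> (real \<Rightarrow> real) \<Rightarrow> bool" where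
  "lebesgue_density_on M S f \<longleftrightarrow> set_borel_measurable lborel S f \<and>
     (AE x in lborel. x \<in> S \<longrightarrow> 0 \<le> f x) \<and>
     (\<forall>A\<in>sets borel. A \<subseteq> S \<longrightarrow> emeasure M A = (\<integral>\<^sup>+x\<in>A. ennreal (f x) \<partial>lborel))"


section \<open>Smooth functions and functions of bounded variation\<close>

definition vderiv :: "(real \<Rightarrow> 'a::real_normed_vector) \<Rightarrow> real \<Rightarrow> 'a" where
  "vderiv f x = vector_derivative f (at x)"

definition smooth :: "(real \<Rightarrow> 'a::real_normed_vector) \<Rightarrow> bool" where
  "smooth f \<longleftrightarrow> (\<forall>n x. (vderiv ^^ n) f differentiable (at x))"

definition fsupport :: "(real \<Rightarrow> 'a::zero) \<Rightarrow> real set" where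
  "fsupport f = closure {x. f x \<noteq> 0}"

definition test_function :: "real set \<Rightarrow> (real \<Rightarrow> real) \<Rightarrow> bool" where
  "test_function S \<phi> \<longleftrightarrow> smooth \<phi> \<and> compact (fsupport \<phi>) \<and> fsupport \<phi> \<subseteq> S"

text \<open>A finite signed measure on the Borel subsets of \<open>S\<close> is a countably additive real set
  function; it is set to \<open>0\<close> elsewhere, so that it is determined as a function.\<close>

definition finite_signed_measure :: "real set \<Rightarrow> (real set \<Rightarrow> real) \<Rightarrow> bool" where
  "finite_signed_measure S m \<longleftrightarrow> m {} = 0 \<and>
     (\<forall>A. A \<notin> sets (restrict_space borel S) \<longrightarrow> m A = 0) \<and>
     (\<forall>A::nat \<Rightarrow> real set. range A \<subseteq> sets (restrict_space borel S) \<longrightarrow> disjoint_family A \<longrightarrow>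
        (\<lambda>i. m (A i)) sums m (\<Union>i. A i))"

definition jordan_decomposition ::
  "real set \<Rightarrow> (real set \<Rightarrow> real) \<Rightarrow> real measure \<Rightarrow> real measure \<Rightarrow> bool" where
  "jordan_decomposition S m P N \<longleftrightarrow>
     sets P = sets (restrict_space borel S) \<and> sets N = sets (restrict_space borel S) \<and>
     finite_measure P \<and> finite_measure N \<and>
     (\<exists>H\<in>sets (restrict_space borel S). emeasure P (S - H) = 0 \<and> emeasure N H = 0) \<and>
     (\<forall>A\<in>sets (restrict_space borel S). m A = measure P A - measure N A)"

definition pos_part :: "real set \<Rightarrow> (real set \<Rightarrow> real) \<Rightarrow> real measure" where
  "pos_part S m = (THE P. \<exists>N. jordan_decomposition S m P N)"

definition neg_part :: "real set \<Rightarrow> (real set \<Rightarrow> real) \<Rightarrow> real measure" where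
  "neg_part S m = (THE N. \<exists>P. jordan_decomposition S m P N)"

text \<open>The distributional derivative on an open set \<open>S\<close>; the integral of a test function against
  the signed measure \<open>m\<close> is taken through the Jordan decomposition of \<open>m\<close>.\<close>

definition has_distr_deriv :: "(real \<Rightarrow> real) \<Rightarrow> real set \<Rightarrow> (real set \<Rightarrow> real) \<Rightarrow> bool" where
  "has_distr_deriv f S m \<longleftrightarrow> finite_signed_measure S m \<and>
     (\<exists>P N. jordan_decomposition S m P N \<and>
        (\<forall>\<phi>. test_function S \<phi> \<longrightarrow>
           (LINT x|lborel. f x * vderiv \<phi> x) = - ((LINT x|P. \<phi> x) - (LINT x|N. \<phi> x))))"

definition distr_deriv :: "(real \<Rightarrow> real) \<Rightarrow> real set \<Rightarrow> real set \<Rightarrow> real" where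
  "distr_deriv f S = (THE m. has_distr_deriv f S m)"

definition BV :: "real \<Rightarrow> real \<Rightarrow> (real \<Rightarrow> real) set" where
  "BV a b = {f. set_integrable lborel {a..b} f \<and> (\<exists>m. has_distr_deriv f {a<..<b} m)}"

definition pos_variation :: "real \<Rightarrow> real \<Rightarrow> (real \<Rightarrow> real) \<Rightarrow> ennreal" where
  "pos_variation a b f = emeasure (pos_part {a<..<b} (distr_deriv f {a<..<b})) {a<..<b}"

definition neg_variation :: "real \<Rightarrow> real \<Rightarrow> (real \<Rightarrow> real) \<Rightarrow> ennreal" where
  "neg_variation a b f = emeasure (neg_part {a<..<b} (distr_deriv f {a<..<b})) {a<..<b}"

definition BV_norm :: "real \<Rightarrow> real \<Rightarrow> (real \<Rightarrow> real) \<Rightarrow> ennreal" where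
  "BV_norm a b f = pos_variation a b f + neg_variation a b f"

definition pos_variation0 :: "real \<Rightarrow> (real \<Rightarrow> real) \<Rightarrow> ennreal" where
  "pos_variation0 \<delta> f = Lim (at_right 0) (\<lambda>\<epsilon>. pos_variation \<epsilon> \<delta> f)"

definition BV_norm0 :: "real \<Rightarrow> (real \<Rightarrow> real) \<Rightarrow> ennreal" where
  "BV_norm0 \<delta> f = Lim (at_right 0) (\<lambda>\<epsilon>. BV_norm \<epsilon> \<delta> f)"

definition right_continuous_version :: "real \<Rightarrow> (real \<Rightarrow> real) \<Rightarrow> (real \<Rightarrow> real) \<Rightarrow> bool" where
  "right_continuous_version \<delta> f g \<longleftrightarrow>
     (AE x in lborel. x \<in> {0<..<\<delta>} \<longrightarrow> g x = f x) \<and>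
     (\<forall>x\<in>{0<..<\<delta>}. continuous (at_right x) g)"


section \<open>Tempered distributions and the Fourier transform\<close>

definition schwartz :: "(real \<Rightarrow> complex) set" where
  "schwartz = {f. smooth f \<and> (\<forall>k n. bounded (range (\<lambda>x. x ^ k *\<^sub>R (vderiv ^^ n) f x)))}"

definition schwartz_norm :: "nat \<Rightarrow> (real \<Rightarrow> complex) \<Rightarrow> real" where
  "schwartz_norm N f = (\<Sum>k\<le>N. \<Sum>n\<le>N. SUP x. norm (x ^ k *\<^sub>R (vderiv ^^ n) f x))"

type_synonym distribution = "(real \<Rightarrow> complex) \<Rightarrow> complex"

text \<open>Only the values of a distribution on \<open>schwartz\<close> are meaningful.\<close>

definition tempered :: "distribution \<Rightarrow> bool" where
  "tempered T \<longleftrightarrow>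
     (\<forall>f\<in>schwartz. \<forall>g\<in>schwartz. T (\<lambda>x. f x + g x) = T f + T g) \<and>
     (\<forall>c. \<forall>f\<in>schwartz. T (\<lambda>x. c * f x) = c * T f) \<and>
     (\<exists>C N. \<forall>f\<in>schwartz. cmod (T f) \<le> C * schwartz_norm N f)"

definition fourier :: "(real \<Rightarrow> complex) \<Rightarrow> real \<Rightarrow> complex" where
  "fourier f u = (CLINT x|lborel. iexp (u * x) * f x)"

definition inv_fourier :: "(real \<Rightarrow> complex) \<Rightarrow> real \<Rightarrow> complex" where
  "inv_fourier g x = (CLINT u|lborel. iexp (- (u * x)) * g u) / complex_of_real (2 * pi)"

definition dist_fourier :: "distribution \<Rightarrow> distribution" where
  "dist_fourier T = (\<lambda>\<phi>. T (fourier \<phi>))"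

definition dist_inv_fourier :: "distribution \<Rightarrow> distribution" where
  "dist_inv_fourier T = (\<lambda>\<phi>. T (inv_fourier \<phi>))"

definition dist_mult :: "(real \<Rightarrow> real) \<Rightarrow> distribution \<Rightarrow> distribution" where
  "dist_mult a T = (\<lambda>\<phi>. T (\<lambda>u. complex_of_real (a u) * \<phi> u))"

definition represents :: "(real \<Rightarrow> complex) \<Rightarrow> distribution \<Rightarrow> bool" where
  "represents g T \<longleftrightarrow> g \<in> borel_measurable borel \<and>
     (\<forall>\<phi>\<in>schwartz. integrable lborel (\<lambda>x. g x * \<phi> x) \<and> T \<phi> = (CLINT x|lborel. g x * \<phi> x))"

text \<open>The function (unique up to null sets) identified with a distribution, when there is one.\<close>

definition fun_of :: "distribution \<Rightarrow> real \<Rightarrow> complex" where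
  "fun_of T = (SOME g. represents g T)"


section \<open>Besov spaces\<close>

definition epowr :: "ennreal \<Rightarrow> real \<Rightarrow> ennreal" where
  "epowr a r = (if a = \<infinity> then \<infinity> else ennreal (enn2real a powr r))"

text \<open>For the counting measure on \<open>nat\<close> this is the sequence norm of \<open>\<ell>\<^sup>p\<close>.\<close>

definition Lp_norm :: "ennreal \<Rightarrow> 'a measure \<Rightarrow> ('a \<Rightarrow> ennreal) \<Rightarrow> ennreal" where
  "Lp_norm p M g = (if p = \<infinity> then esssup M g
     else epowr (\<integral>\<^sup>+x. epowr (g x) (enn2real p) \<partial>M) (1 / enn2real p))"

text \<open>Infinite for distributions that are not given by a function in \<open>L\<^sup>p\<close>.\<close>

definition dist_Lp_norm :: "ennreal \<Rightarrow> distribution \<Rightarrow> ennreal" where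
  "dist_Lp_norm p T = Inf {Lp_norm p lborel (\<lambda>x. ennreal (cmod (g x))) |g. represents g T}"

definition dyadic_partition :: "(nat \<Rightarrow> real \<Rightarrow> real) \<Rightarrow> bool" where
  "dyadic_partition \<psi> \<longleftrightarrow>
     (\<forall>j. smooth (\<psi> j)) \<and> (\<forall>j u. 0 \<le> \<psi> j u) \<and>
     fsupport (\<psi> 0) \<subseteq> {-2..2} \<and>
     (\<exists>\<theta>. fsupport \<theta> \<subseteq> {u. 1 / 2 \<le> \<bar>u\<bar> \<and> \<bar>u\<bar> \<le> 2} \<and> (\<forall>j\<ge>1. \<psi> j = (\<lambda>u. \<theta> (u / 2 ^ j)))) \<and>
     (\<forall>u. (\<lambda>j. \<psi> j u) sums 1)"

definition lp_block :: "(nat \<Rightarrow> real \<Rightarrow> real) \<Rightarrow> nat \<Rightarrow> distribution \<Rightarrow> distribution" where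
  "lp_block \<psi> j f = dist_inv_fourier (dist_mult (\<psi> j) (dist_fourier f))"

definition besov_norm ::
  "(nat \<Rightarrow> real \<Rightarrow> real) \<Rightarrow> real \<Rightarrow> ennreal \<Rightarrow> ennreal \<Rightarrow> distribution \<Rightarrow> ennreal" where
  "besov_norm \<psi> s p q f = Lp_norm q (count_space UNIV)
     (\<lambda>j::nat. ennreal (2 powr (s * real j)) * dist_Lp_norm p (lp_block \<psi> j f))"

definition besov ::
  "(nat \<Rightarrow> real \<Rightarrow> real) \<Rightarrow> real \<Rightarrow> ennreal \<Rightarrow> ennreal \<Rightarrow> distribution set" where
  "besov \<psi> s p q = {f. tempered f \<and> besov_norm \<psi> s p q f < \<infinity>}"


section \<open>Fourier multipliers\<close>

definition cutoffs :: "(nat \<Rightarrow> real \<Rightarrow> real) \<Rightarrow> (nat \<Rightarrow> real \<Rightarrow> real) \<Rightarrow> bool" where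
  "cutoffs \<psi> \<psi>' \<longleftrightarrow>
     (\<forall>j. smooth (\<psi>' j) \<and> compact (fsupport (\<psi>' j)) \<and> (\<forall>u\<in>fsupport (\<psi> j). \<psi>' j u = 1))"

definition multiplier_kernel ::
  "(nat \<Rightarrow> real \<Rightarrow> real) \<Rightarrow> (real \<Rightarrow> complex) \<Rightarrow> nat \<Rightarrow> real \<Rightarrow> complex" where
  "multiplier_kernel \<psi>' a j = inv_fourier (\<lambda>u. complex_of_real (\<psi>' j u) * a u)"

definition conv :: "(real \<Rightarrow> complex) \<Rightarrow> (real \<Rightarrow> complex) \<Rightarrow> real \<Rightarrow> complex" where
  "conv K g x = (CLINT y|lborel. K (x - y) * g y)"

definition multiplier_term :: "(nat \<Rightarrow> real \<Rightarrow> real) \<Rightarrow> (nat \<Rightarrow> real \<Rightarrow> real) \<Rightarrow>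
    (real \<Rightarrow> complex) \<Rightarrow> distribution \<Rightarrow> nat \<Rightarrow> distribution" where
  "multiplier_term \<psi> \<psi>' a f j =
     (\<lambda>\<phi>. CLINT x|lborel. conv (multiplier_kernel \<psi>' a j) (fun_of (lp_block \<psi> j f)) x * \<phi> x)"

definition multiplier_op :: "(nat \<Rightarrow> real \<Rightarrow> real) \<Rightarrow> (nat \<Rightarrow> real \<Rightarrow> real) \<Rightarrow>
    (real \<Rightarrow> complex) \<Rightarrow> distribution \<Rightarrow> distribution" where
  "multiplier_op \<psi> \<psi>' a f = (\<lambda>\<phi>. \<Sum>j. multiplier_term \<psi> \<psi>' a f j \<phi>)"

text \<open>The operator with symbol \<open>a\<close> is well defined, linear and bounded from
  \<open>besov \<psi> s' p q\<close> to \<open>besov \<psi> s p q\<close>. The integrability of the kernels, which makes the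
  convolutions meaningful, is part of well-definedness; for the reciprocal of a nonvanishing
  characteristic function it is automatic by Wiener's lemma.\<close>

definition bounded_multiplier :: "(nat \<Rightarrow> real \<Rightarrow> real) \<Rightarrow> (nat \<Rightarrow> real \<Rightarrow> real) \<Rightarrow>
    (real \<Rightarrow> complex) \<Rightarrow> real \<Rightarrow> real \<Rightarrow> ennreal \<Rightarrow> ennreal \<Rightarrow> bool" where
  "bounded_multiplier \<psi> \<psi>' a s' s p q \<longleftrightarrow>
     (\<forall>j. integrable lborel (multiplier_kernel \<psi>' a j)) \<and>
     (\<forall>f\<in>besov \<psi> s' p q. \<forall>\<phi>\<in>schwartz. summable (\<lambda>j. multiplier_term \<psi> \<psi>' a f j \<phi>)) \<and>
     (\<forall>f\<in>besov \<psi> s' p q. \<forall>g\<in>besov \<psi> s' p q. \<forall>b c. \<forall>\<phi>\<in>schwartz.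
        multiplier_op \<psi> \<psi>' a (\<lambda>\<eta>. b * f \<eta> + c * g \<eta>) \<phi> =
          b * multiplier_op \<psi> \<psi>' a f \<phi> + c * multiplier_op \<psi> \<psi>' a g \<phi>) \<and>
     (\<forall>f\<in>besov \<psi> s' p q. multiplier_op \<psi> \<psi>' a f \<in> besov \<psi> s p q) \<and>
     (\<exists>C\<ge>0. \<forall>f\<in>besov \<psi> s' p q.
        besov_norm \<psi> s p q (multiplier_op \<psi> \<psi>' a f) \<le> ennreal C * besov_norm \<psi> s' p q f)"

end

theory Submission
  imports Defs "HOL-Real_Asymp.Real_Asymp"
begin

text \<open>Integration by parts on test functions identifies \<open>Dk\<^sub>s\<close>, so almost everywhere \<open>k\<^sub>s\<close> is a constant minus
the increasing positive variation (bounded, by hypothesis) plus the negative variation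
\<open>N x = (Dk\<^sub>s)\<^sup>- (x, \<delta>)\<close>. Hence (i) and (ii) both say that \<open>v = 0\<close> and \<open>N\<close> is bounded near \<open>0\<close>, which
for \<open>k\<^sub>s\<close> means boundedness near \<open>0\<close>, while otherwise \<open>k\<^sub>s\<close> tends to infinity. Since
\<open>- ln \<bar>\<phi> u\<bar> = v u\<^sup>2 / 2 + \<integral>(1 - cos (u x)) k\<^sub>s x / x dx\<close> up to a bounded term, a bounded \<open>k\<^sub>s\<close> gives at most
logarithmic growth, hence (iii), and \<open>k\<^sub>s \<ge> \<alpha> + 1\<close> near \<open>0\<close> contradicts the exponent \<open>\<alpha>\<close> in (iii).

Splitting the jumps at size \<open>1\<close> writes \<open>1 / \<phi>\<close> as a twice differentiable function times the exponential of the
Fourier transform of a finite signed measure. Under (iii) the first factor and its two derivatives grow polynomially, so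
its dyadic pieces have kernels with polynomially growing \<open>L\<^sup>1\<close> norm; convolution with the second factor
costs only a constant, and Young's inequality yields the multiplier property. Conversely, a
multiplier bound from \<open>B\<^sup>\<alpha>\<close> to \<open>B\<^sup>0\<close> with \<open>p = q = \<infinity>\<close>, tested on \<open>x \<mapsto> e\<^sup>-\<^sup>i\<^sup>u\<^sup>x\<close>, gives
\<open>1 / \<bar>\<phi> u\<bar> \<le> C (1 + \<bar>u\<bar>)\<^sup>\<alpha>\<close>.\<close>

section \<open>Smooth functions\<close>

text \<open>Jumps larger than 1 need not have moments, so \<open>1 / char \<mu> u\<close> is in
  general only continuous. Only the factor of the jumps in [-1, 1] is differentiated, twice, because
  two derivatives of a symbol make its kernel decay like 1 / (1 + x^2). The large jumps form a
  finite measure and are handled by the exponential series, whose n-th term costs mass^n / n!. The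
  order lost is \<alpha> + 3: two powers of u come from the square of the logarithmic derivative,
  one from the width 2^k of the k-th frequency ring.

  As such symbols are not smooth, the multiplier need not map Schwartz functions to Schwartz
  functions. Each block is therefore represented by a bounded function, which pairs with every
  integrable function: identities are tested on Schwartz functions, become equalities almost
  everywhere, and are then paired with integrable functions. In the converse, an exponential has
  nonzero blocks of finite L^p norm only for p infinite; it is an eigenvector, and the factor sup_j
  \<open>\<psi> j u\<close> occurs on both sides and cancels.\<close>

fun times_differentiable :: "nat \<Rightarrow> (real \<Rightarrow> 'a::real_normed_vector) \<Rightarrow> bool" where
  "times_differentiable 0 f \<longleftrightarrow> True"
| "times_differentiable (Suc n) f \<longleftrightarrow>
     (\<exists>f'. (\<forall>x. (f has_vector_derivative f' x) (at x)) \<and> times_differentiable n f')"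

lemma has_vector_derivative_vderiv_eq:
  assumes "\<And>x. (f has_vector_derivative f' x) (at x)"
  shows "vderiv f = f'"
  using assms by (auto simp: vderiv_def vector_derivative_at)

lemma funpow_vderiv_Suc: "(vderiv ^^ Suc n) f = (vderiv ^^ n) (vderiv f)"
  by (simp add: funpow_swap1)

text \<open>Asking at every level for some derivative, instead of iterating \<open>vderiv\<close>,
  lets the closure properties below be proved by induction on the order, with no Leibniz or Faa di
  Bruno formula; this equivalence carries them over to \<open>smooth\<close>.\<close>

lemma times_differentiable_iff:
  "times_differentiable n f \<longleftrightarrow> (\<forall>k<n. \<forall>x. (vderiv ^^ k) f differentiable (at x))"
proof (induction n arbitrary: f)
  case 0
  then show ?case by simp
next
  case (Suc n)
  show ?case
  proof
    assume "times_differentiable (Suc n) f"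
    then obtain f' where f': "\<And>x. (f has_vector_derivative f' x) (at x)" "times_differentiable n f'"
      by auto
    have e: "vderiv f = f'"
      using f'(1) by (rule has_vector_derivative_vderiv_eq)
    have "(vderiv ^^ k) f differentiable at x" if "k < Suc n" for k x
    proof (cases k)
      case 0
      then show ?thesis using f'(1) by (auto intro: differentiableI_vector)
    next
      case (Suc m)
      then show ?thesis using Suc.IH[of f'] f'(2) that e by (simp add: funpow_swap1)
    qed
    then show "\<forall>k<Suc n. \<forall>x. (vderiv ^^ k) f differentiable at x" by blast
  next
    assume *: "\<forall>k<Suc n. \<forall>x. (vderiv ^^ k) f differentiable at x"
    then have "\<forall>x. f differentiable at x" by (metis funpow_0 zero_less_Suc)
    then have "\<forall>x. (f has_vector_derivative vderiv f x) (at x)"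
      by (simp add: vderiv_def vector_derivative_works)
    moreover have "times_differentiable n (vderiv f)"
      unfolding Suc.IH using * by (metis Suc_less_eq funpow_vderiv_Suc)
    ultimately show "times_differentiable (Suc n) f" by auto
  qed
qed

lemma smooth_iff_times_differentiable: "smooth f \<longleftrightarrow> (\<forall>n. times_differentiable n f)"
  unfolding smooth_def times_differentiable_iff by blast

lemma smooth_has_vector_derivative:
  "smooth f \<Longrightarrow> (f has_vector_derivative vderiv f x) (at x)"
  unfolding smooth_def vderiv_def by (metis funpow_0 vector_derivative_works)

lemma smooth_vderiv: "smooth f \<Longrightarrow> smooth (vderiv f)"
  unfolding smooth_def by (metis funpow_vderiv_Suc)

lemma smooth_funpow_vderiv: "smooth f \<Longrightarrow> smooth ((vderiv ^^ n) f)"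
  by (induction n) (auto intro: smooth_vderiv)

lemma smooth_funpow_vderiv_has_vector_derivative:
  "smooth f \<Longrightarrow> ((vderiv ^^ n) f has_vector_derivative (vderiv ^^ Suc n) f x) (at x)"
  using smooth_has_vector_derivative[OF smooth_funpow_vderiv, of f n x] by simp

lemma smooth_continuous_on: "smooth f \<Longrightarrow> continuous_on S f"
  by (meson continuous_at_imp_continuous_on has_vector_derivative_continuous
      smooth_has_vector_derivative)

lemma smooth_measurable: "smooth f \<Longrightarrow> f \<in> borel_measurable borel"
  for f :: "real \<Rightarrow> 'a::{real_normed_vector, second_countable_topology}"
  by (simp add: borel_measurable_continuous_onI smooth_continuous_on)

text \<open>For functions whose derivatives of all orders have a closed form, such as Fourier
  transforms and dilations: it also identifies the iterated derivative with the given one.\<close>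

lemma smoothI_sequence:
  assumes "\<And>n x. (D n has_vector_derivative D (Suc n) x) (at x)"
  shows "smooth (D 0)" "(vderiv ^^ n) (D 0) = D n"
proof -
  show e: "(vderiv ^^ n) (D 0) = D n" for n
    by (induction n) (simp_all add: has_vector_derivative_vderiv_eq[OF assms])
  show "smooth (D 0)"
    unfolding smooth_def e using assms by (blast intro: differentiableI_vector)
qed

lemma smoothI_vderiv:
  assumes "\<And>x. (f has_vector_derivative f' x) (at x)" "smooth f'"
  shows "smooth f"
  unfolding smooth_iff_times_differentiable
proof
  fix n show "times_differentiable n f"
    using assms by (cases n) (auto simp: smooth_iff_times_differentiable)
qed

lemma times_differentiable_add:
  "times_differentiable n f \<Longrightarrow> times_differentiable n g \<Longrightarrow> times_differentiable n (\<lambda>x. f x + g x)"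
proof (induction n arbitrary: f g)
  case (Suc n)
  from Suc.prems obtain f' g' where
    "\<And>x. (f has_vector_derivative f' x) (at x)" "times_differentiable n f'"
    "\<And>x. (g has_vector_derivative g' x) (at x)" "times_differentiable n g'" by auto
  then show ?case using Suc.IH[of f' g']
    by (auto intro!: exI[of _ "\<lambda>x. f' x + g' x"] has_vector_derivative_add)
qed simp

lemma times_differentiable_mono:
  "times_differentiable (Suc n) f \<Longrightarrow> times_differentiable n f"
  unfolding times_differentiable_iff by simp

lemma times_differentiable_mult:
  fixes f g :: "real \<Rightarrow> 'a::real_normed_algebra"
  shows "times_differentiable n f \<Longrightarrow> times_differentiable n g \<Longrightarrow> times_differentiable n (\<lambda>x. f x * g x)"
proof (induction n arbitrary: f g)
  case (Suc n)
  from Suc.prems obtain f' g' where *: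
    "\<And>x. (f has_vector_derivative f' x) (at x)" "times_differentiable n f'"
    "\<And>x. (g has_vector_derivative g' x) (at x)" "times_differentiable n g'" by auto
  \<comment> \<open>The product rule mixes \<open>f\<close> and \<open>g\<close> with their
    derivatives, so the factors that are one order better are first degraded to order
    \<open>n\<close>.\<close>
  have "times_differentiable n (\<lambda>x. f x * g' x + f' x * g x)"
    using * Suc.IH Suc.prems times_differentiable_mono
    by (intro times_differentiable_add) blast+
  moreover have "((\<lambda>x. f x * g x) has_vector_derivative f x * g' x + f' x * g x) (at x)" for x
    using *(1,3) by (rule has_vector_derivative_mult)
  ultimately show ?case unfolding times_differentiable.simps by (intro exI conjI allI)
qed simp

lemma times_differentiable_bounded_linear:
  assumes L: "bounded_linear L"
  shows "times_differentiable n f \<Longrightarrow> times_differentiable n (\<lambda>x. L (f x))"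
proof (induction n arbitrary: f)
  case (Suc n)
  then obtain f' where "\<And>x. (f has_vector_derivative f' x) (at x)" "times_differentiable n f'"
    by auto
  then have "\<forall>x. ((\<lambda>x. L (f x)) has_vector_derivative L (f' x)) (at x)"
    "times_differentiable n (\<lambda>x. L (f' x))"
    using Suc.IH by (auto intro: bounded_linear.has_vector_derivative[OF L])
  then show ?case unfolding times_differentiable.simps by (intro exI conjI)
qed simp

lemma times_differentiable_affine:
  "times_differentiable n f \<Longrightarrow> times_differentiable n (\<lambda>x. f (a * x + b))"
proof (induction n arbitrary: f)
  case (Suc n)
  then obtain f' where *: "\<And>x. (f has_vector_derivative f' x) (at x)" "times_differentiable n f'"
    by auto
  have "((\<lambda>x. f (a * x + b)) has_vector_derivative a *\<^sub>R f' (a * x + b)) (at x)" for x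
  proof -
    have "((\<lambda>x. a * x + b) has_vector_derivative a) (at x)"
      unfolding has_real_derivative_iff_has_vector_derivative[symmetric]
      by (auto intro!: derivative_eq_intros)
    then show ?thesis
      using vector_diff_chain_at[of "\<lambda>x. a * x + b" a x f "f' (a * x + b)"] *(1)
      by (simp add: o_def)
  qed
  moreover have "times_differentiable n (\<lambda>x. a *\<^sub>R f' (a * x + b))"
    by (rule times_differentiable_bounded_linear[OF bounded_linear_scaleR_right Suc.IH[OF *(2)]])
  ultimately show ?case unfolding times_differentiable.simps by (intro exI conjI allI)
qed simp

lemma smooth_add: "smooth f \<Longrightarrow> smooth g \<Longrightarrow> smooth (\<lambda>x. f x + g x)"
  by (simp add: smooth_iff_times_differentiable times_differentiable_add)

lemma smooth_mult: "smooth f \<Longrightarrow> smooth g \<Longrightarrow> smooth (\<lambda>x. f x * g x)"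
  for f g :: "real \<Rightarrow> 'a::real_normed_algebra"
  by (simp add: smooth_iff_times_differentiable times_differentiable_mult)

lemma smooth_bounded_linear: "bounded_linear L \<Longrightarrow> smooth f \<Longrightarrow> smooth (\<lambda>x. L (f x))"
  by (simp add: smooth_iff_times_differentiable times_differentiable_bounded_linear)

lemma smooth_affine: "smooth f \<Longrightarrow> smooth (\<lambda>x. f (a * x + b))"
  by (simp add: smooth_iff_times_differentiable times_differentiable_affine)

lemma smooth_of_real: "smooth f \<Longrightarrow> smooth (\<lambda>x. complex_of_real (f x))"
  by (rule smooth_bounded_linear[OF bounded_linear_of_real])

lemma smooth_const: "smooth (\<lambda>_. c)"
  using smoothI_sequence(1)[of "\<lambda>n _. if n = 0 then c else 0"] by simp

lemma smooth_sum: "(\<And>i. i \<in> I \<Longrightarrow> smooth (f i)) \<Longrightarrow> smooth (\<lambda>x. \<Sum>i\<in>I. f i x)"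
  by (induction I rule: infinite_finite_induct) (auto intro: smooth_add smooth_const)

lemma smooth_power: "smooth f \<Longrightarrow> smooth (\<lambda>x. f x ^ n)"
  for f :: "real \<Rightarrow> 'a::real_normed_algebra_1"
  by (induction n) (auto intro: smooth_mult smooth_const)

subsection \<open>Bump functions\<close>

text \<open>Polynomials in 1/x times e^(-1/x) form a family closed under differentiation, which acts
  on the polynomial by p -> X^2 (p - p'). All derivatives of the standard flat function are thus
  treated at once.\<close>

definition flat_exp :: "real poly \<Rightarrow> real \<Rightarrow> real" where
  "flat_exp p x = (if x \<le> 0 then 0 else poly p (1 / x) * exp (- 1 / x))"

lemma flat_exp_tendsto_0: "((\<lambda>x. poly p (1 / x) * exp (- 1 / x)) \<longlongrightarrow> 0) (at_right (0::real))"
proof -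
  have "((\<lambda>y. poly p y * exp (- y)) \<longlongrightarrow> 0) (at_top :: real filter)"
  proof -
    have pw: "((\<lambda>y. y ^ n * exp (- y)) \<longlongrightarrow> 0) (at_top :: real filter)" for n
      using tendsto_power_div_exp_0[of "n"] by (simp add: exp_minus field_simps)
    have "((\<lambda>y. (\<Sum>i\<le>degree p. coeff p i * (y ^ i * exp (- y)))) \<longlongrightarrow> 0) (at_top :: real filter)"
      by (rule tendsto_null_sum) (rule tendsto_mult_right_zero[OF pw])
    then show ?thesis
      by (simp add: poly_altdef sum_distrib_right mult.assoc)
  qed
  then have "((\<lambda>x. poly p (inverse x) * exp (- inverse x)) \<longlongrightarrow> 0) (at_right (0::real))"
    by (rule filterlim_compose[OF _ filterlim_inverse_at_top_right])
  then show ?thesis by (simp add: inverse_eq_divide)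
qed

lemma flat_exp_has_derivative:
  "(flat_exp p has_real_derivative flat_exp ([:0, 0, 1:] * (p - pderiv p)) x) (at x)"
proof -
  consider "x < 0" | "x = 0" | "0 < x" by linarith
  then show ?thesis
  proof cases
    case 1
    have "((\<lambda>_. 0) has_real_derivative 0) (at x)" by simp
    then have "(flat_exp p has_real_derivative 0) (at x)"
      by (rule DERIV_cong_ev[THEN iffD1, rotated 3])
         (use 1 in \<open>auto simp: flat_exp_def eventually_nhds intro!: exI[of _ "{..<0}"]\<close>)
    then show ?thesis using 1 by (simp add: flat_exp_def)
  next
    case 3
    have "((\<lambda>x. poly p (1 / x) * exp (- 1 / x)) has_real_derivative
        poly ([:0, 0, 1:] * (p - pderiv p)) (1 / x) * exp (- 1 / x)) (at x)"
    proof -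
      have i: "((\<lambda>x. 1 / x) has_real_derivative (- ((1 / x) ^ 2))) (at x)"
        using 3 by (auto intro!: derivative_eq_intros simp: power2_eq_square)
      have m: "((\<lambda>x. - 1 / x) has_real_derivative ((1 / x) ^ 2)) (at x)"
        using DERIV_minus[OF i] by simp
      have "((\<lambda>x. poly p (1 / x)) has_real_derivative (- ((1 / x) ^ 2) * poly (pderiv p) (1 / x))) (at x)"
        using DERIV_chain'[OF i poly_DERIV[of p "1 / x"]] by (simp add: mult.commute)
      from DERIV_mult[OF this DERIV_chain'[OF m DERIV_exp]]
      show ?thesis by (simp add: algebra_simps power2_eq_square)
    qed
    then have "(flat_exp p has_real_derivative
        poly ([:0, 0, 1:] * (p - pderiv p)) (1 / x) * exp (- 1 / x)) (at x)"
      by (rule DERIV_cong_ev[THEN iffD1, rotated 3])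
         (use 3 in \<open>auto simp: flat_exp_def eventually_nhds intro!: exI[of _ "{0<..}"]\<close>)
    then show ?thesis using 3 by (simp add: flat_exp_def)
  next
    case 2
    \<comment> \<open>Dividing by \<open>h\<close> multiplies the polynomial by X, so the right
      difference quotient at 0 is again of the form covered by the limit.\<close>
    have "((\<lambda>h. flat_exp p h / h) \<longlongrightarrow> 0) (at_right 0)"
      using flat_exp_tendsto_0[of "[:0, 1:] * p"]
      by (rule Lim_transform_eventually)
         (auto simp: flat_exp_def eventually_at_right_field intro!: exI[of _ 1])
    moreover have "((\<lambda>h. flat_exp p h / h) \<longlongrightarrow> 0) (at_left 0)"
      by (rule Lim_transform_eventually[OF tendsto_const])
         (auto simp: flat_exp_def eventually_at_left_field intro!: exI[of _ "-1"])
    ultimately have "((\<lambda>h. flat_exp p h / h) \<longlongrightarrow> 0) (at 0)"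
      by (simp add: filterlim_at_split)
    then show ?thesis
      using 2 by (simp add: DERIV_def flat_exp_def[of _ 0] flat_exp_def[of _ "0 + _"])
  qed
qed

lemma smooth_flat_exp: "smooth (flat_exp p)"
proof -
  have "times_differentiable n (flat_exp p)" for n
  proof (induction n arbitrary: p)
    case (Suc n)
    then show ?case
      using flat_exp_has_derivative[of p]
      by (auto simp: has_real_derivative_iff_has_vector_derivative)
  qed simp
  then show ?thesis by (simp add: smooth_iff_times_differentiable)
qed

definition bump :: "real \<Rightarrow> real \<Rightarrow> real \<Rightarrow> real" where
  "bump a b x = flat_exp 1 (x - a) * flat_exp 1 (b - x)"

lemma smooth_bump: "smooth (bump a b)"
proof -
  have "smooth (\<lambda>x. flat_exp 1 (1 * x + - a) * flat_exp 1 (- 1 * x + b))"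
    by (intro smooth_mult smooth_affine smooth_flat_exp)
  then show ?thesis by (simp add: bump_def[abs_def])
qed

lemma bump_pos: "a < x \<Longrightarrow> x < b \<Longrightarrow> 0 < bump a b x"
  by (simp add: bump_def flat_exp_def)

lemma bump_eq_0: "x \<notin> {a<..<b} \<Longrightarrow> bump a b x = 0"
  by (auto simp: bump_def flat_exp_def)

lemma bump_nonneg: "0 \<le> bump a b x"
  by (simp add: bump_def flat_exp_def)

lemma bump_le_1: "bump a b x \<le> 1"
  by (auto simp: bump_def flat_exp_def intro!: mult_le_one)

lemma fsupport_subset_closed: "closed C \<Longrightarrow> (\<And>x. x \<notin> C \<Longrightarrow> f x = 0) \<Longrightarrow> fsupport f \<subseteq> C"
  unfolding fsupport_def by (rule closure_minimal) auto

lemma fsupport_eq_0: "x \<notin> fsupport f \<Longrightarrow> f x = 0"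
  unfolding fsupport_def using closure_subset[of "{x. f x \<noteq> 0}"] by blast


lemma compact_fsupport:
  assumes "\<And>x. x \<notin> {a..b} \<Longrightarrow> f x = 0"
  shows "compact (fsupport f)"
proof -
  have "fsupport f = {a..b} \<inter> fsupport f"
    using fsupport_subset_closed[of "{a..b}" f] assms by auto
  then show ?thesis
    by (metis closed_closure compact_Icc compact_Int_closed fsupport_def)
qed

lemma compact_fsupportD:
  assumes "compact (fsupport f)"
  obtains R where "R > 0" "\<And>x. R \<le> \<bar>x\<bar> \<Longrightarrow> f x = 0"
proof -
  obtain R where R: "\<And>x. x \<in> fsupport f \<Longrightarrow> \<bar>x\<bar> \<le> R"
    using compact_imp_bounded[OF assms] by (auto simp: bounded_iff)
  show ?thesis
  proof (rule that[of "\<bar>R\<bar> + 1"])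
    fix x assume "\<bar>R\<bar> + 1 \<le> \<bar>x\<bar>"
    then have "x \<notin> fsupport f" using R[of x] by linarith
    then show "f x = 0" by (rule fsupport_eq_0)
  qed simp
qed

lemma test_functionI:
  assumes "smooth \<phi>" "\<And>x. x \<notin> {a..b} \<Longrightarrow> \<phi> x = 0" "{a..b} \<subseteq> S"
  shows "test_function S \<phi>"
  unfolding test_function_def
  using assms compact_fsupport[of a b \<phi>] fsupport_subset_closed[of "{a..b}" \<phi>] by auto

text \<open>Smooth functions increasing to the indicator of \<open>{a<..<b}\<close>.\<close>

definition bump_seq :: "real \<Rightarrow> real \<Rightarrow> nat \<Rightarrow> real \<Rightarrow> real" where
  "bump_seq a b n x = 1 - (1 - bump a b x) ^ n"

lemma smooth_bump_seq: "smooth (bump_seq a b n)"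
proof -
  have "smooth (\<lambda>x. 1 + (- 1) * (1 + (- 1) * bump a b x) ^ n)"
    by (intro smooth_add smooth_mult smooth_const smooth_power smooth_bump)
  then show ?thesis by (simp add: bump_seq_def[abs_def])
qed

lemma bump_seq_eq_0: "x \<notin> {a<..<b} \<Longrightarrow> bump_seq a b n x = 0"
  by (simp add: bump_seq_def bump_eq_0)

lemma bump_seq_bounds: "0 \<le> bump_seq a b n x" "bump_seq a b n x \<le> 1"
  using bump_nonneg[of a b x] bump_le_1[of a b x]
  by (auto simp: bump_seq_def intro!: power_le_one)

lemma bump_seq_tendsto: "(\<lambda>n. bump_seq a b n x) \<longlonglongrightarrow> indicator {a<..<b} x"
proof (cases "x \<in> {a<..<b}")
  case True
  then have "0 < bump a b x" by (auto intro: bump_pos)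
  then have "(\<lambda>n. (1 - bump a b x) ^ n) \<longlonglongrightarrow> 0"
    using bump_le_1[of a b x] by (intro LIMSEQ_realpow_zero) auto
  then have "(\<lambda>n. 1 - (1 - bump a b x) ^ n) \<longlonglongrightarrow> 1 - 0"
    by (intro tendsto_diff tendsto_const)
  then show ?thesis using True by (simp add: bump_seq_def)
next
  case False
  then show ?thesis by (simp add: bump_seq_eq_0)
qed

lemma test_function_bump_seq: "{a..b} \<subseteq> S \<Longrightarrow> test_function S (bump_seq a b n)"
  by (rule test_functionI[of _ a b]) (auto intro: smooth_bump_seq bump_seq_eq_0)

section \<open>Functions of bounded variation\<close>

text \<open>Compactness leaves a gap between the support and the ends of the interval; half of it on
  each side makes the support fit into an open interval whose closure is still inside.\<close>

lemma test_functionD: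
  assumes "test_function {a<..<b} \<phi>" "a < b"
  obtains c d where "a < c" "c < d" "d < b" "\<And>x. x \<notin> {c<..<d} \<Longrightarrow> \<phi> x = 0"
proof (cases "fsupport \<phi> = {}")
  case True
  define c d where "c = a + (b - a) / 3" and "d = a + 2 * ((b - a) / 3)"
  have "a < c" "c < d" "d < b" using assms(2) by (auto simp: c_def d_def field_simps)
  then show ?thesis
    using that[of c d] True fsupport_eq_0[of _ \<phi>] by auto
next
  case False
  have c: "compact (fsupport \<phi>)" and s: "fsupport \<phi> \<subseteq> {a<..<b}"
    using assms by (auto simp: test_function_def)
  obtain l where l: "l \<in> fsupport \<phi>" "\<And>x. x \<in> fsupport \<phi> \<Longrightarrow> l \<le> x"
    using compact_attains_inf[OF c False] by blast
  obtain u where u: "u \<in> fsupport \<phi>" "\<And>x. x \<in> fsupport \<phi> \<Longrightarrow> x \<le> u"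
    using compact_attains_sup[OF c False] by blast
  have lu: "a < l" "l \<le> u" "u < b" using l u s by auto
  define c' d' where "c' = (a + l) / 2" and "d' = (u + b) / 2"
  have cd: "a < c'" "c' < l" "u < d'" "d' < b" using lu by (auto simp: c'_def d'_def)
  moreover have "\<phi> x = 0" if "x \<notin> {c'<..<d'}" for x
    using that l(2)[of x] u(2)[of x] cd by (intro fsupport_eq_0) auto
  ultimately show ?thesis using lu by (intro that[of c' d']) auto
qed

lemma test_function_measurable: "test_function S \<phi> \<Longrightarrow> \<phi> \<in> borel_measurable borel"
  by (simp add: test_function_def smooth_measurable)

lemma continuous_compact_support_bounded:
  fixes f :: "real \<Rightarrow> 'a::real_normed_vector"
  assumes "continuous_on UNIV f" "\<And>x. x \<notin> {c..d} \<Longrightarrow> f x = 0"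
  obtains B where "B \<ge> 0" "\<And>x. norm (f x) \<le> B"
proof -
  have "compact (f ` {c..d})"
    using assms(1) by (intro compact_continuous_image continuous_on_subset[OF assms(1)]) auto
  then obtain B where B: "\<And>x. x \<in> {c..d} \<Longrightarrow> norm (f x) \<le> B"
    using compact_imp_bounded by (fastforce simp: bounded_iff)
  show ?thesis
    by (rule that[of "\<bar>B\<bar>"]) (use B assms(2) in \<open>auto, smt (verit) norm_zero\<close>)
qed

lemma continuous_compact_support_integrable:
  fixes f :: "real \<Rightarrow> 'a::euclidean_space"
  assumes "continuous_on UNIV f" "\<And>x. x \<notin> {c..d} \<Longrightarrow> f x = 0"
  shows "integrable lborel f"
proof -
  have "set_integrable lborel {c..d} f"
    unfolding set_integrable_def
    by (rule borel_integrable_compact[OF compact_Icc continuous_on_subset[OF assms(1)]]) auto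
  moreover have "indicator {c..d} x *\<^sub>R f x = f x" for x
    using assms(2)[of x] by (auto simp: indicator_def)
  ultimately show ?thesis by (simp add: set_integrable_def)
qed

lemma test_function_bounded:
  assumes "test_function S \<phi>"
  obtains B where "B \<ge> 0" "\<And>x. \<bar>\<phi> x\<bar> \<le> B"
proof -
  obtain R where "R > 0" "\<And>x. R \<le> \<bar>x\<bar> \<Longrightarrow> \<phi> x = 0"
    using assms compact_fsupportD by (auto simp: test_function_def)
  then have "\<And>x. x \<notin> {- R..R} \<Longrightarrow> \<phi> x = 0"
    by (metis abs_le_iff atLeastAtMost_iff linorder_le_cases minus_le_iff)
  moreover have "continuous_on UNIV \<phi>"
    using assms by (simp add: test_function_def smooth_continuous_on)
  ultimately show ?thesis
    using continuous_compact_support_bounded[of \<phi> "- R" R] that by (metis real_norm_def)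
qed

text \<open>Stated for differences so that it applies to signed measures.\<close>

lemma signed_measure_eqI_test_functions:
  fixes P N P' N' :: "real measure"
  assumes fin: "finite_measure P" "finite_measure N" "finite_measure P'" "finite_measure N'"
    and sets: "sets P = sets (restrict_space borel {a<..<b})" "sets N = sets (restrict_space borel {a<..<b})"
      "sets P' = sets (restrict_space borel {a<..<b})" "sets N' = sets (restrict_space borel {a<..<b})"
    and eq: "\<And>\<phi>. test_function {a<..<b} \<phi> \<Longrightarrow>
      (LINT x|P. \<phi> x) - (LINT x|N. \<phi> x) = (LINT x|P'. \<phi> x) - (LINT x|N'. \<phi> x)"
    and A: "A \<in> sets (restrict_space borel {a<..<b})"
  shows "measure P A - measure N A = measure P' A - measure N' A"
proof -
  let ?S = "{a<..<b}"
  let ?D = "\<lambda>A. measure P A - measure N A - measure P' A + measure N' A"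
  have S: "B \<in> sets (restrict_space borel ?S) \<longleftrightarrow> B \<in> sets borel \<and> B \<subseteq> ?S" for B
    by (auto simp: sets_restrict_space_iff)
  have conv: "(\<lambda>n. LINT x|Q. bump_seq c d n x) \<longlonglongrightarrow> measure Q {c<..<d}"
    if "finite_measure Q" "sets Q = sets (restrict_space borel ?S)" "{c..d} \<subseteq> ?S" for Q c d
  proof -
    interpret finite_measure Q by fact
    have sp: "space Q = ?S" using sets_eq_imp_space_eq[OF that(2)] by (simp add: space_restrict_space)
    have m: "bump_seq c d n \<in> borel_measurable Q" for n
      unfolding measurable_cong_sets[OF that(2) refl]
      by (rule measurable_restrict_space1[OF smooth_measurable[OF smooth_bump_seq]])
    have cd: "{c<..<d} \<in> sets Q" "{c<..<d} \<inter> space Q = {c<..<d}"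
      unfolding that(2) S sp using that(3) greaterThanLessThan_subseteq_atLeastAtMost_iff[of c d c d]
      by fastforce+
    have "(\<lambda>n. LINT x|Q. bump_seq c d n x) \<longlonglongrightarrow> (LINT x|Q. indicator {c<..<d} x)"
      by (rule integral_dominated_convergence[where w="\<lambda>_. 1"])
         (use m cd bump_seq_bounds in \<open>auto simp: bump_seq_tendsto\<close>)
    then show ?thesis using cd by simp
  qed
  \<comment> \<open>The closed interval has to lie inside the open one, for otherwise the bumps are
    not test functions.\<close>
  have int: "?D {c<..<d} = 0" if "{c..d} \<subseteq> ?S" for c d
  proof -
    have "(\<lambda>n. (LINT x|P. bump_seq c d n x) - (LINT x|N. bump_seq c d n x)
        - (LINT x|P'. bump_seq c d n x) + (LINT x|N'. bump_seq c d n x)) \<longlonglongrightarrow> ?D {c<..<d}"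
      by (intro tendsto_intros conv fin sets that)
    moreover have "(LINT x|P. bump_seq c d n x) - (LINT x|N. bump_seq c d n x)
        - (LINT x|P'. bump_seq c d n x) + (LINT x|N'. bump_seq c d n x) = 0" for n
      using eq[OF test_function_bump_seq[OF that, of n]] by simp
    ultimately show ?thesis by (simp add: LIMSEQ_const_iff)
  qed
  \<comment> \<open>This interval reaches the end \<open>b\<close>, so it is exhausted by intervals
    that stay away from both ends.\<close>
  have ray: "?D ({x<..} \<inter> ?S) = 0" for x
  proof -
    define I where "I n = {max a x + 1 / real (Suc n) <..< b - 1 / real (Suc n)}" for n
    have U: "(\<Union>n. I n) = {x<..} \<inter> ?S"
    proof (intro equalityI subsetI)
      fix y assume y: "y \<in> {x<..} \<inter> {a<..<b}"
      then have "0 < min (y - max a x) (b - y)" by auto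
      then obtain n where "1 / real (Suc n) < min (y - max a x) (b - y)"
        using reals_Archimedean by (metis inverse_eq_divide)
      then have "y \<in> I n" by (auto simp: I_def)
      then show "y \<in> (\<Union>n. I n)" by blast
    next
      fix y assume "y \<in> (\<Union>n. I n)"
      then obtain n where "y \<in> I n" by blast
      moreover have "1 / real (Suc n) > 0" by simp
      ultimately have "max a x < y" "y < b" unfolding I_def by (simp_all only: greaterThanLessThan_iff) linarith+
      then show "y \<in> {x<..} \<inter> {a<..<b}" by auto
    qed
    have inc: "incseq I"
    proof (rule incseq_SucI)
      fix n
      have "1 / real (Suc (Suc n)) \<le> 1 / real (Suc n)" by (simp add: field_simps)
      then show "I n \<le> I (Suc n)" unfolding I_def by auto
    qed
    have In: "I n \<in> sets (restrict_space borel ?S)" for n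
    proof -
      have "I n \<subseteq> ?S" using U by blast
      then show ?thesis unfolding S by (simp add: I_def)
    qed
    have lim: "(\<lambda>n. measure Q (I n)) \<longlonglongrightarrow> measure Q ({x<..} \<inter> ?S)"
      if "finite_measure Q" "sets Q = sets (restrict_space borel ?S)" for Q
      using finite_measure.finite_Lim_measure_incseq[OF that(1) _ inc] In that(2) U by auto
    have "(\<lambda>n. ?D (I n)) \<longlonglongrightarrow> ?D ({x<..} \<inter> ?S)"
      by (intro tendsto_intros lim fin sets)
    moreover have "?D (I n) = 0" for n
    proof (cases "max a x + 1 / real (Suc n) < b - 1 / real (Suc n)")
      case True
      have "1 / real (Suc n) > 0" by simp
      then have "{max a x + 1 / real (Suc n) .. b - 1 / real (Suc n)} \<subseteq> ?S"
        unfolding subset_iff atLeastAtMost_iff greaterThanLessThan_iff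
        by (smt (verit))
      then show ?thesis unfolding I_def by (rule int)
    next
      case False
      then have "I n = {}" by (auto simp: I_def)
      then show ?thesis by simp
    qed
    ultimately show ?thesis by (simp add: LIMSEQ_const_iff)
  qed
  have meas: "B \<inter> ?S \<in> sets P" "B \<inter> ?S \<in> sets N" "B \<inter> ?S \<in> sets P'" "B \<inter> ?S \<in> sets N'"
    if "B \<in> sets borel" for B
    using that unfolding sets S by auto
  have gen: "sets (borel :: real measure) = sigma_sets UNIV (range greaterThan)"
    by (metis borel_Ioi sets_measure_of top_greatest Pow_UNIV)
  \<comment> \<open>\<open>?D\<close> is a difference of measures and may be negative, so uniqueness
    of measures on a generator does not apply; the Dynkin argument is carried out for
    \<open>?D\<close> itself. Complements need \<open>?D ?S = 0\<close>, the case of the ray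
    starting at \<open>a\<close>.\<close>
  have "?D (B \<inter> ?S) = 0" if "B \<in> sets borel" for B
    using that unfolding gen
  proof (induction rule: sigma_sets_induct_disjoint[rotated 2, consumes 1, case_names basic empty compl union])
    show "Int_stable (range greaterThan :: real set set)"
    proof (rule Int_stableI_image)
      fix x y :: real
      have "{x<..} \<inter> {y<..} = {max x y<..}" by auto
      then show "\<exists>z\<in>UNIV. {x<..} \<inter> {y<..} = {z<..}" by blast
    qed
  next
    show "range greaterThan \<subseteq> Pow (UNIV :: real set)" by simp
  next
    case (basic B) then show ?case using ray by auto
  next
    case empty then show ?case by simp
  next
    case (compl B)
    then have B: "B \<in> sets borel" using gen by simp
    have SS: "?S \<in> sets P" "?S \<in> sets N" "?S \<in> sets P'" "?S \<in> sets N'" unfolding sets S by auto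
    have e: "(UNIV - B) \<inter> ?S = ?S - (B \<inter> ?S)" by auto
    have "{a<..} \<inter> ?S = ?S" by auto
    then have "?D ?S = 0" using ray[of a] by simp
    then show ?case unfolding e
      using compl.IH meas[OF B] SS
      by (simp add: finite_measure.finite_measure_Diff fin)
  next
    case (union B)
    then have B: "\<And>i. B i \<in> sets borel" using gen by blast
    have dj: "disjoint_family (\<lambda>i. B i \<inter> ?S)"
      using union(1) by (auto simp: disjoint_family_on_def)
    have e: "(\<Union>i. B i) \<inter> ?S = (\<Union>i. B i \<inter> ?S)" by auto
    have s: "(\<lambda>i. measure Q (B i \<inter> ?S)) sums measure Q (\<Union>i. B i \<inter> ?S)"
      if "finite_measure Q" "sets Q = sets (restrict_space borel ?S)" for Q
      using finite_measure.finite_measure_UNION[OF that(1) _ dj] B unfolding that(2) S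
      by (simp add: image_subset_iff S that(2))
    have "(\<lambda>i. ?D (B i \<inter> ?S)) sums ?D (\<Union>i. B i \<inter> ?S)"
      by (intro sums_add sums_diff s fin sets)
    then show ?case unfolding e using union.IH sums_unique2[OF sums_zero] by auto
  qed
  moreover have "A \<in> sets borel" "A \<inter> ?S = A" using A S by auto
  ultimately show ?thesis by fastforce
qed

text \<open>\<open>P\<close> is carried by \<open>H\<close>, and on subsets of \<open>H\<close>
  outside \<open>H'\<close> the set function is nonnegative by the first decomposition and
  nonpositive by the second. Hence \<open>P\<close> gives \<open>A\<close> the value of
  \<open>m\<close> on \<open>A \<inter> H \<inter> H'\<close>, an expression symmetric in the two
  decompositions.\<close>

lemma jordan_decomposition_unique:
  assumes "jordan_decomposition S m P N" "jordan_decomposition S m P' N'"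
  shows "P = P'" "N = N'"
proof -
  let ?M = "sets (restrict_space borel S)"
  have aux: "measure P A = m (A \<inter> H \<inter> H')"
    if j: "finite_measure P" "finite_measure N" "finite_measure P'" "finite_measure N'"
      "sets P = ?M" "sets N = ?M" "sets P' = ?M" "sets N' = ?M"
      "H \<in> ?M" "H' \<in> ?M" "A \<in> ?M"
      "emeasure P (S - H) = 0" "emeasure N H = 0" "emeasure P' (S - H') = 0" "emeasure N' H' = 0"
      "\<And>A. A \<in> ?M \<Longrightarrow> m A = measure P A - measure N A"
      "\<And>A. A \<in> ?M \<Longrightarrow> m A = measure P' A - measure N' A" for P N P' N' A H H'
  proof -
    have AS: "A \<subseteq> S" using j(11) sets.sets_into_space[of A "restrict_space borel S"]
      by (auto simp: space_restrict_space)
    have S': "S \<in> ?M" using sets.top[of "restrict_space borel S"] by (simp add: space_restrict_space)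
    have 1: "measure P (A - H) = 0"
    proof -
      have "emeasure P (A - H) \<le> emeasure P (S - H)"
        using AS j(5,9) S' by (intro emeasure_mono) auto
      then show ?thesis using j(12) by (simp add: measure_def)
    qed
    have 2: "measure N (A \<inter> H \<inter> B) = 0" for B
    proof -
      have "emeasure N (A \<inter> H \<inter> B) \<le> emeasure N H"
        using j(6,9) by (intro emeasure_mono) auto
      then show ?thesis using j(13) by (simp add: measure_def)
    qed
    have 3: "measure P' (A \<inter> H - H') = 0"
    proof -
      have "emeasure P' (A \<inter> H - H') \<le> emeasure P' (S - H')"
        using AS j(7,10) S' by (intro emeasure_mono) auto
      then show ?thesis using j(14) by (simp add: measure_def)
    qed
    have s: "A - H \<in> ?M" "A \<inter> H \<in> ?M" "A \<inter> H - H' \<in> ?M" "A \<inter> H \<inter> H' \<in> ?M"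
      using j(9-11) by auto
    have "measure P A = measure P (A \<inter> H) + measure P (A - H)"
      using finite_measure.finite_measure_Union[OF j(1), of "A \<inter> H" "A - H"] s j(5)
      by (simp add: Int_Diff_Un Int_Diff_disjoint)
    moreover have "measure P (A \<inter> H) = measure P (A \<inter> H \<inter> H') + measure P (A \<inter> H - H')"
      using finite_measure.finite_measure_Union[OF j(1), of "A \<inter> H \<inter> H'" "A \<inter> H - H'"] s j(5)
      by (simp add: Int_Diff_Un Int_Diff_disjoint)
    moreover have "measure P (A \<inter> H - H') = 0"
    proof -
      have "m (A \<inter> H - H') = measure P (A \<inter> H - H')"
        using j(16)[OF s(3)] 2[of "- H'"] by (simp add: Diff_eq)
      moreover have "m (A \<inter> H - H') \<le> 0"
        using j(17)[OF s(3)] 3 by simp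
      ultimately show ?thesis using measure_nonneg[of P "A \<inter> H - H'"] by linarith
    qed
    ultimately show ?thesis using 1 j(16)[OF s(4)] 2[of H'] by simp
  qed
  from assms obtain H H' where
    H: "H \<in> ?M" "H' \<in> ?M" "emeasure P (S - H) = 0" "emeasure N H = 0"
      "emeasure P' (S - H') = 0" "emeasure N' H' = 0"
    and s: "sets P = ?M" "sets N = ?M" "sets P' = ?M" "sets N' = ?M"
    and f: "finite_measure P" "finite_measure N" "finite_measure P'" "finite_measure N'"
    and m: "\<And>A. A \<in> ?M \<Longrightarrow> m A = measure P A - measure N A"
      "\<And>A. A \<in> ?M \<Longrightarrow> m A = measure P' A - measure N' A"
    unfolding jordan_decomposition_def by blast
  have PP: "measure P A = measure P' A" if "A \<in> ?M" for A
  proof -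
    have "measure P A = m (A \<inter> H \<inter> H')" by (rule aux[of P N P' N' H H' A]) (use H s f m that in auto)
    moreover have "measure P' A = m (A \<inter> H' \<inter> H)" by (rule aux[of P' N' P N H' H A]) (use H s f m that in auto)
    ultimately show ?thesis by (simp add: Int_ac)
  qed
  then have NN: "measure N A = measure N' A" if "A \<in> ?M" for A
    using m[OF that] that by fastforce
  show "P = P'" by (rule measure_eqI) (use PP f s in \<open>auto simp: finite_measure.emeasure_eq_measure\<close>)
  show "N = N'" by (rule measure_eqI) (use NN f s in \<open>auto simp: finite_measure.emeasure_eq_measure\<close>)
qed

section \<open>Uniqueness and localisation of the distributional derivative\<close>

lemma pos_part_eq: "jordan_decomposition S m P N \<Longrightarrow> pos_part S m = P"
  unfolding pos_part_def by (rule the_equality) (auto dest: jordan_decomposition_unique)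

lemma neg_part_eq: "jordan_decomposition S m P N \<Longrightarrow> neg_part S m = N"
  unfolding neg_part_def by (rule the_equality) (auto dest: jordan_decomposition_unique)

lemma has_distr_deriv_unique:
  assumes "has_distr_deriv f {a<..<b} m" "has_distr_deriv f {a<..<b} m'"
  shows "m = m'"
proof
  fix A
  let ?S = "{a<..<b}"
  from assms obtain P N P' N' where
    j: "jordan_decomposition ?S m P N" "jordan_decomposition ?S m' P' N'"
    and t: "\<And>\<phi>. test_function ?S \<phi> \<Longrightarrow>
        (LINT x|lborel. f x * vderiv \<phi> x) = - ((LINT x|P. \<phi> x) - (LINT x|N. \<phi> x))"
      "\<And>\<phi>. test_function ?S \<phi> \<Longrightarrow>
        (LINT x|lborel. f x * vderiv \<phi> x) = - ((LINT x|P'. \<phi> x) - (LINT x|N'. \<phi> x))"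
    unfolding has_distr_deriv_def by blast
  show "m A = m' A"
  proof (cases "A \<in> sets (restrict_space borel ?S)")
    case True
    have "measure P A - measure N A = measure P' A - measure N' A"
      proof (rule signed_measure_eqI_test_functions[OF _ _ _ _ _ _ _ _ _ True])
      fix \<phi> assume "test_function ?S \<phi>"
      from t[OF this] show "(LINT x|P. \<phi> x) - (LINT x|N. \<phi> x) = (LINT x|P'. \<phi> x) - (LINT x|N'. \<phi> x)"
        by simp
    qed (use j in \<open>auto simp: jordan_decomposition_def\<close>)
    then show ?thesis using j True by (simp add: jordan_decomposition_def)
  next
    case False
    then show ?thesis using assms by (simp add: has_distr_deriv_def finite_signed_measure_def)
  qed
qed

lemma distr_deriv_eq: "has_distr_deriv f {a<..<b} m \<Longrightarrow> distr_deriv f {a<..<b} = m"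
  unfolding distr_deriv_def by (rule the_equality) (auto dest: has_distr_deriv_unique)

text \<open>A test function on the smaller interval is one on the larger, and the Hahn set is cut
  down to \<open>S'\<close>, so restriction commutes with the Jordan decomposition.\<close>

lemma has_distr_deriv_restrict:
  assumes d: "has_distr_deriv f {a<..<b} m" and j: "jordan_decomposition {a<..<b} m P N"
    and a: "a \<le> a'"
  defines "S' \<equiv> {a'<..<b}"
  defines "m' \<equiv> \<lambda>A. if A \<in> sets (restrict_space borel S') then m A else 0"
  shows "has_distr_deriv f S' m'"
    "jordan_decomposition S' m' (restrict_space P S') (restrict_space N S')"
proof -
  let ?S = "{a<..<b}"
  have sub: "S' \<subseteq> ?S" using a by (auto simp: S'_def)
  have S: "B \<in> sets (restrict_space borel ?S) \<longleftrightarrow> B \<in> sets borel \<and> B \<subseteq> ?S" for B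
    by (auto simp: sets_restrict_space_iff)
  have S1: "B \<in> sets (restrict_space borel S') \<longleftrightarrow> B \<in> sets borel \<and> B \<subseteq> S'" for B
    by (auto simp: S'_def sets_restrict_space_iff)
  have le: "sets (restrict_space borel S') \<subseteq> sets (restrict_space borel ?S)"
    using S S1 sub by blast
  from j have s: "sets P = sets (restrict_space borel ?S)" "sets N = sets (restrict_space borel ?S)"
    and f: "finite_measure P" "finite_measure N"
    and m: "\<And>A. A \<in> sets (restrict_space borel ?S) \<Longrightarrow> m A = measure P A - measure N A"
    by (auto simp: jordan_decomposition_def)
  have sp: "space P = ?S" "space N = ?S"
    using sets_eq_imp_space_eq[OF s(1)] sets_eq_imp_space_eq[OF s(2)] by (auto simp: space_restrict_space)
  have S'P: "S' \<inter> space P \<in> sets P" "S' \<inter> space N \<in> sets N" "S' \<in> sets P" "S' \<in> sets N"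
    using sub unfolding s sp S by (auto simp: S'_def)
  have sr: "sets (restrict_space Q S') = sets (restrict_space borel S')"
    if "sets Q = sets (restrict_space borel ?S)" for Q
  proof -
    have "B \<in> sets (restrict_space Q S') \<longleftrightarrow> B \<in> sets (restrict_space borel S')" for B
      unfolding sets_restrict_space that S1 image_iff using sub S by (auto simp: S'_def) (blast+)?
    then show ?thesis by blast
  qed
  have er: "emeasure (restrict_space Q S') A = emeasure Q A"
    if "sets Q = sets (restrict_space borel ?S)" "A \<subseteq> S'" for Q A
  proof (rule emeasure_restrict_space[OF _ that(2)])
    have "space Q = ?S" using sets_eq_imp_space_eq[OF that(1)] by (simp add: space_restrict_space)
    then show "S' \<inter> space Q \<in> sets Q" using sub unfolding that(1) S by (auto simp: S'_def)
  qed
  show jr: "jordan_decomposition S' m' (restrict_space P S') (restrict_space N S')"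
  proof -
    from j obtain H where H: "H \<in> sets (restrict_space borel ?S)" "emeasure P (?S - H) = 0" "emeasure N H = 0"
      by (auto simp: jordan_decomposition_def)
    have HS: "H \<inter> S' \<in> sets (restrict_space borel S')"
      using H(1) unfolding S S1 by (auto simp: S'_def)
    have "emeasure P (S' - H \<inter> S') \<le> emeasure P (?S - H)"
      using sub H(1) s by (intro emeasure_mono) (auto simp: s S)
    moreover have "emeasure N (H \<inter> S') \<le> emeasure N H"
      using H(1) s by (intro emeasure_mono) auto
    moreover have "finite_measure (restrict_space P S')" "finite_measure (restrict_space N S')"
      using f S'P by (auto intro!: finite_measure_restrict_space)
    moreover have "m' A = measure (restrict_space P S') A - measure (restrict_space N S') A"
      if "A \<in> sets (restrict_space borel S')" for A
      using that m[of A] le er[OF s(1), of A] er[OF s(2), of A] S1[of A] by (auto simp: m'_def measure_def)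
    ultimately show ?thesis
      unfolding jordan_decomposition_def
      using sr s HS er[OF s(1), of "S' - H \<inter> S'"] er[OF s(2), of "H \<inter> S'"] H
      by (auto intro!: bexI[of _ "H \<inter> S'"])
  qed
  have fs: "finite_signed_measure ?S m" using d by (simp add: has_distr_deriv_def)
  have "finite_signed_measure S' m'"
    unfolding finite_signed_measure_def
  proof (intro conjI allI impI)
    show "m' {} = 0" using fs by (simp add: m'_def finite_signed_measure_def)
    show "m' A = 0" if "A \<notin> sets (restrict_space borel S')" for A using that by (simp add: m'_def)
    fix A :: "nat \<Rightarrow> real set" assume A: "range A \<subseteq> sets (restrict_space borel S')" "disjoint_family A"
    then have "(\<lambda>i. m (A i)) sums m (\<Union>i. A i)"
      using fs le unfolding finite_signed_measure_def by blast
    moreover have "A i \<in> sets (restrict_space borel S')" for i using A by blast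
    moreover have "(\<Union>i. A i) \<in> sets (restrict_space borel S')" using A by auto
    ultimately show "(\<lambda>i. m' (A i)) sums m' (\<Union>i. A i)" by (simp add: m'_def)
  qed
  moreover have "(LINT x|lborel. f x * vderiv \<phi> x) =
      - ((LINT x|restrict_space P S'. \<phi> x) - (LINT x|restrict_space N S'. \<phi> x))"
    if t: "test_function S' \<phi>" for \<phi>
  proof -
    have t': "test_function ?S \<phi>" using t sub by (auto simp: test_function_def)
    obtain P0 N0 where j0: "jordan_decomposition ?S m P0 N0"
      and "(LINT x|lborel. f x * vderiv \<phi> x) = - ((LINT x|P0. \<phi> x) - (LINT x|N0. \<phi> x))"
      using d t' unfolding has_distr_deriv_def by blast
    moreover have "P0 = P" "N0 = N" using jordan_decomposition_unique[OF j0 j] by auto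
    moreover have "(LINT x|restrict_space Q S'. \<phi> x) = (LINT x|Q. \<phi> x)"
      if "S' \<inter> space Q \<in> sets Q" for Q
    proof -
      have "\<phi> x = 0" if "x \<notin> S'" for x
        using t that by (intro fsupport_eq_0) (auto simp: test_function_def)
      then have e: "indicat_real S' x *\<^sub>R \<phi> x = \<phi> x" for x by (auto simp: indicator_def)
      show ?thesis unfolding integral_restrict_space[OF that] set_lebesgue_integral_def e ..
    qed
    ultimately show ?thesis using S'P by simp
  qed
  ultimately show "has_distr_deriv f S' m'"
    unfolding has_distr_deriv_def using jr by blast
qed

text \<open>Each variation is defined through the derivative on its own interval. Reading all of
  them off one pair of measures turns monotonicity and right-continuity in the left end point into
  properties of measures.\<close>

lemma variation_eq:
  assumes d: "has_distr_deriv f {a<..<b} m" and j: "jordan_decomposition {a<..<b} m P N"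
    and a: "a \<le> a'"
  shows "pos_variation a' b f = emeasure P {a'<..<b}" "neg_variation a' b f = emeasure N {a'<..<b}"
proof -
  let ?S' = "{a'<..<b}"
  have sp: "space P = {a<..<b}" "space N = {a<..<b}" "sets P = sets (restrict_space borel {a<..<b})"
     "sets N = sets (restrict_space borel {a<..<b})"
    using j sets_eq_imp_space_eq[of P] sets_eq_imp_space_eq[of N]
    by (auto simp: jordan_decomposition_def space_restrict_space)
  have S'P: "?S' \<inter> space P \<in> sets P" "?S' \<inter> space N \<in> sets N"
    using a unfolding sp by (auto simp: sets_restrict_space_iff)
  note * = has_distr_deriv_restrict[OF d j a]
  show "pos_variation a' b f = emeasure P {a'<..<b}"
    unfolding pos_variation_def distr_deriv_eq[OF *(1)] pos_part_eq[OF *(2)]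
    by (rule emeasure_restrict_space[OF S'P(1)]) simp
  show "neg_variation a' b f = emeasure N {a'<..<b}"
    unfolding neg_variation_def distr_deriv_eq[OF *(1)] neg_part_eq[OF *(2)]
    by (rule emeasure_restrict_space[OF S'P(2)]) simp
qed

text \<open>The positive and negative parts of \<open>g\<close> are taken as densities of two finite
  measures; test functions cannot tell their difference from that of two null measures, so the
  measures coincide and with them the densities.\<close>

lemma AE_eq_0I_test_functions:
  fixes g :: "real \<Rightarrow> real"
  assumes g: "set_integrable lborel {a<..<b} g"
    and eq: "\<And>\<phi>. test_function {a<..<b} \<phi> \<Longrightarrow> (LINT x|lborel. g x * \<phi> x) = 0"
  shows "AE x in lborel. x \<in> {a<..<b} \<longrightarrow> g x = 0"
proof -
  let ?S = "{a<..<b}"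
  define M where "M = restrict_space lborel ?S"
  have sM: "sets M = sets (restrict_space borel ?S)"
    unfolding M_def by (intro sets_restrict_space_cong) simp
  have gi: "integrable M g"
    using g unfolding M_def set_integrable_def by (subst integrable_restrict_space) auto
  then have gm[measurable]: "g \<in> borel_measurable M" by simp
  define P where "P = density M (\<lambda>x. ennreal (g x))"
  define N where "N = density M (\<lambda>x. ennreal (- g x))"
  have fin: "(\<integral>\<^sup>+x. ennreal (g x) \<partial>M) \<noteq> \<infinity>" "(\<integral>\<^sup>+x. ennreal (- g x) \<partial>M) \<noteq> \<infinity>"
    using gi by (auto simp: real_integrable_def)
  have fP: "finite_measure P" "finite_measure N"
    using fin by (auto simp: P_def N_def emeasure_density intro!: finite_measureI nn_integral_cong
        cong: nn_integral_cong simp: indicator_def)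
  have sP: "sets P = sets (restrict_space borel ?S)" "sets N = sets (restrict_space borel ?S)"
    by (simp_all add: P_def N_def sM)
  have t: "(LINT x|P. \<phi> x) - (LINT x|N. \<phi> x) = 0" if p: "test_function ?S \<phi>" for \<phi>
  proof -
    have pm[measurable]: "\<phi> \<in> borel_measurable M"
      unfolding measurable_cong_sets[OF sM refl]
      by (rule measurable_restrict_space1[OF test_function_measurable[OF p]])
    have dm: "(LINT x|density M (\<lambda>x. ennreal (f x)). \<phi> x) = (LINT x|M. max 0 (f x) * \<phi> x)"
      if [measurable]: "f \<in> borel_measurable M" for f :: "real \<Rightarrow> real"
    proof -
      have "density M (\<lambda>x. ennreal (f x)) = density M (\<lambda>x. ennreal (max 0 (f x)))"
        by (intro density_cong) (auto simp: max_def ennreal_neg)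
      also have "(LINT x|\<dots>. \<phi> x) = (LINT x|M. max 0 (f x) *\<^sub>R \<phi> x)"
        by (rule integral_density) auto
      finally show ?thesis by simp
    qed
    have 1: "(LINT x|P. \<phi> x) = (LINT x|M. max 0 (g x) * \<phi> x)"
      unfolding P_def by (rule dm) simp
    have 2: "(LINT x|N. \<phi> x) = (LINT x|M. max 0 (- g x) * \<phi> x)"
      unfolding N_def by (rule dm) simp
    obtain B where B: "B \<ge> 0" "\<And>x. \<bar>\<phi> x\<bar> \<le> B" using test_function_bounded[OF p] by metis
    have i: "integrable M (\<lambda>x. max 0 (g x) * \<phi> x)" "integrable M (\<lambda>x. max 0 (- g x) * \<phi> x)"
    proof -
      have gB: "integrable M (\<lambda>x. B * g x)" using gi by simp
      show "integrable M (\<lambda>x. max 0 (g x) * \<phi> x)" "integrable M (\<lambda>x. max 0 (- g x) * \<phi> x)"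
        by (rule Bochner_Integration.integrable_bound[OF gB];
            use B in \<open>auto simp: abs_mult mult.commute[of B] intro!: mult_mono\<close>)+
    qed
    have "(LINT x|P. \<phi> x) - (LINT x|N. \<phi> x) = (LINT x|M. max 0 (g x) * \<phi> x - max 0 (- g x) * \<phi> x)"
      using i by (simp add: 1 2)
    also have "\<dots> = (LINT x|M. g x * \<phi> x)"
      by (rule Bochner_Integration.integral_cong) (auto simp: max_def)
    also have "\<dots> = (LINT x|lborel. indicator ?S x *\<^sub>R (g x * \<phi> x))"
      unfolding M_def by (subst integral_restrict_space) (auto simp: set_lebesgue_integral_def)
    also have "\<dots> = (LINT x|lborel. g x * \<phi> x)"
    proof (rule Bochner_Integration.integral_cong)
      fix x
      show "indicator ?S x *\<^sub>R (g x * \<phi> x) = g x * \<phi> x"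
      proof (cases "x \<in> ?S")
        case False
        then have "\<phi> x = 0" using p by (intro fsupport_eq_0) (auto simp: test_function_def)
        then show ?thesis by simp
      qed simp
    qed simp
    finally show ?thesis using eq[OF p] by simp
  qed
  interpret nul: finite_measure "null_measure M"
    by (rule finite_measureI) simp
  have "P = N"
  proof (rule measure_eqI)
    show "sets P = sets N" using sP by simp
    fix A assume "A \<in> sets P"
    then have A: "A \<in> sets (restrict_space borel ?S)" using sP by simp
    have "measure P A - measure N A = measure (null_measure M) A - measure (null_measure M) A"
      by (rule signed_measure_eqI_test_functions[OF fP nul.finite_measure_axioms nul.finite_measure_axioms sP _ _ _ A])
         (use sM t in auto)
    then show "emeasure P A = emeasure N A"
      using fP by (simp add: finite_measure.emeasure_eq_measure)
  qed
  then have "AE x in M. ennreal (g x) = ennreal (- g x)"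
    unfolding P_def N_def using fin by (subst (asm) finite_density_unique) auto
  then have "AE x in M. g x = 0"
    by eventually_elim (smt (verit) ennreal_eq_0_iff ennreal_neg)
  then show ?thesis
    unfolding M_def by (subst (asm) AE_restrict_space_iff) auto
qed

section \<open>Functions with vanishing distributional derivative\<close>

lemma ex_antiderivative:
  fixes f :: "real \<Rightarrow> 'a::euclidean_space"
  assumes "continuous_on UNIV f"
  shows "\<exists>F. \<forall>x. (F has_vector_derivative f x) (at x)"
proof -
  have "\<exists>F. \<forall>x :: real. -\<infinity> < ereal x \<longrightarrow> ereal x < \<infinity> \<longrightarrow> (F has_vector_derivative f x) (at x)"
    by (rule einterval_antiderivative) (use assms in \<open>auto simp: continuous_on_eq_continuous_at\<close>)
  then show ?thesis by auto
qed

lemma vderiv_eq_0: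
  assumes "\<And>x. x \<notin> {c..d} \<Longrightarrow> \<phi> x = 0" "x \<notin> {c..d}"
  shows "vderiv \<phi> x = 0"
proof -
  have "(\<phi> has_vector_derivative 0) (at x)"
  proof (rule has_vector_derivative_transform_within_open[of "\<lambda>_. 0" 0 x "- {c..d}"])
    show "open (- {c..d})" by (simp add: open_Compl)
  qed (use assms in auto)
  then show ?thesis by (simp add: vderiv_def vector_derivative_at)
qed

text \<open>The antiderivative is normalised to vanish to the left of the support; vanishing of the
  integral makes it vanish to the right as well.\<close>

lemma test_function_antiderivative:
  assumes \<phi>: "test_function {a<..<b} \<phi>" "a < b" and z: "(LINT x|lborel. \<phi> x) = 0"
  obtains \<Phi> where "test_function {a<..<b} \<Phi>" "vderiv \<Phi> = \<phi>"
proof -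
  obtain c d where cd: "a < c" "c < d" "d < b" "\<And>x. x \<notin> {c<..<d} \<Longrightarrow> \<phi> x = 0"
    using test_functionD[OF \<phi>] by metis
  have s: "smooth \<phi>" using \<phi> by (simp add: test_function_def)
  obtain F where F: "\<And>x. (F has_vector_derivative \<phi> x) (at x)"
    using ex_antiderivative[OF smooth_continuous_on[OF s]] by blast
  define \<Phi> where "\<Phi> x = F x + (- F c)" for x
  have D: "(\<Phi> has_vector_derivative \<phi> x) (at x)" for x
    unfolding \<Phi>_def using has_vector_derivative_add[OF F[of x] has_vector_derivative_const[of "- F c"]] by simp
  have "integral\<^sup>L lborel (\<lambda>x. indicator {c..d} x *\<^sub>R \<phi> x) = F d - F c"
    by (rule integral_FTC_Icc[of c d F])
       (use cd F s in \<open>auto simp: smooth_continuous_on intro: has_vector_derivative_at_within\<close>)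
  moreover have "(\<lambda>x. indicator {c..d} x *\<^sub>R \<phi> x) = \<phi>"
  proof
    fix x show "indicator {c..d} x *\<^sub>R \<phi> x = \<phi> x"
      using cd(4)[of x] by (cases "x \<in> {c..d}") auto
  qed
  ultimately have dc: "F d = F c" using z by simp
  have const: "F x = F y" if "x \<in> T" "y \<in> T" "convex T" "\<And>x. x \<in> T \<Longrightarrow> \<phi> x = 0" for x y T
  proof -
    have "(F has_vector_derivative 0) (at x within T)" if "x \<in> T" for x
      using F[of x] \<open>\<And>x. x \<in> T \<Longrightarrow> \<phi> x = 0\<close>[OF that] by (auto intro: has_vector_derivative_at_within)
    from has_vector_derivative_zero_constant[OF that(3) this]
    obtain k where "\<And>x. x \<in> T \<Longrightarrow> F x = k" by blast
    then show ?thesis using that(1,2) by auto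
  qed
  have "\<Phi> x = 0" if "x \<notin> {c..d}" for x
  proof -
    have "F x = F c"
    proof (cases "x < c")
      case True then show ?thesis by (intro const[of x "{..c}" c]) (use cd in auto)
    next
      case False
      then have "F x = F d" using that by (intro const[of x "{d..}" d]) (use cd in auto)
      then show ?thesis using dc by simp
    qed
    then show ?thesis by (simp add: \<Phi>_def)
  qed
  then have "test_function {a<..<b} \<Phi>"
    using cd by (intro test_functionI[of \<Phi> c d] smoothI_vderiv[OF D s]) auto
  moreover have "vderiv \<Phi> = \<phi>" using D by (rule has_vector_derivative_vderiv_eq)
  ultimately show ?thesis by (rule that)
qed

lemma set_integrable_mult_test_function:
  fixes g :: "real \<Rightarrow> real"
  assumes g: "set_integrable lborel S g" and p: "\<phi> \<in> borel_measurable borel" "\<And>x. \<bar>\<phi> x\<bar> \<le> B"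
    "\<And>x. x \<notin> S \<Longrightarrow> \<phi> x = 0"
  shows "integrable lborel (\<lambda>x. g x * \<phi> x)"
proof -
  have gB: "integrable lborel (\<lambda>x. B * (indicator S x * g x))" using g by (simp add: set_integrable_def)
  have e: "g x * \<phi> x = (indicator S x * g x) * \<phi> x" for x
    using p(3)[of x] by (auto simp: indicator_def)
  have m: "(\<lambda>x. indicator S x * g x) \<in> borel_measurable lborel" using g by (simp add: set_integrable_def)
  show ?thesis unfolding e
    by (rule Bochner_Integration.integrable_bound[OF gB])
       (use m p in \<open>auto simp: abs_mult mult.commute[of B] intro!: mult_mono order_trans[OF p(2)]\<close>)
qed

text \<open>The du Bois-Reymond lemma. Subtracting a multiple of one fixed bump from a test function
  makes its integral zero, hence makes it the derivative of a test function, on which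
  \<open>g\<close> vanishes by hypothesis. The constant is the mean of \<open>g\<close> against that
  bump.\<close>

lemma AE_const_test_functions:
  fixes g :: "real \<Rightarrow> real"
  assumes ab: "a < b" and g: "set_integrable lborel {a<..<b} g"
    and eq: "\<And>\<phi>. test_function {a<..<b} \<phi> \<Longrightarrow> (LINT x|lborel. g x * vderiv \<phi> x) = 0"
  obtains c where "AE x in lborel. x \<in> {a<..<b} \<longrightarrow> g x = c"
proof -
  let ?S = "{a<..<b}"
  define c' d' where "c' = a + (b - a) / 3" and "d' = a + 2 * ((b - a) / 3)"
  have cd: "a < c'" "c' < d'" "d' < b" using ab by (auto simp: c'_def d'_def field_simps)
  have t0: "test_function ?S (bump c' d')"
    by (rule test_functionI[of _ c' d']) (use cd in \<open>auto simp: smooth_bump bump_eq_0\<close>)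
  have int: "integrable lborel \<phi>" "integrable lborel (\<lambda>x. g x * \<phi> x)" if t: "test_function ?S \<phi>" for \<phi>
  proof -
    obtain c d where cd: "\<And>x. x \<notin> {c<..<d} \<Longrightarrow> \<phi> x = 0" using test_functionD[OF t ab] by metis
    show "integrable lborel \<phi>"
      using t cd by (intro continuous_compact_support_integrable[of _ c d])
        (auto simp: test_function_def smooth_continuous_on)
    obtain B where "\<And>x. \<bar>\<phi> x\<bar> \<le> B" using test_function_bounded[OF t] by blast
    then show "integrable lborel (\<lambda>x. g x * \<phi> x)"
      using t by (intro set_integrable_mult_test_function[OF g])
        (auto simp: test_function_measurable test_function_def smooth_measurable
          intro!: fsupport_eq_0[of _ \<phi>])
  qed
  define I where "I = (LINT x|lborel. bump c' d' x)"
  have "I \<noteq> 0"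
  proof
    assume "I = 0"
    then have "AE x in lborel. bump c' d' x = 0"
      unfolding I_def using int(1)[OF t0] by (subst (asm) integral_nonneg_eq_0_iff_AE) (auto simp: bump_nonneg)
    then have "AE x in lborel. x \<notin> {c'<..<d'}"
      by eventually_elim (use bump_pos in fastforce)
    then have "emeasure lborel {x \<in> space lborel. \<not> x \<notin> {c'<..<d'}} = 0"
      by (subst (asm) AE_iff_measurable[OF _ refl]) auto
    moreover have "{x \<in> space lborel. \<not> x \<notin> {c'<..<d'}} = {c'<..<d'}" by auto
    ultimately show False using cd by simp
  qed
  define c where "c = (LINT x|lborel. g x * bump c' d' x) / I"
  have "(LINT x|lborel. (g x - c) * \<phi> x) = 0" if t: "test_function ?S \<phi>" for \<phi>
  proof -
    define J where "J = (LINT x|lborel. \<phi> x)"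
    define \<psi> where "\<psi> x = \<phi> x + (- (J / I)) * bump c' d' x" for x
    have tp: "test_function ?S \<psi>"
    proof -
      obtain l u where lu: "a < l" "u < b" "\<And>x. x \<notin> {l<..<u} \<Longrightarrow> \<phi> x = 0"
        using test_functionD[OF t ab] by metis
      show ?thesis
      proof (rule test_functionI[of _ "min l c'" "max u d'"])
        show "smooth \<psi>" unfolding \<psi>_def using t
          by (intro smooth_add smooth_mult smooth_const smooth_bump) (simp add: test_function_def)
        show "{min l c'..max u d'} \<subseteq> ?S" using lu cd by auto
        show "\<psi> x = 0" if "x \<notin> {min l c'..max u d'}" for x
        proof -
          have "x \<notin> {l<..<u}" "x \<notin> {c'<..<d'}" using that by auto
          then show ?thesis using lu(3)[of x] bump_eq_0[of x c' d'] by (simp add: \<psi>_def)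
        qed
      qed
    qed
    have "(LINT x|lborel. \<psi> x) = J + (- (J / I)) * I"
      unfolding \<psi>_def I_def J_def using int(1)[OF t] int(1)[OF t0]
      by (subst Bochner_Integration.integral_add) auto
    then have "(LINT x|lborel. \<psi> x) = 0" using \<open>I \<noteq> 0\<close> by simp
    then obtain \<Psi> where \<Psi>: "test_function ?S \<Psi>" "vderiv \<Psi> = \<psi>"
      using test_function_antiderivative[OF tp ab] by blast
    have "0 = (LINT x|lborel. g x * \<psi> x)" using eq[OF \<Psi>(1)] \<Psi>(2) by simp
    also have "\<dots> = (LINT x|lborel. g x * \<phi> x + (- (J / I)) * (g x * bump c' d' x))"
      by (simp add: \<psi>_def algebra_simps)
    also have "\<dots> = (LINT x|lborel. g x * \<phi> x) + (- (J / I)) * (LINT x|lborel. g x * bump c' d' x)"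
      using int(2)[OF t] int(2)[OF t0] by (subst Bochner_Integration.integral_add) auto
    also have "\<dots> = (LINT x|lborel. g x * \<phi> x) - c * J"
      using \<open>I \<noteq> 0\<close> by (simp add: c_def)
    also have "\<dots> = (LINT x|lborel. g x * \<phi> x - c * \<phi> x)"
      unfolding J_def using int[OF t] by simp
    finally show ?thesis by (simp add: algebra_simps)
  qed
  moreover have "set_integrable lborel ?S (\<lambda>x. g x - c)"
    using ab by (intro set_integral_diff(1)[OF g]) (auto simp: set_integrable_def)
  ultimately have "AE x in lborel. x \<in> ?S \<longrightarrow> g x - c = 0"
    by (intro AE_eq_0I_test_functions) auto
  then show ?thesis by (intro that[of c]) auto
qed

section \<open>Tails of measures and functions of bounded variation\<close>

lemma antimono_measure_ray:
  assumes "finite_measure N" "sets N = sets (borel :: real measure)"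
  shows "antimono (\<lambda>x. measure N {x<..})"
  using assms by (intro antimonoI finite_measure.finite_measure_mono) auto

lemma borel_measurable_antimono:
  fixes f :: "real \<Rightarrow> real"
  assumes "antimono f" shows "f \<in> borel_measurable borel"
proof -
  have "mono (\<lambda>x. - f x)" using assms by (auto simp: mono_def antimono_def)
  then have "(\<lambda>x. - f x) \<in> borel_measurable borel" by (rule borel_measurable_mono)
  then show ?thesis by simp
qed

text \<open>The tail x -> N(x, infinity) has distributional derivative -N: after an exchange of
  integrals the inner one is that of \<open>vderiv \<phi>\<close> up to \<open>y\<close>, which is
  \<open>\<phi> y\<close>.\<close>

lemma integral_measure_ray:
  assumes N: "finite_measure N" "sets N = sets (borel :: real measure)"
    and \<phi>: "smooth \<phi>" "\<And>x. x \<notin> {c<..<d} \<Longrightarrow> \<phi> x = 0" "c < d"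
  shows "(LINT x|lborel. measure N {x<..} * vderiv \<phi> x) = (LINT y|N. \<phi> y)"
proof -
  interpret N: finite_measure N by fact
  interpret pair_sigma_finite lborel N ..
  have [measurable_cong]: "sets N = sets borel" by fact
  have spN: "space N = UNIV" using sets_eq_imp_space_eq[OF N(2)] by simp
  have vm[measurable]: "vderiv \<phi> \<in> borel_measurable borel" by (rule smooth_measurable[OF smooth_vderiv[OF \<phi>(1)]])
  have v0: "vderiv \<phi> x = 0" if "x \<notin> {c..d}" for x
    by (rule vderiv_eq_0[OF _ that]) (use \<phi>(2) in auto)
  have vi: "integrable lborel (vderiv \<phi>)"
    by (rule continuous_compact_support_integrable[OF _ v0]) (auto intro: smooth_continuous_on smooth_vderiv \<phi>)
  let ?g = "\<lambda>x y. indicator {x<..} y * vderiv \<phi> x"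
  have gm[measurable]: "(\<lambda>(x, y). ?g x y) \<in> borel_measurable (lborel \<Otimes>\<^sub>M N)"
  proof -
    have e: "(\<lambda>(x, y). ?g x y) = (\<lambda>z. (if fst z < snd z then 1 else 0) * vderiv \<phi> (fst z))"
      by (auto simp: indicator_def)
    show ?thesis unfolding e by measurable
  qed
  have inner: "(LINT y|N. ?g x y) = measure N {x<..} * vderiv \<phi> x" for x
    using N(2) by (simp add: spN)
  have gi: "integrable (lborel \<Otimes>\<^sub>M N) (\<lambda>(x, y). ?g x y)"
  proof (rule Fubini_integrable[OF gm])
    have "(\<lambda>x. LINT y|N. norm (?g x y)) = (\<lambda>x. measure N {x<..} * \<bar>vderiv \<phi> x\<bar>)"
      using N(2) by (simp add: abs_mult spN)
    moreover have "integrable lborel (\<lambda>x. measure N {x<..} * \<bar>vderiv \<phi> x\<bar>)"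
    proof (rule Bochner_Integration.integrable_bound)
      show "integrable lborel (\<lambda>x. measure N (space N) * vderiv \<phi> x)" using vi by simp
      show "(\<lambda>x. measure N {x<..} * \<bar>vderiv \<phi> x\<bar>) \<in> borel_measurable lborel"
        using borel_measurable_antimono[OF antimono_measure_ray[OF N]] by measurable
      show "AE x in lborel. norm (measure N {x<..} * \<bar>vderiv \<phi> x\<bar>) \<le> norm (measure N (space N) * vderiv \<phi> x)"
        by (auto simp: abs_mult intro!: mult_right_mono N.bounded_measure)
    qed
    ultimately show "integrable lborel (\<lambda>x. LINT y|N. norm (case (x, y) of (x, y) \<Rightarrow> ?g x y))" by simp
    show "AE x in lborel. integrable N (\<lambda>y. case (x, y) of (x, y) \<Rightarrow> ?g x y)"
      using N(2) by (auto intro!: integrable_mult_left simp: N.emeasure_eq_measure)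
  qed
  have "(LINT x|lborel. measure N {x<..} * vderiv \<phi> x) = (LINT x|lborel. LINT y|N. ?g x y)"
    unfolding inner ..
  also have "\<dots> = (LINT y|N. LINT x|lborel. ?g x y)"
    by (rule Fubini_integral[symmetric, OF gi])
  also have "\<dots> = (LINT y|N. \<phi> y)"
  proof (rule Bochner_Integration.integral_cong[OF refl])
    fix y
    \<comment> \<open>A point to the left of both the support and \<open>y\<close>: the integral
      over the half line effectively starts there.\<close>
    define e where "e = min c y - 1"
    have e: "e < y" "e < c" by (auto simp: e_def)
    have "(LINT x|lborel. indicator {e..y} x *\<^sub>R vderiv \<phi> x) = \<phi> y - \<phi> e"
      by (rule integral_FTC_Icc)
         (use e \<phi>(1) in \<open>auto intro!: has_vector_derivative_at_within smooth_has_vector_derivative smooth_continuous_on smooth_vderiv\<close>)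
    \<comment> \<open>As the ray is open, the point \<open>x = y\<close> is excluded on the
      right-hand side but not on the left.\<close>
    moreover have "AE x in lborel. indicator {e..y} x *\<^sub>R vderiv \<phi> x = ?g x y"
    proof -
      have "AE x in lborel. x \<noteq> y" by (rule AE_lborel_singleton)
      then show ?thesis
      proof eventually_elim
        fix x assume "x \<noteq> y"
        moreover have "vderiv \<phi> x = 0" if "x < e" using that e(2) by (intro v0) auto
        ultimately show "indicator {e..y} x *\<^sub>R vderiv \<phi> x = ?g x y"
          by (cases "x < e") (auto simp: indicator_def)
      qed
    qed
    moreover have "(\<lambda>x. ?g x y) \<in> borel_measurable lborel"
    proof -
      have "(\<lambda>x. ?g x y) = (\<lambda>x. (if x < y then 1 else 0) * vderiv \<phi> x)" by (auto simp: indicator_def)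
      then show ?thesis by simp
    qed
    ultimately have "(LINT x|lborel. ?g x y) = \<phi> y - \<phi> e"
      using integral_cong_AE[of "\<lambda>x. indicator {e..y} x *\<^sub>R vderiv \<phi> x" lborel "\<lambda>x. ?g x y"] by simp
    then show "(LINT x|lborel. ?g x y) = \<phi> y" using \<phi>(2)[of e] e by simp
  qed
  finally show ?thesis .
qed

text \<open>Tails have the negative measures as derivatives, so \<open>h\<close> below has
  derivative \<open>P - N\<close>, the same as \<open>f\<close>, and the difference is constant.
  This is why \<open>N\<close> enters with the plus sign.\<close>

lemma BV_representation:
  assumes ab: "a < b" and f: "set_integrable lborel {a..b} f" and d: "has_distr_deriv f {a<..<b} m"
    and j: "jordan_decomposition {a<..<b} m P N"
  obtains c where "AE x in lborel. x \<in> {a<..<b} \<longrightarrow> f x = c + measure N {x<..<b} - measure P {x<..<b}"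
proof -
  let ?S = "{a<..<b}"
  have sP: "sets P = sets (restrict_space borel ?S)" "sets N = sets (restrict_space borel ?S)"
    "finite_measure P" "finite_measure N"
    using j by (auto simp: jordan_decomposition_def)
  \<comment> \<open>The measures live on the open interval only; the tail lemma is applied to their
    images on the whole line.\<close>
  define Q where "Q = distr P borel (\<lambda>x. x)"
  define R where "R = distr N borel (\<lambda>x. x)"
  have mid: "(\<lambda>x. x) \<in> M \<rightarrow>\<^sub>M borel" if "sets M = sets (restrict_space borel ?S)" for M
    unfolding measurable_cong_sets[OF that refl] by (rule measurable_restrict_space1) simp
  have Q: "finite_measure Q" "sets Q = sets borel" "finite_measure R" "sets R = sets borel"
    using sP mid by (auto simp: Q_def R_def intro!: finite_measure.finite_measure_distr)
  have int: "(LINT x|distr M borel (\<lambda>x. x). \<phi> x) = (LINT x|M. \<phi> x)"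
    if "sets M = sets (restrict_space borel ?S)" "\<phi> \<in> borel_measurable borel" for M and \<phi> :: "real \<Rightarrow> real"
    using integral_distr[OF mid[OF that(1)] that(2)] by simp
  have ms: "measure (distr M borel (\<lambda>x. x)) {x<..} = measure M {x<..<b}"
    if "sets M = sets (restrict_space borel ?S)" "x \<in> ?S" for M x
  proof -
    have sp: "space M = ?S" using sets_eq_imp_space_eq[OF that(1)] by (simp add: space_restrict_space)
    have "(\<lambda>x. x) -` {x<..} \<inter> space M = {x<..<b}" using that(2) by (auto simp: sp)
    then show ?thesis by (subst measure_distr[OF mid[OF that(1)]]) simp_all
  qed
  define h where "h x = measure R {x<..} - measure Q {x<..}" for x
  have hm[measurable]: "(\<lambda>x. measure R {x<..}) \<in> borel_measurable borel" "(\<lambda>x. measure Q {x<..}) \<in> borel_measurable borel"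
    using Q by (auto intro!: borel_measurable_antimono antimono_measure_ray)
  have hi: "set_integrable lborel ?S (\<lambda>x. measure M {x<..})" if M: "finite_measure M"
    and [measurable]: "(\<lambda>x. measure M {x<..}) \<in> borel_measurable borel" for M
    unfolding set_integrable_def
  proof (rule Bochner_Integration.integrable_bound)
    show "integrable lborel (\<lambda>x. indicator ?S x * measure M (space M))"
      using ab by (intro integrable_mult_left integrable_real_indicator) auto
    show "AE x in lborel. norm (indicator ?S x *\<^sub>R measure M {x<..}) \<le> norm (indicator ?S x * measure M (space M))"
      using finite_measure.bounded_measure[OF M] by (auto simp: indicator_def)
  qed measurable
  have fS: "set_integrable lborel ?S f" by (rule set_integrable_subset[OF f]) auto
  have "set_integrable lborel ?S (\<lambda>x. f x - h x)"
    unfolding h_def using Q hm fS by (intro set_integral_diff hi) auto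
  moreover have "(LINT x|lborel. (f x - h x) * vderiv \<phi> x) = 0" if t: "test_function ?S \<phi>" for \<phi>
  proof -
    have s: "smooth \<phi>" using t by (simp add: test_function_def)
    obtain c d where cd: "c < d" "\<And>x. x \<notin> {c<..<d} \<Longrightarrow> \<phi> x = 0" "a < c" "d < b"
      using test_functionD[OF t ab] by metis
    have v0: "vderiv \<phi> x = 0" if "x \<notin> ?S" for x
      by (rule vderiv_eq_0[of c d]) (use that cd in auto)
    have vs: "smooth (vderiv \<phi>)" by (rule smooth_vderiv[OF s])
    have "\<And>x. x \<notin> {a..b} \<Longrightarrow> vderiv \<phi> x = 0" using v0 by auto
    then obtain B where B: "\<And>x. norm (vderiv \<phi> x) \<le> B"
      using continuous_compact_support_bounded[OF smooth_continuous_on[OF vs], of a b] by blast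
    have i: "integrable lborel (\<lambda>x. g x * vderiv \<phi> x)" if "set_integrable lborel ?S g" for g
      by (rule set_integrable_mult_test_function[OF that, of _ B])
         (use smooth_measurable[OF vs] B v0 in auto)
    obtain P0 N0 where j0: "jordan_decomposition ?S m P0 N0"
      and "(LINT x|lborel. f x * vderiv \<phi> x) = - ((LINT x|P0. \<phi> x) - (LINT x|N0. \<phi> x))"
      using d t unfolding has_distr_deriv_def by blast
    moreover have "P0 = P" "N0 = N" using jordan_decomposition_unique[OF j0 j] by auto
    moreover have "(LINT x|lborel. measure Q {x<..} * vderiv \<phi> x) = (LINT x|P. \<phi> x)"
      using integral_measure_ray[OF Q(1,2) s cd(2,1)] int[OF sP(1) smooth_measurable[OF s]] by (simp add: Q_def)
    moreover have "(LINT x|lborel. measure R {x<..} * vderiv \<phi> x) = (LINT x|N. \<phi> x)"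
      using integral_measure_ray[OF Q(3,4) s cd(2,1)] int[OF sP(2) smooth_measurable[OF s]] by (simp add: R_def)
    moreover have "(LINT x|lborel. (f x - h x) * vderiv \<phi> x) = (LINT x|lborel. f x * vderiv \<phi> x)
        - ((LINT x|lborel. measure R {x<..} * vderiv \<phi> x) - (LINT x|lborel. measure Q {x<..} * vderiv \<phi> x))"
      using i[OF fS] i[OF hi[OF Q(3) hm(1)]] i[OF hi[OF Q(1) hm(2)]]
      by (simp add: h_def left_diff_distrib)
    ultimately show ?thesis by simp
  qed
  ultimately obtain c where "AE x in lborel. x \<in> ?S \<longrightarrow> f x - h x = c"
    using AE_const_test_functions[OF ab] by blast
  then have "AE x in lborel. x \<in> ?S \<longrightarrow> f x = c + measure N {x<..<b} - measure P {x<..<b}"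
    by eventually_elim (use ms sP in \<open>auto simp: h_def Q_def R_def\<close>)
  then show ?thesis by (rule that)
qed

section \<open>Variation on intervals shrinking to the origin\<close>

lemma AE_interval_ex:
  assumes "AE x in lborel. x \<in> {a<..<b} \<longrightarrow> Q x" "a < (b::real)"
  shows "\<exists>x. a < x \<and> x < b \<and> Q x"
proof (rule ccontr)
  assume "\<not> ?thesis"
  then have "AE x in lborel. x \<notin> {a<..<b}" using assms(1) by (auto elim!: eventually_mono)
  then have "emeasure lborel {x \<in> space lborel. \<not> x \<notin> {a<..<b}} = 0"
    by (subst (asm) AE_iff_measurable[OF _ refl]) auto
  moreover have "{x \<in> space lborel. \<not> x \<notin> {a<..<b}} = {a<..<b}" by auto
  ultimately show False using assms(2) by simp
qed

lemma tendsto_at_right_cSUP_antimono: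
  fixes f :: "real \<Rightarrow> 'a::{conditionally_complete_linorder, linorder_topology}"
  assumes "0 < \<delta>" "\<And>x y. 0 < x \<Longrightarrow> x \<le> y \<Longrightarrow> y < \<delta> \<Longrightarrow> f y \<le> f x"
    and bdd: "bdd_above (f ` {0<..<\<delta>})"
  shows "(f \<longlongrightarrow> (SUP x\<in>{0<..<\<delta>}. f x)) (at_right 0)"
proof (rule order_tendstoI)
  fix a assume "a < (SUP x\<in>{0<..<\<delta>}. f x)"
  then obtain x where x: "x \<in> {0<..<\<delta>}" "a < f x"
    using less_cSUP_iff[OF _ bdd] assms(1) by (metis dense_order_class.dense empty_iff greaterThanLessThan_iff)
  then show "\<forall>\<^sub>F y in at_right 0. a < f y"
    using assms(2)[of _ x] by (auto simp: eventually_at_right_field intro!: exI[of _ x] elim: order.strict_trans2)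
next
  fix a assume a: "(SUP x\<in>{0<..<\<delta>}. f x) < a"
  show "\<forall>\<^sub>F y in at_right 0. f y < a"
    using cSUP_upper[OF _ bdd] assms(1)
    by (auto simp: eventually_at_right_field intro!: exI[of _ \<delta>] intro: order.strict_trans1[OF _ a])
qed

locale BV_near_zero =
  fixes \<delta> :: real and k :: "real \<Rightarrow> real"
  assumes delta_pos: "0 < \<delta>"
    and BV: "\<And>\<epsilon>. 0 < \<epsilon> \<Longrightarrow> \<epsilon> < \<delta> \<Longrightarrow> k \<in> BV \<epsilon> \<delta>"
begin

definition pv :: "real \<Rightarrow> real" where "pv x = enn2real (pos_variation x \<delta> k)"

definition nv :: "real \<Rightarrow> real" where "nv x = enn2real (neg_variation x \<delta> k)"

lemma variation_measures:
  assumes "0 < \<epsilon>" "\<epsilon> < \<delta>"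
  obtains P N c where "finite_measure P" "finite_measure N"
    "sets P = sets (restrict_space borel {\<epsilon><..<\<delta>})" "sets N = sets (restrict_space borel {\<epsilon><..<\<delta>})"
    "\<And>x. \<epsilon> \<le> x \<Longrightarrow> pos_variation x \<delta> k = emeasure P {x<..<\<delta>}"
    "\<And>x. \<epsilon> \<le> x \<Longrightarrow> neg_variation x \<delta> k = emeasure N {x<..<\<delta>}"
    "AE x in lborel. x \<in> {\<epsilon><..<\<delta>} \<longrightarrow> k x = c + nv x - pv x"
proof -
  from BV[OF assms] obtain m where m: "set_integrable lborel {\<epsilon>..\<delta>} k" "has_distr_deriv k {\<epsilon><..<\<delta>} m"
    by (auto simp: BV_def)
  then obtain P N where j: "jordan_decomposition {\<epsilon><..<\<delta>} m P N" by (auto simp: has_distr_deriv_def)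
  note v = variation_eq[OF m(2) j]
  have PN: "finite_measure P" "finite_measure N" using j by (auto simp: jordan_decomposition_def)
  obtain c where "AE x in lborel. x \<in> {\<epsilon><..<\<delta>} \<longrightarrow> k x = c + measure N {x<..<\<delta>} - measure P {x<..<\<delta>}"
    using BV_representation[OF assms(2) m j] .
  then have "AE x in lborel. x \<in> {\<epsilon><..<\<delta>} \<longrightarrow> k x = c + nv x - pv x"
    by eventually_elim (use v PN in \<open>auto simp: nv_def pv_def finite_measure.emeasure_eq_measure\<close>)
  then show ?thesis
    using that[of P N c] PN v j by (auto simp: jordan_decomposition_def)
qed

lemma variation_eq_ennreal:
  assumes "0 < x" "x < \<delta>"
  shows "pos_variation x \<delta> k = ennreal (pv x)" "neg_variation x \<delta> k = ennreal (nv x)"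
proof -
  obtain P N where v: "finite_measure P" "finite_measure N"
    "\<And>y. x \<le> y \<Longrightarrow> pos_variation y \<delta> k = emeasure P {y<..<\<delta>}"
    "\<And>y. x \<le> y \<Longrightarrow> neg_variation y \<delta> k = emeasure N {y<..<\<delta>}"
    by (rule variation_measures[OF assms]) blast
  show "pos_variation x \<delta> k = ennreal (pv x)" "neg_variation x \<delta> k = ennreal (nv x)"
    using v(3,4)[of x] by (auto simp: pv_def nv_def finite_measure.emeasure_eq_measure v(1,2))
qed

lemma variation_nonneg: "0 \<le> pv x" "0 \<le> nv x"
  by (auto simp: pv_def nv_def)

lemma variation_antimono:
  assumes "0 < x" "x \<le> y" "y < \<delta>"
  shows "pv y \<le> pv x" "nv y \<le> nv x"
proof -
  obtain P N c where v: "finite_measure P" "finite_measure N"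
    "sets P = sets (restrict_space borel {x<..<\<delta>})" "sets N = sets (restrict_space borel {x<..<\<delta>})"
    "\<And>y. x \<le> y \<Longrightarrow> pos_variation y \<delta> k = emeasure P {y<..<\<delta>}"
    "\<And>y. x \<le> y \<Longrightarrow> neg_variation y \<delta> k = emeasure N {y<..<\<delta>}"
    "AE y in lborel. y \<in> {x<..<\<delta>} \<longrightarrow> k y = c + nv y - pv y"
    by (rule variation_measures[OF assms(1) order.strict_trans1[OF assms(2,3)]]) blast
  have s: "{x<..<\<delta>} \<in> sets (restrict_space borel {x<..<\<delta>})" "{y<..<\<delta>} \<subseteq> {x<..<\<delta>}"
    using assms by (auto simp: sets_restrict_space_iff)
  show "pv y \<le> pv x"
    using v(5)[of x] v(5)[of y] assms s v(3) finite_measure.finite_measure_mono[OF v(1), of "{y<..<\<delta>}" "{x<..<\<delta>}"]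
    by (auto simp: pv_def finite_measure.emeasure_eq_measure[OF v(1)])
  show "nv y \<le> nv x"
    using v(6)[of x] v(6)[of y] assms s v(4) finite_measure.finite_measure_mono[OF v(2), of "{y<..<\<delta>}" "{x<..<\<delta>}"]
    by (auto simp: nv_def finite_measure.emeasure_eq_measure[OF v(2)])
qed

text \<open>The variations use open intervals, and those with left end points decreasing to
  \<open>x\<close> increase to the one at \<open>x\<close>. This makes \<open>c + nv - pv\<close>
  the right-continuous version of the density.\<close>

lemma variation_right_continuous:
  assumes x: "0 < x" "x < \<delta>"
  shows "continuous (at_right x) pv" "continuous (at_right x) nv"
proof -
  obtain P N c where v: "finite_measure P" "finite_measure N"
    "sets P = sets (restrict_space borel {x<..<\<delta>})" "sets N = sets (restrict_space borel {x<..<\<delta>})"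
    "\<And>y. x \<le> y \<Longrightarrow> pos_variation y \<delta> k = emeasure P {y<..<\<delta>}"
    "\<And>y. x \<le> y \<Longrightarrow> neg_variation y \<delta> k = emeasure N {y<..<\<delta>}"
    "AE y in lborel. y \<in> {x<..<\<delta>} \<longrightarrow> k y = c + nv y - pv y"
    by (rule variation_measures[OF x]) blast
  have lim: "((\<lambda>y. measure M {y<..<\<delta>}) \<longlongrightarrow> measure M {x<..<\<delta>}) (at_right x)"
    if M: "finite_measure M" "sets M = sets (restrict_space borel {x<..<\<delta>})" for M
  proof (rule tendsto_at_right_sequentially[OF x(2)])
    fix S :: "nat \<Rightarrow> real"
    assume S: "\<And>n. x < S n" "\<And>n. S n < \<delta>" "decseq S" "S \<longlonglongrightarrow> x"
    have "(\<Union>n. {S n<..<\<delta>}) = {x<..<\<delta>}"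
    proof (intro equalityI subsetI)
      fix y assume y: "y \<in> {x<..<\<delta>}"
      then have "\<forall>\<^sub>F n in sequentially. S n < y" using order_tendstoD(2)[OF S(4), of y] by simp
      then obtain n where "S n < y" by (auto simp: eventually_sequentially)
      then show "y \<in> (\<Union>n. {S n<..<\<delta>})" using y by auto
    next
      fix y assume "y \<in> (\<Union>n. {S n<..<\<delta>})"
      then obtain n where "S n < y" "y < \<delta>" by auto
      then show "y \<in> {x<..<\<delta>}" using S(1)[of n] by auto
    qed
    moreover have "incseq (\<lambda>n. {S n<..<\<delta>})"
    proof (rule incseq_SucI)
      fix n
      have "S (Suc n) \<le> S n" using S(3) by (simp add: decseq_Suc_iff)
      then show "{S n<..<\<delta>} \<le> {S (Suc n)<..<\<delta>}" by auto
    qed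
    moreover have "range (\<lambda>n. {S n<..<\<delta>}) \<subseteq> sets M"
    proof -
      have "{S n<..<\<delta>} \<subseteq> {x<..<\<delta>}" for n using S(1)[of n] by auto
      then show ?thesis unfolding M(2) by (auto simp: sets_restrict_space_iff)
    qed
    ultimately show "(\<lambda>n. measure M {S n<..<\<delta>}) \<longlonglongrightarrow> measure M {x<..<\<delta>}"
      using finite_measure.finite_Lim_measure_incseq[OF M(1), of "\<lambda>n. {S n<..<\<delta>}"] by simp
  qed
  have "\<forall>\<^sub>F y in at_right x. measure P {y<..<\<delta>} = pv y" "\<forall>\<^sub>F y in at_right x. measure N {y<..<\<delta>} = nv y"
    using v(5,6) x by (auto simp: eventually_at_right_field pv_def nv_def
        finite_measure.emeasure_eq_measure[OF v(1)] finite_measure.emeasure_eq_measure[OF v(2)] intro!: exI[of _ \<delta>])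
  moreover have "measure P {x<..<\<delta>} = pv x" "measure N {x<..<\<delta>} = nv x"
    using v(5,6) by (auto simp: pv_def nv_def
        finite_measure.emeasure_eq_measure[OF v(1)] finite_measure.emeasure_eq_measure[OF v(2)])
  ultimately show "continuous (at_right x) pv" "continuous (at_right x) nv"
    using lim[OF v(1,3)] lim[OF v(2,4)]
    by (auto simp: continuous_within intro: Lim_transform_eventually)
qed

lemma representation:
  obtains c where "AE x in lborel. x \<in> {0<..<\<delta>} \<longrightarrow> k x = c + nv x - pv x"
proof -
  \<comment> \<open>The summand 2 keeps every \<open>e i\<close>, in particular \<open>e 0\<close>,
    strictly below \<delta>.\<close>
  define e where "e i = \<delta> / (real i + 2)" for i :: nat
  have e: "0 < e i" "e i < \<delta>" for i
  proof -
    show "0 < e i" using delta_pos by (simp add: e_def)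
    have "\<delta> * 1 < \<delta> * (real i + 2)" using delta_pos by (intro mult_strict_left_mono) auto
    then show "e i < \<delta>" by (simp add: e_def divide_less_eq)
  qed
  have "\<exists>c. AE x in lborel. x \<in> {e i<..<\<delta>} \<longrightarrow> k x = c + nv x - pv x" for i
    by (rule variation_measures[OF e, of i]) blast
  then have "\<exists>c. \<forall>i. AE x in lborel. x \<in> {e i<..<\<delta>} \<longrightarrow> k x = c i + nv x - pv x" by (intro choice allI)
  then obtain c where c: "\<And>i. AE x in lborel. x \<in> {e i<..<\<delta>} \<longrightarrow> k x = c i + nv x - pv x" by blast
  \<comment> \<open>Both identities hold almost everywhere on the interval for \<open>e 0\<close>,
    hence together at some point of it, and that point forces the constants to agree.\<close>
  have "c i = c 0" for i
  proof -
    have "e i \<le> e 0" unfolding e_def using delta_pos by (intro divide_left_mono) auto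
    have "AE x in lborel. x \<in> {e 0<..<\<delta>} \<longrightarrow> c i = c 0"
      using c[of i] c[of 0] by eventually_elim (use \<open>e i \<le> e 0\<close> in auto)
    from AE_interval_ex[OF this e(2)] show ?thesis by blast
  qed
  then have "\<forall>i. AE x in lborel. x \<in> {e i<..<\<delta>} \<longrightarrow> k x = c 0 + nv x - pv x"
    using c by metis
  then have "AE x in lborel. \<forall>i. x \<in> {e i<..<\<delta>} \<longrightarrow> k x = c 0 + nv x - pv x"
    unfolding AE_all_countable .
  then have "AE x in lborel. x \<in> {0<..<\<delta>} \<longrightarrow> k x = c 0 + nv x - pv x"
  proof eventually_elim
    fix x assume *: "\<forall>i. x \<in> {e i<..<\<delta>} \<longrightarrow> k x = c 0 + nv x - pv x"
    show "x \<in> {0<..<\<delta>} \<longrightarrow> k x = c 0 + nv x - pv x"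
    proof
      assume x: "x \<in> {0<..<\<delta>}"
      obtain i :: nat where i: "\<delta> / x < real i" using reals_Archimedean2 by blast
      then have "\<delta> / x < real i + 2" by simp
      then have "e i < x" using x by (simp add: e_def divide_less_eq mult.commute)
      then show "k x = c 0 + nv x - pv x" using * x by auto
    qed
  qed
  then show ?thesis by (rule that)
qed

text \<open>\<open>Lim\<close> is meaningful only where the limit exists; monotonicity provides it,
  as the supremum.\<close>

lemma variation0_eq:
  shows "pos_variation0 \<delta> k = (SUP x\<in>{0<..<\<delta>}. ennreal (pv x))"
    "BV_norm0 \<delta> k = (SUP x\<in>{0<..<\<delta>}. ennreal (pv x + nv x))"
proof -
  have ev: "\<forall>\<^sub>F x in at_right 0. x \<in> {0<..<\<delta>}"
    using delta_pos by (auto simp: eventually_at_right_field)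
  have "((\<lambda>x. ennreal (pv x)) \<longlongrightarrow> (SUP x\<in>{0<..<\<delta>}. ennreal (pv x))) (at_right 0)"
    by (rule tendsto_at_right_cSUP_antimono[OF delta_pos]) (auto intro!: ennreal_leI variation_antimono)
  then have "((\<lambda>x. pos_variation x \<delta> k) \<longlongrightarrow> (SUP x\<in>{0<..<\<delta>}. ennreal (pv x))) (at_right 0)"
    by (rule Lim_transform_eventually) (use ev in \<open>auto elim!: eventually_mono simp: variation_eq_ennreal\<close>)
  then show "pos_variation0 \<delta> k = (SUP x\<in>{0<..<\<delta>}. ennreal (pv x))"
    unfolding pos_variation0_def by (intro tendsto_Lim) auto
  have "((\<lambda>x. ennreal (pv x + nv x)) \<longlongrightarrow> (SUP x\<in>{0<..<\<delta>}. ennreal (pv x + nv x))) (at_right 0)"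
    by (rule tendsto_at_right_cSUP_antimono[OF delta_pos]) (auto intro!: ennreal_leI variation_antimono add_mono)
  then have "((\<lambda>x. BV_norm x \<delta> k) \<longlongrightarrow> (SUP x\<in>{0<..<\<delta>}. ennreal (pv x + nv x))) (at_right 0)"
    by (rule Lim_transform_eventually)
       (use ev in \<open>auto elim!: eventually_mono simp: BV_norm_def variation_eq_ennreal variation_nonneg ennreal_plus\<close>)
  then show "BV_norm0 \<delta> k = (SUP x\<in>{0<..<\<delta>}. ennreal (pv x + nv x))"
    unfolding BV_norm0_def by (intro tendsto_Lim) auto
qed

end

lemma SUP_ennreal_less_top_iff:
  assumes "I \<noteq> {}" "\<And>x. x \<in> I \<Longrightarrow> 0 \<le> f x"
  shows "(SUP x\<in>I. ennreal (f x)) < \<infinity> \<longleftrightarrow> (\<exists>B. \<forall>x\<in>I. f x \<le> B)"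
proof
  assume "(SUP x\<in>I. ennreal (f x)) < \<infinity>"
  then obtain B where B: "B \<ge> 0" "(SUP x\<in>I. ennreal (f x)) = ennreal B"
    by (metis ennreal_cases less_irrefl infinity_ennreal_def)
  have "f x \<le> B" if "x \<in> I" for x
    using SUP_upper[OF that, of "\<lambda>x. ennreal (f x)"] B by (simp add: ennreal_le_iff)
  then show "\<exists>B. \<forall>x\<in>I. f x \<le> B" by blast
next
  assume "\<exists>B. \<forall>x\<in>I. f x \<le> B"
  then obtain B where "\<And>x. x \<in> I \<Longrightarrow> f x \<le> B" by blast
  then have "(SUP x\<in>I. ennreal (f x)) \<le> ennreal B"
    by (intro SUP_least ennreal_leI)
  then show "(SUP x\<in>I. ennreal (f x)) < \<infinity>"
    by (simp add: order.strict_trans1)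
qed

locale BV_near_zero_pos_bounded = BV_near_zero +
  assumes pos_variation0: "pos_variation0 \<delta> k < \<infinity>"
begin

lemma ne: "{0<..<\<delta>} \<noteq> {}"
  using delta_pos by simp

lemma pv_bounded: "\<exists>B. \<forall>x\<in>{0<..<\<delta>}. pv x \<le> B"
  using pos_variation0 unfolding variation0_eq
  by (subst (asm) SUP_ennreal_less_top_iff[OF ne]) (auto simp: variation_nonneg)

text \<open>The positive variation being bounded, only the negative one can make the norm
  infinite.\<close>

lemma BV_norm0_finite_iff: "BV_norm0 \<delta> k < \<infinity> \<longleftrightarrow> (\<exists>B. \<forall>x\<in>{0<..<\<delta>}. nv x \<le> B)"
proof -
  obtain B0 where B0: "\<And>x. x \<in> {0<..<\<delta>} \<Longrightarrow> pv x \<le> B0" using pv_bounded by blast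
  have "BV_norm0 \<delta> k < \<infinity> \<longleftrightarrow> (\<exists>B. \<forall>x\<in>{0<..<\<delta>}. pv x + nv x \<le> B)"
    unfolding variation0_eq by (rule SUP_ennreal_less_top_iff[OF ne]) (auto simp: variation_nonneg)
  also have "\<dots> \<longleftrightarrow> (\<exists>B. \<forall>x\<in>{0<..<\<delta>}. nv x \<le> B)"
  proof
    assume "\<exists>B. \<forall>x\<in>{0<..<\<delta>}. pv x + nv x \<le> B"
    then show "\<exists>B. \<forall>x\<in>{0<..<\<delta>}. nv x \<le> B"
      using variation_nonneg by (metis add_increasing order_trans order_refl)
  next
    assume "\<exists>B. \<forall>x\<in>{0<..<\<delta>}. nv x \<le> B"
    then show "\<exists>B. \<forall>x\<in>{0<..<\<delta>}. pv x + nv x \<le> B"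
      using B0 by (meson add_mono)
  qed
  finally show ?thesis .
qed

text \<open>One direction exhibits the explicit version \<open>c + nv - pv\<close>. In the other the
  version \<open>g\<close> is arbitrary and agrees with \<open>k\<close> only almost everywhere, so
  its bound is used at a single good point below \<open>x\<close> and carried to \<open>x\<close> by
  monotonicity.\<close>

lemma right_limit_finite_iff:
  "(\<exists>g L. right_continuous_version \<delta> k g \<and> ((\<lambda>x. ereal (g x)) \<longlongrightarrow> L) (at_right 0) \<and> L < \<infinity>)
    \<longleftrightarrow> (\<exists>B. \<forall>x\<in>{0<..<\<delta>}. nv x \<le> B)"
proof
  obtain c where c: "AE x in lborel. x \<in> {0<..<\<delta>} \<longrightarrow> k x = c + nv x - pv x" by (rule representation)
  obtain B0 where B0: "\<And>x. x \<in> {0<..<\<delta>} \<Longrightarrow> pv x \<le> B0" using pv_bounded by blast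
  {
    assume "\<exists>B. \<forall>x\<in>{0<..<\<delta>}. nv x \<le> B"
    then obtain B where B: "\<And>x. x \<in> {0<..<\<delta>} \<Longrightarrow> nv x \<le> B" by blast
    have "right_continuous_version \<delta> k (\<lambda>x. c + nv x - pv x)"
      unfolding right_continuous_version_def
      using c by (auto intro!: continuous_intros variation_right_continuous elim!: eventually_mono)
    moreover have "(pv \<longlongrightarrow> (SUP x\<in>{0<..<\<delta>}. pv x)) (at_right 0)" "(nv \<longlongrightarrow> (SUP x\<in>{0<..<\<delta>}. nv x)) (at_right 0)"
      using B0 B by (auto intro!: tendsto_at_right_cSUP_antimono[OF delta_pos] variation_antimono
          bdd_aboveI2[of _ pv B0] bdd_aboveI2[of _ nv B])
    then have "((\<lambda>x. ereal (c + nv x - pv x)) \<longlongrightarrow> ereal (c + (SUP x\<in>{0<..<\<delta>}. nv x) - (SUP x\<in>{0<..<\<delta>}. pv x))) (at_right 0)"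
      by (intro tendsto_intros)
    ultimately show "\<exists>g L. right_continuous_version \<delta> k g \<and> ((\<lambda>x. ereal (g x)) \<longlongrightarrow> L) (at_right 0) \<and> L < \<infinity>"
      by (intro exI[of _ "\<lambda>x. c + nv x - pv x"]) auto
  next
    assume "\<exists>g L. right_continuous_version \<delta> k g \<and> ((\<lambda>x. ereal (g x)) \<longlongrightarrow> L) (at_right 0) \<and> L < \<infinity>"
    then obtain g L where g: "AE x in lborel. x \<in> {0<..<\<delta>} \<longrightarrow> g x = k x"
      "((\<lambda>x. ereal (g x)) \<longlongrightarrow> L) (at_right 0)" "L < \<infinity>"
      by (auto simp: right_continuous_version_def)
    obtain M where "L < ereal M" using ereal_dense2[OF g(3)] by blast
    from order_tendstoD(2)[OF g(2) this] obtain \<epsilon> where \<epsilon>: "0 < \<epsilon>" "\<And>x. 0 < x \<Longrightarrow> x < \<epsilon> \<Longrightarrow> g x < M"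
      by (auto simp: eventually_at_right_field)
    have "nv x \<le> M - c + B0" if x: "x \<in> {0<..<\<delta>}" for x
    proof -
      have "AE y in lborel. y \<in> {0<..<min x \<epsilon>} \<longrightarrow> nv y \<le> M - c + B0"
        using c g(1)
      proof eventually_elim
        fix y assume "y \<in> {0<..<\<delta>} \<longrightarrow> k y = c + nv y - pv y" "y \<in> {0<..<\<delta>} \<longrightarrow> g y = k y"
        then show "y \<in> {0<..<min x \<epsilon>} \<longrightarrow> nv y \<le> M - c + B0"
          using \<epsilon>(2)[of y] B0[of y] x by auto
      qed
      from AE_interval_ex[OF this] x \<epsilon> obtain y where "0 < y" "y < min x \<epsilon>" "nv y \<le> M - c + B0"
        by auto
      then show ?thesis using variation_antimono(2)[of y x] x by auto
    qed
    then show "\<exists>B. \<forall>x\<in>{0<..<\<delta>}. nv x \<le> B" by blast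
  }
qed

lemma bounded_near_zero:
  assumes "\<exists>B. \<forall>x\<in>{0<..<\<delta>}. nv x \<le> B"
  obtains K where "0 < K" "AE x in lborel. x \<in> {0<..<\<delta>} \<longrightarrow> k x \<le> K"
proof -
  obtain c where c: "AE x in lborel. x \<in> {0<..<\<delta>} \<longrightarrow> k x = c + nv x - pv x" by (rule representation)
  from assms obtain B where B: "\<And>x. x \<in> {0<..<\<delta>} \<Longrightarrow> nv x \<le> B" by blast
  have "AE x in lborel. x \<in> {0<..<\<delta>} \<longrightarrow> k x \<le> \<bar>c + B\<bar> + 1"
    using c by eventually_elim (use B variation_nonneg in \<open>smt (verit)\<close>)
  then show ?thesis by (intro that[of "\<bar>c + B\<bar> + 1"]) auto
qed

text \<open>Since \<open>nv\<close> increases towards 0 and \<open>pv\<close> stays below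
  \<open>B0\<close>, one large value of \<open>nv\<close> makes \<open>k\<close> large almost
  everywhere to the left of it.\<close>

lemma unbounded_near_zero:
  assumes "\<not> (\<exists>B. \<forall>x\<in>{0<..<\<delta>}. nv x \<le> B)"
  obtains \<epsilon> where "0 < \<epsilon>" "\<epsilon> < \<delta>" "AE x in lborel. x \<in> {0<..<\<epsilon>} \<longrightarrow> K \<le> k x"
proof -
  obtain c where c: "AE x in lborel. x \<in> {0<..<\<delta>} \<longrightarrow> k x = c + nv x - pv x" by (rule representation)
  obtain B0 where B0: "\<And>x. x \<in> {0<..<\<delta>} \<Longrightarrow> pv x \<le> B0" using pv_bounded by blast
  from assms obtain \<epsilon> where \<epsilon>: "0 < \<epsilon>" "\<epsilon> < \<delta>" "K - c + B0 < nv \<epsilon>"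
    by (metis greaterThanLessThan_iff not_le)
  have "AE x in lborel. x \<in> {0<..<\<epsilon>} \<longrightarrow> K \<le> k x"
    using c
  proof eventually_elim
    fix x assume x: "x \<in> {0<..<\<delta>} \<longrightarrow> k x = c + nv x - pv x"
    show "x \<in> {0<..<\<epsilon>} \<longrightarrow> K \<le> k x"
      using x variation_antimono(2)[of x \<epsilon>] B0[of x] \<epsilon> by auto
  qed
  then show ?thesis using \<epsilon> by (intro that[of \<epsilon>])
qed

end

section \<open>Schwartz functions and the Fourier transform\<close>

subsection \<open>Integration\<close>

lemma integrable_inverse_1_plus_square_UNIV:
  "integrable lborel (\<lambda>x::real. inverse (1 + x\<^sup>2))"
  "(LINT x|lborel. inverse (1 + x\<^sup>2 :: real)) = pi"
proof -
  have e: "einterval (-\<infinity>) \<infinity> = UNIV" by (auto simp: einterval_def)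
  show "integrable lborel (\<lambda>x::real. inverse (1 + x\<^sup>2))"
    using integrable_inverse_1_plus_square by (simp add: set_integrable_def e)
  show "(LINT x|lborel. inverse (1 + x\<^sup>2 :: real)) = pi"
    using LBINT_inverse_1_plus_square
    by (simp add: interval_lebesgue_integral_def set_lebesgue_integral_def e)
qed

text \<open>The total mass \<pi> of the weight 1 / (1 + x^2) is the constant that turns pointwise
  decay into an L1 bound.\<close>

lemma quadratic_decay_integrable:
  fixes f :: "real \<Rightarrow> 'a::{banach, second_countable_topology}"
  assumes [measurable]: "f \<in> borel_measurable borel" and B: "\<And>x. norm (f x) * (1 + x\<^sup>2) \<le> B"
  shows "integrable lborel f" "(LINT x|lborel. norm (f x)) \<le> B * pi"
proof -
  have pos: "0 < 1 + x\<^sup>2" for x :: real by (simp add: add_pos_nonneg)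
  have le: "norm (f x) \<le> B * inverse (1 + x\<^sup>2)" for x
    using B[of x] pos[of x] by (simp add: field_simps)
  have iB: "integrable lborel (\<lambda>x. B * inverse (1 + x\<^sup>2))"
    by (intro integrable_mult_right integrable_inverse_1_plus_square_UNIV)
  show i: "integrable lborel f"
    by (rule Bochner_Integration.integrable_bound[OF iB]) (use le in \<open>auto intro: order_trans[OF _ abs_ge_self]\<close>)
  have "(LINT x|lborel. norm (f x)) \<le> (LINT x|lborel. B * inverse (1 + x\<^sup>2))"
    by (rule integral_mono[OF integrable_norm[OF i] iB le])
  then show "(LINT x|lborel. norm (f x)) \<le> B * pi"
    by (simp add: integrable_inverse_1_plus_square_UNIV)
qed

lemma (in pair_sigma_finite) integrable_product_mult:
  fixes f :: "'a \<Rightarrow> 'c::{real_normed_field, banach, second_countable_topology}"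
  assumes f: "integrable M1 f" and g: "integrable M2 g"
  shows "integrable (M1 \<Otimes>\<^sub>M M2) (\<lambda>(x, y). f x * g y)"
proof (rule Fubini_integrable)
  have [measurable]: "f \<in> borel_measurable M1" "g \<in> borel_measurable M2" using f g by auto
  show "(\<lambda>(x, y). f x * g y) \<in> borel_measurable (M1 \<Otimes>\<^sub>M M2)" by measurable
  show "integrable M1 (\<lambda>x. LINT y|M2. norm (case (x, y) of (x, y) \<Rightarrow> f x * g y))"
    using f g by (simp add: norm_mult)
  show "AE x in M1. integrable M2 (\<lambda>y. case (x, y) of (x, y) \<Rightarrow> f x * g y)"
    using g by simp
qed

text \<open>The last hypothesis makes \<open>F\<close> vanish at both infinities, so the integrals
  over [-n, n] tend to 0.\<close>

lemma integral_derivative_eq_0: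
  fixes F :: "real \<Rightarrow> 'a::euclidean_space"
  assumes F: "\<And>x. (F has_vector_derivative f x) (at x)" and f: "integrable lborel f" "continuous_on UNIV f"
    and B: "\<And>x. \<bar>x\<bar> * norm (F x) \<le> B"
  shows "(LINT x|lborel. f x) = 0"
proof -
  have [measurable]: "f \<in> borel_measurable borel" using f by simp
  have "(\<lambda>n. LINT x|lborel. indicator {- real n..real n} x *\<^sub>R f x) \<longlonglongrightarrow> (LINT x|lborel. f x)"
  proof (rule integral_dominated_convergence)
    show "integrable lborel (\<lambda>x. norm (f x))" using f by simp
    show "AE x in lborel. (\<lambda>n. indicator {- real n..real n} x *\<^sub>R f x) \<longlonglongrightarrow> f x"
    proof (rule AE_I2)
      fix x
      obtain N :: nat where N: "\<bar>x\<bar> \<le> real N" using real_arch_simple by blast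
      have "\<forall>\<^sub>F n in sequentially. indicator {- real n..real n} x *\<^sub>R f x = f x"
        using eventually_ge_at_top[of N] by eventually_elim (use N in \<open>auto simp: indicator_def\<close>)
      then show "(\<lambda>n. indicator {- real n..real n} x *\<^sub>R f x) \<longlonglongrightarrow> f x" by (rule tendsto_eventually)
    qed
  qed (auto simp: indicator_def)
  moreover have "(LINT x|lborel. indicator {- real n..real n} x *\<^sub>R f x) = F (real n) - F (- real n)" for n
    by (rule integral_FTC_Icc) (use F f in \<open>auto intro: has_vector_derivative_at_within continuous_on_subset\<close>)
  moreover have "(\<lambda>n. F (real n) - F (- real n)) \<longlonglongrightarrow> 0"
  proof -
    have s: "(\<lambda>n. F (s * real n)) \<longlonglongrightarrow> 0" if "\<bar>s\<bar> = 1" for s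
    proof (rule Lim_null_comparison)
      show "\<forall>\<^sub>F n in sequentially. norm (F (s * real n)) \<le> B * inverse (real n)"
        using eventually_gt_at_top[of 0]
      proof eventually_elim
        fix n :: nat assume "0 < n"
        then show "norm (F (s * real n)) \<le> B * inverse (real n)"
          using B[of "s * real n"] that by (simp add: abs_mult field_simps)
      qed
      show "(\<lambda>n. B * inverse (real n)) \<longlonglongrightarrow> 0" by (intro tendsto_mult_right_zero lim_inverse_n)
    qed
    show ?thesis using tendsto_diff[OF s[of 1] s[of "-1"]] by simp
  qed
  ultimately show ?thesis using LIMSEQ_unique by simp
qed

lemma has_vector_derivative_iff_tendsto:
  "(f has_vector_derivative D) (at u) \<longleftrightarrow> ((\<lambda>y. (f y - f u) /\<^sub>R (y - u)) \<longlongrightarrow> D) (at u)"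
proof -
  have "(f has_vector_derivative D) (at u) \<longleftrightarrow>
      ((\<lambda>y. norm ((f y - f u) - (y - u) *\<^sub>R D) / norm (y - u)) \<longlongrightarrow> 0) (at u)"
    by (simp add: has_vector_derivative_def has_derivative_iff_norm bounded_linear_scaleR_left)
  also have "\<dots> \<longleftrightarrow> ((\<lambda>y. norm ((f y - f u) /\<^sub>R (y - u) - D)) \<longlongrightarrow> 0) (at u)"
  proof (rule filterlim_cong[OF refl refl])
    show "\<forall>\<^sub>F y in at u. norm ((f y - f u) - (y - u) *\<^sub>R D) / norm (y - u) = norm ((f y - f u) /\<^sub>R (y - u) - D)"
    proof (rule eventually_at_filter[THEN iffD2], rule always_eventually, intro allI impI)
      fix y :: real assume "y \<noteq> u"
      then have "(f y - f u) /\<^sub>R (y - u) - D = ((f y - f u) - (y - u) *\<^sub>R D) /\<^sub>R (y - u)"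
        by (simp add: scaleR_diff_right)
      then show "norm ((f y - f u) - (y - u) *\<^sub>R D) / norm (y - u) = norm ((f y - f u) /\<^sub>R (y - u) - D)"
        by (simp add: divide_inverse mult.commute)
    qed
  qed
  also have "\<dots> \<longleftrightarrow> ((\<lambda>y. (f y - f u) /\<^sub>R (y - u)) \<longlongrightarrow> D) (at u)"
    by (simp add: tendsto_norm_zero_iff LIM_zero_iff)
  finally show ?thesis .
qed

text \<open>Difference quotients are bounded by the mean value inequality, and dominated convergence
  applies. The dominating function is required only for parameters within distance 1 of
  \<open>u\<close>, because the first derivative of a Levy exponent grows with
  \<open>u\<close>.\<close>

lemma has_vector_derivative_integral:
  fixes f :: "real \<Rightarrow> 'b \<Rightarrow> 'a::{euclidean_space}"
  assumes i: "\<And>u. integrable M (f u)"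
    and d: "\<And>u x. x \<in> space M \<Longrightarrow> ((\<lambda>u. f u x) has_vector_derivative f' u x) (at u)"
    and m: "f' u \<in> borel_measurable M"
    and w: "integrable M w" "\<And>y x. x \<in> space M \<Longrightarrow> \<bar>y - u\<bar> < 1 \<Longrightarrow> norm (f' y x) \<le> w x"
  shows "((\<lambda>u. LINT x|M. f u x) has_vector_derivative (LINT x|M. f' u x)) (at u)"
proof -
  have diffq: "norm ((f y x - f u x) /\<^sub>R (y - u)) \<le> w x" if "\<bar>y - u\<bar> < 1" "y \<noteq> u" "x \<in> space M" for x y
  proof -
    have "norm (f y x - f u x) \<le> w x * norm (y - u)"
    proof (rule differentiable_bound[where S="ball u 1"])
      show "((\<lambda>u. f u x) has_derivative (\<lambda>h. h *\<^sub>R f' z x)) (at z within ball u 1)" for z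
        using d[OF that(3), of z] by (simp add: has_vector_derivative_def has_derivative_at_withinI)
      show "onorm (\<lambda>h. h *\<^sub>R f' z x) \<le> w x" if "z \<in> ball u 1" for z
        using w(2)[OF \<open>x \<in> space M\<close>, of z] that
        by (intro onorm_le) (auto simp: dist_real_def abs_minus_commute mult.commute[of "w x"] intro!: mult_left_mono)
    qed (use that in \<open>auto simp: dist_real_def abs_minus_commute\<close>)
    then show ?thesis using that(2) by (simp add: divide_simps mult.commute)
  qed
  have "((\<lambda>y. ((LINT x|M. f y x) - (LINT x|M. f u x)) /\<^sub>R (y - u)) \<longlongrightarrow> (LINT x|M. f' u x)) (at u within ball u 1)"
    unfolding tendsto_at_iff_sequentially
  proof (intro allI impI)
    fix X :: "nat \<Rightarrow> real" assume X: "\<forall>n. X n \<in> ball u 1 - {u}" "X \<longlonglongrightarrow> u"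
    have Xn: "\<bar>X n - u\<bar> < 1" "X n \<noteq> u" for n
      using X(1) by (auto simp: dist_real_def abs_minus_commute)
    have "(\<lambda>n. LINT x|M. (f (X n) x - f u x) /\<^sub>R (X n - u)) \<longlonglongrightarrow> (LINT x|M. f' u x)"
    proof (rule integral_dominated_convergence[OF m _ w(1)])
      show "(\<lambda>x. (f (X n) x - f u x) /\<^sub>R (X n - u)) \<in> borel_measurable M" for n
        using i by (intro borel_measurable_scaleR borel_measurable_diff) auto
      show "AE x in M. (\<lambda>n. (f (X n) x - f u x) /\<^sub>R (X n - u)) \<longlonglongrightarrow> f' u x"
      proof (rule AE_I2)
        fix x assume "x \<in> space M"
        from d[OF this, of u] have "((\<lambda>y. (f y x - f u x) /\<^sub>R (y - u)) \<longlongrightarrow> f' u x) (at u)"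
          by (simp add: has_vector_derivative_iff_tendsto)
        then show "(\<lambda>n. (f (X n) x - f u x) /\<^sub>R (X n - u)) \<longlonglongrightarrow> f' u x"
          using X(2) Xn unfolding tendsto_at_iff_sequentially by (auto simp: o_def)
      qed
      show "AE x in M. norm ((f (X n) x - f u x) /\<^sub>R (X n - u)) \<le> w x" for n
        using diffq[OF Xn] by auto
    qed
    moreover have "(LINT x|M. (f (X n) x - f u x) /\<^sub>R (X n - u)) = ((LINT x|M. f (X n) x) - (LINT x|M. f u x)) /\<^sub>R (X n - u)" for n
      using i[of "X n"] i[of u] by (subst integral_scaleR_right) (simp only: Bochner_Integration.integral_diff)
    ultimately show "((\<lambda>y. ((LINT x|M. f y x) - (LINT x|M. f u x)) /\<^sub>R (y - u)) \<circ> X) \<longlonglongrightarrow> (LINT x|M. f' u x)"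
      unfolding o_def by (simp only:)
  qed
  then have "((\<lambda>y. ((LINT x|M. f y x) - (LINT x|M. f u x)) /\<^sub>R (y - u)) \<longlongrightarrow> (LINT x|M. f' u x)) (at u)"
    by (simp add: at_within_open[OF _ open_ball])
  then show ?thesis by (simp add: has_vector_derivative_iff_tendsto)
qed


subsection \<open>The Schwartz space\<close>

lemma schwartz_smooth: "f \<in> schwartz \<Longrightarrow> smooth f"
  by (simp add: schwartz_def)

lemma schwartz_bound:
  assumes "f \<in> schwartz"
  obtains B where "\<And>x. norm (x ^ k *\<^sub>R (vderiv ^^ n) f x) \<le> B"
proof -
  have "bounded (range (\<lambda>x. x ^ k *\<^sub>R (vderiv ^^ n) f x))"
    using assms by (simp add: schwartz_def)
  then obtain B where "\<And>y. y \<in> range (\<lambda>x. x ^ k *\<^sub>R (vderiv ^^ n) f x) \<Longrightarrow> norm y \<le> B"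
    unfolding bounded_iff by blast
  then show ?thesis by (intro that[of B]) blast
qed

lemma schwartzI_sequence:
  assumes "\<And>n x. (D n has_vector_derivative D (Suc n) x) (at x)"
    and "\<And>n k. \<exists>B. \<forall>x. norm (x ^ k *\<^sub>R D n x) \<le> B"
  shows "D 0 \<in> schwartz"
  using assms(2) smoothI_sequence[of D, OF assms(1)]
  by (auto simp: schwartz_def bounded_iff)

lemma schwartz_vderiv: "f \<in> schwartz \<Longrightarrow> vderiv f \<in> schwartz"
  by (auto simp: schwartz_def smooth_vderiv funpow_vderiv_Suc[symmetric] simp del: funpow.simps)

lemma schwartz_funpow_vderiv: "f \<in> schwartz \<Longrightarrow> (vderiv ^^ n) f \<in> schwartz"
  by (induction n) (auto intro: schwartz_vderiv)

lemma schwartz_cmult: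
  assumes "f \<in> schwartz"
  shows "(\<lambda>x. c * f x) \<in> schwartz"
proof -
  have "(\<lambda>n x. c * (vderiv ^^ n) f x) 0 \<in> schwartz"
  proof (rule schwartzI_sequence)
    show "((\<lambda>x. c * (vderiv ^^ n) f x) has_vector_derivative c * (vderiv ^^ Suc n) f x) (at x)" for n x
      using assms by (intro has_vector_derivative_mult_right smooth_funpow_vderiv_has_vector_derivative schwartz_smooth)
    show "\<exists>B. \<forall>x. norm (x ^ k *\<^sub>R (c * (vderiv ^^ n) f x)) \<le> B" for k n
    proof -
      obtain A where A: "\<And>x. norm (x ^ k *\<^sub>R (vderiv ^^ n) f x) \<le> A" using schwartz_bound[OF assms(1)] by metis
      have "norm (x ^ k *\<^sub>R (c * (vderiv ^^ n) f x)) \<le> norm c * A" for x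
        using mult_left_mono[OF A[of x], of "norm c"] by (simp add: norm_mult mult_ac)
      then show ?thesis by blast
    qed
  qed
  then show ?thesis by simp
qed

lemma schwartz_mult_ident:
  assumes "f \<in> schwartz"
  shows "(\<lambda>x. of_real x * f x) \<in> schwartz"
proof -
  \<comment> \<open>The Leibniz formula for x f; at n = 0 the meaningless predecessor is multiplied
    by 0.\<close>
  define D where "D n x = of_real x * (vderiv ^^ n) f x + of_nat n * (vderiv ^^ (n - 1)) f x" for n x
  have "D 0 \<in> schwartz"
  proof (rule schwartzI_sequence)
    fix n x
    have s: "((vderiv ^^ n) f has_vector_derivative (vderiv ^^ Suc n) f x) (at x)" for n x
      by (rule smooth_funpow_vderiv_has_vector_derivative[OF schwartz_smooth[OF assms]])
    have i: "(complex_of_real has_vector_derivative 1) (at x)"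
      using has_vector_derivative_of_real[of "\<lambda>x. x" 1 "at x"] by (simp add: has_vector_derivative_id)
    have "((\<lambda>x. of_nat n * (vderiv ^^ (n - 1)) f x) has_vector_derivative of_nat n * (vderiv ^^ n) f x) (at x)"
      using s[of "n - 1" x] by (cases n) (auto intro: has_vector_derivative_mult_right simp del: of_nat_Suc)
    from has_vector_derivative_add[OF has_vector_derivative_mult[OF i s[of n x]] this]
    show "(D n has_vector_derivative D (Suc n) x) (at x)"
      unfolding D_def by (simp add: algebra_simps)
  next
    fix n k
    obtain A where A: "\<And>x. norm (x ^ Suc k *\<^sub>R (vderiv ^^ n) f x) \<le> A" using schwartz_bound[OF assms(1)] by metis
    obtain B where B: "\<And>x. norm (x ^ k *\<^sub>R (vderiv ^^ (n - 1)) f x) \<le> B" using schwartz_bound[OF assms(1)] by metis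
    have "norm (x ^ k *\<^sub>R D n x) \<le> A + real n * B" for x
    proof -
      have "norm (x ^ k *\<^sub>R D n x) \<le> norm (x ^ k *\<^sub>R (of_real x * (vderiv ^^ n) f x))
          + norm (x ^ k *\<^sub>R (of_nat n * (vderiv ^^ (n - 1)) f x))"
        unfolding D_def scaleR_add_right by (rule norm_triangle_ineq)
      also have "\<dots> = norm (x ^ Suc k *\<^sub>R (vderiv ^^ n) f x) + real n * norm (x ^ k *\<^sub>R (vderiv ^^ (n - 1)) f x)"
        by (simp add: norm_mult abs_mult mult_ac)
      finally show ?thesis using A[of x] mult_left_mono[OF B[of x], of "real n"] by simp
    qed
    then show "\<exists>B. \<forall>x. norm (x ^ k *\<^sub>R D n x) \<le> B" by blast
  qed
  then show ?thesis by (simp add: D_def[abs_def])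
qed

lemma funpow_vderiv_eq_0:
  assumes "\<And>x. x \<notin> {c..d} \<Longrightarrow> f x = 0" "x \<notin> {c..d}"
  shows "(vderiv ^^ n) f x = 0"
  using assms(2)
proof (induction n arbitrary: x)
  case (Suc n)
  then show ?case using vderiv_eq_0[of c d "(vderiv ^^ n) f" x] by simp
qed (use assms(1) in simp)

lemma schwartz_compact_support:
  assumes s: "smooth f" and R: "\<And>x. R \<le> \<bar>x\<bar> \<Longrightarrow> f x = 0"
  shows "f \<in> schwartz"
  unfolding schwartz_def
proof (intro CollectI conjI allI s)
  fix k n
  have z: "x ^ k *\<^sub>R (vderiv ^^ n) f x = 0" if "x \<notin> {- R..R}" for x
  proof -
    have "f y = 0" if "y \<notin> {- R..R}" for y using that by (intro R) auto
    then show ?thesis using funpow_vderiv_eq_0[of "- R" R f x n] that by simp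
  qed
  have "continuous_on UNIV (\<lambda>x. x ^ k *\<^sub>R (vderiv ^^ n) f x)"
    by (intro continuous_intros smooth_continuous_on smooth_funpow_vderiv s)
  from continuous_compact_support_bounded[OF this z]
  obtain B where "\<And>x. norm (x ^ k *\<^sub>R (vderiv ^^ n) f x) \<le> B" by metis
  then show "bounded (range (\<lambda>x. x ^ k *\<^sub>R (vderiv ^^ n) f x))"
    unfolding bounded_iff by blast
qed

lemma schwartz_measurable: "f \<in> schwartz \<Longrightarrow> f \<in> borel_measurable borel"
  by (simp add: schwartz_smooth smooth_measurable)

lemma schwartz_norm_ge:
  assumes "f \<in> schwartz" "k \<le> N" "n \<le> N"
  shows "norm (x ^ k *\<^sub>R (vderiv ^^ n) f x) \<le> schwartz_norm N f"
proof -
  let ?s = "\<lambda>k n. SUP x. norm (x ^ k *\<^sub>R (vderiv ^^ n) f x)"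
  have bdd: "bdd_above (range (\<lambda>x. norm (x ^ k *\<^sub>R (vderiv ^^ n) f x)))" for k n
  proof -
    obtain B where "\<And>x. norm (x ^ k *\<^sub>R (vderiv ^^ n) f x) \<le> B"
      using schwartz_bound[OF assms(1)] by metis
    then show ?thesis by (intro bdd_aboveI2[of _ _ B])
  qed
  have nn: "0 \<le> ?s k n" for k n
    by (rule cSUP_upper2[OF bdd, of 0]) auto
  have "norm (x ^ k *\<^sub>R (vderiv ^^ n) f x) \<le> ?s k n"
    by (rule cSUP_upper[OF _ bdd]) simp
  also have "\<dots> \<le> (\<Sum>n\<le>N. ?s k n)"
    using assms(3) nn by (intro member_le_sum) auto
  also have "\<dots> \<le> (\<Sum>k\<le>N. \<Sum>n\<le>N. ?s k n)"
    using assms(2) nn by (intro member_le_sum[of k "{..N}" "\<lambda>k. \<Sum>n\<le>N. ?s k n"] sum_nonneg) auto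
  finally show ?thesis by (simp add: schwartz_norm_def)
qed

text \<open>The order n + 2 of the seminorm accommodates the second power of \<open>x\<close> that
  makes the derivative integrable.\<close>

lemma schwartz_integrable_funpow:
  assumes "f \<in> schwartz"
  shows "integrable lborel ((vderiv ^^ n) f)"
    "(LINT x|lborel. norm ((vderiv ^^ n) f x)) \<le> 2 * pi * schwartz_norm (n + 2) f"
proof -
  have "norm ((vderiv ^^ n) f x) * (1 + x\<^sup>2) \<le> 2 * schwartz_norm (n + 2) f" for x
    using schwartz_norm_ge[OF assms, of 0 "n + 2" n x] schwartz_norm_ge[OF assms, of 2 "n + 2" n x]
    by (simp add: algebra_simps)
  note * = quadratic_decay_integrable[OF schwartz_measurable[OF schwartz_funpow_vderiv[OF assms]] this]
  show "integrable lborel ((vderiv ^^ n) f)" by (rule *(1))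
  show "(LINT x|lborel. norm ((vderiv ^^ n) f x)) \<le> 2 * pi * schwartz_norm (n + 2) f"
    using *(2) by (simp add: mult_ac)
qed

lemma schwartz_integrable: "f \<in> schwartz \<Longrightarrow> integrable lborel f"
  using schwartz_integrable_funpow(1)[of f 0] by simp

lemma schwartz_norm_nonneg: "f \<in> schwartz \<Longrightarrow> 0 \<le> schwartz_norm N f"
  using schwartz_norm_ge[of f 0 N 0 0] order_trans[OF norm_ge_zero] by blast


subsection \<open>The Fourier transform\<close>

lemma norm_fourier_le: "norm (fourier g u) \<le> (LINT x|lborel. norm (g x))"
proof -
  have "norm (fourier g u) \<le> (LINT x|lborel. norm (iexp (u * x) * g x))"
    unfolding fourier_def by (rule integral_norm_bound)
  then show ?thesis by (simp add: norm_mult)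
qed

lemma integrable_iexp_mult:
  assumes "integrable lborel g"
  shows "integrable lborel (\<lambda>x. iexp (u * x) * g x)"
proof (rule Bochner_Integration.integrable_bound[OF integrable_norm[OF assms]])
  have [measurable]: "g \<in> borel_measurable borel" using assms by simp
  show "(\<lambda>x. iexp (u * x) * g x) \<in> borel_measurable lborel" by measurable
qed (simp add: norm_mult)

lemma inv_fourier_eq: "inv_fourier g x = fourier g (- x) / complex_of_real (2 * pi)"
  by (simp add: inv_fourier_def fourier_def mult.commute)

lemma fourier_has_vector_derivative:
  assumes "integrable lborel g" "integrable lborel (\<lambda>x. of_real x * g x)"
  shows "(fourier g has_vector_derivative fourier (\<lambda>x. \<i> * (of_real x * g x)) u) (at u)"
proof -
  have "((\<lambda>u. CLINT x|lborel. iexp (u * x) * g x) has_vector_derivative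
      (CLINT x|lborel. iexp (u * x) * (\<i> * (of_real x * g x)))) (at u)"
  proof (rule has_vector_derivative_integral)
    show "integrable lborel (\<lambda>x. iexp (u * x) * g x)" for u by (rule integrable_iexp_mult[OF assms(1)])
    show "((\<lambda>u. iexp (u * x) * g x) has_vector_derivative iexp (u * x) * (\<i> * (of_real x * g x))) (at u)" for u x
    proof -
      have "((\<lambda>u. iexp (u * x)) has_vector_derivative iexp (u * x) * (\<i> * of_real x)) (at u)"
        by (rule has_vector_derivative_real_field[of "\<lambda>u. exp (\<i> * (u * of_real x))", simplified of_real_mult[symmetric]])
           (auto intro!: derivative_eq_intros)
      from has_vector_derivative_mult_left[OF this, of "g x"] show ?thesis by (simp add: mult_ac)
    qed
    show "(\<lambda>x. iexp (u * x) * (\<i> * (of_real x * g x))) \<in> borel_measurable lborel"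
      using integrable_iexp_mult[OF assms(2), of u] assms by measurable
    show "integrable lborel (\<lambda>x. norm (of_real x * g x))" by (rule integrable_norm[OF assms(2)])
  qed (simp add: norm_mult)
  then show ?thesis by (simp add: fourier_def[abs_def])
qed

lemma schwartz_ipow_mult: "f \<in> schwartz \<Longrightarrow> (\<lambda>x. (\<i> * of_real x) ^ n * f x) \<in> schwartz"
proof (induction n)
  case (Suc n)
  from schwartz_cmult[OF schwartz_mult_ident[OF Suc.IH[OF Suc.prems]], of "\<i>"]
  show ?case by (simp add: mult_ac)
qed simp

lemma smooth_fourier:
  assumes "f \<in> schwartz"
  shows "smooth (fourier f)" "(vderiv ^^ n) (fourier f) = fourier (\<lambda>x. (\<i> * of_real x) ^ n * f x)"
proof -
  define D where "D n = fourier (\<lambda>x. (\<i> * of_real x) ^ n * f x)" for n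
  have *: "(D n has_vector_derivative D (Suc n) u) (at u)" for n u
    unfolding D_def
    using fourier_has_vector_derivative[of "\<lambda>x. (\<i> * of_real x) ^ n * f x" u]
      schwartz_integrable[OF schwartz_ipow_mult[OF assms, of n]]
      schwartz_integrable[OF schwartz_mult_ident[OF schwartz_ipow_mult[OF assms, of n]]]
    by (simp add: mult_ac)
  have "D 0 = fourier f" by (simp add: D_def)
  then show "smooth (fourier f)" "(vderiv ^^ n) (fourier f) = fourier (\<lambda>x. (\<i> * of_real x) ^ n * f x)"
    using smoothI_sequence[of D, OF *] by (auto simp: D_def)
qed

text \<open>Integration by parts: the derivative of \<open>iexp (u * x) * f x\<close> integrates to
  0. With \<open>iexp (u * x)\<close> in the transform, a derivative becomes the factor -iu.\<close>

lemma fourier_vderiv: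
  assumes "f \<in> schwartz"
  shows "fourier (vderiv f) u = - (\<i> * of_real u) * fourier f u"
proof -
  have i: "integrable lborel (\<lambda>x. iexp (u * x) * vderiv f x)" "integrable lborel (\<lambda>x. iexp (u * x) * f x)"
    by (intro integrable_iexp_mult schwartz_integrable schwartz_vderiv assms)+
  obtain B where B: "\<And>x. norm (x ^ 1 *\<^sub>R (vderiv ^^ 0) f x) \<le> B"
    using schwartz_bound[OF assms] by metis
  have "(LINT x|lborel. iexp (u * x) * vderiv f x + \<i> * of_real u * (iexp (u * x) * f x)) = 0"
  proof (rule integral_derivative_eq_0)
    show "((\<lambda>x. iexp (u * x) * f x) has_vector_derivative
        iexp (u * x) * vderiv f x + \<i> * of_real u * (iexp (u * x) * f x)) (at x)" for x
    proof -
      have "((\<lambda>x. iexp (u * x)) has_vector_derivative iexp (u * x) * (\<i> * of_real u)) (at x)"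
        by (rule has_vector_derivative_real_field[of "\<lambda>x. exp (\<i> * (of_real u * x))", simplified of_real_mult[symmetric]])
           (auto intro!: derivative_eq_intros)
      from has_vector_derivative_mult[OF this smooth_has_vector_derivative[OF schwartz_smooth[OF assms], of x]]
      show ?thesis by (simp add: mult_ac)
    qed
    show "integrable lborel (\<lambda>x. iexp (u * x) * vderiv f x + \<i> * of_real u * (iexp (u * x) * f x))"
      using i by (intro Bochner_Integration.integrable_add integrable_mult_right) auto
    show "continuous_on UNIV (\<lambda>x. iexp (u * x) * vderiv f x + \<i> * of_real u * (iexp (u * x) * f x))"
      by (intro continuous_intros smooth_continuous_on smooth_vderiv schwartz_smooth assms)
    show "\<bar>x\<bar> * norm (iexp (u * x) * f x) \<le> B" for x using B[of x] by (simp add: norm_mult)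
  qed
  then have "fourier (vderiv f) u + \<i> * of_real u * fourier f u = 0"
    using i unfolding fourier_def by (subst (asm) Bochner_Integration.integral_add) auto
  then show ?thesis by (simp add: eq_neg_iff_add_eq_0)
qed

lemma fourier_funpow_vderiv:
  assumes "f \<in> schwartz"
  shows "fourier ((vderiv ^^ n) f) u = (- (\<i> * of_real u)) ^ n * fourier f u"
  using assms
proof (induction n)
  case (Suc n)
  then show ?case using fourier_vderiv[OF schwartz_funpow_vderiv[OF assms, of n], of u] by simp
qed simp

text \<open>A power of \<open>x\<close> times a derivative of the transform is, up to a unimodular
  factor, the transform of a derivative of a power times \<open>f\<close>, and a transform is
  bounded by the L1 norm.\<close>

lemma schwartz_fourier:
  assumes "f \<in> schwartz"
  shows "fourier f \<in> schwartz"
  unfolding schwartz_def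
proof (intro CollectI conjI allI smooth_fourier(1)[OF assms])
  fix k n
  define w where "w = (\<lambda>x. (\<i> * of_real x) ^ n * f x)"
  have w: "w \<in> schwartz" unfolding w_def by (rule schwartz_ipow_mult[OF assms])
  have "norm (x ^ k *\<^sub>R fourier w x) = norm (fourier ((vderiv ^^ k) w) x)" for x
    unfolding fourier_funpow_vderiv[OF w] by (simp add: norm_mult norm_power power_abs)
  then have "norm (x ^ k *\<^sub>R fourier w x) \<le> (LINT x|lborel. norm ((vderiv ^^ k) w x))" for x
    by (simp add: norm_fourier_le)
  then show "bounded (range (\<lambda>x. x ^ k *\<^sub>R (vderiv ^^ n) (fourier f) x))"
    unfolding bounded_iff smooth_fourier(2)[OF assms] w_def by blast
qed

lemma smooth_inv_fourier:
  assumes "f \<in> schwartz"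
  shows "smooth (inv_fourier f)"
proof -
  have "smooth (\<lambda>x. (1 / complex_of_real (2 * pi)) * fourier f ((- 1) * x + 0))"
    using assms by (intro smooth_mult smooth_const smooth_affine smooth_fourier)
  then show ?thesis by (simp add: inv_fourier_eq[abs_def])
qed

lemma inv_fourier_funpow_vderiv:
  assumes "f \<in> schwartz"
  shows "inv_fourier ((vderiv ^^ n) f) u = (\<i> * of_real u) ^ n * inv_fourier f u"
  by (simp add: inv_fourier_eq fourier_funpow_vderiv[OF assms])

subsection \<open>Fourier inversion\<close>

text \<open>Read off from the characteristic function of the standard normal law by the substitution
  z = t u.\<close>

lemma fourier_gaussian:
  assumes t: "0 < t"
  shows "(CLINT u|lborel. iexp (u * s) * of_real (exp (- (t * u)\<^sup>2 / 2)))
    = of_real (2 * pi / t * std_normal_density (s / t))"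
proof -
  let ?f = "\<lambda>z. iexp (s / t * z) * of_real (exp (- z\<^sup>2 / 2))"
  have "char std_normal_distribution (s / t) = (CLINT z|lborel. std_normal_density z *\<^sub>R iexp (s / t * z))"
    unfolding char_def by (subst integral_density) auto
  also have "(\<lambda>z. std_normal_density z *\<^sub>R iexp (s / t * z)) = (\<lambda>z. of_real (1 / sqrt (2 * pi)) * ?f z)"
    by (auto simp: std_normal_density_def scaleR_conv_of_real)
  finally have "of_real (exp (- (s / t)\<^sup>2 / 2)) = of_real (1 / sqrt (2 * pi)) * (CLINT z|lborel. ?f z)"
    by (simp add: char_std_normal_distribution)
  then have "of_real (sqrt (2 * pi)) * of_real (exp (- (s / t)\<^sup>2 / 2))
      = of_real (sqrt (2 * pi)) * (of_real (1 / sqrt (2 * pi)) * (CLINT z|lborel. ?f z))"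
    by (rule arg_cong)
  also have "\<dots> = (CLINT z|lborel. ?f z)" by (simp add: field_simps)
  also have "\<dots> = \<bar>t\<bar> *\<^sub>R (CLINT u|lborel. ?f (0 + t * u))"
    by (rule lborel_integral_real_affine) (use t in simp)
  also have "(\<lambda>u. ?f (0 + t * u)) = (\<lambda>u. iexp (u * s) * of_real (exp (- (t * u)\<^sup>2 / 2)))"
    using t by (auto simp: mult_ac)
  finally have e: "of_real (sqrt (2 * pi)) * of_real (exp (- (s / t)\<^sup>2 / 2))
     = of_real t * (CLINT u|lborel. iexp (u * s) * of_real (exp (- (t * u)\<^sup>2 / 2)))"
    using t by (simp add: scaleR_conv_of_real)
  have "2 * pi * std_normal_density (s / t) = sqrt (2 * pi) * exp (- (s / t)\<^sup>2 / 2)"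
  proof -
    have "2 * pi * std_normal_density (s / t) = 2 * pi / sqrt (2 * pi) * exp (- (s / t)\<^sup>2 / 2)"
      by (simp add: std_normal_density_def)
    also have "2 * pi / sqrt (2 * pi) = sqrt (2 * pi)" by (rule real_div_sqrt) simp
    finally show ?thesis .
  qed
  then have "of_real t * (CLINT u|lborel. iexp (u * s) * of_real (exp (- (t * u)\<^sup>2 / 2)))
      = complex_of_real (2 * pi * std_normal_density (s / t))"
    unfolding e[symmetric] of_real_mult[symmetric] by simp
  then show ?thesis using t by (simp add: field_simps)
qed

lemma fourier_measurable:
  assumes "g \<in> borel_measurable borel"
  shows "fourier g \<in> borel_measurable borel"
proof -
  note assms[measurable]
  have "(\<lambda>u. CLINT x|lborel. iexp (u * x) * g x) \<in> borel_measurable borel"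
    by measurable
  then show ?thesis by (simp add: fourier_def[abs_def])
qed

lemma inv_fourier_measurable:
  assumes "g \<in> borel_measurable borel"
  shows "inv_fourier g \<in> borel_measurable borel"
proof -
  note fourier_measurable[OF assms, measurable]
  show ?thesis unfolding inv_fourier_eq[abs_def] by measurable
qed

lemma integrable_gaussian:
  fixes t :: real
  assumes t: "t \<noteq> 0"
  shows "integrable lborel (\<lambda>u. exp (- (t * u)\<^sup>2 / 2))"
proof -
  have "integrable lborel (\<lambda>u. sqrt (2 * pi) * std_normal_density (0 + t * u))"
    by (intro integrable_mult_right lborel_integrable_real_affine t integrable_normal_density[OF zero_less_one])
  then show ?thesis by (simp add: std_normal_density_def)
qed

text \<open>Gaussian summation: with a factor exp(-(t u)^2 / 2) the double integral converges
  absolutely, and exchanging the integrals gives a normal average of \<open>h\<close> around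
  \<open>x\<close> with spread t. As t tends to 0 this tends to \<open>h x\<close> by continuity and
  boundedness of \<open>h\<close>.\<close>

theorem inv_fourier_fourier:
  assumes cont: "continuous_on UNIV h" and int: "integrable lborel h" and B: "\<And>x. norm (h x) \<le> B"
    and fi: "integrable lborel (fourier h)"
  shows "inv_fourier (fourier h) x = h x"
proof -
  define t where "t n = inverse (real (Suc n))" for n
  have t: "0 < t n" for n by (simp add: t_def)
  have t0: "t \<longlonglongrightarrow> 0" unfolding t_def by (rule LIMSEQ_inverse_real_of_nat)
  have [measurable]: "h \<in> borel_measurable borel" "fourier h \<in> borel_measurable borel"
    using int fourier_measurable by auto
  define L where "L n = (CLINT u|lborel. (iexp (- (u * x)) * fourier h u) * of_real (exp (- (t n * u)\<^sup>2 / 2)))" for n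
  have nI: "norm (iexp (- (u * x)) * fourier h u) = norm (fourier h u)" for u x by (simp add: norm_mult)
  have lim1: "L \<longlonglongrightarrow> (CLINT u|lborel. iexp (- (u * x)) * fourier h u)"
    unfolding L_def
  proof (rule integral_dominated_convergence)
    show "integrable lborel (\<lambda>u. norm (fourier h u))" using fi by simp
    show "AE u in lborel. (\<lambda>n. (iexp (- (u * x)) * fourier h u) * of_real (exp (- (t n * u)\<^sup>2 / 2)))
        \<longlonglongrightarrow> iexp (- (u * x)) * fourier h u"
    proof (rule AE_I2)
      fix u
      have "(\<lambda>n. exp (- (t n * u)\<^sup>2 / 2)) \<longlonglongrightarrow> exp (- (0 * u)\<^sup>2 / 2)"
        by (intro tendsto_intros t0) simp
      then have "(\<lambda>n. (iexp (- (u * x)) * fourier h u) * of_real (exp (- (t n * u)\<^sup>2 / 2)))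
          \<longlonglongrightarrow> (iexp (- (u * x)) * fourier h u) * of_real (exp (- (0 * u)\<^sup>2 / 2))"
        by (intro tendsto_mult_left tendsto_of_real)
      then show "(\<lambda>n. (iexp (- (u * x)) * fourier h u) * of_real (exp (- (t n * u)\<^sup>2 / 2)))
        \<longlonglongrightarrow> iexp (- (u * x)) * fourier h u" by simp
    qed
    show "AE u in lborel. norm ((iexp (- (u * x)) * fourier h u) * of_real (exp (- (t n * u)\<^sup>2 / 2)))
        \<le> norm (fourier h u)" for n
      by (rule AE_I2) (simp add: norm_mult mult_left_le)
  qed measurable
  have L_eq: "L n = (CLINT z|lborel. h (x + t n * z) * of_real (2 * pi * std_normal_density z))" for n
  proof -
    let ?E = "\<lambda>u. complex_of_real (exp (- (t n * u)\<^sup>2 / 2))"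
    let ?F = "\<lambda>u y. (iexp (- (u * x)) * ?E u) * (iexp (u * y) * h y)"
    have Ei: "integrable lborel ?E"
      using integrable_gaussian[of "t n"] t[of n] by (intro integrable_of_real) auto
    have prod: "integrable (lborel \<Otimes>\<^sub>M lborel) (\<lambda>(u, y). ?F u y)"
    proof (rule Bochner_Integration.integrable_bound)
      show "integrable (lborel \<Otimes>\<^sub>M lborel) (\<lambda>(u, y). norm (?E u) * norm (h y))"
        by (intro lborel_pair.integrable_product_mult integrable_norm Ei int)
      show "AE z in lborel \<Otimes>\<^sub>M lborel. norm (case z of (u, y) \<Rightarrow> ?F u y) \<le> norm (case z of (u, y) \<Rightarrow> norm (?E u) * norm (h y))"
        by (rule AE_I2) (auto simp: norm_mult)
    qed measurable
    have "L n = (CLINT u|lborel. CLINT y|lborel. ?F u y)"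
    proof -
      have "(CLINT y|lborel. ?F u y) = (iexp (- (u * x)) * fourier h u) * ?E u" for u
        unfolding integral_mult_right_zero fourier_def by (simp only: mult_ac)
      then show ?thesis unfolding L_def by (simp only: mult.assoc mult.commute mult.left_commute)
    qed
    also have "\<dots> = (CLINT y|lborel. CLINT u|lborel. ?F u y)"
      using lborel_pair.Fubini_integral[OF prod] by simp
    also have "\<dots> = (CLINT y|lborel. h y * of_real (2 * pi / t n * std_normal_density ((y - x) / t n)))"
    proof (rule Bochner_Integration.integral_cong[OF refl])
      fix y
      have "?F u y = h y * (iexp (u * (y - x)) * ?E u)" for u
      proof -
        have "iexp (- (u * x)) * iexp (u * y) = iexp (u * (y - x))"
          unfolding exp_add[symmetric] by (simp add: algebra_simps)
        then show ?thesis by (simp add: mult_ac)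
      qed
      then show "(CLINT u|lborel. ?F u y) = h y * of_real (2 * pi / t n * std_normal_density ((y - x) / t n))"
        by (simp only: integral_mult_right_zero fourier_gaussian[OF t])
    qed
    also have "\<dots> = \<bar>t n\<bar> *\<^sub>R (CLINT z|lborel. h (x + t n * z) * of_real (2 * pi / t n * std_normal_density ((x + t n * z - x) / t n)))"
      by (rule lborel_integral_real_affine) (use t[of n] in simp)
    also have "\<dots> = (CLINT z|lborel. of_real (t n) * (h (x + t n * z) * of_real (2 * pi / t n * std_normal_density ((x + t n * z - x) / t n))))"
      using t[of n] by (simp add: scaleR_conv_of_real)
    also have "\<dots> = (CLINT z|lborel. h (x + t n * z) * of_real (2 * pi * std_normal_density z))"
      using t[of n] by (intro Bochner_Integration.integral_cong refl) (simp add: field_simps)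
    finally show ?thesis .
  qed
  have lim2: "L \<longlonglongrightarrow> (CLINT z|lborel. h x * of_real (2 * pi * std_normal_density z))"
    unfolding L_eq
  proof (rule integral_dominated_convergence)
    show "integrable lborel (\<lambda>z. B * (2 * pi * std_normal_density z))"
      by (intro integrable_mult_right integrable_normal_density[OF zero_less_one])
    show "AE z in lborel. (\<lambda>n. h (x + t n * z) * of_real (2 * pi * std_normal_density z))
        \<longlonglongrightarrow> h x * of_real (2 * pi * std_normal_density z)"
    proof (rule AE_I2)
      fix z
      have "(\<lambda>n. x + t n * z) \<longlonglongrightarrow> x + 0 * z" by (intro tendsto_intros t0)
      then have "(\<lambda>n. h (x + t n * z)) \<longlonglongrightarrow> h x"
        using cont by (intro isCont_tendsto_compose[of x h]) (auto simp: continuous_on_eq_continuous_at)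
      then show "(\<lambda>n. h (x + t n * z) * of_real (2 * pi * std_normal_density z))
        \<longlonglongrightarrow> h x * of_real (2 * pi * std_normal_density z)" by (rule tendsto_mult_right)
    qed
    show "AE z in lborel. norm (h (x + t n * z) * of_real (2 * pi * std_normal_density z)) \<le> B * (2 * pi * std_normal_density z)" for n
      by (rule AE_I2) (simp add: norm_mult B mult_right_mono)
  qed measurable
  have "(CLINT z|lborel. h x * of_real (2 * pi * std_normal_density z)) = h x * of_real (2 * pi * (LINT z|lborel. std_normal_density z))"
    by (simp only: integral_mult_right_zero integral_complex_of_real)
  also have "(LINT z|lborel. std_normal_density z) = 1" by (rule integral_normal_density) simp
  finally have "(CLINT u|lborel. iexp (- (u * x)) * fourier h u) = h x * of_real (2 * pi)"
    using LIMSEQ_unique[OF lim1 lim2] by simp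
  then show ?thesis by (simp add: inv_fourier_def)
qed

lemma fourier_continuous:
  assumes "integrable lborel g"
  shows "continuous_on UNIV (fourier g)"
  unfolding continuous_on_eq_continuous_at[OF open_UNIV]
proof (intro ballI, unfold continuous_at_sequentially, intro allI impI)
  fix u :: real and X :: "nat \<Rightarrow> real" assume X: "X \<longlonglongrightarrow> u"
  have [measurable]: "g \<in> borel_measurable borel" using assms by simp
  have "(\<lambda>n. CLINT x|lborel. iexp (X n * x) * g x) \<longlonglongrightarrow> (CLINT x|lborel. iexp (u * x) * g x)"
  proof (rule integral_dominated_convergence)
    show "integrable lborel (\<lambda>x. norm (g x))" using assms by simp
    show "AE x in lborel. (\<lambda>n. iexp (X n * x) * g x) \<longlonglongrightarrow> iexp (u * x) * g x"
      by (intro AE_I2 tendsto_intros X)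
  qed (auto simp: norm_mult)
  then show "(fourier g \<circ> X) \<longlonglongrightarrow> fourier g u" by (simp add: o_def fourier_def)
qed

lemma inv_fourier_continuous:
  assumes "integrable lborel g"
  shows "continuous_on UNIV (inv_fourier g)"
  unfolding inv_fourier_eq[abs_def]
  by (intro continuous_intros continuous_on_compose2[OF fourier_continuous[OF assms]]) auto

lemma norm_inv_fourier_le: "norm (inv_fourier g u) \<le> (LINT x|lborel. norm (g x)) / (2 * pi)"
  using norm_fourier_le[of g "- u"] by (simp add: inv_fourier_eq norm_divide divide_right_mono)

lemma schwartz_inv_fourier_integrable:
  assumes "f \<in> schwartz" shows "integrable lborel (inv_fourier f)"
proof -
  have "integrable lborel (\<lambda>x. fourier f (0 + (- 1) * x) / complex_of_real (2 * pi))"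
    by (intro integrable_divide lborel_integrable_real_affine schwartz_integrable schwartz_fourier assms) simp
  then show ?thesis by (simp add: inv_fourier_eq[abs_def])
qed


subsection \<open>Uniqueness of representing functions\<close>

lemma test_function_schwartz:
  assumes "test_function S \<phi>" shows "(\<lambda>x. complex_of_real (\<phi> x)) \<in> schwartz"
proof -
  obtain R where "\<And>x. R \<le> \<bar>x\<bar> \<Longrightarrow> \<phi> x = 0"
    using assms compact_fsupportD[of \<phi>] unfolding test_function_def by metis
  then show ?thesis
    using assms by (intro schwartz_compact_support[of _ R] smooth_of_real) (auto simp: test_function_def)
qed

text \<open>Real and imaginary part, both instances of \<open>p\<close>, are treated on bounded
  intervals by the version for real test functions.\<close>

lemma AE_eq_0I_schwartz:
  fixes g :: "real \<Rightarrow> complex"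
  assumes m[measurable]: "g \<in> borel_measurable borel"
    and int: "\<And>\<phi>. \<phi> \<in> schwartz \<Longrightarrow> integrable lborel (\<lambda>x. g x * \<phi> x)"
    and eq: "\<And>\<phi>. \<phi> \<in> schwartz \<Longrightarrow> (CLINT x|lborel. g x * \<phi> x) = 0"
  shows "AE x in lborel. g x = 0"
proof -
  have part: "AE x in lborel. x \<in> {- r<..<r} \<longrightarrow> p (g x) = 0"
    if r: "0 < r" and p: "bounded_linear p" "\<And>z a. p (z * complex_of_real a) = p z * a"
      "\<And>z. \<bar>p z\<bar> \<le> norm z" for r and p :: "complex \<Rightarrow> real"
  proof (rule AE_eq_0I_test_functions)
    have pm[measurable]: "p \<in> borel_measurable borel"
      using p(1) by (simp add: borel_measurable_continuous_onI linear_continuous_on)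
    have b: "test_function UNIV (bump (- (r + 1)) (r + 1))"
      by (rule test_functionI[of _ "- (r + 1)" "r + 1"]) (auto simp: smooth_bump bump_eq_0)
    \<comment> \<open>Local integrability of \<open>g\<close> is not given; it follows from
      integrability against one bump, which has a positive minimum on [-r, r].\<close>
    have "continuous_on {- r..r} (bump (- (r + 1)) (r + 1))"
      by (rule smooth_continuous_on[OF smooth_bump])
    then obtain y where y: "y \<in> {- r..r}" "\<And>x. x \<in> {- r..r} \<Longrightarrow> bump (- (r + 1)) (r + 1) y \<le> bump (- (r + 1)) (r + 1) x"
      using continuous_attains_inf[of "{- r..r}" "bump (- (r + 1)) (r + 1)"] r by auto
    define m where "m = bump (- (r + 1)) (r + 1) y"
    have mpos: "0 < m" unfolding m_def using y(1) by (intro bump_pos) auto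
    have "integrable lborel (\<lambda>x. g x * complex_of_real (bump (- (r + 1)) (r + 1) x))"
      by (rule int[OF test_function_schwartz[OF b]])
    then have i: "integrable lborel (\<lambda>x. norm (g x * complex_of_real (bump (- (r + 1)) (r + 1) x)) / m)"
      by (intro integrable_divide integrable_norm)
    show "set_integrable lborel {- r<..<r} (\<lambda>x. p (g x))"
      unfolding set_integrable_def
    proof (rule Bochner_Integration.integrable_bound[OF i])
      show "AE x in lborel. norm (indicat_real {- r<..<r} x *\<^sub>R p (g x))
          \<le> norm (norm (g x * complex_of_real (bump (- (r + 1)) (r + 1) x)) / m)"
      proof (rule AE_I2)
        fix x
        show "norm (indicat_real {- r<..<r} x *\<^sub>R p (g x))
          \<le> norm (norm (g x * complex_of_real (bump (- (r + 1)) (r + 1) x)) / m)"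
        proof (cases "x \<in> {- r<..<r}")
          case True
          then have "m \<le> bump (- (r + 1)) (r + 1) x" using y(2)[of x] by (simp add: m_def)
          then have "norm (g x) * m \<le> norm (g x) * bump (- (r + 1)) (r + 1) x" by (intro mult_left_mono) auto
          then have "norm (g x) \<le> norm (g x) * bump (- (r + 1)) (r + 1) x / m" using mpos by (simp add: field_simps)
          then show ?thesis using True p(3)[of "g x"] mpos bump_nonneg[of "- (r + 1)" "r + 1" x]
            by (simp add: norm_mult abs_mult)
        qed simp
      qed
    qed measurable
    show "(LINT x|lborel. p (g x) * \<phi> x) = 0" if t: "test_function {- r<..<r} \<phi>" for \<phi>
    proof -
      have s: "(\<lambda>x. complex_of_real (\<phi> x)) \<in> schwartz" by (rule test_function_schwartz[OF t])
      have "(LINT x|lborel. p (g x * complex_of_real (\<phi> x))) = p (CLINT x|lborel. g x * complex_of_real (\<phi> x))"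
        by (rule integral_bounded_linear[OF p(1) int[OF s]])
      moreover have "p 0 = 0" by (rule linear_0[OF bounded_linear.linear[OF p(1)]])
      ultimately show ?thesis using eq[OF s] by (simp add: p(2))
    qed
  qed
  have "AE x in lborel. x \<in> {- real (Suc n)<..<real (Suc n)} \<longrightarrow> g x = 0" for n
  proof -
    have "AE x in lborel. x \<in> {- real (Suc n)<..<real (Suc n)} \<longrightarrow> Re (g x) = 0"
      by (rule part) (auto simp: bounded_linear_Re abs_Re_le_cmod)
    moreover have "AE x in lborel. x \<in> {- real (Suc n)<..<real (Suc n)} \<longrightarrow> Im (g x) = 0"
      by (rule part) (auto simp: bounded_linear_Im abs_Im_le_cmod)
    ultimately show ?thesis by eventually_elim (auto simp: complex_eq_iff)
  qed
  then have "AE x in lborel. \<forall>n. x \<in> {- real (Suc n)<..<real (Suc n)} \<longrightarrow> g x = 0"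
    unfolding AE_all_countable by blast
  then show ?thesis
  proof eventually_elim
    fix x assume *: "\<forall>n. x \<in> {- real (Suc n)<..<real (Suc n)} \<longrightarrow> g x = 0"
    obtain n where "\<bar>x\<bar> < real n" using reals_Archimedean2 by blast
    then have "x \<in> {- real (Suc n)<..<real (Suc n)}" by auto
    then show "g x = 0" using * by blast
  qed
qed

lemma represents_unique:
  assumes "represents g T" "represents g' T"
  shows "AE x in lborel. g x = g' x"
proof -
  have "AE x in lborel. g x - g' x = 0"
  proof (rule AE_eq_0I_schwartz)
    show "(\<lambda>x. g x - g' x) \<in> borel_measurable borel" using assms by (auto simp: represents_def)
    fix \<phi> :: "real \<Rightarrow> complex" assume "\<phi> \<in> schwartz"
    then have *: "integrable lborel (\<lambda>x. g x * \<phi> x)" "integrable lborel (\<lambda>x. g' x * \<phi> x)"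
      "(CLINT x|lborel. g x * \<phi> x) = (CLINT x|lborel. g' x * \<phi> x)"
      using assms by (auto simp: represents_def)
    then show "integrable lborel (\<lambda>x. (g x - g' x) * \<phi> x)" "(CLINT x|lborel. (g x - g' x) * \<phi> x) = 0"
      by (auto simp: left_diff_distrib)
  qed
  then show ?thesis by simp
qed

lemma represents_fun_of: "represents g T \<Longrightarrow> represents (fun_of T) T"
  unfolding fun_of_def by (rule someI[where P="\<lambda>g. represents g T" and x=g])

section \<open>Fourier multipliers on test functions\<close>

text \<open>The transpose of the operator with symbol \<open>b\<close>: distributions and
  convolutions are always tested, so the operator acts on the test function, with the two transforms
  in reversed order.\<close>

definition mult_op :: "(real \<Rightarrow> complex) \<Rightarrow> (real \<Rightarrow> complex) \<Rightarrow> real \<Rightarrow> complex" where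
  "mult_op b h = fourier (\<lambda>u. b u * inv_fourier h u)"

lemma lp_block_eq: "lp_block \<psi> j f \<phi> = f (mult_op (\<lambda>u. complex_of_real (\<psi> j u)) \<phi>)"
  by (simp add: lp_block_def dist_inv_fourier_def dist_mult_def dist_fourier_def mult_op_def)

section \<open>Convolution kernels on L1\<close>

lemma lborel_integral_reflect:
  fixes f :: "real \<Rightarrow> 'a::{banach, second_countable_topology}"
  shows "(LINT y|lborel. f (x - y)) = (LINT y|lborel. f y)"
  using lborel_integral_real_affine[of "-1" f x] by simp

lemma lborel_integrable_reflect:
  fixes f :: "real \<Rightarrow> 'a::{banach, second_countable_topology}"
  shows "integrable lborel f \<Longrightarrow> integrable lborel (\<lambda>y. f (x - y))"
  using lborel_integrable_real_affine[of f "-1" x] by simp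

lemma lborel_integral_shift:
  fixes f :: "real \<Rightarrow> 'a::{banach, second_countable_topology}"
  shows "(LINT x|lborel. f (x - y)) = (LINT x|lborel. f x)"
  using lborel_integral_real_affine[of 1 f "- y"] by simp

lemma lborel_integrable_shift:
  fixes f :: "real \<Rightarrow> 'a::{banach, second_countable_topology}"
  shows "integrable lborel f \<Longrightarrow> integrable lborel (\<lambda>x. f (x - y))"
  using lborel_integrable_real_affine[of f 1 "- y"] by simp

lemma integrable_convolution_kernel:
  fixes K h :: "real \<Rightarrow> complex"
  assumes K: "integrable lborel K" and h: "integrable lborel h"
  shows "integrable (lborel \<Otimes>\<^sub>M lborel) (\<lambda>(x, y). K (x - y) * h x)"
proof (rule lborel_pair.Fubini_integrable)
  have [measurable]: "K \<in> borel_measurable borel" "h \<in> borel_measurable borel" using K h by auto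
  show "(\<lambda>(x, y). K (x - y) * h x) \<in> borel_measurable (lborel \<Otimes>\<^sub>M lborel)" by measurable
  have "(LINT y|lborel. norm (K (x - y) * h x)) = (LINT y|lborel. norm (K y)) * norm (h x)" for x
    using lborel_integral_reflect[of "\<lambda>y. norm (K y)" x] by (simp add: norm_mult)
  then show "integrable lborel (\<lambda>x. LINT y|lborel. norm (case (x, y) of (x, y) \<Rightarrow> K (x - y) * h x))"
    using h by simp
  show "AE x in lborel. integrable lborel (\<lambda>y. case (x, y) of (x, y) \<Rightarrow> K (x - y) * h x)"
    using lborel_integrable_reflect[OF K] by simp
qed

text \<open>Fubini in frequency and space. The kernel appears reflected, because the operator is the
  transpose of a convolution.\<close>

lemma mult_op_eq_convolution:
  assumes b: "integrable lborel b" and h: "integrable lborel h"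
  shows "mult_op b h y = (CLINT x|lborel. inv_fourier b (x - y) * h x)"
proof -
  let ?F = "\<lambda>u x. (iexp (u * y) * b u) * (iexp (- (x * u)) * h x) / complex_of_real (2 * pi)"
  have [measurable]: "b \<in> borel_measurable borel" "h \<in> borel_measurable borel" using b h by auto
  have prod: "integrable (lborel \<Otimes>\<^sub>M lborel) (\<lambda>(u, x). ?F u x)"
  proof (rule Bochner_Integration.integrable_bound)
    show "integrable (lborel \<Otimes>\<^sub>M lborel) (\<lambda>(u, x). norm (b u) * norm (h x))"
      by (intro lborel_pair.integrable_product_mult integrable_norm b h)
    show "AE z in lborel \<Otimes>\<^sub>M lborel. norm (case z of (u, x) \<Rightarrow> ?F u x) \<le> norm (case z of (u, x) \<Rightarrow> norm (b u) * norm (h x))"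
    proof (rule AE_I2, clarify)
      fix u x
      have "norm (b u) * norm (h x) / (2 * pi) \<le> norm (b u) * norm (h x) / 1"
        using pi_gt3 by (intro divide_left_mono) auto
      then show "norm (?F u x) \<le> norm (norm (b u) * norm (h x))"
        by (simp add: norm_mult norm_divide)
    qed
  qed measurable
  have "mult_op b h y = (CLINT u|lborel. CLINT x|lborel. ?F u x)"
  proof -
    have "(CLINT x|lborel. ?F u x) = iexp (u * y) * (b u * inv_fourier h u)" for u
    proof -
      have "(CLINT x|lborel. ?F u x) = (iexp (u * y) * b u) * (CLINT x|lborel. iexp (- (x * u)) * h x) / complex_of_real (2 * pi)"
        by (simp only: integral_mult_right_zero integral_divide_zero)
      then show ?thesis by (simp add: inv_fourier_def mult.assoc)
    qed
    then show ?thesis by (simp add: mult_op_def fourier_def mult.commute)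
  qed
  also have "\<dots> = (CLINT x|lborel. CLINT u|lborel. ?F u x)"
    using lborel_pair.Fubini_integral[OF prod] by simp
  also have "\<dots> = (CLINT x|lborel. inv_fourier b (x - y) * h x)"
  proof (rule Bochner_Integration.integral_cong[OF refl])
    fix x
    have "?F u x = (iexp (- (u * (x - y))) * b u) * (h x / complex_of_real (2 * pi))" for u
    proof -
      have "iexp (u * y) * iexp (- (x * u)) = iexp (- (u * (x - y)))"
        by (simp add: exp_add[symmetric] algebra_simps)
      then show ?thesis by (simp add: mult_ac)
    qed
    then have "(CLINT u|lborel. ?F u x) = (CLINT u|lborel. iexp (- (u * (x - y))) * b u) * (h x / complex_of_real (2 * pi))"
      by (simp only: integral_mult_left_zero)
    then show "(CLINT u|lborel. ?F u x) = inv_fourier b (x - y) * h x"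
      by (simp add: inv_fourier_def)
  qed
  finally show ?thesis .
qed

lemma mult_op_L1:
  assumes b: "integrable lborel b" "integrable lborel (inv_fourier b)" and h: "integrable lborel h"
  shows "integrable lborel (mult_op b h)"
    "(LINT y|lborel. norm (mult_op b h y)) \<le> (LINT x|lborel. norm (inv_fourier b x)) * (LINT x|lborel. norm (h x))"
proof -
  let ?k = "\<lambda>x y. inv_fourier b (x - y) * h x"
  have prod: "integrable (lborel \<Otimes>\<^sub>M lborel) (\<lambda>(x, y). ?k x y)"
    by (rule integrable_convolution_kernel[OF b(2) h])
  have eq: "mult_op b h = (\<lambda>y. CLINT x|lborel. ?k x y)"
    using mult_op_eq_convolution[OF b(1) h] by auto
  show i: "integrable lborel (mult_op b h)"
    unfolding eq using lborel_pair.integrable_snd[OF prod] by simp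
  have np: "integrable (lborel \<Otimes>\<^sub>M lborel) (\<lambda>(x, y). norm (?k x y))"
    using integrable_norm[OF prod] by (simp add: case_prod_beta')
  have "(LINT y|lborel. norm (mult_op b h y)) \<le> (LINT y|lborel. LINT x|lborel. norm (?k x y))"
    unfolding eq using i lborel_pair.integrable_snd[OF np] unfolding eq
    by (intro integral_mono integrable_norm) auto
  also have "\<dots> = (LINT x|lborel. LINT y|lborel. norm (?k x y))"
    using lborel_pair.Fubini_integral[OF np] by simp
  also have "\<dots> = (LINT x|lborel. norm (inv_fourier b x)) * (LINT x|lborel. norm (h x))"
    using lborel_integral_reflect[of "\<lambda>y. norm (inv_fourier b y)"] by (simp add: norm_mult)
  finally show "(LINT y|lborel. norm (mult_op b h y)) \<le> (LINT x|lborel. norm (inv_fourier b x)) * (LINT x|lborel. norm (h x))" .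
qed

text \<open>Continuity instead of smoothness, since cutoffs of \<open>1 / char \<mu> u\<close> need
  not be differentiable. Compact support makes the symbol itself integrable, and the integrable
  kernel is what bounds the operator on L1.\<close>

definition fourier_symbol :: "(real \<Rightarrow> complex) \<Rightarrow> bool" where
  "fourier_symbol b \<longleftrightarrow> continuous_on UNIV b \<and> (\<exists>R. \<forall>u. R \<le> \<bar>u\<bar> \<longrightarrow> b u = 0) \<and>
     integrable lborel (inv_fourier b)"

lemma bounded_support_Icc: "\<forall>u. R \<le> \<bar>u\<bar> \<longrightarrow> b u = 0 \<Longrightarrow> x \<notin> {- R..R} \<Longrightarrow> b x = 0" for x :: real
  by (metis abs_le_iff atLeastAtMost_iff linorder_le_cases minus_le_iff)

lemma fourier_symbolD:
  assumes "fourier_symbol b"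
  shows "continuous_on UNIV b" "integrable lborel b" "integrable lborel (inv_fourier b)"
    "\<exists>B. \<forall>u. norm (b u) \<le> B"
proof -
  from assms obtain R where c: "continuous_on UNIV b" and R: "\<forall>u. R \<le> \<bar>u\<bar> \<longrightarrow> b u = 0"
    and "integrable lborel (inv_fourier b)" by (auto simp: fourier_symbol_def)
  then show "continuous_on UNIV b" "integrable lborel (inv_fourier b)" by auto
  show "integrable lborel b"
    by (rule continuous_compact_support_integrable[OF c bounded_support_Icc[OF R]])
  show "\<exists>B. \<forall>u. norm (b u) \<le> B"
    using continuous_compact_support_bounded[OF c bounded_support_Icc[OF R]] by metis
qed

text \<open>Inversion is applied to the product \<open>b u * inv_fourier h u\<close>, whose
  transform is integrable by the L1 bound. Consequently composing operators multiplies
  symbols.\<close>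

lemma inv_fourier_mult_op:
  assumes b: "fourier_symbol b" and h: "integrable lborel h"
  shows "inv_fourier (mult_op b h) u = b u * inv_fourier h u"
proof -
  let ?w = "\<lambda>u. b u * inv_fourier h u"
  have c: "continuous_on UNIV ?w"
    by (intro continuous_intros fourier_symbolD(1)[OF b] inv_fourier_continuous h)
  obtain B where B: "\<And>u. norm (b u) \<le> B" using fourier_symbolD(4)[OF b] by blast
  define C where "C = (LINT x|lborel. norm (h x)) / (2 * pi)"
  have C: "norm (inv_fourier h u) \<le> C" for u unfolding C_def by (rule norm_inv_fourier_le)
  have "0 \<le> B" using B[of 0] norm_ge_zero order_trans by blast
  then have bd: "norm (?w u) \<le> B * C" for u
    unfolding norm_mult by (intro mult_mono B C) auto
  have [measurable]: "b \<in> borel_measurable borel" "inv_fourier h \<in> borel_measurable borel"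
    using fourier_symbolD(2)[OF b] inv_fourier_continuous[OF h] by (auto intro: borel_measurable_continuous_onI)
  have i: "integrable lborel ?w"
  proof (rule Bochner_Integration.integrable_bound)
    show "integrable lborel (\<lambda>u. C *\<^sub>R b u)" by (intro integrable_scaleR_right fourier_symbolD(2)[OF b])
    have "0 \<le> C" using C[of 0] norm_ge_zero order_trans by blast
    then show "AE u in lborel. norm (?w u) \<le> norm (C *\<^sub>R b u)"
      using mult_left_mono[OF C norm_ge_zero] by (intro AE_I2) (simp add: norm_mult mult.commute)
  qed measurable
  have "integrable lborel (fourier ?w)"
    using mult_op_L1(1)[OF fourier_symbolD(2,3)[OF b] h] by (simp add: mult_op_def)
  from inv_fourier_fourier[OF c i bd this] show ?thesis by (simp add: mult_op_def)
qed

lemma mult_op_mult_op: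
  assumes b: "fourier_symbol b" and h: "integrable lborel h"
  shows "mult_op c (mult_op b h) = mult_op (\<lambda>u. c u * b u) h"
  using inv_fourier_mult_op[OF assms] by (simp add: mult_op_def mult.assoc)

lemma mult_op_integrable:
  assumes "fourier_symbol b" "integrable lborel h"
  shows "integrable lborel (mult_op b h)"
  by (rule mult_op_L1(1)[OF fourier_symbolD(2,3)[OF assms(1)] assms(2)])

lemma fourier_symbol_mult_inv_fourier_integrable:
  assumes b: "fourier_symbol b" and h: "integrable lborel h"
  shows "integrable lborel (\<lambda>u. b u * inv_fourier h u)"
proof -
  have "inv_fourier (mult_op b h) = (\<lambda>u. b u * inv_fourier h u)" using inv_fourier_mult_op[OF assms] by auto
  obtain R where c: "continuous_on UNIV b" and R: "\<forall>u. R \<le> \<bar>u\<bar> \<longrightarrow> b u = 0"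
    using b by (auto simp: fourier_symbol_def)
  have "continuous_on UNIV (\<lambda>u. b u * inv_fourier h u)"
    by (intro continuous_intros c inv_fourier_continuous h)
  moreover have "b x * inv_fourier h x = 0" if "x \<notin> {- R..R}" for x
    using bounded_support_Icc[OF R that] by simp
  ultimately show ?thesis by (rule continuous_compact_support_integrable)
qed

lemma mult_op_sum:
  assumes b: "\<And>i. i \<in> I \<Longrightarrow> fourier_symbol (b i)" and h: "integrable lborel h"
  shows "mult_op (\<lambda>u. \<Sum>i\<in>I. b i u) h x = (\<Sum>i\<in>I. mult_op (b i) h x)"
proof -
  have "integrable lborel (\<lambda>u. iexp (x * u) * (b i u * inv_fourier h u))" if "i \<in> I" for i
    by (intro integrable_iexp_mult fourier_symbol_mult_inv_fourier_integrable b that h)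
  from Bochner_Integration.integral_sum[of I lborel "\<lambda>i u. iexp (x * u) * (b i u * inv_fourier h u)", OF this]
  show ?thesis by (simp add: mult_op_def fourier_def sum_distrib_right sum_distrib_left)
qed

lemma smooth_symbol:
  assumes "smooth \<rho>" "compact (fsupport \<rho>)"
  shows "(\<lambda>u. complex_of_real (\<rho> u)) \<in> schwartz" "fourier_symbol (\<lambda>u. complex_of_real (\<rho> u))"
proof -
  obtain R where R: "\<And>x. R \<le> \<bar>x\<bar> \<Longrightarrow> \<rho> x = 0"
    using compact_fsupportD[OF assms(2)] by metis
  show s: "(\<lambda>u. complex_of_real (\<rho> u)) \<in> schwartz"
    using R by (intro schwartz_compact_support[of _ R] smooth_of_real assms) auto
  show "fourier_symbol (\<lambda>u. complex_of_real (\<rho> u))"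
    unfolding fourier_symbol_def
    using R schwartz_inv_fourier_integrable[OF s] smooth_continuous_on[OF schwartz_smooth[OF s]] by auto
qed

lemma mult_op_schwartz:
  assumes "smooth \<rho>" "compact (fsupport \<rho>)" "\<phi> \<in> schwartz"
  shows "mult_op (\<lambda>u. complex_of_real (\<rho> u)) \<phi> \<in> schwartz"
proof -
  obtain R where R: "\<And>x. R \<le> \<bar>x\<bar> \<Longrightarrow> \<rho> x = 0"
    using compact_fsupportD[OF assms(2)] by metis
  have "smooth (\<lambda>u. complex_of_real (\<rho> u) * inv_fourier \<phi> u)"
    by (rule smooth_mult[OF smooth_of_real[OF assms(1)] smooth_inv_fourier[OF assms(3)]])
  then have "(\<lambda>u. complex_of_real (\<rho> u) * inv_fourier \<phi> u) \<in> schwartz"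
    by (rule schwartz_compact_support[of _ R]) (simp add: R)
  then show ?thesis unfolding mult_op_def by (rule schwartz_fourier)
qed

text \<open>Fubini; the two lemmas that follow supply the joint integrability, once from a bounded
  \<open>g\<close> and once from fast decay of kernel and test function.\<close>

lemma conv_duality:
  assumes b: "integrable lborel b" and \<phi>: "integrable lborel \<phi>"
    and i: "integrable (lborel \<Otimes>\<^sub>M lborel) (\<lambda>(x, y). inv_fourier b (x - y) * g y * \<phi> x)"
  shows "integrable lborel (\<lambda>x. conv (inv_fourier b) g x * \<phi> x)"
    "(CLINT x|lborel. conv (inv_fourier b) g x * \<phi> x) = (CLINT y|lborel. g y * mult_op b \<phi> y)"
proof -
  have 1: "(CLINT y|lborel. inv_fourier b (x - y) * g y * \<phi> x) = conv (inv_fourier b) g x * \<phi> x" for x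
    by (simp add: conv_def)
  have 2: "(CLINT x|lborel. inv_fourier b (x - y) * g y * \<phi> x) = g y * mult_op b \<phi> y" for y
  proof -
    have "(CLINT x|lborel. inv_fourier b (x - y) * g y * \<phi> x) = (CLINT x|lborel. g y * (inv_fourier b (x - y) * \<phi> x))"
      by (simp add: mult_ac)
    then show ?thesis by (simp add: mult_op_eq_convolution[OF b \<phi>])
  qed
  show "integrable lborel (\<lambda>x. conv (inv_fourier b) g x * \<phi> x)"
    using lborel_pair.integrable_fst[OF i] unfolding 1 .
  show "(CLINT x|lborel. conv (inv_fourier b) g x * \<phi> x) = (CLINT y|lborel. g y * mult_op b \<phi> y)"
    using lborel_pair.Fubini_integral[OF i] unfolding 1 2 by simp
qed

lemma conv_duality_bounded:
  assumes b: "fourier_symbol b" and \<phi>: "integrable lborel \<phi>"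
    and g[measurable]: "g \<in> borel_measurable borel" and B: "\<And>x. norm (g x) \<le> B"
  shows "integrable lborel (\<lambda>x. conv (inv_fourier b) g x * \<phi> x)"
    "(CLINT x|lborel. conv (inv_fourier b) g x * \<phi> x) = (CLINT y|lborel. g y * mult_op b \<phi> y)"
proof -
  have [measurable]: "inv_fourier b \<in> borel_measurable borel" "\<phi> \<in> borel_measurable borel"
    using \<phi> fourier_symbolD(3)[OF b] by auto
  have "integrable (lborel \<Otimes>\<^sub>M lborel) (\<lambda>(x, y). inv_fourier b (x - y) * g y * \<phi> x)"
  proof (rule Bochner_Integration.integrable_bound)
    show "integrable (lborel \<Otimes>\<^sub>M lborel) (\<lambda>z. B *\<^sub>R (case z of (x, y) \<Rightarrow> inv_fourier b (x - y) * \<phi> x))"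
      by (intro integrable_scaleR_right integrable_convolution_kernel fourier_symbolD(3) b \<phi>)
    show "AE z in lborel \<Otimes>\<^sub>M lborel. norm (case z of (x, y) \<Rightarrow> inv_fourier b (x - y) * g y * \<phi> x)
        \<le> norm (B *\<^sub>R (case z of (x, y) \<Rightarrow> inv_fourier b (x - y) * \<phi> x))"
    proof (rule AE_I2, clarify)
      fix x y
      have "norm (g y) * (norm (inv_fourier b (x - y)) * norm (\<phi> x)) \<le> \<bar>B\<bar> * (norm (inv_fourier b (x - y)) * norm (\<phi> x))"
        using order_trans[OF B abs_ge_self] by (intro mult_right_mono) auto
      then show "norm (inv_fourier b (x - y) * g y * \<phi> x) \<le> norm (B *\<^sub>R (inv_fourier b (x - y) * \<phi> x))"
        by (simp add: norm_mult mult_ac)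
    qed
  qed measurable
  note * = conv_duality[OF fourier_symbolD(2)[OF b] \<phi> this]
  show "integrable lborel (\<lambda>x. conv (inv_fourier b) g x * \<phi> x)"
    "(CLINT x|lborel. conv (inv_fourier b) g x * \<phi> x) = (CLINT y|lborel. g y * mult_op b \<phi> y)"
    by (rule *)+
qed

text \<open>An L^p representative of a block is a priori unbounded and only known to be integrable
  against 1 / (1 + x^2); the kernel and the test function have to absorb that weight.\<close>

lemma conv_duality_schwartz:
  assumes b: "b \<in> schwartz" and \<phi>: "\<phi> \<in> schwartz"
    and g[measurable]: "g \<in> borel_measurable borel" and gi: "integrable lborel (\<lambda>x. norm (g x) / (1 + x\<^sup>2))"
  shows "integrable lborel (\<lambda>x. conv (inv_fourier b) g x * \<phi> x)"
    "(CLINT x|lborel. conv (inv_fourier b) g x * \<phi> x) = (CLINT y|lborel. g y * mult_op b \<phi> y)"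
proof -
  have [measurable]: "inv_fourier b \<in> borel_measurable borel" "\<phi> \<in> borel_measurable borel"
    using \<phi> b schwartz_inv_fourier_integrable schwartz_measurable by auto
  have pos: "0 < 1 + x\<^sup>2" for x :: real by (simp add: add_pos_nonneg)
  obtain B where B: "\<And>x. norm (inv_fourier b x) * (1 + x\<^sup>2) \<le> B"
  proof -
    have s: "fourier b \<in> schwartz" by (rule schwartz_fourier[OF b])
    obtain B0 where B0: "\<And>x. norm (x ^ 0 *\<^sub>R (vderiv ^^ 0) (fourier b) x) \<le> B0" using schwartz_bound[OF s] by metis
    obtain B2 where B2: "\<And>x. norm (x ^ 2 *\<^sub>R (vderiv ^^ 0) (fourier b) x) \<le> B2" using schwartz_bound[OF s] by metis
    have "norm (inv_fourier b x) * (1 + x\<^sup>2) \<le> (B0 + B2) / (2 * pi)" for x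
    proof -
      have "norm (inv_fourier b x) * (1 + x\<^sup>2) = (norm (fourier b (- x)) + x\<^sup>2 * norm (fourier b (- x))) / (2 * pi)"
        by (simp add: inv_fourier_eq norm_divide algebra_simps add_divide_distrib)
      also have "\<dots> \<le> (B0 + B2) / (2 * pi)"
        using B0[of "-x"] B2[of "-x"] by (intro divide_right_mono add_mono) auto
      finally show ?thesis .
    qed
    then show ?thesis by (rule that)
  qed
  \<comment> \<open>Two factors 1 + x^2: one is spent on moving the weight from y to x, the other
    leaves integrability in x.\<close>
  obtain A where A: "\<And>x. norm (\<phi> x) * (1 + x\<^sup>2) * (1 + x\<^sup>2) \<le> A"
  proof -
    obtain A0 where A0: "\<And>x. norm (x ^ 0 *\<^sub>R (vderiv ^^ 0) \<phi> x) \<le> A0" using schwartz_bound[OF \<phi>] by metis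
    obtain A2 where A2: "\<And>x. norm (x ^ 2 *\<^sub>R (vderiv ^^ 0) \<phi> x) \<le> A2" using schwartz_bound[OF \<phi>] by metis
    obtain A4 where A4: "\<And>x. norm (x ^ 4 *\<^sub>R (vderiv ^^ 0) \<phi> x) \<le> A4" using schwartz_bound[OF \<phi>] by metis
    have "norm (\<phi> x) * (1 + x\<^sup>2) * (1 + x\<^sup>2) \<le> A0 + 2 * A2 + A4" for x
    proof -
      have "norm (\<phi> x) * (1 + x\<^sup>2) * (1 + x\<^sup>2) = norm (\<phi> x) + 2 * (x\<^sup>2 * norm (\<phi> x)) + x ^ 4 * norm (\<phi> x)"
        by (simp add: algebra_simps power2_eq_square power4_eq_xxxx)
      then show ?thesis using A0[of x] A2[of x] A4[of x] by (simp add: abs_mult power_abs)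
    qed
    then show ?thesis by (rule that)
  qed
  have "norm (\<phi> 0) \<le> A" using A[of 0] by simp
  then have "0 \<le> A" by (rule order_trans[OF norm_ge_zero])
  have "norm (inv_fourier b 0) \<le> B" using B[of 0] by simp
  then have "0 \<le> B" by (rule order_trans[OF norm_ge_zero])
  have le: "norm (inv_fourier b (x - y)) * norm (\<phi> x) \<le> 2 * A * B * inverse (1 + x\<^sup>2) / (1 + y\<^sup>2)" for x y
  proof -
    let ?K = "norm (inv_fourier b (x - y))" and ?p = "norm (\<phi> x)"
    \<comment> \<open>Peetre's inequality: a weight at y is split between x - y, paid by the kernel,
      and x, paid by the test function.\<close>
    have "1 + y\<^sup>2 \<le> 2 * ((1 + (x - y)\<^sup>2) * (1 + x\<^sup>2))"
    proof -
      have "0 \<le> (2 * x - y)\<^sup>2 + 1 + 2 * ((x - y) * x)\<^sup>2" by simp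
      then show ?thesis by (simp add: power2_eq_square algebra_simps)
    qed
    then have "?K * ?p * (1 + x\<^sup>2) * (1 + y\<^sup>2) \<le> ?K * ?p * (1 + x\<^sup>2) * (2 * ((1 + (x - y)\<^sup>2) * (1 + x\<^sup>2)))"
      by (intro mult_left_mono) auto
    also have "\<dots> = 2 * (?K * (1 + (x - y)\<^sup>2)) * (?p * (1 + x\<^sup>2) * (1 + x\<^sup>2))" by (simp add: mult_ac)
    also have "\<dots> \<le> 2 * B * A"
      using A[of x] B[of "x - y"] \<open>0 \<le> B\<close> by (intro mult_mono) auto
    finally have "?K * ?p * (1 + x\<^sup>2) * (1 + y\<^sup>2) \<le> 2 * A * B" by (simp add: mult_ac)
    moreover have "t \<le> M * inverse a / c" if "t * a * c \<le> M" "0 < a" "0 < c" for t a c M :: real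
      using that by (simp add: field_simps)
    ultimately show ?thesis using pos by blast
  qed
  have "integrable (lborel \<Otimes>\<^sub>M lborel) (\<lambda>(x, y). inv_fourier b (x - y) * g y * \<phi> x)"
  proof (rule Bochner_Integration.integrable_bound)
    show "integrable (lborel \<Otimes>\<^sub>M lborel) (\<lambda>(x, y). (2 * A * B * inverse (1 + x\<^sup>2)) * (norm (g y) / (1 + y\<^sup>2)))"
      by (intro lborel_pair.integrable_product_mult integrable_mult_right integrable_inverse_1_plus_square_UNIV gi)
    show "AE z in lborel \<Otimes>\<^sub>M lborel. norm (case z of (x, y) \<Rightarrow> inv_fourier b (x - y) * g y * \<phi> x)
        \<le> norm (case z of (x, y) \<Rightarrow> (2 * A * B * inverse (1 + x\<^sup>2)) * (norm (g y) / (1 + y\<^sup>2)))"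
    proof (rule AE_I2, clarify)
      fix x y
      have "norm (g y) * (norm (inv_fourier b (x - y)) * norm (\<phi> x)) \<le> norm (g y) * (2 * A * B * inverse (1 + x\<^sup>2) / (1 + y\<^sup>2))"
        by (intro mult_left_mono le) auto
      also have "\<dots> = 2 * A * B * inverse (1 + x\<^sup>2) * (norm (g y) / (1 + y\<^sup>2))" by simp
      also have "\<dots> \<le> norm (2 * A * B * inverse (1 + x\<^sup>2) * (norm (g y) / (1 + y\<^sup>2)))"
        unfolding real_norm_def by (rule abs_ge_self)
      finally show "norm (inv_fourier b (x - y) * g y * \<phi> x) \<le> norm (2 * A * B * inverse (1 + x\<^sup>2) * (norm (g y) / (1 + y\<^sup>2)))"
        by (simp add: norm_mult mult_ac)
    qed
  qed measurable
  note * = conv_duality[OF schwartz_integrable[OF b] schwartz_integrable[OF \<phi>] this]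
  show "integrable lborel (\<lambda>x. conv (inv_fourier b) g x * \<phi> x)"
    "(CLINT x|lborel. conv (inv_fourier b) g x * \<phi> x) = (CLINT y|lborel. g y * mult_op b \<phi> y)"
    by (rule *)+
qed

lemma conv_measurable:
  assumes "K \<in> borel_measurable borel" "g \<in> borel_measurable borel"
  shows "conv K g \<in> borel_measurable borel"
proof -
  note assms[measurable]
  have "(\<lambda>x. CLINT y|lborel. K (x - y) * g y) \<in> borel_measurable borel" by measurable
  then show ?thesis by (simp add: conv_def[abs_def])
qed

text \<open>Makes the arbitrary choice in \<open>fun_of\<close> harmless.\<close>

lemma conv_cong_AE:
  assumes "AE x in lborel. g x = g' x" "K \<in> borel_measurable borel" "g \<in> borel_measurable borel" "g' \<in> borel_measurable borel"
  shows "conv K g = conv K g'"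
proof
  fix x
  note assms(2-4)[measurable]
  show "conv K g x = conv K g' x"
    unfolding conv_def using assms(1) by (intro integral_cong_AE) (auto elim!: eventually_mono)
qed

section \<open>Lebesgue norms\<close>

lemma epowr_ennreal: "0 \<le> a \<Longrightarrow> epowr (ennreal a) r = ennreal (a powr r)"
  by (simp add: epowr_def)

lemma epowr_mono: "a \<le> b \<Longrightarrow> 0 \<le> r \<Longrightarrow> epowr a r \<le> epowr b r"
  by (cases a; cases b) (auto simp: epowr_def top_unique intro!: ennreal_leI powr_mono2)

lemma epowr_inverse: "0 < r \<Longrightarrow> epowr (epowr a r) (1 / r) = a"
  by (cases a) (auto simp: epowr_def powr_powr)

lemma epowr_cmult: "0 \<le> c \<Longrightarrow> epowr (ennreal c * a) r = epowr (ennreal c) r * epowr a r"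
proof (cases a)
  case (real x)
  then show "0 \<le> c \<Longrightarrow> ?thesis"
    by (simp add: ennreal_mult[symmetric] epowr_ennreal powr_mult)
next
  case top
  then show "0 \<le> c \<Longrightarrow> ?thesis"
    by (cases "c = 0") (auto simp: epowr_def ennreal_mult_top)
qed

lemma epowr_measurable[measurable]:
  assumes "f \<in> borel_measurable M" shows "(\<lambda>x. epowr (f x) r) \<in> borel_measurable M"
  using assms unfolding epowr_def by measurable

lemma real_exponent:
  assumes "1 \<le> p" "p \<noteq> (\<infinity>::ennreal)"
  shows "1 \<le> enn2real p"
  using assms by (cases p) (auto simp: ennreal_1[symmetric] ennreal_le_iff simp del: ennreal_1)

lemma Lp_norm_mono_cmult_AE:
  fixes f g :: "'a \<Rightarrow> ennreal"
  assumes p: "1 \<le> p" and C: "0 \<le> C" and [measurable]: "f \<in> borel_measurable M" "g \<in> borel_measurable M"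
    and le: "AE x in M. f x \<le> ennreal C * g x"
  shows "Lp_norm p M f \<le> ennreal C * Lp_norm p M g"
proof (cases "p = \<infinity>")
  case True
  have "AE x in M. g x \<le> esssup M g" by (rule esssup_AE)
  then have "AE x in M. f x \<le> ennreal C * esssup M g"
    using le by eventually_elim (metis mult_left_mono order_trans zero_le)
  then show ?thesis using True by (simp add: Lp_norm_def esssup_I)
next
  case False
  define r where "r = enn2real p"
  have r: "1 \<le> r" unfolding r_def using real_exponent p False by blast
  have "(\<integral>\<^sup>+x. epowr (f x) r \<partial>M) \<le> (\<integral>\<^sup>+x. epowr (ennreal C) r * epowr (g x) r \<partial>M)"
    by (rule nn_integral_mono_AE)
       (use le in \<open>eventually_elim, use r C in \<open>auto simp: epowr_cmult[symmetric] intro!: epowr_mono\<close>\<close>)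
  also have "\<dots> = ennreal (C powr r) * (\<integral>\<^sup>+x. epowr (g x) r \<partial>M)"
    using C by (simp add: nn_integral_cmult epowr_ennreal)
  finally have "epowr (\<integral>\<^sup>+x. epowr (f x) r \<partial>M) (1 / r) \<le> epowr (ennreal (C powr r) * (\<integral>\<^sup>+x. epowr (g x) r \<partial>M)) (1 / r)"
    using r by (intro epowr_mono) auto
  also have "\<dots> = ennreal C * epowr (\<integral>\<^sup>+x. epowr (g x) r \<partial>M) (1 / r)"
    using r C by (simp add: epowr_cmult epowr_ennreal powr_powr)
  finally show ?thesis using False by (simp add: Lp_norm_def r_def)
qed

lemma Lp_norm_cong_AE:
  fixes f g :: "'a \<Rightarrow> ennreal"
  assumes "1 \<le> p" "f \<in> borel_measurable M" "g \<in> borel_measurable M" "AE x in M. f x = g x"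
  shows "Lp_norm p M f = Lp_norm p M g"
proof (rule antisym)
  have "AE x in M. f x \<le> ennreal 1 * g x" "AE x in M. g x \<le> ennreal 1 * f x"
    using assms(4) by (eventually_elim, simp)+
  then show "Lp_norm p M f \<le> Lp_norm p M g" "Lp_norm p M g \<le> Lp_norm p M f"
    using Lp_norm_mono_cmult_AE[OF assms(1), of 1 f M g] Lp_norm_mono_cmult_AE[OF assms(1), of 1 g M f]
      assms(2,3) by simp_all
qed

text \<open>Every index is an atom of mass 1, so the integral of the powers contains the power of
  the single term.\<close>

lemma le_Lp_norm_count_space:
  fixes g :: "'a \<Rightarrow> ennreal"
  assumes "1 \<le> q"
  shows "g j \<le> Lp_norm q (count_space UNIV) g"
proof (cases "q = \<infinity>")
  case True
  have "AE x in count_space UNIV. g x \<le> esssup (count_space UNIV) g" by (rule esssup_AE)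
  then show ?thesis using True by (simp add: Lp_norm_def AE_count_space)
next
  case False
  define r where "r = enn2real q"
  have r: "1 \<le> r" unfolding r_def using real_exponent assms False by blast
  have "epowr (g j) r = (\<integral>\<^sup>+x. epowr (g j) r * indicator {j} x \<partial>count_space UNIV)"
    by (simp add: nn_integral_cmult_indicator)
  also have "\<dots> \<le> (\<integral>\<^sup>+x. epowr (g x) r \<partial>count_space UNIV)"
    by (rule nn_integral_mono) (auto simp: indicator_def)
  finally have "epowr (epowr (g j) r) (1 / r) \<le> epowr (\<integral>\<^sup>+x. epowr (g x) r \<partial>count_space UNIV) (1 / r)"
    using r by (intro epowr_mono) auto
  then show ?thesis using False r by (simp add: Lp_norm_def r_def epowr_inverse)
qed

text \<open>Representatives agree almost everywhere, so the infimum is over a single value.\<close>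

lemma dist_Lp_norm_eq:
  assumes "represents g T" "1 \<le> p"
  shows "dist_Lp_norm p T = Lp_norm p lborel (\<lambda>x. ennreal (cmod (g x)))"
proof -
  have *: "Lp_norm p lborel (\<lambda>x. ennreal (cmod (g' x))) = Lp_norm p lborel (\<lambda>x. ennreal (cmod (g x)))"
    if "represents g' T" for g'
  proof (rule Lp_norm_cong_AE[OF assms(2)])
    show "(\<lambda>x. ennreal (cmod (g' x))) \<in> borel_measurable lborel" "(\<lambda>x. ennreal (cmod (g x))) \<in> borel_measurable lborel"
      using that assms(1) by (auto simp: represents_def)
    show "AE x in lborel. ennreal (cmod (g' x)) = ennreal (cmod (g x))"
      using represents_unique[OF that assms(1)] by eventually_elim simp
  qed
  then have "{Lp_norm p lborel (\<lambda>x. ennreal (cmod (g x))) |g. represents g T} = {Lp_norm p lborel (\<lambda>x. ennreal (cmod (g x)))}"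
    (is "?A = {?c}")
  proof (intro equalityI subsetI)
    fix y assume "y \<in> ?A"
    then obtain g' where "represents g' T" "y = Lp_norm p lborel (\<lambda>x. ennreal (cmod (g' x)))" by blast
    with * show "y \<in> {?c}" by (simp only: singleton_iff)
  qed (use assms(1) in blast)
  then show ?thesis unfolding dist_Lp_norm_def by (simp only: cInf_singleton)
qed

text \<open>The infimum over an empty set of representatives is infinite.\<close>

lemma represents_of_finite_norm:
  assumes "dist_Lp_norm p T < \<infinity>"
  obtains g where "represents g T"
proof -
  have "{Lp_norm p lborel (\<lambda>x. ennreal (cmod (g x))) |g. represents g T} \<noteq> {}"
  proof
    assume "{Lp_norm p lborel (\<lambda>x. ennreal (cmod (g x))) |g. represents g T} = {}"
    then have "dist_Lp_norm p T = \<infinity>" by (simp only: dist_Lp_norm_def Inf_empty infinity_ennreal_def)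
    then show False using assms by simp
  qed
  then show ?thesis using that by blast
qed

text \<open>A convex power lies above its tangent at \<open>c\<close>. Scaling to c = 1 leaves
  Bernoulli's inequality, obtained here from ln x \<le> x - 1 and 1 + x \<le> exp x.\<close>

lemma powr_tangent:
  fixes t c p :: real
  assumes "0 \<le> t" "0 < c" "1 \<le> p"
  shows "p * c powr (p - 1) * t \<le> t powr p + (p - 1) * c powr p"
proof (cases "t = 0")
  case True
  then show ?thesis using assms by simp
next
  case False
  define s where "s = t / c"
  have s: "0 < s" "t = s * c" using False assms by (auto simp: s_def)
  have "ln (1 / s) \<le> 1 / s - 1" using s by (intro ln_le_minus_one) auto
  then have l: "1 - 1 / s \<le> ln s" using s by (simp add: ln_div)
  have "1 + (p - 1) * (1 - 1 / s) \<le> 1 + (p - 1) * ln s"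
    using l assms by (intro add_left_mono mult_left_mono) auto
  also have "\<dots> \<le> exp ((p - 1) * ln s)" by (rule exp_ge_add_one_self)
  also have "\<dots> = s powr (p - 1)" using s by (simp add: powr_def)
  finally have "s * (1 + (p - 1) * (1 - 1 / s)) \<le> s * s powr (p - 1)"
    using s by (intro mult_left_mono) auto
  also have "s * s powr (p - 1) = s powr p" using s by (simp add: powr_mult_base)
  also have "s * (1 + (p - 1) * (1 - 1 / s)) = p * s - (p - 1)" using s by (simp add: field_simps)
  finally have "p * s \<le> s powr p + (p - 1)" by simp
  then have "c powr p * (p * s) \<le> c powr p * (s powr p + (p - 1))" by (intro mult_left_mono) auto
  moreover have "c powr p = c * c powr (p - 1)" using assms by (simp add: powr_mult_base)
  moreover have "t powr p = s powr p * c powr p" using s assms by (simp add: powr_mult)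
  ultimately show ?thesis using s(2) by (simp add: algebra_simps)
qed

text \<open>Jensen's inequality for a weight of mass at most \<open>B\<close>, obtained by
  integrating the tangent inequality at an arbitrary point \<open>c\<close> and then choosing the
  best \<open>c\<close>.\<close>

lemma weighted_power_mean:
  fixes w f :: "'a \<Rightarrow> ennreal"
  assumes [measurable]: "w \<in> borel_measurable M" "f \<in> borel_measurable M"
    and W: "(\<integral>\<^sup>+x. w x \<partial>M) \<le> ennreal B" and B: "0 < B" and p: "1 \<le> p"
  shows "epowr (\<integral>\<^sup>+x. w x * f x \<partial>M) p \<le> ennreal (B powr (p - 1)) * (\<integral>\<^sup>+x. w x * epowr (f x) p \<partial>M)"
proof -
  define I where "I = (\<integral>\<^sup>+x. w x * f x \<partial>M)"
  define J where "J = (\<integral>\<^sup>+x. w x * epowr (f x) p \<partial>M)"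
  have main: "ennreal (p * c powr (p - 1)) * I \<le> J + ennreal ((p - 1) * c powr p * B)" if c: "0 < c" for c
  proof -
    have pt: "ennreal (p * c powr (p - 1)) * f x \<le> epowr (f x) p + ennreal ((p - 1) * c powr p)" for x
    proof (cases "f x")
      case (real t)
      then show ?thesis
        using powr_tangent[OF real(1) c p] p c
        by (simp add: epowr_ennreal ennreal_mult[symmetric] ennreal_plus[symmetric] del: ennreal_plus)
    next
      case top
      then show ?thesis by (simp add: epowr_def)
    qed
    have "ennreal (p * c powr (p - 1)) * I = (\<integral>\<^sup>+x. w x * (ennreal (p * c powr (p - 1)) * f x) \<partial>M)"
      unfolding I_def by (subst nn_integral_cmult[symmetric]) (auto simp: mult_ac)
    also have "\<dots> \<le> (\<integral>\<^sup>+x. w x * epowr (f x) p + w x * ennreal ((p - 1) * c powr p) \<partial>M)"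
      unfolding distrib_left[symmetric] by (intro nn_integral_mono mult_left_mono pt) auto
    also have "\<dots> = J + (\<integral>\<^sup>+x. w x \<partial>M) * ennreal ((p - 1) * c powr p)"
      unfolding J_def by (subst nn_integral_add) (auto simp: nn_integral_multc)
    also have "\<dots> \<le> J + ennreal B * ennreal ((p - 1) * c powr p)"
      by (intro add_left_mono mult_right_mono W) auto
    also have "\<dots> = J + ennreal ((p - 1) * c powr p * B)"
      using B p by (simp add: ennreal_mult'[symmetric] mult.commute)
    finally show ?thesis .
  qed
  show ?thesis unfolding I_def[symmetric] J_def[symmetric]
  proof (cases J)
    case top
    then show "epowr I p \<le> ennreal (B powr (p - 1)) * J"
      using B by (simp add: ennreal_mult_top)
  next
    case (real j)
    \<comment> \<open>The tangent at 1 already shows that \<open>I\<close> is finite when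
      \<open>J\<close> is.\<close>
    have "ennreal p * I < \<infinity>"
      using main[of 1] real by (simp add: order.strict_trans1 ennreal_plus[symmetric] del: ennreal_plus)
    then have "I \<noteq> \<infinity>" using p by (auto simp: ennreal_mult_top)
    then obtain i where i: "0 \<le> i" "I = ennreal i" by (cases I) auto
    show "epowr I p \<le> ennreal (B powr (p - 1)) * J"
    proof (cases "i = 0")
      case True
      then show ?thesis using i by (simp add: epowr_def)
    next
      case False
      then have ip: "0 < i" using i by simp
      \<comment> \<open>The optimal tangent point is the mean of \<open>f\<close> with respect to a
        weight of mass \<open>B\<close>.\<close>
      define c where "c = i / B"
      have c: "0 < c" "i = c * B" using ip B by (auto simp: c_def)
      have "ennreal (p * c powr (p - 1) * i) \<le> ennreal (j + (p - 1) * c powr p * B)"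
        using main[OF c(1)] real i p c B
        by (simp add: ennreal_mult[symmetric] ennreal_plus[symmetric] del: ennreal_plus)
      then have "p * c powr (p - 1) * i \<le> j + (p - 1) * c powr p * B"
        using real p c B by (subst (asm) ennreal_le_iff) auto
      moreover have "c powr p = c * c powr (p - 1)" using c by (simp add: powr_mult_base)
      ultimately have "c powr (p - 1) * i \<le> j" using c(2) by (simp add: algebra_simps)
      then have "B powr (p - 1) * (c powr (p - 1) * i) \<le> B powr (p - 1) * j" by (intro mult_left_mono) auto
      moreover have "B powr (p - 1) * (c powr (p - 1) * i) = i powr p"
        using B ip by (simp add: c_def powr_divide powr_mult_base mult.commute)
      ultimately have "i powr p \<le> B powr (p - 1) * j" by simp
      then show ?thesis using i real by (simp add: epowr_ennreal ennreal_mult[symmetric] ennreal_leI)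
    qed
  qed
qed

lemma norm_conv_le_nn_integral:
  assumes [measurable]: "K \<in> borel_measurable borel" "g \<in> borel_measurable borel"
  shows "ennreal (cmod (conv K g x)) \<le> (\<integral>\<^sup>+y. ennreal (cmod (K (x - y))) * ennreal (cmod (g y)) \<partial>lborel)"
proof (cases "integrable lborel (\<lambda>y. K (x - y) * g y)")
  case True
  from integral_norm_bound_ennreal[OF this] show ?thesis
    by (simp add: conv_def norm_mult ennreal_mult)
next
  \<comment> \<open>The integral of a non-integrable function is 0, so the bound is trivial.\<close>
  case False
  then show ?thesis by (simp add: conv_def not_integrable_integral_eq)
qed

lemma nn_integral_reflect:
  fixes f :: "real \<Rightarrow> ennreal"
  assumes [measurable]: "f \<in> borel_measurable borel"
  shows "(\<integral>\<^sup>+y. f (x - y) \<partial>lborel) = (\<integral>\<^sup>+y. f y \<partial>lborel)"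
  using nn_integral_real_affine[of f "-1" x] by simp

lemma nn_integral_shift:
  fixes f :: "real \<Rightarrow> ennreal"
  assumes [measurable]: "f \<in> borel_measurable borel"
  shows "(\<integral>\<^sup>+x. f (x - y) \<partial>lborel) = (\<integral>\<^sup>+x. f x \<partial>lborel)"
  using nn_integral_real_affine[of f 1 "- y"] by simp

text \<open>Young's inequality with an L1 kernel: Jensen with weight |K(x - y)| gives the factor
  B^(r - 1), Fubini the remaining B, and the r-th root restores B.\<close>

lemma conv_Lp_norm_le:
  assumes K: "integrable lborel K" "(LINT x|lborel. cmod (K x)) \<le> B" and B: "0 < B"
    and [measurable]: "g \<in> borel_measurable borel" and p: "1 \<le> p"
  shows "Lp_norm p lborel (\<lambda>x. ennreal (cmod (conv K g x))) \<le> ennreal B * Lp_norm p lborel (\<lambda>x. ennreal (cmod (g x)))"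
proof -
  have Km[measurable]: "K \<in> borel_measurable borel" using K by simp
  note conv_measurable[OF Km, of g, measurable]
  have KB: "(\<integral>\<^sup>+y. ennreal (cmod (K (x - y))) \<partial>lborel) \<le> ennreal B" "(\<integral>\<^sup>+x. ennreal (cmod (K (x - y))) \<partial>lborel) \<le> ennreal B" for x y
    using nn_integral_reflect[of "\<lambda>y. ennreal (cmod (K y))" x] nn_integral_shift[of "\<lambda>y. ennreal (cmod (K y))" y]
      nn_integral_eq_integral[OF integrable_norm[OF K(1)]] K(2) by (auto intro: ennreal_leI)
  show ?thesis
  proof (cases "p = \<infinity>")
    case True
    let ?E = "esssup lborel (\<lambda>x. ennreal (cmod (g x)))"
    have ae: "AE y in lborel. ennreal (cmod (g y)) \<le> ?E" by (rule esssup_AE)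
    have "ennreal (cmod (conv K g x)) \<le> ennreal B * ?E" for x
    proof -
      have "ennreal (cmod (conv K g x)) \<le> (\<integral>\<^sup>+y. ennreal (cmod (K (x - y))) * ennreal (cmod (g y)) \<partial>lborel)"
        by (rule norm_conv_le_nn_integral) auto
      also have "\<dots> \<le> (\<integral>\<^sup>+y. ennreal (cmod (K (x - y))) * ?E \<partial>lborel)"
        by (rule nn_integral_mono_AE) (use ae in \<open>eventually_elim, auto intro: mult_left_mono\<close>)
      also have "\<dots> = (\<integral>\<^sup>+y. ennreal (cmod (K (x - y))) \<partial>lborel) * ?E" by (rule nn_integral_multc) simp
      also have "\<dots> \<le> ennreal B * ?E" by (intro mult_right_mono KB) auto
      finally show ?thesis .
    qed
    then show ?thesis using True by (simp add: Lp_norm_def esssup_I)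
  next
    case False
    define r where "r = enn2real p"
    have r: "1 \<le> r" unfolding r_def using real_exponent p False by blast
    let ?G = "\<lambda>y. epowr (ennreal (cmod (g y))) r"
    have "(\<integral>\<^sup>+x. epowr (ennreal (cmod (conv K g x))) r \<partial>lborel)
      \<le> (\<integral>\<^sup>+x. ennreal (B powr (r - 1)) * (\<integral>\<^sup>+y. ennreal (cmod (K (x - y))) * ?G y \<partial>lborel) \<partial>lborel)"
    proof (rule nn_integral_mono)
      fix x
      have "epowr (ennreal (cmod (conv K g x))) r \<le> epowr (\<integral>\<^sup>+y. ennreal (cmod (K (x - y))) * ennreal (cmod (g y)) \<partial>lborel) r"
        using r by (intro epowr_mono norm_conv_le_nn_integral) auto
      also have "\<dots> \<le> ennreal (B powr (r - 1)) * (\<integral>\<^sup>+y. ennreal (cmod (K (x - y))) * ?G y \<partial>lborel)"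
        by (rule weighted_power_mean) (use KB B r in auto)
      finally show "epowr (ennreal (cmod (conv K g x))) r \<le> ennreal (B powr (r - 1)) * (\<integral>\<^sup>+y. ennreal (cmod (K (x - y))) * ?G y \<partial>lborel)" .
    qed
    also have "\<dots> = ennreal (B powr (r - 1)) * (\<integral>\<^sup>+x. \<integral>\<^sup>+y. ennreal (cmod (K (x - y))) * ?G y \<partial>lborel \<partial>lborel)"
      by (rule nn_integral_cmult) measurable
    also have "(\<integral>\<^sup>+x. \<integral>\<^sup>+y. ennreal (cmod (K (x - y))) * ?G y \<partial>lborel \<partial>lborel)
      = (\<integral>\<^sup>+y. \<integral>\<^sup>+x. ennreal (cmod (K (x - y))) * ?G y \<partial>lborel \<partial>lborel)"
      by (rule lborel_pair.Fubini'[symmetric]) measurable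
    also have "\<dots> = (\<integral>\<^sup>+y. (\<integral>\<^sup>+x. ennreal (cmod (K (x - y))) \<partial>lborel) * ?G y \<partial>lborel)"
      by (intro nn_integral_cong nn_integral_multc) auto
    also have "\<dots> \<le> (\<integral>\<^sup>+y. ennreal B * ?G y \<partial>lborel)"
      by (intro nn_integral_mono mult_right_mono KB) auto
    also have "\<dots> = ennreal B * (\<integral>\<^sup>+y. ?G y \<partial>lborel)" by (rule nn_integral_cmult) simp
    finally have "(\<integral>\<^sup>+x. epowr (ennreal (cmod (conv K g x))) r \<partial>lborel) \<le> ennreal (B powr (r - 1)) * (ennreal B * (\<integral>\<^sup>+y. ?G y \<partial>lborel))"
      by (simp add: mult_left_mono)
    also have "\<dots> = ennreal (B powr r) * (\<integral>\<^sup>+y. ?G y \<partial>lborel)"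
      using B by (simp add: mult.assoc[symmetric] ennreal_mult[symmetric] powr_mult_base mult.commute)
    finally have "epowr (\<integral>\<^sup>+x. epowr (ennreal (cmod (conv K g x))) r \<partial>lborel) (1 / r) \<le> epowr (ennreal (B powr r) * (\<integral>\<^sup>+y. ?G y \<partial>lborel)) (1 / r)"
      using r by (intro epowr_mono) auto
    also have "\<dots> = ennreal B * epowr (\<integral>\<^sup>+y. ?G y \<partial>lborel) (1 / r)"
      using r B by (simp add: epowr_cmult epowr_ennreal powr_powr)
    finally show ?thesis using False by (simp add: Lp_norm_def r_def)
  qed
qed

text \<open>Bernstein's inequality, for a kernel that reproduces the function.\<close>

lemma conv_sup_le:
  assumes K: "integrable lborel K" "(LINT x|lborel. cmod (K x)) \<le> B" "\<And>x. cmod (K x) \<le> B" and B: "0 < B"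
    and [measurable]: "g \<in> borel_measurable borel" and p: "1 \<le> p"
  shows "ennreal (cmod (conv K g x)) \<le> ennreal B * Lp_norm p lborel (\<lambda>x. ennreal (cmod (g x)))"
proof -
  have Km[measurable]: "K \<in> borel_measurable borel" using K by simp
  have KB: "(\<integral>\<^sup>+y. ennreal (cmod (K (x - y))) \<partial>lborel) \<le> ennreal B" for x
    using nn_integral_reflect[of "\<lambda>y. ennreal (cmod (K y))" x]
      nn_integral_eq_integral[OF integrable_norm[OF K(1)]] K(2) by (auto intro: ennreal_leI)
  have le: "ennreal (cmod (conv K g x)) \<le> (\<integral>\<^sup>+y. ennreal (cmod (K (x - y))) * ennreal (cmod (g y)) \<partial>lborel)"
    by (rule norm_conv_le_nn_integral) auto
  show ?thesis
  proof (cases "p = \<infinity>")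
    case True
    let ?E = "esssup lborel (\<lambda>x. ennreal (cmod (g x)))"
    have ae: "AE y in lborel. ennreal (cmod (g y)) \<le> ?E" by (rule esssup_AE)
    note le
    also have "(\<integral>\<^sup>+y. ennreal (cmod (K (x - y))) * ennreal (cmod (g y)) \<partial>lborel) \<le> (\<integral>\<^sup>+y. ennreal (cmod (K (x - y))) * ?E \<partial>lborel)"
      by (rule nn_integral_mono_AE) (use ae in \<open>eventually_elim, auto intro: mult_left_mono\<close>)
    also have "\<dots> = (\<integral>\<^sup>+y. ennreal (cmod (K (x - y))) \<partial>lborel) * ?E" by (rule nn_integral_multc) simp
    also have "\<dots> \<le> ennreal B * ?E" by (intro mult_right_mono KB) auto
    finally show ?thesis using True by (simp add: Lp_norm_def)
  next
    case False
    define r where "r = enn2real p"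
    have r: "1 \<le> r" unfolding r_def using real_exponent p False by blast
    let ?G = "\<lambda>y. epowr (ennreal (cmod (g y))) r"
    have "epowr (ennreal (cmod (conv K g x))) r \<le> epowr (\<integral>\<^sup>+y. ennreal (cmod (K (x - y))) * ennreal (cmod (g y)) \<partial>lborel) r"
      using r by (intro epowr_mono le) auto
    also have "\<dots> \<le> ennreal (B powr (r - 1)) * (\<integral>\<^sup>+y. ennreal (cmod (K (x - y))) * ?G y \<partial>lborel)"
      by (rule weighted_power_mean) (use KB B r in auto)
    \<comment> \<open>The kernel left over by Jensen is estimated by its supremum; integrating it,
      as in Young's inequality, would bound only a norm.\<close>
    also have "\<dots> \<le> ennreal (B powr (r - 1)) * (\<integral>\<^sup>+y. ennreal B * ?G y \<partial>lborel)"
      by (intro mult_left_mono nn_integral_mono mult_right_mono ennreal_leI K) auto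
    also have "\<dots> = ennreal (B powr (r - 1)) * (ennreal B * (\<integral>\<^sup>+y. ?G y \<partial>lborel))"
      by (subst nn_integral_cmult) auto
    also have "\<dots> = ennreal (B powr r) * (\<integral>\<^sup>+y. ?G y \<partial>lborel)"
      using B by (simp add: mult.assoc[symmetric] ennreal_mult[symmetric] powr_mult_base mult.commute)
    finally have "epowr (epowr (ennreal (cmod (conv K g x))) r) (1 / r) \<le> epowr (ennreal (B powr r) * (\<integral>\<^sup>+y. ?G y \<partial>lborel)) (1 / r)"
      using r by (intro epowr_mono) auto
    also have "\<dots> = ennreal B * epowr (\<integral>\<^sup>+y. ?G y \<partial>lborel) (1 / r)"
      using r B by (simp add: epowr_cmult epowr_ennreal powr_powr)
    finally show ?thesis using False r by (simp add: Lp_norm_def r_def epowr_inverse)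
  qed
qed

text \<open>Where |g| exceeds 1 it is below |g|^r, and elsewhere the weight alone is integrable.
  This is the condition under which duality with Schwartz functions applies.\<close>

lemma Lp_finite_weight_integrable:
  assumes [measurable]: "g \<in> borel_measurable borel" and p: "1 \<le> p"
    and fin: "Lp_norm p lborel (\<lambda>x. ennreal (cmod (g x))) < \<infinity>"
  shows "integrable lborel (\<lambda>x. cmod (g x) / (1 + x\<^sup>2))"
proof (cases "p = \<infinity>")
  case True
  then obtain E where E: "0 \<le> E" "esssup lborel (\<lambda>x. ennreal (cmod (g x))) = ennreal E"
    using fin by (cases "esssup lborel (\<lambda>x. ennreal (cmod (g x)))") (auto simp: Lp_norm_def)
  have "AE x in lborel. ennreal (cmod (g x)) \<le> ennreal E" unfolding E(2)[symmetric] by (rule esssup_AE)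
  then have "AE x in lborel. cmod (g x) \<le> E" using E by (auto simp: ennreal_le_iff elim!: eventually_mono)
  then have "AE x in lborel. norm (cmod (g x) / (1 + x\<^sup>2)) \<le> norm (E * inverse (1 + x\<^sup>2))"
    using E by (auto simp: divide_inverse intro!: mult_mono elim!: eventually_mono)
  then show ?thesis
    by (intro Bochner_Integration.integrable_bound[OF integrable_mult_right[OF integrable_inverse_1_plus_square_UNIV(1), of E]]) auto
next
  case False
  define r where "r = enn2real p"
  have r: "1 \<le> r" unfolding r_def using real_exponent p False by blast
  have "(\<integral>\<^sup>+x. epowr (ennreal (cmod (g x))) r \<partial>lborel) \<noteq> \<infinity>"
    using fin False by (auto simp: Lp_norm_def r_def epowr_def)
  then have i: "integrable lborel (\<lambda>x. cmod (g x) powr r)"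
    by (intro integrableI_nonneg) (auto simp: epowr_ennreal top.not_eq_extremum)
  have le: "cmod (g x) / (1 + x\<^sup>2) \<le> cmod (g x) powr r + inverse (1 + x\<^sup>2)" for x
  proof (cases "cmod (g x) \<le> 1")
    case True
    then have "cmod (g x) / (1 + x\<^sup>2) \<le> 1 / (1 + x\<^sup>2)" by (intro divide_right_mono) auto
    then show ?thesis by (simp add: inverse_eq_divide add_increasing)
  next
    case False
    then have "cmod (g x) powr 1 \<le> cmod (g x) powr r" using r by (intro powr_mono) auto
    moreover have "cmod (g x) / (1 + x\<^sup>2) \<le> cmod (g x) / 1"
      by (intro divide_left_mono) (auto simp: add_pos_nonneg)
    ultimately have "cmod (g x) / (1 + x\<^sup>2) \<le> cmod (g x) powr r" using False by simp
    then show ?thesis by (simp add: add_increasing2)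
  qed
  show ?thesis
    by (rule Bochner_Integration.integrable_bound[OF Bochner_Integration.integrable_add[OF i integrable_inverse_1_plus_square_UNIV(1)]])
       (use le in \<open>auto simp: abs_of_nonneg intro: order_trans[OF _ abs_ge_self]\<close>)
qed

section \<open>Dyadic partitions of unity\<close>

lemma funpow_vderiv_scale:
  assumes "smooth f"
  shows "(vderiv ^^ n) (\<lambda>x. f (a * x)) = (\<lambda>x. a ^ n *\<^sub>R (vderiv ^^ n) f (a * x))"
proof -
  define D where "D n x = a ^ n *\<^sub>R (vderiv ^^ n) f (a * x)" for n x
  have "(D n has_vector_derivative D (Suc n) x) (at x)" for n x
  proof -
    have "((\<lambda>x. a * x) has_vector_derivative a) (at x)"
      unfolding has_real_derivative_iff_has_vector_derivative[symmetric]
      by (auto intro!: derivative_eq_intros)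
    from vector_diff_chain_at[OF this smooth_funpow_vderiv_has_vector_derivative[OF assms, of n "a * x"]]
    have "((\<lambda>x. (vderiv ^^ n) f (a * x)) has_vector_derivative a *\<^sub>R (vderiv ^^ Suc n) f (a * x)) (at x)"
      by (simp add: o_def)
    from bounded_linear.has_vector_derivative[OF bounded_linear_scaleR_right this, of "a ^ n"]
    show ?thesis by (simp add: D_def[abs_def] mult.commute)
  qed
  from smoothI_sequence(2)[of D, OF this] show ?thesis by (simp add: D_def[abs_def])
qed

lemma smooth_of_real_has_vector_derivative:
  assumes "smooth \<rho>"
  shows "((\<lambda>u. complex_of_real ((vderiv ^^ n) \<rho> u)) has_vector_derivative
    complex_of_real ((vderiv ^^ Suc n) \<rho> u)) (at u)"
  using bounded_linear.has_vector_derivative[OF bounded_linear_of_real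
      smooth_funpow_vderiv_has_vector_derivative[OF assms]] .

locale dyadic =
  fixes \<psi> :: "nat \<Rightarrow> real \<Rightarrow> real"
  assumes partition: "dyadic_partition \<psi>"
begin

lemma smooth_block: "smooth (\<psi> j)"
  using partition by (simp add: dyadic_partition_def)

lemma block_nonneg: "0 \<le> \<psi> j u"
  using partition by (simp add: dyadic_partition_def)

lemma block_sums: "(\<lambda>j. \<psi> j u) sums 1"
  using partition by (simp add: dyadic_partition_def)

lemma block_le_1: "\<psi> j u \<le> 1"
proof -
  have "(\<Sum>i\<in>{j}. \<psi> i u) \<le> (\<Sum>i. \<psi> i u)"
    using block_sums[of u] by (intro sum_le_suminf) (auto simp: sums_iff block_nonneg)
  then show ?thesis using block_sums[of u] by (simp add: sums_iff)
qed

text \<open>Smoothness of the profile is recovered from \<open>\<psi> 1\<close> by dilation: the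
  profile at \<open>u\<close> is \<open>\<psi> 1 (2 * u)\<close>.\<close>

lemma profile:
  obtains \<theta> where "smooth \<theta>" "\<And>u. 2 < \<bar>u\<bar> \<Longrightarrow> \<theta> u = 0" "\<And>u. \<bar>u\<bar> < 1 / 2 \<Longrightarrow> \<theta> u = 0"
    "\<And>j. 1 \<le> j \<Longrightarrow> \<psi> j = (\<lambda>u. \<theta> (u / 2 ^ j))"
proof -
  from partition obtain \<theta> where \<theta>: "fsupport \<theta> \<subseteq> {u. 1 / 2 \<le> \<bar>u\<bar> \<and> \<bar>u\<bar> \<le> 2}"
    "\<And>j. 1 \<le> j \<Longrightarrow> \<psi> j = (\<lambda>u. \<theta> (u / 2 ^ j))" by (auto simp: dyadic_partition_def)
  have "smooth (\<lambda>u. \<psi> 1 (2 * u + 0))" by (intro smooth_affine smooth_block)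
  then have "smooth \<theta>" by (simp add: \<theta>(2))
  moreover have "\<theta> u = 0" if "2 < \<bar>u\<bar> \<or> \<bar>u\<bar> < 1 / 2" for u
    using that \<theta>(1) by (intro fsupport_eq_0) auto
  ultimately show ?thesis using that \<theta>(2) by blast
qed

lemma block_support:
  assumes "\<psi> j u \<noteq> 0"
  shows "\<bar>u\<bar> \<le> 2 * 2 ^ j" "j = 0 \<or> 2 ^ j \<le> 2 * \<bar>u\<bar>"
proof -
  obtain \<theta> where \<theta>: "\<And>u. 2 < \<bar>u\<bar> \<Longrightarrow> \<theta> u = 0" "\<And>u. \<bar>u\<bar> < 1 / 2 \<Longrightarrow> \<theta> u = 0"
    "\<And>j. 1 \<le> j \<Longrightarrow> \<psi> j = (\<lambda>u. \<theta> (u / 2 ^ j))" by (rule profile) blast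
  show "\<bar>u\<bar> \<le> 2 * 2 ^ j"
  proof (cases "j = 0")
    case True
    have "fsupport (\<psi> 0) \<subseteq> {-2..2}" using partition by (simp add: dyadic_partition_def)
    then have "u \<in> {-2..2}" using assms fsupport_eq_0[of u "\<psi> 0"] True by blast
    then show ?thesis using True by auto
  next
    case False
    then have "\<theta> (u / 2 ^ j) \<noteq> 0" using assms \<theta>(3)[of j] by simp
    then have "\<not> 2 < \<bar>u / 2 ^ j\<bar>" using \<theta>(1) by blast
    then show ?thesis by (simp add: abs_divide field_simps)
  qed
  show "j = 0 \<or> 2 ^ j \<le> 2 * \<bar>u\<bar>"
  proof (cases "j = 0")
    case False
    then have "\<theta> (u / 2 ^ j) \<noteq> 0" using assms \<theta>(3)[of j] by simp
    then have "\<not> \<bar>u / 2 ^ j\<bar> < 1 / 2" using \<theta>(2) by blast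
    then show ?thesis by (simp add: abs_divide field_simps)
  qed simp
qed

lemma compact_block_support: "compact (fsupport (\<psi> j))"
proof (rule compact_fsupport)
  show "\<psi> j u = 0" if "u \<notin> {- (2 * 2 ^ j)..2 * 2 ^ j}" for u
    using that block_support(1)[of j u] by (fastforce simp: abs_le_iff)
qed

lemma blocks_overlap:
  assumes "\<psi> j u \<noteq> 0" "\<psi> k u \<noteq> 0"
  shows "j \<le> k + 2"
proof (rule ccontr)
  assume "\<not> j \<le> k + 2"
  then have jk: "k + 3 \<le> j" by simp
  then have "2 ^ j \<le> 2 * \<bar>u\<bar>" using block_support(2)[OF assms(1)] by auto
  also have "\<dots> \<le> 2 * (2 * 2 ^ k)" using block_support(1)[OF assms(2)] by simp
  also have "\<dots> < (2::real) ^ (k + 3)" by (simp add: power_add)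
  also have "\<dots> \<le> 2 ^ j" using jk by (intro power_increasing) auto
  finally show False by simp
qed

lemma finite_sum_block:
  assumes "finite I" "\<And>j. j \<notin> I \<Longrightarrow> \<psi> j u = 0"
  shows "(\<Sum>j\<in>I. \<psi> j u) = 1"
  using sums_unique2[OF sums_finite[OF assms] block_sums] .

text \<open>A cutoff equal to 1 where \<open>\<psi> k\<close> is nonzero, with derivatives bounded
  uniformly in \<open>k\<close>; the cutoffs \<open>\<psi>'\<close> of the statement carry no such
  uniform bound. For k < 2 truncated subtraction starts the range at 0.\<close>

definition wide :: "nat \<Rightarrow> real \<Rightarrow> real" where
  "wide k u = (\<Sum>j\<in>{k - 2..k + 2}. \<psi> j u)"

lemma smooth_wide: "smooth (wide k)"
  unfolding wide_def[abs_def] by (intro smooth_sum smooth_block)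

lemma wide_eq_1:
  assumes "\<psi> k u \<noteq> 0" shows "wide k u = 1"
  unfolding wide_def
proof (rule finite_sum_block)
  fix j assume "j \<notin> {k - 2..k + 2}"
  then show "\<psi> j u = 0"
    using blocks_overlap[OF _ assms, of j] blocks_overlap[OF assms, of j] by fastforce
qed simp

lemma block_mult_wide: "\<psi> k u * wide k u = \<psi> k u"
  using wide_eq_1[of k u] by (cases "\<psi> k u = 0") auto

text \<open>The blocks below k + 3 are those for which the terms of the multiplier series tested at
  block k can be nonzero.\<close>

lemma lower_sum_eq_1:
  assumes "\<psi> k u \<noteq> 0" shows "(\<Sum>j<k + 3. \<psi> j u) = 1"
proof (rule finite_sum_block)
  fix j assume "j \<notin> {..<k + 3}"
  then show "\<psi> j u = 0" using blocks_overlap[OF _ assms, of j] by fastforce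
qed simp

text \<open>The ring of a single block is enlarged by the factor 4 = 2^2 owing to the two extra
  blocks on each side. For k \<le> 2 the block 0, which has no lower frequency bound, takes
  part.\<close>

lemma wide_support:
  assumes "wide k u \<noteq> 0"
  shows "\<bar>u\<bar> \<le> 8 * 2 ^ k" "k \<le> 2 \<or> 2 ^ k \<le> 8 * \<bar>u\<bar>"
proof -
  from assms obtain j where j: "j \<in> {k - 2..k + 2}" "\<psi> j u \<noteq> 0"
    unfolding wide_def by (meson sum.neutral)
  have "\<bar>u\<bar> \<le> 2 * 2 ^ j" by (rule block_support(1)[OF j(2)])
  also have "\<dots> \<le> 2 * 2 ^ (k + 2)" using j(1) by (intro mult_left_mono power_increasing) auto
  finally show "\<bar>u\<bar> \<le> 8 * 2 ^ k" by (simp add: power_add)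
  show "k \<le> 2 \<or> 2 ^ k \<le> 8 * \<bar>u\<bar>"
  proof (cases "k \<le> 2")
    case False
    have "(2::real) ^ k \<le> 2 ^ (j + 2)" using j(1) by (intro power_increasing) auto
    also have "\<dots> \<le> 4 * (2 * \<bar>u\<bar>)" using block_support(2)[OF j(2)] j(1) False by (auto simp: power_add)
    finally show ?thesis by simp
  qed simp
qed

lemma compact_wide_support: "compact (fsupport (wide k))"
proof (rule compact_fsupport)
  show "wide k u = 0" if "u \<notin> {- (8 * 2 ^ k)..8 * 2 ^ k}" for u
    using that wide_support(1)[of k u] by (fastforce simp: abs_le_iff)
qed

text \<open>Dilation by 2^j multiplies an n-th derivative by 2^(-jn) \<le> 1, so the profile and
  block 0 bound all blocks.\<close>

lemma block_derivatives_bounded: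
  obtains D where "0 < D" "\<And>j n u. n \<le> 2 \<Longrightarrow> \<bar>(vderiv ^^ n) (\<psi> j) u\<bar> \<le> D"
proof -
  obtain \<theta> where s: "smooth \<theta>" and \<theta>: "\<And>u. 2 < \<bar>u\<bar> \<Longrightarrow> \<theta> u = 0"
    "\<And>j. 1 \<le> j \<Longrightarrow> \<psi> j = (\<lambda>u. \<theta> (u / 2 ^ j))" by (rule profile) blast
  have bd: "\<exists>B. \<forall>u. \<bar>(vderiv ^^ n) f u\<bar> \<le> B" if "smooth f" "\<And>u. 2 < \<bar>u\<bar> \<Longrightarrow> f u = 0" for f :: "real \<Rightarrow> real" and n
  proof -
    have "f u = 0" if "u \<notin> {-2..2}" for u
      using that \<open>\<And>u. 2 < \<bar>u\<bar> \<Longrightarrow> f u = 0\<close>[of u] by (auto simp: abs_if split: if_splits)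
    then have "(vderiv ^^ n) f u = 0" if "u \<notin> {-2..2}" for u using funpow_vderiv_eq_0 that by blast
    from continuous_compact_support_bounded[OF smooth_continuous_on[OF smooth_funpow_vderiv[OF \<open>smooth f\<close>]] this]
    show ?thesis unfolding real_norm_def by metis
  qed
  have p0: "\<psi> 0 u = 0" if "2 < \<bar>u\<bar>" for u
    using block_support(1)[of 0 u] that by auto
  obtain A where A: "\<And>n u. \<bar>(vderiv ^^ n) (\<psi> 0) u\<bar> \<le> A n"
    using bd[OF smooth_block p0] by metis
  obtain B where B: "\<And>n u. \<bar>(vderiv ^^ n) \<theta> u\<bar> \<le> B n"
    using bd[OF s \<theta>(1)] by metis
  have AB: "0 \<le> A n" "0 \<le> B n" for n using A[of n 0] B[of n 0] by linarith+
  define D where "D = (\<Sum>n\<le>2. A n + B n) + 1"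
  have D: "A n + B n \<le> D" if "n \<le> 2" for n
    unfolding D_def using member_le_sum[of n "{..2}" "\<lambda>n. A n + B n"] AB that by (simp add: add_increasing2)
  show ?thesis
  proof (rule that[of D])
    show "0 < D" unfolding D_def using AB by (simp add: add_nonneg_pos sum_nonneg)
    fix j n u assume n: "n \<le> (2::nat)"
    show "\<bar>(vderiv ^^ n) (\<psi> j) u\<bar> \<le> D"
    proof (cases "j = 0")
      case True
      then show ?thesis using A[of n u] D[OF n] AB[of n] by simp
    next
      case False
      have "\<psi> j = (\<lambda>u. \<theta> ((1 / 2 ^ j) * u))" using \<theta>(2)[of j] False by simp
      then have "\<bar>(vderiv ^^ n) (\<psi> j) u\<bar> = (1 / 2 ^ j) ^ n * \<bar>(vderiv ^^ n) \<theta> ((1 / 2 ^ j) * u)\<bar>"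
        using funpow_vderiv_scale[OF s, of n "1 / 2 ^ j"] by (simp add: abs_mult)
      also have "\<dots> \<le> 1 * B n"
        by (intro mult_mono B power_le_one) auto
      finally show ?thesis using D[OF n] AB[of n] by linarith
    qed
  qed
qed

lemma funpow_vderiv_wide: "(vderiv ^^ n) (wide k) u = (\<Sum>j\<in>{k - 2..k + 2}. (vderiv ^^ n) (\<psi> j) u)"
proof -
  define D where "D n u = (\<Sum>j\<in>{k - 2..k + 2}. (vderiv ^^ n) (\<psi> j) u)" for n u
  have "(D n has_vector_derivative D (Suc n) u) (at u)" for n u
    unfolding D_def by (intro has_vector_derivative_sum smooth_funpow_vderiv_has_vector_derivative smooth_block)
  from smoothI_sequence(2)[of D, OF this, of n] show ?thesis unfolding D_def[abs_def] wide_def[abs_def] by (simp only: funpow_0)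
qed

lemma wide_derivatives_bounded:
  obtains D where "0 < D" "\<And>k n u. n \<le> 2 \<Longrightarrow> \<bar>(vderiv ^^ n) (wide k) u\<bar> \<le> D"
proof -
  obtain D where D: "0 < D" "\<And>j n u. n \<le> 2 \<Longrightarrow> \<bar>(vderiv ^^ n) (\<psi> j) u\<bar> \<le> D"
    using block_derivatives_bounded by metis
  have "\<bar>(vderiv ^^ n) (wide k) u\<bar> \<le> 5 * D" if "n \<le> 2" for k n u
  proof -
    have "\<bar>(vderiv ^^ n) (wide k) u\<bar> \<le> (\<Sum>j\<in>{k - 2..k + 2}. D)"
      unfolding funpow_vderiv_wide by (rule order_trans[OF sum_abs]) (intro sum_mono D that)
    also have "\<dots> \<le> 5 * D" using D(1) by (auto intro!: mult_right_mono)
    finally show ?thesis .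
  qed
  then show ?thesis using D(1) by (intro that[of "5 * D"]) auto
qed

end


section \<open>Integrable kernels\<close>

text \<open>Two integrations by parts turn x^2 times the kernel into minus the kernel of
  \<open>h2\<close>. Each of the two kernels is at most 2 R B / (2 \<pi>), and the weight 1 / (1 +
  x^2) integrates to \<pi>.\<close>

lemma kernel_L1_bound:
  fixes h :: "real \<Rightarrow> complex"
  assumes d1: "\<And>u. (h has_vector_derivative h1 u) (at u)" and d2: "\<And>u. (h1 has_vector_derivative h2 u) (at u)"
    and c2: "continuous_on UNIV h2" and R: "\<And>u. u \<notin> {- R..R} \<Longrightarrow> h u = 0" "0 \<le> R"
    and B: "\<And>u. norm (h u) \<le> B" "\<And>u. norm (h2 u) \<le> B"
  shows "integrable lborel (inv_fourier h)" "(LINT x|lborel. norm (inv_fourier h x)) \<le> 2 * R * B"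
proof -
  have vd: "vderiv h = h1" "vderiv h1 = h2" using d1 d2 by (auto intro: has_vector_derivative_vderiv_eq)
  have R1: "h1 u = 0" if "u \<notin> {- R..R}" for u using vderiv_eq_0[of "- R" R h u] R(1) that vd by simp
  have R2: "h2 u = 0" if "u \<notin> {- R..R}" for u using vderiv_eq_0[of "- R" R h1 u] R1 that vd by simp
  have c: "continuous_on UNIV h" "continuous_on UNIV h1"
    using d1 d2 by (meson continuous_at_imp_continuous_on has_vector_derivative_continuous)+
  have i: "integrable lborel h" "integrable lborel h2"
    using continuous_compact_support_integrable[OF c(1) R(1)] continuous_compact_support_integrable[OF c2 R2] by auto
  have [measurable]: "h \<in> borel_measurable borel" "h2 \<in> borel_measurable borel" using i by auto
  have L1: "(LINT u|lborel. norm (g u)) \<le> 2 * R * B"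
    if "integrable lborel g" "\<And>u. u \<notin> {- R..R} \<Longrightarrow> g u = 0" "\<And>u. norm (g u) \<le> B" for g :: "real \<Rightarrow> complex"
  proof -
    have "(LINT u|lborel. norm (g u)) \<le> (LINT u|lborel. B * indicator {- R..R} u)"
    proof (rule integral_mono[OF integrable_norm[OF that(1)]])
      show "integrable lborel (\<lambda>u. B * indicator {- R..R} u)"
        using R(2) by (intro integrable_mult_right integrable_real_indicator) auto
      show "norm (g u) \<le> B * indicator {- R..R} u" for u
        using that(2)[of u] that(3)[of u] by (auto simp: indicator_def)
    qed
    also have "\<dots> = 2 * R * B" using R(2) by simp
    finally show ?thesis .
  qed
  \<comment> \<open>The primitive e^(-iux) (h' + i x h) has derivative e^(-iux) (h'' + x^2 h), so
    both integrations by parts are done in one stroke.\<close>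
  have zero: "(CLINT u|lborel. iexp (- (u * x)) * h2 u + of_real (x\<^sup>2) * (iexp (- (u * x)) * h u)) = 0" for x
  proof -
    let ?F = "\<lambda>u. iexp (- (u * x)) * (h1 u + \<i> * of_real x * h u)"
    let ?f = "\<lambda>u. iexp (- (u * x)) * h2 u + of_real (x\<^sup>2) * (iexp (- (u * x)) * h u)"
    have cF: "continuous_on UNIV (\<lambda>u. of_real u * ?F u)" by (intro continuous_intros c)
    have zF: "of_real u * ?F u = 0" if "u \<notin> {- R..R}" for u using R(1)[OF that] R1[OF that] by simp
    obtain A where A: "\<And>u. norm (of_real u * ?F u) \<le> A"
      using continuous_compact_support_bounded[OF cF zF] by metis
    show ?thesis
    proof (rule integral_derivative_eq_0[of ?F ?f A])
      show "(?F has_vector_derivative ?f u) (at u)" for u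
      proof -
        have e: "((\<lambda>u. iexp (- (u * x))) has_vector_derivative iexp (- (u * x)) * (- (\<i> * of_real x))) (at u)"
          by (rule has_vector_derivative_real_field[of "\<lambda>u. exp (\<i> * (- (u * of_real x)))", simplified of_real_mult[symmetric] of_real_minus[symmetric]])
             (auto intro!: derivative_eq_intros)
        have "((\<lambda>u. h1 u + \<i> * of_real x * h u) has_vector_derivative h2 u + \<i> * of_real x * h1 u) (at u)"
          by (intro has_vector_derivative_add has_vector_derivative_mult_right d1 d2)
        from has_vector_derivative_mult[OF e this]
        show ?thesis by (simp add: algebra_simps power2_eq_square)
      qed
      show "integrable lborel ?f"
      proof -
        have "integrable lborel (\<lambda>u. iexp ((- x) * u) * h2 u)" "integrable lborel (\<lambda>u. of_real (x\<^sup>2) * (iexp ((- x) * u) * h u))"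
          by (intro integrable_mult_right integrable_iexp_mult i)+
        from Bochner_Integration.integrable_add[OF this] show ?thesis by (simp add: mult.commute)
      qed
      show "continuous_on UNIV ?f" by (intro continuous_intros c c2)
      show "\<bar>u\<bar> * norm (?F u) \<le> A" for u using A[of u] by (simp add: norm_mult)
    qed
  qed
  have key: "norm (inv_fourier h x) * (1 + x\<^sup>2) \<le> 2 * R * B / pi" for x
  proof -
    have ii: "integrable lborel (\<lambda>u. iexp (- (u * x)) * h2 u)" "integrable lborel (\<lambda>u. iexp (- (u * x)) * h u)"
      using integrable_iexp_mult[OF i(2), of "- x"] integrable_iexp_mult[OF i(1), of "- x"] by (simp_all add: mult.commute)
    have "(CLINT u|lborel. iexp (- (u * x)) * h2 u) + of_real (x\<^sup>2) * (CLINT u|lborel. iexp (- (u * x)) * h u) = 0"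
      using zero[of x] ii by (subst (asm) Bochner_Integration.integral_add) auto
    then have "inv_fourier h2 x + of_real (x\<^sup>2) * inv_fourier h x = 0"
      by (simp add: inv_fourier_def add_divide_distrib[symmetric])
    then have "of_real (x\<^sup>2) * inv_fourier h x = - inv_fourier h2 x"
      by (metis add.commute add_eq_0_iff)
    then have "norm (of_real (x\<^sup>2) * inv_fourier h x) = norm (inv_fourier h2 x)" by simp
    then have "x\<^sup>2 * norm (inv_fourier h x) = norm (inv_fourier h2 x)" by (simp add: norm_mult norm_power)
    also have "\<dots> \<le> 2 * R * B / (2 * pi)"
      by (rule order_trans[OF norm_inv_fourier_le divide_right_mono[OF L1]]) (use i R2 B in auto)
    finally have "x\<^sup>2 * norm (inv_fourier h x) \<le> 2 * R * B / (2 * pi)" .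
    moreover have "norm (inv_fourier h x) \<le> 2 * R * B / (2 * pi)"
      by (rule order_trans[OF norm_inv_fourier_le divide_right_mono[OF L1]]) (use i R B in auto)
    ultimately have "norm (inv_fourier h x) + x\<^sup>2 * norm (inv_fourier h x) \<le> 2 * R * B / (2 * pi) + 2 * R * B / (2 * pi)"
      by (rule add_mono[rotated])
    then show ?thesis by (simp add: algebra_simps)
  qed
  have m: "inv_fourier h \<in> borel_measurable borel" by (rule inv_fourier_measurable) simp
  show "integrable lborel (inv_fourier h)" by (rule quadratic_decay_integrable(1)[OF m key])
  show "(LINT x|lborel. norm (inv_fourier h x)) \<le> 2 * R * B"
    using quadratic_decay_integrable(2)[OF m key] by simp
qed

lemma product_second_derivative_bound:
  fixes e e1 e2 :: complex and w w1 w2 :: real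
  assumes "\<bar>w\<bar> \<le> D" "\<bar>w1\<bar> \<le> D" "\<bar>w2\<bar> \<le> D" "norm e \<le> A" "norm e1 \<le> A" "norm e2 \<le> A"
  shows "norm (of_real w2 * e + 2 * (of_real w1 * e1) + of_real w * e2) \<le> 4 * D * A"
proof -
  have m: "\<bar>x\<bar> * norm y \<le> D * A" if "\<bar>x\<bar> \<le> D" "norm y \<le> A" for x :: real and y :: complex
    using that by (intro mult_mono) auto
  have "norm (of_real w2 * e + 2 * (of_real w1 * e1) + of_real w * e2)
      \<le> norm (of_real w2 * e) + norm (2 * (of_real w1 * e1)) + norm (of_real w * e2)"
    by (meson add_right_mono norm_triangle_ineq order_trans)
  also have "\<dots> = \<bar>w2\<bar> * norm e + 2 * (\<bar>w1\<bar> * norm e1) + \<bar>w\<bar> * norm e2" by (simp add: norm_mult)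
  also have "\<dots> \<le> D * A + 2 * (D * A) + D * A"
    using assms by (intro add_mono mult_left_mono m) auto
  finally show ?thesis by (simp add: mult_ac)
qed

text \<open>The bounds on the symbol are required only on the frequency ring carrying
  \<open>wide k\<close>, and the constant depends neither on \<open>k\<close> nor on the symbol; the
  factor 2^k is the width of the ring.\<close>

lemma (in dyadic) wide_kernel_bound:
  obtains C where "0 < C" "\<And>k e e1 e2 A.
     (\<And>u. (e has_vector_derivative e1 u) (at u)) \<Longrightarrow> (\<And>u. (e1 has_vector_derivative e2 u) (at u)) \<Longrightarrow>
     continuous_on UNIV e2 \<Longrightarrow>
     (\<And>u. \<bar>u\<bar> \<le> 8 * 2 ^ k \<Longrightarrow> k \<le> 2 \<or> 2 ^ k \<le> 8 * \<bar>u\<bar> \<Longrightarrow> norm (e u) \<le> A \<and> norm (e1 u) \<le> A \<and> norm (e2 u) \<le> (A::real)) \<Longrightarrow>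
     integrable lborel (inv_fourier (\<lambda>u. of_real (wide k u) * e u)) \<and>
     (LINT x|lborel. norm (inv_fourier (\<lambda>u. of_real (wide k u) * e u) x)) \<le> C * 2 ^ k * A"
proof -
  obtain D where D: "0 < D" "\<And>k n u. n \<le> 2 \<Longrightarrow> \<bar>(vderiv ^^ n) (wide k) u\<bar> \<le> D"
    using wide_derivatives_bounded by metis
  show ?thesis
  \<comment> \<open>64 = 2 * 8 * 4: the ring lies in an interval of length 16 times 2^k, and the
    Leibniz rule with coefficients 1, 2, 1 contributes 4.\<close>
  proof (rule that[of "64 * D"])
    show "0 < 64 * D" using D by simp
    fix k :: nat and e e1 e2 :: "real \<Rightarrow> complex" and A :: real
    assume e: "\<And>u. (e has_vector_derivative e1 u) (at u)" "\<And>u. (e1 has_vector_derivative e2 u) (at u)"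
      "continuous_on UNIV e2"
      and A: "\<And>u. \<bar>u\<bar> \<le> 8 * 2 ^ k \<Longrightarrow> k \<le> 2 \<or> 2 ^ k \<le> 8 * \<bar>u\<bar> \<Longrightarrow> norm (e u) \<le> A \<and> norm (e1 u) \<le> A \<and> norm (e2 u) \<le> A"
    let ?R = "8 * 2 ^ k :: real"
    let ?w = "\<lambda>n u. complex_of_real ((vderiv ^^ n) (wide k) u)"
    let ?h = "\<lambda>u. ?w 0 u * e u"
    let ?h1 = "\<lambda>u. ?w 0 u * e1 u + ?w 1 u * e u"
    let ?h2 = "\<lambda>u. ?w 2 u * e u + 2 * (?w 1 u * e1 u) + ?w 0 u * e2 u"
    have w: "(?w n has_vector_derivative ?w (Suc n) u) (at u)" for n u
      by (rule smooth_of_real_has_vector_derivative[OF smooth_wide])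
    have w0: "?w n u = 0" if "u \<notin> {- ?R..?R}" for u n
    proof -
      have "wide k u = 0" if "u \<notin> {- ?R..?R}" for u using wide_support(1)[of k u] that by (fastforce simp: abs_le_iff)
      from funpow_vderiv_eq_0[of "- ?R" ?R "wide k", OF this that] show ?thesis by simp
    qed
    have "norm (e (8 * 2 ^ k)) \<le> A" using A[of "8 * 2 ^ k"] by simp
    then have A0: "0 \<le> A" by (rule order_trans[OF norm_ge_zero])
    \<comment> \<open>Off the ring \<open>wide k\<close> vanishes on an open set, hence so do its
      derivatives, and nothing need be known about the symbol there.\<close>
    have sup: "wide k u = 0 \<and> ?w 1 u = 0 \<and> ?w 2 u = 0 \<or> (norm (e u) \<le> A \<and> norm (e1 u) \<le> A \<and> norm (e2 u) \<le> A)" for u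
    proof (cases "\<bar>u\<bar> \<le> 8 * 2 ^ k \<and> (k \<le> 2 \<or> 2 ^ k \<le> 8 * \<bar>u\<bar>)")
      case True
      then show ?thesis using A by blast
    next
      case False
      have "?w n u = 0" for n
      proof (cases "\<bar>u\<bar> \<le> 8 * 2 ^ k")
        case False
        then have "u \<notin> {- ?R..?R}" by auto
        then show ?thesis by (rule w0)
      next
        case True
        then have k: "\<not> k \<le> 2" and u: "8 * \<bar>u\<bar> < 2 ^ k" using \<open>\<not> (_ \<and> _)\<close> by auto
        let ?r = "2 ^ k / 8 :: real"
        have z: "wide k y = 0" if "y \<in> {- ?r<..<?r}" for y
        proof -
          have "\<bar>y\<bar> < ?r" using that by (auto simp: abs_less_iff)
          then show ?thesis using wide_support(2)[of k y] k by fastforce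
        qed
        have "(vderiv ^^ n) (wide k) y = 0" if "y \<in> {- ?r<..<?r}" for y
          using that
        proof (induction n arbitrary: y)
          case 0 then show ?case using z by simp
        next
          case (Suc n)
          have "((vderiv ^^ n) (wide k) has_vector_derivative 0) (at y)"
            by (rule has_vector_derivative_transform_within_open[of "\<lambda>_. 0" 0 y "{- ?r<..<?r}"])
               (use Suc in auto)
          from vector_derivative_at[OF this]
          show ?case by (simp add: vderiv_def[of "(vderiv ^^ n) (wide k)"])
        qed
        moreover have "u \<in> {- ?r<..<?r}" using u by auto
        ultimately show ?thesis by simp
      qed
      then show ?thesis by (metis funpow_0 of_real_eq_0_iff)
    qed
    have b: "norm (?h u) \<le> 4 * D * A" "norm (?h2 u) \<le> 4 * D * A" for u
    proof -
      have 0: "0 \<le> 4 * D * A" using D(1) A0 by simp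
      consider "wide k u = 0 \<and> ?w 1 u = 0 \<and> ?w 2 u = 0" | "norm (e u) \<le> A \<and> norm (e1 u) \<le> A \<and> norm (e2 u) \<le> A"
        using sup by blast
      then show "norm (?h2 u) \<le> 4 * D * A"
      proof cases
        case 1 then show ?thesis using 0 by simp
      next
        case 2 then show ?thesis using D(2)[of 0 k u] D(2)[of 1 k u] D(2)[of 2 k u]
          by (intro product_second_derivative_bound) auto
      qed
      show "norm (?h u) \<le> 4 * D * A"
        using sup
      proof (rule disjE)
        assume "norm (e u) \<le> A \<and> norm (e1 u) \<le> A \<and> norm (e2 u) \<le> A"
        then have "\<bar>wide k u\<bar> * norm (e u) \<le> D * A" using D(2)[of 0 k u] D(1) by (intro mult_mono) auto
        also have "\<dots> \<le> 4 * D * A" using D(1) A0 by simp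
        finally show ?thesis by (simp add: norm_mult)
      qed (use 0 in simp)
    qed
    have d1: "(?h has_vector_derivative ?h1 u) (at u)" for u
      using has_vector_derivative_mult[OF w[of 0 u] e(1)[of u]] by simp
    have d2: "(?h1 has_vector_derivative ?h2 u) (at u)" for u
      using has_vector_derivative_add[OF has_vector_derivative_mult[OF w[of 0 u] e(2)[of u]]
          has_vector_derivative_mult[OF w[of 1 u] e(1)[of u]]]
      by (simp add: algebra_simps numeral_2_eq_2)
    have ce: "continuous_on UNIV e" "continuous_on UNIV e1"
      using e(1,2) by (meson continuous_at_imp_continuous_on has_vector_derivative_continuous)+
    have cw: "continuous_on UNIV (?w n)" for n
      by (intro continuous_on_of_real smooth_continuous_on smooth_funpow_vderiv smooth_wide)
    have c2: "continuous_on UNIV ?h2" by (intro continuous_intros ce e(3) cw)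
    have z: "?h u = 0" if "u \<notin> {- ?R..?R}" for u using w0[OF that, of 0] by simp
    have "0 \<le> ?R" by simp
    note * = kernel_L1_bound[OF d1 d2 c2 z this b]
    show "integrable lborel (inv_fourier (\<lambda>u. of_real (wide k u) * e u)) \<and>
     (LINT x|lborel. norm (inv_fourier (\<lambda>u. of_real (wide k u) * e u) x)) \<le> 64 * D * 2 ^ k * A"
      using * by (simp add: mult_ac)
  qed
qed

text \<open>For an arbitrary cutoff no uniform bound is sought; compactness of its support provides
  some bound.\<close>

lemma smooth_cutoff_symbol:
  assumes \<rho>: "smooth \<rho>" "compact (fsupport \<rho>)"
    and e: "\<And>u. (e has_vector_derivative e1 u) (at u)" "\<And>u. (e1 has_vector_derivative e2 u) (at u)"
      "continuous_on UNIV e2"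
  shows "integrable lborel (inv_fourier (\<lambda>u. of_real (\<rho> u) * e u))"
proof -
  obtain R where R: "0 < R" "\<And>u. R \<le> \<bar>u\<bar> \<Longrightarrow> \<rho> u = 0" using compact_fsupportD[OF \<rho>(2)] by metis
  let ?w = "\<lambda>n u. complex_of_real ((vderiv ^^ n) \<rho> u)"
  let ?h = "\<lambda>u. ?w 0 u * e u"
  let ?h1 = "\<lambda>u. ?w 0 u * e1 u + ?w 1 u * e u"
  let ?h2 = "\<lambda>u. ?w 2 u * e u + 2 * (?w 1 u * e1 u) + ?w 0 u * e2 u"
  have w: "(?w n has_vector_derivative ?w (Suc n) u) (at u)" for n u
    by (rule smooth_of_real_has_vector_derivative[OF \<rho>(1)])
  have r0: "\<rho> u = 0" if "u \<notin> {- R..R}" for u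
    using that by (intro R(2)) auto
  have w0: "?w n u = 0" if "u \<notin> {- R..R}" for u n
    using funpow_vderiv_eq_0[of "- R" R \<rho>, OF r0 that] by simp
  have d1: "(?h has_vector_derivative ?h1 u) (at u)" for u
    using has_vector_derivative_mult[OF w[of 0 u] e(1)[of u]] by simp
  have d2: "(?h1 has_vector_derivative ?h2 u) (at u)" for u
    using has_vector_derivative_add[OF has_vector_derivative_mult[OF w[of 0 u] e(2)[of u]]
        has_vector_derivative_mult[OF w[of 1 u] e(1)[of u]]]
    by (simp add: algebra_simps numeral_2_eq_2)
  have ce: "continuous_on UNIV e" "continuous_on UNIV e1"
    using e(1,2) by (meson continuous_at_imp_continuous_on has_vector_derivative_continuous)+
  have cw: "continuous_on UNIV (?w n)" for n
    by (intro continuous_on_of_real smooth_continuous_on smooth_funpow_vderiv \<rho>)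
  have c: "continuous_on UNIV ?h" and c2: "continuous_on UNIV ?h2"
    by (intro continuous_intros ce e(3) cw)+
  have z: "?h u = 0" "?h2 u = 0" if "u \<notin> {- R..R}" for u
    using w0[OF that, of 0] w0[OF that, of 1] w0[OF that, of 2] by simp_all
  obtain B1 where B1: "\<And>u. norm (?h u) \<le> B1" using continuous_compact_support_bounded[OF c z(1)] by metis
  obtain B2 where B2: "\<And>u. norm (?h2 u) \<le> B2" using continuous_compact_support_bounded[OF c2 z(2)] by metis
  have "integrable lborel (inv_fourier ?h)"
  proof (rule kernel_L1_bound(1)[OF d1 d2 c2 z(1)])
    show "norm (?h u) \<le> max B1 B2" "norm (?h2 u) \<le> max B1 B2" for u
      using B1[of u] B2[of u] by (auto intro: max.coboundedI1 max.coboundedI2)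
  qed (use R(1) in auto)
  then show ?thesis by simp
qed

section \<open>Littlewood-Paley blocks\<close>

lemma norm_integral_bounded_mult_le:
  fixes g h :: "real \<Rightarrow> complex"
  assumes [measurable]: "g \<in> borel_measurable borel" and B: "\<And>x. norm (g x) \<le> B" and h: "integrable lborel h"
  shows "integrable lborel (\<lambda>x. g x * h x)" "norm (CLINT x|lborel. g x * h x) \<le> B * (LINT x|lborel. norm (h x))"
proof -
  have [measurable]: "h \<in> borel_measurable borel" using h by simp
  have B0: "0 \<le> B" by (rule order_trans[OF norm_ge_zero B])
  have le: "norm (g x * h x) \<le> B * norm (h x)" for x
    unfolding norm_mult by (intro mult_right_mono B) auto
  have iB: "integrable lborel (\<lambda>x. B * norm (h x))" using h by simp
  show i: "integrable lborel (\<lambda>x. g x * h x)"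
    by (rule Bochner_Integration.integrable_bound[OF iB]) (use le B0 in auto)
  have "norm (CLINT x|lborel. g x * h x) \<le> (LINT x|lborel. norm (g x * h x))" by (rule integral_norm_bound)
  also have "\<dots> \<le> (LINT x|lborel. B * norm (h x))" by (intro integral_mono integrable_norm i iB le)
  finally show "norm (CLINT x|lborel. g x * h x) \<le> B * (LINT x|lborel. norm (h x))" by simp
qed

context dyadic
begin

abbreviation csym :: "(real \<Rightarrow> real) \<Rightarrow> real \<Rightarrow> complex" where
  "csym \<rho> \<equiv> (\<lambda>u. complex_of_real (\<rho> u))"

lemma symbol_block: "fourier_symbol (csym (\<psi> j))"
  by (rule smooth_symbol(2)[OF smooth_block compact_block_support])

lemma symbol_wide: "fourier_symbol (csym (wide j))"
  by (rule smooth_symbol(2)[OF smooth_wide compact_wide_support])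

text \<open>A bounded representative pairs with every integrable function, whereas the distribution
  accepts only Schwartz functions. This is needed because symbols that are merely continuous may
  lead out of the Schwartz space.\<close>

definition bounded_block :: "distribution \<Rightarrow> nat \<Rightarrow> (real \<Rightarrow> complex) \<Rightarrow> bool" where
  "bounded_block f j g \<longleftrightarrow> g \<in> borel_measurable borel \<and> (\<exists>B. \<forall>x. norm (g x) \<le> B) \<and> represents g (lp_block \<psi> j f)"

lemma bounded_block_integrable:
  assumes "bounded_block f j g" "integrable lborel h"
  shows "integrable lborel (\<lambda>x. g x * h x)"
  using assms norm_integral_bounded_mult_le(1) by (auto simp: bounded_block_def)

lemma bounded_block_conv:
  assumes "bounded_block f j g" "fourier_symbol b" "integrable lborel h"
  shows "integrable lborel (\<lambda>x. conv (inv_fourier b) g x * h x)"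
    "(CLINT x|lborel. conv (inv_fourier b) g x * h x) = (CLINT x|lborel. g x * mult_op b h x)"
proof -
  obtain B where "g \<in> borel_measurable borel" "\<And>x. norm (g x) \<le> B" using assms(1) by (auto simp: bounded_block_def)
  from conv_duality_bounded[OF assms(2,3) this]
  show "integrable lborel (\<lambda>x. conv (inv_fourier b) g x * h x)"
    "(CLINT x|lborel. conv (inv_fourier b) g x * h x) = (CLINT x|lborel. g x * mult_op b h x)" by auto
qed

lemma bounded_block_pairing:
  assumes "bounded_block f j g" "\<phi> \<in> schwartz"
  shows "(CLINT x|lborel. g x * \<phi> x) = f (mult_op (csym (\<psi> j)) \<phi>)"
  using assms by (simp add: bounded_block_def represents_def lp_block_eq[symmetric])

lemma conv_measurable_symbol:
  assumes "fourier_symbol b" "g \<in> borel_measurable borel"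
  shows "conv (inv_fourier b) g \<in> borel_measurable borel"
  using fourier_symbolD(3)[OF assms(1)] assms(2) by (intro conv_measurable) auto

text \<open>By duality, convolving a block with the kernel of \<open>\<rho>\<close> multiplies its
  symbol by \<open>\<rho>\<close>. Smoothness of \<open>\<rho>\<close> keeps the argument of
  \<open>f\<close> in the Schwartz space.\<close>

lemma conv_represents:
  assumes g: "bounded_block f j g" and \<rho>: "smooth \<rho>" "compact (fsupport \<rho>)"
  shows "represents (conv (inv_fourier (csym \<rho>)) g) (\<lambda>\<phi>. f (mult_op (\<lambda>u. csym (\<psi> j) u * csym \<rho> u) \<phi>))"
  unfolding represents_def
proof (intro conjI ballI)
  note s = smooth_symbol[OF \<rho>]
  show "conv (inv_fourier (csym \<rho>)) g \<in> borel_measurable borel"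
    using g by (intro conv_measurable_symbol s) (auto simp: bounded_block_def)
  fix \<phi> :: "real \<Rightarrow> complex" assume \<phi>: "\<phi> \<in> schwartz"
  note i = schwartz_integrable[OF \<phi>]
  show "integrable lborel (\<lambda>x. conv (inv_fourier (csym \<rho>)) g x * \<phi> x)"
    by (rule bounded_block_conv(1)[OF g s(2) i])
  show "f (mult_op (\<lambda>u. csym (\<psi> j) u * csym \<rho> u) \<phi>) = (CLINT x|lborel. conv (inv_fourier (csym \<rho>)) g x * \<phi> x)"
    unfolding bounded_block_conv(2)[OF g s(2) i] bounded_block_pairing[OF g mult_op_schwartz[OF \<rho> \<phi>]]
      mult_op_mult_op[OF s(2) i] ..
qed

lemma pairing_cong_AE:
  assumes "AE x in lborel. g x = g' x" "g \<in> borel_measurable borel" "g' \<in> borel_measurable borel" "integrable lborel h"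
  shows "(CLINT x|lborel. g x * h x) = (CLINT x|lborel. g' x * h x)"
  using assms by (intro integral_cong_AE) (auto elim!: eventually_mono)

text \<open>The convolved block has symbol \<open>\<psi> j * \<rho>\<close>, which is
  \<open>\<psi> j\<close>. So two functions represent the same distribution and agree almost
  everywhere, and the identity extends from Schwartz functions to integrable
  \<open>h\<close>.\<close>

lemma pairing_reproduce:
  assumes g: "bounded_block f j g" and \<rho>: "smooth \<rho>" "compact (fsupport \<rho>)" "\<And>u. \<psi> j u * \<rho> u = \<psi> j u"
    and h: "integrable lborel h"
  shows "(CLINT x|lborel. g x * mult_op (csym \<rho>) h x) = (CLINT x|lborel. g x * h x)"
proof -
  note s = smooth_symbol(2)[OF \<rho>(1,2)]
  have "(\<lambda>u. csym (\<psi> j) u * csym \<rho> u) = csym (\<psi> j)"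
    unfolding of_real_mult[symmetric] \<rho>(3) ..
  then have "represents (conv (inv_fourier (csym \<rho>)) g) (\<lambda>\<phi>. f (mult_op (csym (\<psi> j)) \<phi>))"
    using conv_represents[OF g \<rho>(1,2)] by simp
  moreover have gr: "represents g (\<lambda>\<phi>. f (mult_op (csym (\<psi> j)) \<phi>))"
    using g by (simp add: bounded_block_def lp_block_eq[abs_def])
  ultimately have "AE x in lborel. conv (inv_fourier (csym \<rho>)) g x = g x" by (rule represents_unique)
  from pairing_cong_AE[OF this _ _ h] show ?thesis
    using g conv_measurable_symbol[OF s] unfolding bounded_block_conv(2)[OF g s h]
    by (simp add: bounded_block_def)
qed

text \<open>Both sides come from functions representing the distribution with symbol
  \<open>\<psi> j * \<psi> k\<close>.\<close>

lemma pairing_exchange: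
  assumes g: "bounded_block f j g" and g': "bounded_block f k g'" and h: "integrable lborel h"
  shows "(CLINT x|lborel. g x * mult_op (csym (\<psi> k)) h x) = (CLINT x|lborel. g' x * mult_op (csym (\<psi> j)) h x)"
proof -
  have "represents (conv (inv_fourier (csym (\<psi> j))) g') (\<lambda>\<phi>. f (mult_op (\<lambda>u. csym (\<psi> j) u * csym (\<psi> k) u) \<phi>))"
    using conv_represents[OF g' smooth_block compact_block_support, of j] by (simp add: mult.commute)
  from represents_unique[OF conv_represents[OF g smooth_block compact_block_support] this]
  have "AE x in lborel. conv (inv_fourier (csym (\<psi> k))) g x = conv (inv_fourier (csym (\<psi> j))) g' x" .
  from pairing_cong_AE[OF this _ _ h] show ?thesis
    using g g' conv_measurable_symbol[OF symbol_block]
    unfolding bounded_block_conv(2)[OF g symbol_block h] bounded_block_conv(2)[OF g' symbol_block h]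
    by (simp add: bounded_block_def)
qed

lemma mult_op_zero: "mult_op (\<lambda>u. 0) h = (\<lambda>x. 0)"
  by (auto simp: mult_op_def fourier_def)

lemma tempered_zero:
  assumes "tempered f" shows "f (\<lambda>x. 0) = 0"
proof -
  have s: "(\<lambda>x. 0 :: complex) \<in> schwartz" by (rule schwartz_compact_support[of _ 0]) (auto simp: smooth_const)
  have "\<forall>c. \<forall>g\<in>schwartz. f (\<lambda>x. c * g x) = c * f g" using assms by (simp add: tempered_def)
  from bspec[OF spec[OF this, of 0] s] show ?thesis by simp
qed

lemma pairing_disjoint:
  assumes f: "tempered f" and g: "bounded_block f j g" and d: "\<And>u. \<psi> j u * \<psi> k u = 0" and h: "integrable lborel h"
  shows "(CLINT x|lborel. g x * mult_op (csym (\<psi> k)) h x) = 0"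
proof -
  have "(\<lambda>u. csym (\<psi> j) u * csym (\<psi> k) u) = (\<lambda>u. 0)"
    unfolding of_real_mult[symmetric] d by simp
  then have "represents (conv (inv_fourier (csym (\<psi> k))) g) (\<lambda>\<phi>. 0)"
    using conv_represents[OF g smooth_block compact_block_support, of k] by (simp add: mult_op_zero tempered_zero[OF f])
  moreover have "represents (\<lambda>x. 0) (\<lambda>\<phi>. 0)" by (simp add: represents_def)
  ultimately have "AE x in lborel. conv (inv_fourier (csym (\<psi> k))) g x = 0" by (rule represents_unique)
  from pairing_cong_AE[OF this _ _ h] show ?thesis
    using g conv_measurable_symbol[OF symbol_block] unfolding bounded_block_conv(2)[OF g symbol_block h]
    by (simp add: bounded_block_def)
qed

lemma wide_bounds: "0 \<le> wide k u" "wide k u \<le> 5"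
proof -
  show "0 \<le> wide k u" unfolding wide_def by (intro sum_nonneg block_nonneg)
  have "wide k u \<le> (\<Sum>j\<in>{k - 2..k + 2}. 1)" unfolding wide_def by (intro sum_mono block_le_1)
  then show "wide k u \<le> 5" by simp
qed

text \<open>The L^p representative \<open>r\<close> is convolved with the kernel of
  \<open>wide j\<close>. This does not change the block, as \<open>wide j\<close> is 1 wherever
  \<open>\<psi> j\<close> is nonzero, and makes it bounded by Bernstein's inequality. The crude
  factor 2^j will be absorbed by the decay of the test functions.\<close>

lemma ex_bounded_block:
  obtains C where "0 < C" "\<And>f j p. 1 \<le> p \<Longrightarrow> dist_Lp_norm p (lp_block \<psi> j f) < \<infinity> \<Longrightarrow>
    \<exists>g. bounded_block f j g \<and> (\<forall>x. ennreal (cmod (g x)) \<le> ennreal (C * 2 ^ j) * dist_Lp_norm p (lp_block \<psi> j f))"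
proof -
  obtain C0 where C0: "0 < C0" "\<And>k e e1 e2 A.
     (\<And>u. (e has_vector_derivative e1 u) (at u)) \<Longrightarrow> (\<And>u. (e1 has_vector_derivative e2 u) (at u)) \<Longrightarrow>
     continuous_on UNIV e2 \<Longrightarrow>
     (\<And>u. \<bar>u\<bar> \<le> 8 * 2 ^ k \<Longrightarrow> k \<le> 2 \<or> 2 ^ k \<le> 8 * \<bar>u\<bar> \<Longrightarrow> norm (e u) \<le> A \<and> norm (e1 u) \<le> A \<and> norm (e2 u) \<le> (A::real)) \<Longrightarrow>
     integrable lborel (inv_fourier (\<lambda>u. of_real (wide k u) * e u)) \<and>
     (LINT x|lborel. norm (inv_fourier (\<lambda>u. of_real (wide k u) * e u) x)) \<le> C0 * 2 ^ k * A"
    using wide_kernel_bound by blast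
  have L1: "integrable lborel (inv_fourier (csym (wide j))) \<and>
     (LINT x|lborel. norm (inv_fourier (csym (wide j)) x)) \<le> C0 * 2 ^ j" for j
    using C0(2)[of "\<lambda>_. 1" "\<lambda>_. 0" "\<lambda>_. 0" j 1] by (simp add: has_vector_derivative_const)
  \<comment> \<open>80 = 5 * 16: at most five blocks of height 1 on an interval of length 16 * 2^j;
    the factor 1 / (2 \<pi>) is dropped.\<close>
  have sup: "norm (inv_fourier (csym (wide j)) x) \<le> 80 * 2 ^ j" for j x
  proof -
    have "(LINT u|lborel. norm (csym (wide j) u)) \<le> (LINT u|lborel. 5 * indicator {- (8 * 2 ^ j)..8 * 2 ^ j :: real} u)"
    proof (rule integral_mono)
      show "integrable lborel (\<lambda>u. norm (csym (wide j) u))"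
        by (intro integrable_norm fourier_symbolD(2) symbol_wide)
      show "integrable lborel (\<lambda>u. 5 * indicator {- (8 * 2 ^ j)..8 * 2 ^ j :: real} u :: real)"
        by (intro integrable_mult_right integrable_real_indicator) auto
      show "norm (csym (wide j) u) \<le> 5 * indicator {- (8 * 2 ^ j)..8 * 2 ^ j :: real} u" for u
        using wide_bounds[of j u] wide_support(1)[of j u] by (cases "wide j u = 0") (auto simp: abs_le_iff indicator_def)
    qed
    also have "\<dots> = 80 * 2 ^ j" by simp
    finally have "(LINT u|lborel. norm (csym (wide j) u)) / (2 * pi) \<le> 80 * 2 ^ j / (2 * pi)" by (intro divide_right_mono) auto
    also have "\<dots> \<le> 80 * 2 ^ j / 1" using pi_gt3 by (intro divide_left_mono) auto
    finally show ?thesis using norm_inv_fourier_le[of "csym (wide j)" x] by linarith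
  qed
  define C where "C = C0 + 80"
  show ?thesis
  proof (rule that[of C])
    show "0 < C" using C0(1) by (simp add: C_def)
    fix f j and p :: ennreal assume p: "1 \<le> p" and fin: "dist_Lp_norm p (lp_block \<psi> j f) < \<infinity>"
    obtain r where r: "represents r (lp_block \<psi> j f)" using represents_of_finite_norm[OF fin] .
    have rm: "r \<in> borel_measurable borel" using r by (simp add: represents_def)
    have n: "dist_Lp_norm p (lp_block \<psi> j f) = Lp_norm p lborel (\<lambda>x. ennreal (cmod (r x)))"
      by (rule dist_Lp_norm_eq[OF r p])
    have w: "integrable lborel (\<lambda>x. cmod (r x) / (1 + x\<^sup>2))"
      by (rule Lp_finite_weight_integrable[OF rm p]) (use fin n in simp)
    define g where "g = conv (inv_fourier (csym (wide j))) r"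
    have gm: "g \<in> borel_measurable borel" unfolding g_def by (rule conv_measurable_symbol[OF symbol_wide rm])
    have le: "ennreal (cmod (g x)) \<le> ennreal (C * 2 ^ j) * dist_Lp_norm p (lp_block \<psi> j f)" for x
      unfolding g_def n
    proof (rule conv_sup_le[OF _ _ _ _ rm p])
      show "integrable lborel (inv_fourier (csym (wide j)))" using L1 by blast
      have "C0 * 2 ^ j \<le> C * 2 ^ j" "80 * 2 ^ j \<le> C * 2 ^ j" using C0(1) by (auto simp: C_def)
      then show "(LINT x|lborel. cmod (inv_fourier (csym (wide j)) x)) \<le> C * 2 ^ j"
        "cmod (inv_fourier (csym (wide j)) x) \<le> C * 2 ^ j" for x
        using L1[of j] sup[of j x] by linarith+
      show "0 < C * 2 ^ j" using \<open>0 < C\<close> by simp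
    qed
    have "\<exists>B. \<forall>x. norm (g x) \<le> B"
    proof -
      obtain N where N: "0 \<le> N" "dist_Lp_norm p (lp_block \<psi> j f) = ennreal N"
        using fin by (cases "dist_Lp_norm p (lp_block \<psi> j f)") auto
      have "norm (g x) \<le> C * 2 ^ j * N" for x
        using le[of x] N \<open>0 < C\<close> by (simp add: ennreal_mult[symmetric] ennreal_le_iff)
      then show ?thesis by blast
    qed
    moreover have "represents g (lp_block \<psi> j f)"
      unfolding represents_def
    proof (intro conjI ballI gm)
      fix \<phi> :: "real \<Rightarrow> complex" assume \<phi>: "\<phi> \<in> schwartz"
      note cd = conv_duality_schwartz[OF smooth_symbol(1)[OF smooth_wide compact_wide_support] \<phi> rm w]
      show "integrable lborel (\<lambda>x. g x * \<phi> x)" unfolding g_def by (rule cd(1))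
      have "(CLINT x|lborel. g x * \<phi> x) = lp_block \<psi> j f (mult_op (csym (wide j)) \<phi>)"
        unfolding g_def cd(2) using r mult_op_schwartz[OF smooth_wide compact_wide_support \<phi>] by (simp add: represents_def)
      also have "\<dots> = f (mult_op (\<lambda>u. csym (\<psi> j) u * csym (wide j) u) \<phi>)"
        unfolding lp_block_eq mult_op_mult_op[OF symbol_wide schwartz_integrable[OF \<phi>]] ..
      also have "\<dots> = lp_block \<psi> j f \<phi>"
        unfolding lp_block_eq of_real_mult[symmetric] block_mult_wide ..
      finally show "lp_block \<psi> j f \<phi> = (CLINT x|lborel. g x * \<phi> x)" by simp
    qed
    ultimately show "\<exists>g. bounded_block f j g \<and> (\<forall>x. ennreal (cmod (g x)) \<le> ennreal (C * 2 ^ j) * dist_Lp_norm p (lp_block \<psi> j f))"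
      using gm le unfolding bounded_block_def by blast
  qed
qed

lemma lp_block_linear:
  "lp_block \<psi> j (\<lambda>\<eta>. b * f \<eta> + c * f' \<eta>) \<phi> = b * lp_block \<psi> j f \<phi> + c * lp_block \<psi> j f' \<phi>"
  by (simp add: lp_block_eq)

lemma bounded_block_linear:
  assumes g: "bounded_block f j g" and g': "bounded_block f' j g'"
  shows "bounded_block (\<lambda>\<eta>. b * f \<eta> + c * f' \<eta>) j (\<lambda>x. b * g x + c * g' x)"
proof -
  obtain A where A: "\<And>x. norm (g x) \<le> A" using g by (auto simp: bounded_block_def)
  obtain B where B: "\<And>x. norm (g' x) \<le> B" using g' by (auto simp: bounded_block_def)
  have "norm (b * g x + c * g' x) \<le> norm b * A + norm c * B" for x
    by (rule norm_triangle_mono) (auto simp: norm_mult intro!: mult_left_mono A B)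
  moreover have "represents (\<lambda>x. b * g x + c * g' x) (lp_block \<psi> j (\<lambda>\<eta>. b * f \<eta> + c * f' \<eta>))"
    unfolding represents_def
  proof (intro conjI ballI)
    show "(\<lambda>x. b * g x + c * g' x) \<in> borel_measurable borel" using g g' by (auto simp: bounded_block_def)
    fix \<phi> :: "real \<Rightarrow> complex" assume "\<phi> \<in> schwartz"
    then have "integrable lborel (\<lambda>x. g x * \<phi> x)" "integrable lborel (\<lambda>x. g' x * \<phi> x)"
      "lp_block \<psi> j f \<phi> = (CLINT x|lborel. g x * \<phi> x)" "lp_block \<psi> j f' \<phi> = (CLINT x|lborel. g' x * \<phi> x)"
      using g g' by (auto simp: bounded_block_def represents_def)
    then show "integrable lborel (\<lambda>x. (b * g x + c * g' x) * \<phi> x)"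
      "lp_block \<psi> j (\<lambda>\<eta>. b * f \<eta> + c * f' \<eta>) \<phi> = (CLINT x|lborel. (b * g x + c * g' x) * \<phi> x)"
      by (auto simp: lp_block_linear distrib_right mult.assoc)
  qed
  ultimately show ?thesis
    using g g' unfolding bounded_block_def by auto
qed

end


subsection \<open>Rapid decay of the blocks of a Schwartz function\<close>

text \<open>The operator (1 - d^2/dx^2)^m, whose symbol is (1 + u^2)^m, expanded by the binomial
  theorem.\<close>

definition bessel_op :: "nat \<Rightarrow> (real \<Rightarrow> complex) \<Rightarrow> real \<Rightarrow> complex" where
  "bessel_op m \<phi> x = (\<Sum>i\<le>m. of_nat (m choose i) * ((- 1) ^ i * (vderiv ^^ (2 * i)) \<phi> x))"

lemma inv_fourier_sum:
  assumes "\<And>i. i \<in> I \<Longrightarrow> integrable lborel (f i)"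
  shows "inv_fourier (\<lambda>x. \<Sum>i\<in>I. f i x) u = (\<Sum>i\<in>I. inv_fourier (f i) u)"
proof -
  have "integrable lborel (\<lambda>x. iexp ((- u) * x) * f i x)" if "i \<in> I" for i
    by (rule integrable_iexp_mult[OF assms[OF that]])
  from Bochner_Integration.integral_sum[of I lborel "\<lambda>i x. iexp ((- u) * x) * f i x", OF this]
  show ?thesis by (simp add: inv_fourier_eq fourier_def sum_distrib_left sum_divide_distrib)
qed

lemma inv_fourier_cmult: "inv_fourier (\<lambda>x. c * f x) u = c * inv_fourier f u"
proof -
  have "(CLINT x|lborel. iexp (- (x * u)) * (c * f x)) = (CLINT x|lborel. c * (iexp (- (x * u)) * f x))"
    by (simp only: mult.left_commute)
  then show ?thesis unfolding inv_fourier_def integral_mult_right_zero by simp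
qed

lemma bessel_op_integrable:
  assumes "\<phi> \<in> schwartz" shows "integrable lborel (bessel_op m \<phi>)"
  unfolding bessel_op_def[abs_def]
  by (intro Bochner_Integration.integrable_sum integrable_mult_right schwartz_integrable_funpow assms)

lemma inv_fourier_bessel_op:
  assumes "\<phi> \<in> schwartz"
  shows "inv_fourier (bessel_op m \<phi>) u = (1 + (of_real u)\<^sup>2) ^ m * inv_fourier \<phi> u"
proof -
  have "inv_fourier (bessel_op m \<phi>) u = (\<Sum>i\<le>m. inv_fourier (\<lambda>x. of_nat (m choose i) * ((- 1) ^ i * (vderiv ^^ (2 * i)) \<phi> x)) u)"
    unfolding bessel_op_def[abs_def]
    by (intro inv_fourier_sum integrable_mult_right schwartz_integrable_funpow assms)
  also have "\<dots> = (\<Sum>i\<le>m. of_nat (m choose i) * ((of_real u)\<^sup>2) ^ i * 1 ^ (m - i)) * inv_fourier \<phi> u"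
    unfolding sum_distrib_right
  proof (intro sum.cong refl)
    fix i
    have "(- 1) ^ i * (\<i> * complex_of_real u) ^ (2 * i) = ((of_real u)\<^sup>2) ^ i"
      by (simp add: power_mult power_mult_distrib power_mult_distrib[symmetric])
    then show "inv_fourier (\<lambda>x. of_nat (m choose i) * ((- 1) ^ i * (vderiv ^^ (2 * i)) \<phi> x)) u
        = of_nat (m choose i) * ((of_real u)\<^sup>2) ^ i * 1 ^ (m - i) * inv_fourier \<phi> u"
      by (simp add: inv_fourier_cmult inv_fourier_funpow_vderiv[OF assms] mult.assoc[symmetric])
  qed
  also have "(\<Sum>i\<le>m. of_nat (m choose i) * ((of_real u)\<^sup>2) ^ i * 1 ^ (m - i)) = ((of_real u)\<^sup>2 + 1 :: complex) ^ m"
    by (rule binomial_ring[symmetric])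
  finally show ?thesis by (simp add: add.commute)
qed

lemma schwartz_norm_mono:
  assumes "f \<in> schwartz" "N \<le> N'" shows "schwartz_norm N f \<le> schwartz_norm N' f"
proof -
  let ?s = "\<lambda>k n. SUP x. norm (x ^ k *\<^sub>R (vderiv ^^ n) f x)"
  have nn: "0 \<le> ?s k n" for k n
  proof -
    obtain B where "\<And>x. norm (x ^ k *\<^sub>R (vderiv ^^ n) f x) \<le> B" using schwartz_bound[OF assms(1)] by metis
    then have "bdd_above (range (\<lambda>x. norm (x ^ k *\<^sub>R (vderiv ^^ n) f x)))" by (intro bdd_aboveI2[of _ _ B])
    then show ?thesis by (rule cSUP_upper2[of _ _ 0]) auto
  qed
  have "schwartz_norm N f \<le> (\<Sum>k\<le>N. \<Sum>n\<le>N'. ?s k n)"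
    unfolding schwartz_norm_def using assms(2) nn by (intro sum_mono sum_mono2) auto
  also have "\<dots> \<le> (\<Sum>k\<le>N'. \<Sum>n\<le>N'. ?s k n)"
    using assms(2) nn by (intro sum_mono2 sum_nonneg) auto
  finally show ?thesis by (simp add: schwartz_norm_def)
qed

lemma bessel_op_L1_bound:
  assumes "\<phi> \<in> schwartz"
  shows "(LINT x|lborel. norm (bessel_op m \<phi> x)) \<le> 2 ^ m * (2 * pi) * schwartz_norm (2 * m + 2) \<phi>"
proof -
  let ?t = "\<lambda>i x. of_nat (m choose i) * ((- 1) ^ i * (vderiv ^^ (2 * i)) \<phi> x)"
  have i: "integrable lborel (?t i)" for i
    by (intro integrable_mult_right schwartz_integrable_funpow assms)
  have "(LINT x|lborel. norm (bessel_op m \<phi> x)) \<le> (LINT x|lborel. (\<Sum>i\<le>m. norm (?t i x)))"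
    by (intro integral_mono integrable_norm bessel_op_integrable assms Bochner_Integration.integrable_sum i)
       (simp add: bessel_op_def norm_sum)
  also have "\<dots> = (\<Sum>i\<le>m. (LINT x|lborel. norm (?t i x)))"
    by (intro Bochner_Integration.integral_sum integrable_norm i)
  also have "\<dots> \<le> (\<Sum>i\<le>m. real (m choose i) * (2 * pi * schwartz_norm (2 * m + 2) \<phi>))"
  proof (rule sum_mono)
    fix i assume "i \<in> {..m}"
    then have "schwartz_norm (2 * i + 2) \<phi> \<le> schwartz_norm (2 * m + 2) \<phi>" by (intro schwartz_norm_mono assms) auto
    then have "2 * pi * schwartz_norm (2 * i + 2) \<phi> \<le> 2 * pi * schwartz_norm (2 * m + 2) \<phi>" by (intro mult_left_mono) auto
    with schwartz_integrable_funpow(2)[OF assms, of "2 * i"]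
    have "(LINT x|lborel. norm ((vderiv ^^ (2 * i)) \<phi> x)) \<le> 2 * pi * schwartz_norm (2 * m + 2) \<phi>" by linarith
    then show "(LINT x|lborel. norm (?t i x)) \<le> real (m choose i) * (2 * pi * schwartz_norm (2 * m + 2) \<phi>)"
      by (simp add: norm_mult norm_power mult_left_mono)
  qed
  also have "\<dots> = (\<Sum>i\<le>m. real (m choose i)) * (2 * pi * schwartz_norm (2 * m + 2) \<phi>)" by (simp add: sum_distrib_right)
  also have "(\<Sum>i\<le>m. real (m choose i)) = 2 ^ m"
    unfolding of_nat_sum[symmetric] choose_row_sum by simp
  finally show ?thesis by (simp add: mult_ac)
qed

context dyadic
begin

text \<open>The identity (1 + u^2)^(-m) (1 + u^2)^m = 1 is inserted in frequency. The second factor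
  is \<open>bessel_op m\<close> and goes to \<phi>, where it costs a seminorm; the first is of order
  4^(-jm) on the j-th ring, together with its first two derivatives.\<close>

lemma wide_mult_op_decay:
  obtains C where "0 < C" "\<And>j \<phi>. \<phi> \<in> schwartz \<Longrightarrow>
    (LINT x|lborel. norm (mult_op (csym (wide j)) \<phi> x)) \<le> C * 2 ^ j * (1 / 4 ^ j) ^ m * schwartz_norm (2 * m + 2) \<phi>"
proof -
  obtain C0 where C0: "0 < C0" "\<And>k e e1 e2 A.
     (\<And>u. (e has_vector_derivative e1 u) (at u)) \<Longrightarrow> (\<And>u. (e1 has_vector_derivative e2 u) (at u)) \<Longrightarrow>
     continuous_on UNIV e2 \<Longrightarrow>
     (\<And>u. \<bar>u\<bar> \<le> 8 * 2 ^ k \<Longrightarrow> k \<le> 2 \<or> 2 ^ k \<le> 8 * \<bar>u\<bar> \<Longrightarrow> norm (e u) \<le> A \<and> norm (e1 u) \<le> A \<and> norm (e2 u) \<le> (A::real)) \<Longrightarrow>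
     integrable lborel (inv_fourier (\<lambda>u. of_real (wide k u) * e u)) \<and>
     (LINT x|lborel. norm (inv_fourier (\<lambda>u. of_real (wide k u) * e u) x)) \<le> C0 * 2 ^ k * A"
    using wide_kernel_bound by blast
  define q where "q u = inverse (1 + u\<^sup>2)" for u :: real
  have pos: "0 < 1 + u\<^sup>2" for u :: real by (simp add: add_pos_nonneg)
  have q: "0 < q u" "q u \<le> 1" "u\<^sup>2 * q u \<le> 1" "\<bar>u\<bar> * q u \<le> 1" for u
  proof -
    show "0 < q u" using pos[of u] by (simp add: q_def)
    show "q u \<le> 1" unfolding q_def by (rule inverse_le_1_iff[THEN iffD2]) simp
    show "u\<^sup>2 * q u \<le> 1" using pos[of u] by (simp add: q_def divide_inverse[symmetric])
    have "0 \<le> (\<bar>u\<bar> - 1)\<^sup>2 + \<bar>u\<bar>" by simp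
    then have "\<bar>u\<bar> \<le> 1 + u\<^sup>2" by (simp add: power2_eq_square algebra_simps)
    then show "\<bar>u\<bar> * q u \<le> 1" using pos[of u] by (simp add: q_def divide_inverse[symmetric])
  qed
  have dq: "(q has_real_derivative - (2 * u * (q u * q u))) (at u)" for u
    unfolding q_def using pos[of u]
    by (auto intro!: derivative_eq_intros simp: power2_eq_square)
  define e where "e u = q u ^ m" for u
  define e1 where "e1 u = - (2 * real m * u * q u ^ (m + 1))" for u
  define e2 where "e2 u = - (2 * real m * q u ^ (m + 1)) + 4 * real m * real (m + 1) * (u\<^sup>2 * q u ^ (m + 2))" for u
  have d1: "(e has_real_derivative e1 u) (at u)" for u
  proof (cases m)
    case 0
    then show ?thesis by (simp add: e_def[abs_def] e1_def)
  next
    case (Suc n)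
    show ?thesis unfolding e_def[abs_def] e1_def using DERIV_power[OF dq, of m u] Suc
      by (simp add: algebra_simps del: of_nat_Suc)
  qed
  have d2: "(e1 has_real_derivative e2 u) (at u)" for u
  proof -
    have "((\<lambda>u. q u ^ (m + 1)) has_real_derivative real (m + 1) * (- (2 * u * (q u * q u)) * q u ^ m)) (at u)"
      using DERIV_power[OF dq, of "m + 1" u] by simp
    from DERIV_mult[OF DERIV_cmult_Id[of "- (2 * real m)"] this]
    show ?thesis unfolding e1_def[abs_def] e2_def
      by (simp add: algebra_simps power2_eq_square del: of_nat_Suc)
  qed
  \<comment> \<open>Chosen so that \<open>e\<close> and both derivatives are at most
    \<open>c * q u ^ m\<close>: differentiation produces only factors \<open>q u\<close>,
    \<open>u * q u\<close> and \<open>u\<^sup>2 * q u\<close>, all at most 1 in absolute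
    value.\<close>
  define c where "c = 1 + 2 * real m + 4 * real m * real (m + 1)"
  have c1: "1 \<le> c" by (simp add: c_def)
  have eb: "\<bar>e u\<bar> \<le> c * q u ^ m" "\<bar>e1 u\<bar> \<le> c * q u ^ m" "\<bar>e2 u\<bar> \<le> c * q u ^ m" for u
  proof -
    have qm: "0 \<le> q u ^ m" using q(1)[of u] by simp
    have "\<bar>e u\<bar> = 1 * q u ^ m" using qm by (simp add: e_def)
    also have "\<dots> \<le> c * q u ^ m" by (rule mult_right_mono[OF c1 qm])
    finally show "\<bar>e u\<bar> \<le> c * q u ^ m" .
    have "\<bar>e1 u\<bar> = 2 * real m * (\<bar>u\<bar> * q u) * q u ^ m" using q(1)[of u] by (simp add: e1_def abs_mult power_abs)
    also have "\<dots> \<le> 2 * real m * 1 * q u ^ m" by (intro mult_right_mono mult_left_mono q qm) auto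
    also have "\<dots> \<le> c * q u ^ m" by (intro mult_right_mono qm) (simp add: c_def)
    finally show "\<bar>e1 u\<bar> \<le> c * q u ^ m" .
    have "\<bar>e2 u\<bar> \<le> 2 * real m * (q u * q u ^ m) + 4 * real m * real (m + 1) * ((u\<^sup>2 * q u) * q u * q u ^ m)"
    proof -
      have "\<bar>e2 u\<bar> \<le> \<bar>2 * real m * q u ^ (m + 1)\<bar> + \<bar>4 * real m * real (m + 1) * (u\<^sup>2 * q u ^ (m + 2))\<bar>"
        unfolding e2_def by linarith
      also have "\<dots> = 2 * real m * (q u * q u ^ m) + 4 * real m * real (m + 1) * ((u\<^sup>2 * q u) * q u * q u ^ m)"
        using q(1)[of u] by (simp add: abs_mult power_abs power_add power2_eq_square mult_ac)
      finally show ?thesis .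
    qed
    also have "\<dots> \<le> 2 * real m * (1 * q u ^ m) + 4 * real m * real (m + 1) * (1 * 1 * q u ^ m)"
      using q(1)[of u] by (intro add_mono mult_left_mono mult_right_mono mult_mono q qm) auto
    also have "\<dots> \<le> c * q u ^ m" using qm by (simp add: c_def algebra_simps)
    finally show "\<bar>e2 u\<bar> \<le> c * q u ^ m" .
  qed
  have kern: "integrable lborel (inv_fourier (\<lambda>u. of_real (wide k u) * of_real (e u))) \<and>
     (LINT x|lborel. norm (inv_fourier (\<lambda>u. of_real (wide k u) * complex_of_real (e u)) x)) \<le> C0 * 2 ^ k * (c * (64 / 4 ^ k) ^ m)" for k
  proof (rule C0(2))
    show "((\<lambda>u. complex_of_real (e u)) has_vector_derivative of_real (e1 u)) (at u)" for u
      by (rule bounded_linear.has_vector_derivative[OF bounded_linear_of_real])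
         (use d1 in \<open>simp add: has_real_derivative_iff_has_vector_derivative\<close>)
    show "((\<lambda>u. complex_of_real (e1 u)) has_vector_derivative of_real (e2 u)) (at u)" for u
      by (rule bounded_linear.has_vector_derivative[OF bounded_linear_of_real])
         (use d2 in \<open>simp add: has_real_derivative_iff_has_vector_derivative\<close>)
    have "continuous_on UNIV q" unfolding q_def using pos by (intro continuous_intros) (auto simp: less_imp_neq[symmetric])
    then show "continuous_on UNIV (\<lambda>u. complex_of_real (e2 u))"
      unfolding e2_def by (intro continuous_intros)
    fix u :: real assume u: "\<bar>u\<bar> \<le> 8 * 2 ^ k" "k \<le> 2 \<or> 2 ^ k \<le> 8 * \<bar>u\<bar>"
    \<comment> \<open>On the ring 2^k is at most 8|u|, and squaring gives 64; for k \<le> 2 the left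
      side is at most 16.\<close>
    have "(4::real) ^ k \<le> 64 * (1 + u\<^sup>2)"
    proof (cases "k \<le> 2")
      case True
      then have "(4::real) ^ k \<le> 4 ^ 2" by (intro power_increasing) auto
      then show ?thesis by (simp add: add_increasing2)
    next
      case False
      then have "(2 ^ k)\<^sup>2 \<le> (8 * \<bar>u\<bar>)\<^sup>2" using u by (intro power_mono) auto
      then show ?thesis by (simp add: power_mult_distrib power2_eq_square[of "2 ^ k"] power_mult_distrib[symmetric])
    qed
    then have "q u \<le> 64 / 4 ^ k" using pos[of u] by (simp add: q_def field_simps)
    then have "c * q u ^ m \<le> c * (64 / 4 ^ k) ^ m" using c1 q(1)[of u] by (intro mult_left_mono power_mono) auto
    then show "norm (complex_of_real (e u)) \<le> c * (64 / 4 ^ k) ^ m \<and> norm (complex_of_real (e1 u)) \<le> c * (64 / 4 ^ k) ^ m \<and>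
        norm (complex_of_real (e2 u)) \<le> c * (64 / 4 ^ k) ^ m"
      using eb[of u] by auto
  qed
  define C where "C = C0 * c * 64 ^ m * (2 ^ m * (2 * pi))"
  show ?thesis
  proof (rule that[of C])
    show "0 < C" using C0(1) c1 by (simp add: C_def)
    fix j and \<phi> :: "real \<Rightarrow> complex" assume \<phi>: "\<phi> \<in> schwartz"
    let ?b = "\<lambda>u. of_real (wide j u) * complex_of_real (e u)"
    have bi: "integrable lborel ?b"
    proof (rule continuous_compact_support_integrable)
      have "continuous_on UNIV e" using d1 by (meson DERIV_isCont continuous_at_imp_continuous_on)
      then show "continuous_on UNIV ?b" by (intro continuous_intros smooth_continuous_on[OF smooth_wide])
      show "?b u = 0" if "u \<notin> {- (8 * 2 ^ j)..8 * 2 ^ j}" for u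
        using wide_support(1)[of j u] that by (fastforce simp: abs_le_iff)
    qed
    have eq: "mult_op (csym (wide j)) \<phi> = mult_op ?b (bessel_op m \<phi>)"
    proof -
      have "?b u * inv_fourier (bessel_op m \<phi>) u = csym (wide j) u * inv_fourier \<phi> u" for u
      proof -
        have "complex_of_real (e u) * (1 + (of_real u)\<^sup>2) ^ m = of_real ((q u * (1 + u\<^sup>2)) ^ m)"
          by (simp add: e_def power_mult_distrib)
        also have "\<dots> = 1" using pos[of u] by (simp add: q_def)
        finally have "complex_of_real (e u) * (1 + (of_real u)\<^sup>2) ^ m = 1" .
        then show ?thesis unfolding inv_fourier_bessel_op[OF \<phi>]
          by (metis (no_types, lifting) mult.assoc mult.right_neutral)
      qed
      then show ?thesis unfolding mult_op_def by (simp only:)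
    qed
    have "(LINT x|lborel. norm (mult_op (csym (wide j)) \<phi> x))
        \<le> (LINT x|lborel. norm (inv_fourier ?b x)) * (LINT x|lborel. norm (bessel_op m \<phi> x))"
      unfolding eq by (rule mult_op_L1(2)[OF bi _ bessel_op_integrable[OF \<phi>]]) (use kern in blast)
    also have "\<dots> \<le> (C0 * 2 ^ j * (c * (64 / 4 ^ j) ^ m)) * (2 ^ m * (2 * pi) * schwartz_norm (2 * m + 2) \<phi>)"
      using kern[of j] bessel_op_L1_bound[OF \<phi>, of m] C0(1) c1 by (intro mult_mono) (auto intro!: integral_nonneg_AE)
    also have "\<dots> = C * 2 ^ j * (1 / 4 ^ j) ^ m * schwartz_norm (2 * m + 2) \<phi>"
      by (simp add: C_def power_divide mult_ac)
    finally show "(LINT x|lborel. norm (mult_op (csym (wide j)) \<phi> x)) \<le> C * 2 ^ j * (1 / 4 ^ j) ^ m * schwartz_norm (2 * m + 2) \<phi>" .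
  qed
qed

end

section \<open>Multipliers of polynomial growth\<close>

text \<open>Replaces the representative chosen by \<open>fun_of\<close>, which may be unbounded on a
  null set, by a bounded one; the convolutions agree everywhere.\<close>

lemma (in dyadic) multiplier_term_eq_symbol:
  assumes b: "fourier_symbol (\<lambda>u. complex_of_real (\<psi>' j u) * a u)" and g: "bounded_block f j g" and h: "integrable lborel h"
  shows "integrable lborel (\<lambda>x. conv (multiplier_kernel \<psi>' a j) (fun_of (lp_block \<psi> j f)) x * h x)"
    "multiplier_term \<psi> \<psi>' a f j h = (CLINT x|lborel. g x * mult_op (\<lambda>u. complex_of_real (\<psi>' j u) * a u) h x)"
proof -
  have r: "represents g (lp_block \<psi> j f)" using g by (simp add: bounded_block_def)
  have e: "conv (multiplier_kernel \<psi>' a j) (fun_of (lp_block \<psi> j f)) = conv (inv_fourier (\<lambda>u. complex_of_real (\<psi>' j u) * a u)) g"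
    unfolding multiplier_kernel_def
    using represents_unique[OF represents_fun_of[OF r] r] represents_fun_of[OF r] r fourier_symbolD(3)[OF b]
    by (intro conv_cong_AE) (auto simp: represents_def)
  show "integrable lborel (\<lambda>x. conv (multiplier_kernel \<psi>' a j) (fun_of (lp_block \<psi> j f)) x * h x)"
    unfolding e by (rule bounded_block_conv(1)[OF g b h])
  show "multiplier_term \<psi> \<psi>' a f j h = (CLINT x|lborel. g x * mult_op (\<lambda>u. complex_of_real (\<psi>' j u) * a u) h x)"
    unfolding multiplier_term_def e by (rule bounded_block_conv(2)[OF g b h])
qed

lemma cutoffs_mult:
  assumes "cutoffs \<psi> \<psi>'" shows "\<psi> j u * \<psi>' j u = \<psi> j u"
proof (cases "\<psi> j u = 0")
  case False
  then have "u \<in> fsupport (\<psi> j)" using fsupport_eq_0[of u "\<psi> j"] by blast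
  then show ?thesis using assms by (simp add: cutoffs_def)
qed simp

text \<open>Quantitative control is required only for the cutoffs \<open>wide k\<close>. For all
  others integrability of the kernel suffices, because changing the cutoff does not change the
  pairing with a block.\<close>

locale polynomial_multiplier = dyadic +
  fixes \<psi>' :: "nat \<Rightarrow> real \<Rightarrow> real" and a :: "real \<Rightarrow> complex" and \<alpha> C\<^sub>a :: real
  assumes cutoffs: "cutoffs \<psi> \<psi>'"
    and cont: "continuous_on UNIV a"
    and local_kernel: "\<And>\<rho>. smooth \<rho> \<Longrightarrow> compact (fsupport \<rho>) \<Longrightarrow>
      integrable lborel (inv_fourier (\<lambda>u. complex_of_real (\<rho> u) * a u))"
    and C\<^sub>a: "0 < C\<^sub>a"
    and kernel_bound: "\<And>k. (LINT x|lborel. norm (inv_fourier (\<lambda>u. complex_of_real (wide k u) * a u) x))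
      \<le> C\<^sub>a * 2 powr (\<alpha> * real k)"
begin

lemma cutoff_smooth: "smooth (\<psi>' j)" "compact (fsupport (\<psi>' j))"
  using cutoffs by (auto simp: cutoffs_def)

lemmas block_mult_cutoff = cutoffs_mult[OF cutoffs]

lemma local_symbol:
  assumes "smooth \<rho>" "compact (fsupport \<rho>)"
  shows "fourier_symbol (\<lambda>u. complex_of_real (\<rho> u) * a u)"
proof -
  obtain R where "\<And>x. R \<le> \<bar>x\<bar> \<Longrightarrow> \<rho> x = 0" using compact_fsupportD[OF assms(2)] by metis
  then have "\<exists>R. \<forall>u. R \<le> \<bar>u\<bar> \<longrightarrow> complex_of_real (\<rho> u) * a u = 0" by auto
  moreover have "continuous_on UNIV (\<lambda>u. complex_of_real (\<rho> u) * a u)"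
    by (intro continuous_intros smooth_continuous_on[OF assms(1)] cont)
  ultimately show ?thesis using local_kernel[OF assms] by (simp add: fourier_symbol_def)
qed

abbreviation cutoff_symbol :: "nat \<Rightarrow> real \<Rightarrow> complex" where
  "cutoff_symbol j \<equiv> (\<lambda>u. complex_of_real (\<psi>' j u) * a u)"

abbreviation wide_symbol :: "nat \<Rightarrow> real \<Rightarrow> complex" where
  "wide_symbol j \<equiv> (\<lambda>u. complex_of_real (wide j u) * a u)"

lemmas symbol_cutoff = local_symbol[OF cutoff_smooth]

lemmas symbol_wide_symbol = local_symbol[OF smooth_wide compact_wide_support]

lemma multiplier_term_eq:
  assumes "bounded_block f j g" "integrable lborel h"
  shows "multiplier_term \<psi> \<psi>' a f j h = (CLINT x|lborel. g x * mult_op (cutoff_symbol j) h x)"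
  by (rule multiplier_term_eq_symbol(2)[OF symbol_cutoff assms])

text \<open>The choice of the cutoffs is immaterial, since each of them reproduces the blocks.\<close>

lemma pairing_cutoff_eq_wide:
  assumes g: "bounded_block f j g" and h: "integrable lborel h"
  shows "(CLINT x|lborel. g x * mult_op (cutoff_symbol j) h x) = (CLINT x|lborel. g x * mult_op (wide_symbol j) h x)"
proof -
  have i: "integrable lborel (mult_op (cutoff_symbol j) h)" "integrable lborel (mult_op (wide_symbol j) h)"
    by (intro mult_op_integrable symbol_cutoff symbol_wide_symbol h)+
  have "mult_op (csym (wide j)) (mult_op (cutoff_symbol j) h) = mult_op (csym (\<psi>' j)) (mult_op (wide_symbol j) h)"
    unfolding mult_op_mult_op[OF symbol_cutoff h] mult_op_mult_op[OF symbol_wide_symbol h]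
    by (simp only: mult.left_commute)
  then show ?thesis
    using pairing_reproduce[OF g smooth_wide compact_wide_support block_mult_wide i(1)]
      pairing_reproduce[OF g cutoff_smooth block_mult_cutoff i(2)] by simp
qed

text \<open>In each term the blocks j and k exchange roles; then only \<open>\<psi> j\<close> still
  depends on \<open>j\<close>, and the sum over j is 1 where \<open>\<psi> k\<close> is nonzero. So
  the multiplier acts block by block.\<close>

lemma block_of_multiplier:
  assumes f: "tempered f" and g: "\<And>j. bounded_block f j (g j)" and \<phi>: "\<phi> \<in> schwartz"
  shows "lp_block \<psi> k (multiplier_op \<psi> \<psi>' a f) \<phi> = (CLINT x|lborel. g k x * mult_op (cutoff_symbol k) \<phi> x)"
proof -
  let ?h = "mult_op (csym (\<psi> k)) \<phi>"
  have hi: "integrable lborel \<phi>" "integrable lborel ?h"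
    using \<phi> by (auto intro: schwartz_integrable mult_op_integrable[OF symbol_block])
  have ci: "integrable lborel (mult_op (cutoff_symbol j) \<phi>)" for j
    by (intro mult_op_integrable symbol_cutoff hi)
  let ?H = "mult_op (cutoff_symbol k) \<phi>"
  have t: "multiplier_term \<psi> \<psi>' a f j ?h = (CLINT x|lborel. g j x * mult_op (csym (\<psi> k)) (mult_op (cutoff_symbol j) \<phi>) x)" for j
  proof -
    have "mult_op (cutoff_symbol j) ?h = mult_op (csym (\<psi> k)) (mult_op (cutoff_symbol j) \<phi>)"
      unfolding mult_op_mult_op[OF symbol_cutoff hi(1)] mult_op_mult_op[OF symbol_block hi(1)]
      by (simp only: mult.commute)
    then show ?thesis unfolding multiplier_term_eq[OF g hi(2)] by simp
  qed
  \<comment> \<open>First the bounded functions are swapped, then \<open>\<psi>' k\<close> is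
    inserted for free at \<open>g k\<close>, and finally \<open>\<psi>' j\<close> is dropped next to
    \<open>\<psi> j\<close>.\<close>
  have exch: "(CLINT x|lborel. g j x * mult_op (csym (\<psi> k)) (mult_op (cutoff_symbol j) \<phi>) x)
      = (CLINT x|lborel. g k x * mult_op (csym (\<psi> j)) ?H x)" for j
  proof -
    let ?P = "mult_op (csym (\<psi> j)) (mult_op (cutoff_symbol j) \<phi>)"
    have Pi: "integrable lborel ?P" by (intro mult_op_integrable symbol_block ci)
    have "(CLINT x|lborel. g j x * mult_op (csym (\<psi> k)) (mult_op (cutoff_symbol j) \<phi>) x) = (CLINT x|lborel. g k x * ?P x)"
      by (rule pairing_exchange[OF g g ci])
    also have "\<dots> = (CLINT x|lborel. g k x * mult_op (csym (\<psi>' k)) ?P x)"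
      by (rule pairing_reproduce[OF g cutoff_smooth block_mult_cutoff Pi, symmetric])
    also have "mult_op (csym (\<psi>' k)) ?P = mult_op (csym (\<psi> j)) ?H"
    proof -
      have "mult_op (csym (\<psi>' k)) ?P = mult_op (\<lambda>u. csym (\<psi>' k) u * csym (\<psi> j) u * (csym (\<psi>' j) u * a u)) \<phi>"
        by (rule trans[OF mult_op_mult_op[OF symbol_block ci] mult_op_mult_op[OF symbol_cutoff hi(1)]])
      also have "(\<lambda>u. csym (\<psi>' k) u * csym (\<psi> j) u * (csym (\<psi>' j) u * a u)) = (\<lambda>u. csym (\<psi> j) u * (csym (\<psi>' k) u * a u))"
      proof
        fix u
        have "csym (\<psi> j) u * csym (\<psi>' j) u = csym (\<psi> j) u"
          unfolding of_real_mult[symmetric] block_mult_cutoff ..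
        then show "csym (\<psi>' k) u * csym (\<psi> j) u * (csym (\<psi>' j) u * a u) = csym (\<psi> j) u * (csym (\<psi>' k) u * a u)"
          by (metis (no_types, lifting) mult.assoc mult.commute)
      qed
      also have "mult_op (\<lambda>u. csym (\<psi> j) u * (csym (\<psi>' k) u * a u)) \<phi> = mult_op (csym (\<psi> j)) ?H"
        unfolding mult_op_mult_op[OF symbol_cutoff hi(1)] ..
      finally show ?thesis .
    qed
    finally show ?thesis .
  qed
  \<comment> \<open>Only large j need to be excluded: the aim is a finite sum, not one over the
    neighbours of k.\<close>
  have zero: "multiplier_term \<psi> \<psi>' a f j ?h = 0" if "j \<notin> {..<k + 3}" for j
  proof -
    have "\<psi> j u * \<psi> k u = 0" for u
      using blocks_overlap[of j u k] that by fastforce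
    then show ?thesis unfolding t by (rule pairing_disjoint[OF f g _ ci])
  qed
  have "lp_block \<psi> k (multiplier_op \<psi> \<psi>' a f) \<phi> = (\<Sum>j. multiplier_term \<psi> \<psi>' a f j ?h)"
    by (simp add: lp_block_eq multiplier_op_def)
  also have "\<dots> = (\<Sum>j<k + 3. multiplier_term \<psi> \<psi>' a f j ?h)"
    by (rule suminf_finite) (use zero in auto)
  also have "\<dots> = (\<Sum>j<k + 3. (CLINT x|lborel. g k x * mult_op (csym (\<psi> j)) ?H x))"
    unfolding t exch ..
  also have "\<dots> = (CLINT x|lborel. (\<Sum>j<k + 3. g k x * mult_op (csym (\<psi> j)) ?H x))"
    by (intro Bochner_Integration.integral_sum[symmetric] bounded_block_integrable[OF g] mult_op_integrable symbol_block ci)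
  also have "\<dots> = (CLINT x|lborel. g k x * mult_op (csym (\<lambda>u. \<Sum>j<k + 3. \<psi> j u)) ?H x)"
  proof -
    have "mult_op (csym (\<lambda>u. \<Sum>j<k + 3. \<psi> j u)) ?H x = (\<Sum>j<k + 3. mult_op (csym (\<psi> j)) ?H x)" for x
      unfolding of_real_sum by (rule mult_op_sum[OF symbol_block ci])
    then show ?thesis by (simp only: sum_distrib_left)
  qed
  also have "\<dots> = (CLINT x|lborel. g k x * ?H x)"
  proof (rule pairing_reproduce[OF g _ _ _ ci])
    show "smooth (\<lambda>u. \<Sum>j<k + 3. \<psi> j u)" by (intro smooth_sum smooth_block)
    have "(\<Sum>j<k + 3. \<psi> j u) = 0" if "u \<notin> {- (2 * 2 ^ (k + 3))..2 * 2 ^ (k + 3)}" for u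
    proof (rule sum.neutral, rule ballI)
      fix j assume j: "j \<in> {..<k + 3}"
      have "2 * 2 ^ (k + 3) < \<bar>u\<bar>" using that by (auto simp: abs_le_iff not_le)
      moreover have "(2::real) ^ j \<le> 2 ^ (k + 3)" using j by (intro power_increasing) auto
      ultimately show "\<psi> j u = 0" using block_support(1)[of j u] by fastforce
    qed
    then show "compact (fsupport (\<lambda>u. \<Sum>j<k + 3. \<psi> j u))" by (rule compact_fsupport)
    show "\<psi> k u * (\<Sum>j<k + 3. \<psi> j u) = \<psi> k u" for u
      using lower_sum_eq_1[of k u] by (cases "\<psi> k u = 0") auto
  qed
  finally show ?thesis .
qed

text \<open>The cutoff \<open>wide j\<close> is inserted a second time, so that one copy tames the
  kernel of \<open>a\<close> and the other is left to localise \<phi>.\<close>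

lemma multiplier_term_bound:
  assumes g: "bounded_block f j g" "\<And>x. norm (g x) \<le> B" and \<phi>: "integrable lborel \<phi>"
  shows "norm (multiplier_term \<psi> \<psi>' a f j \<phi>)
    \<le> B * (C\<^sub>a * 2 powr (\<alpha> * real j) * (LINT x|lborel. norm (mult_op (csym (wide j)) \<phi> x)))"
proof -
  have i: "integrable lborel (mult_op (wide_symbol j) \<phi>)" "integrable lborel (mult_op (csym (wide j)) \<phi>)"
    by (intro mult_op_integrable symbol_wide symbol_wide_symbol \<phi>)+
  let ?h = "mult_op (wide_symbol j) (mult_op (csym (wide j)) \<phi>)"
  have hi: "integrable lborel ?h" by (intro mult_op_integrable symbol_wide_symbol i)
  have "multiplier_term \<psi> \<psi>' a f j \<phi> = (CLINT x|lborel. g x * mult_op (csym (wide j)) (mult_op (wide_symbol j) \<phi>) x)"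
    unfolding multiplier_term_eq[OF g(1) \<phi>] pairing_cutoff_eq_wide[OF g(1) \<phi>]
    by (rule pairing_reproduce[OF g(1) smooth_wide compact_wide_support block_mult_wide i(1), symmetric])
  also have "mult_op (csym (wide j)) (mult_op (wide_symbol j) \<phi>) = ?h"
    unfolding mult_op_mult_op[OF symbol_wide_symbol \<phi>] mult_op_mult_op[OF symbol_wide \<phi>]
    by (simp only: mult.commute)
  finally have "norm (multiplier_term \<psi> \<psi>' a f j \<phi>) \<le> B * (LINT x|lborel. norm (?h x))"
    using norm_integral_bounded_mult_le(2)[OF _ g(2) hi] g(1) by (simp add: bounded_block_def)
  also have "\<dots> \<le> B * ((LINT x|lborel. norm (inv_fourier (wide_symbol j) x)) * (LINT x|lborel. norm (mult_op (csym (wide j)) \<phi> x)))"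
    using order_trans[OF norm_ge_zero g(2)]
    by (intro mult_left_mono mult_op_L1(2) fourier_symbolD symbol_wide_symbol i) auto
  also have "\<dots> \<le> B * (C\<^sub>a * 2 powr (\<alpha> * real j) * (LINT x|lborel. norm (mult_op (csym (wide j)) \<phi> x)))"
    using order_trans[OF norm_ge_zero g(2)]
    by (intro mult_left_mono mult_right_mono kernel_bound integral_nonneg_AE) auto
  finally show ?thesis .
qed

text \<open>An l^q norm dominates each of its terms, so the weighted block norms are bounded;
  Bernstein's inequality turns this into pointwise bounds.\<close>

lemma besov_blocks:
  assumes p: "1 \<le> p" and q: "1 \<le> q" and f: "f \<in> besov \<psi> s p q"
  obtains g N where "\<And>j. bounded_block f j (g j)" "0 \<le> N" "\<And>j x. norm (g j x) \<le> N * 2 ^ j * 2 powr (- s * real j)"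
proof -
  obtain C where C: "0 < C" "\<And>f j p. 1 \<le> p \<Longrightarrow> dist_Lp_norm p (lp_block \<psi> j f) < \<infinity> \<Longrightarrow>
    \<exists>g. bounded_block f j g \<and> (\<forall>x. ennreal (cmod (g x)) \<le> ennreal (C * 2 ^ j) * dist_Lp_norm p (lp_block \<psi> j f))"
    using ex_bounded_block by blast
  let ?D = "\<lambda>j. dist_Lp_norm p (lp_block \<psi> j f)"
  have fin: "besov_norm \<psi> s p q f < \<infinity>" using f by (simp add: besov_def)
  then obtain N where N: "0 \<le> N" "besov_norm \<psi> s p q f = ennreal N"
    by (cases "besov_norm \<psi> s p q f") auto
  have le: "ennreal (2 powr (s * real j)) * ?D j \<le> ennreal N" for j
    using le_Lp_norm_count_space[OF q, of "\<lambda>j. ennreal (2 powr (s * real j)) * ?D j" j] N(2)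
    by (simp add: besov_norm_def)
  have D: "?D j \<le> ennreal (N * 2 powr (- s * real j))" for j
  proof -
    have "ennreal (2 powr (- s * real j)) * ennreal (2 powr (s * real j)) = 1"
      by (simp add: ennreal_mult[symmetric] powr_add[symmetric])
    then have "?D j = ennreal (2 powr (- s * real j)) * (ennreal (2 powr (s * real j)) * ?D j)"
      by (simp only: mult.assoc[symmetric] mult_1_left)
    also have "\<dots> \<le> ennreal (2 powr (- s * real j)) * ennreal N"
      by (intro mult_left_mono le) auto
    also have "\<dots> = ennreal (N * 2 powr (- s * real j))"
      using N(1) by (simp only: ennreal_mult'[symmetric] mult.commute)
    finally show ?thesis .
  qed
  then have Dfin: "?D j < \<infinity>" for j by (rule order.strict_trans1) simp
  obtain g where g: "\<And>j. bounded_block f j (g j)" "\<And>j x. ennreal (cmod (g j x)) \<le> ennreal (C * 2 ^ j) * ?D j"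
    using C(2)[OF p Dfin] by metis
  have "norm (g j x) \<le> (C * N) * 2 ^ j * 2 powr (- s * real j)" for j x
  proof -
    have "ennreal (cmod (g j x)) \<le> ennreal (C * 2 ^ j) * ennreal (N * 2 powr (- s * real j))"
      by (rule order_trans[OF g(2)]) (intro mult_left_mono D, simp)
    also have "\<dots> = ennreal ((C * N) * 2 ^ j * 2 powr (- s * real j))"
      using C(1) N(1) by (simp add: ennreal_mult[symmetric] mult_ac)
    finally show ?thesis using C(1) N(1) by (simp add: ennreal_le_iff)
  qed
  then show ?thesis using g(1) C(1) N(1) by (intro that[of g "C * N"]) auto
qed

text \<open>A bound through a seminorm of \<phi>, with geometric decay in j, yields both convergence
  of the series and temperedness of its sum.\<close>

lemma multiplier_term_decay:
  assumes p: "1 \<le> p" and q: "1 \<le> q" and f: "f \<in> besov \<psi> s p q"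
  obtains C m where "0 \<le> C" "\<And>j \<phi>. \<phi> \<in> schwartz \<Longrightarrow>
    norm (multiplier_term \<psi> \<psi>' a f j \<phi>) \<le> C * schwartz_norm m \<phi> * (1 / 2) ^ j"
proof -
  obtain g N where g: "\<And>j. bounded_block f j (g j)" and N: "0 \<le> N"
    and b: "\<And>j x. norm (g j x) \<le> N * 2 ^ j * 2 powr (- s * real j)"
    using besov_blocks[OF p q f] by metis
  \<comment> \<open>Large enough for 2 m to be at least 3 - s + \<alpha>, so that 4^(-jm) outweighs
    all other powers of 2^j and leaves at most 2^(-j).\<close>
  obtain m :: nat where m: "3 - s + \<alpha> \<le> real m" using real_arch_simple by blast
  obtain C where C: "0 < C" "\<And>j \<phi>. \<phi> \<in> schwartz \<Longrightarrow>
    (LINT x|lborel. norm (mult_op (csym (wide j)) \<phi> x)) \<le> C * 2 ^ j * (1 / 4 ^ j) ^ m * schwartz_norm (2 * m + 2) \<phi>"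
    using wide_mult_op_decay by metis
  show ?thesis
  proof (rule that[of "N * C\<^sub>a * C" "2 * m + 2"])
    show "0 \<le> N * C\<^sub>a * C" using N C(1) C\<^sub>a by simp
    fix j and \<phi> :: "real \<Rightarrow> complex" assume \<phi>: "\<phi> \<in> schwartz"
    let ?S = "schwartz_norm (2 * m + 2) \<phi>"
    have S: "0 \<le> ?S" by (rule schwartz_norm_nonneg[OF \<phi>])
    let ?B = "N * 2 ^ j * 2 powr (- s * real j)"
    have "norm (multiplier_term \<psi> \<psi>' a f j \<phi>)
        \<le> ?B * (C\<^sub>a * 2 powr (\<alpha> * real j) * (LINT x|lborel. norm (mult_op (csym (wide j)) \<phi> x)))"
      by (rule multiplier_term_bound[OF g b schwartz_integrable[OF \<phi>]])
    also have "\<dots> \<le> ?B * (C\<^sub>a * 2 powr (\<alpha> * real j) * (C * 2 ^ j * (1 / 4 ^ j) ^ m * ?S))"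
      using N C\<^sub>a C(2)[OF \<phi>, of j] by (intro mult_left_mono) auto
    also have "\<dots> = (N * C\<^sub>a * C) * ?S * (2 ^ j * 2 powr (- s * real j) * 2 powr (\<alpha> * real j) * 2 ^ j * (1 / 4 ^ j) ^ m)"
      by (simp add: mult_ac)
    also have "2 ^ j * 2 powr (- s * real j) * 2 powr (\<alpha> * real j) * 2 ^ j * (1 / 4 ^ j) ^ m
        = 2 powr ((2 - s + \<alpha> - 2 * real m) * real j)"
    proof -
      have 1: "(2::real) ^ j = 2 powr real j" by (simp add: powr_realpow)
      have 2: "(1 / 4 ^ j :: real) ^ m = 2 powr (- 2 * real m * real j)"
      proof -
        have "(4::real) ^ j = 2 powr (2 * real j)"
          using powr_powr[of 2 2 "real j"] by (simp add: powr_realpow[symmetric])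
        then have "(1 / 4 ^ j :: real) = 2 powr (- 2 * real j)" by (simp add: powr_minus divide_inverse)
        then show ?thesis by (simp add: powr_realpow[symmetric] powr_powr mult_ac)
      qed
      show ?thesis unfolding 2 unfolding 1 by (simp add: powr_add[symmetric] algebra_simps)
    qed
    also have "\<dots> \<le> 2 powr (- real j)"
    proof (rule powr_mono)
      have "2 - s + \<alpha> - 2 * real m \<le> - 1" using m by linarith
      then have "(2 - s + \<alpha> - 2 * real m) * real j \<le> - 1 * real j" by (intro mult_right_mono) auto
      then show "(2 - s + \<alpha> - 2 * real m) * real j \<le> - real j" by simp
    qed simp
    also have "2 powr (- real j) = (1 / 2 :: real) ^ j"
      by (simp add: powr_minus powr_realpow power_one_over inverse_eq_divide)
    finally show "norm (multiplier_term \<psi> \<psi>' a f j \<phi>) \<le> N * C\<^sub>a * C * ?S * (1 / 2) ^ j"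
      using N C(1) C\<^sub>a S by (simp add: mult_left_mono)
  qed
qed

lemma multiplier_term_summable:
  assumes p: "1 \<le> p" and q: "1 \<le> q" and f: "f \<in> besov \<psi> s p q" and \<phi>: "\<phi> \<in> schwartz"
  shows "summable (\<lambda>j. multiplier_term \<psi> \<psi>' a f j \<phi>)"
proof -
  obtain C m where C: "\<And>j \<phi>. \<phi> \<in> schwartz \<Longrightarrow>
    norm (multiplier_term \<psi> \<psi>' a f j \<phi>) \<le> C * schwartz_norm m \<phi> * (1 / 2) ^ j"
    using multiplier_term_decay[OF p q f] by metis
  show ?thesis
  proof (rule summable_comparison_test'[of "\<lambda>j. C * schwartz_norm m \<phi> * (1 / 2) ^ j" 0])
    show "summable (\<lambda>j. C * schwartz_norm m \<phi> * (1 / 2 :: real) ^ j)"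
      by (intro summable_mult summable_geometric) simp
  qed (rule C[OF \<phi>])
qed

lemma multiplier_op_tempered:
  assumes p: "1 \<le> p" and q: "1 \<le> q" and f: "f \<in> besov \<psi> s p q"
  shows "tempered (multiplier_op \<psi> \<psi>' a f)"
proof -
  obtain g where g: "\<And>j. bounded_block f j (g j)" using besov_blocks[OF p q f] by metis
  note summ = multiplier_term_summable[OF p q f]
  have ti: "integrable lborel (\<lambda>x. conv (multiplier_kernel \<psi>' a j) (fun_of (lp_block \<psi> j f)) x * \<phi> x)"
    if "\<phi> \<in> schwartz" for j \<phi>
    by (rule multiplier_term_eq_symbol(1)[OF symbol_cutoff g schwartz_integrable[OF that]])
  have add: "multiplier_term \<psi> \<psi>' a f j (\<lambda>x. \<phi> x + \<eta> x) = multiplier_term \<psi> \<psi>' a f j \<phi> + multiplier_term \<psi> \<psi>' a f j \<eta>"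
    if "\<phi> \<in> schwartz" "\<eta> \<in> schwartz" for j \<phi> \<eta>
    using ti[OF that(1), of j] ti[OF that(2), of j] by (simp add: multiplier_term_def distrib_left)
  have scale: "multiplier_term \<psi> \<psi>' a f j (\<lambda>x. c * \<phi> x) = c * multiplier_term \<psi> \<psi>' a f j \<phi>" for j \<phi> c
    by (simp add: multiplier_term_def mult.left_commute[of _ c])
  obtain C m where C: "0 \<le> C" "\<And>j \<phi>. \<phi> \<in> schwartz \<Longrightarrow>
    norm (multiplier_term \<psi> \<psi>' a f j \<phi>) \<le> C * schwartz_norm m \<phi> * (1 / 2) ^ j"
    using multiplier_term_decay[OF p q f] by metis
  show ?thesis
    unfolding tempered_def
  proof (intro conjI ballI allI)
    show "multiplier_op \<psi> \<psi>' a f (\<lambda>x. \<phi> x + \<eta> x) = multiplier_op \<psi> \<psi>' a f \<phi> + multiplier_op \<psi> \<psi>' a f \<eta>"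
      if "\<phi> \<in> schwartz" "\<eta> \<in> schwartz" for \<phi> \<eta>
      unfolding multiplier_op_def add[OF that] by (rule suminf_add[symmetric]) (intro summ that)+
    show "multiplier_op \<psi> \<psi>' a f (\<lambda>x. c * \<phi> x) = c * multiplier_op \<psi> \<psi>' a f \<phi>" if "\<phi> \<in> schwartz" for c \<phi>
      unfolding multiplier_op_def scale by (rule suminf_mult[OF summ[OF that]])
    have "cmod (multiplier_op \<psi> \<psi>' a f \<phi>) \<le> (2 * C) * schwartz_norm m \<phi>" if "\<phi> \<in> schwartz" for \<phi>
    proof -
      have gs: "(\<lambda>j. C * schwartz_norm m \<phi> * (1 / 2) ^ j) sums (C * schwartz_norm m \<phi> * 2)"
        using sums_mult[OF geometric_sums[of "1 / 2 :: real"], of "C * schwartz_norm m \<phi>"] by simp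
      have "cmod (multiplier_op \<psi> \<psi>' a f \<phi>) \<le> (\<Sum>j. C * schwartz_norm m \<phi> * (1 / 2) ^ j)"
        unfolding multiplier_op_def
        by (rule norm_suminf_le[OF C(2)[OF that] sums_summable[OF gs]])
      then show ?thesis using gs by (simp add: sums_iff mult_ac)
    qed
    then show "\<exists>C N. \<forall>f'\<in>schwartz. cmod (multiplier_op \<psi> \<psi>' a f f') \<le> C * schwartz_norm N f'" by blast
  qed
qed

lemma multiplier_op_linear:
  assumes p: "1 \<le> p" and q: "1 \<le> q" and f: "f \<in> besov \<psi> s p q" "f' \<in> besov \<psi> s p q" and \<phi>: "\<phi> \<in> schwartz"
  shows "multiplier_op \<psi> \<psi>' a (\<lambda>\<eta>. b * f \<eta> + c * f' \<eta>) \<phi> = b * multiplier_op \<psi> \<psi>' a f \<phi> + c * multiplier_op \<psi> \<psi>' a f' \<phi>"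
proof -
  obtain g where g: "\<And>j. bounded_block f j (g j)" using besov_blocks[OF p q f(1)] by metis
  obtain g' where g': "\<And>j. bounded_block f' j (g' j)" using besov_blocks[OF p q f(2)] by metis
  note i = schwartz_integrable[OF \<phi>]
  have "multiplier_term \<psi> \<psi>' a (\<lambda>\<eta>. b * f \<eta> + c * f' \<eta>) j \<phi>
      = b * multiplier_term \<psi> \<psi>' a f j \<phi> + c * multiplier_term \<psi> \<psi>' a f' j \<phi>" for j
  proof -
    have h: "integrable lborel (mult_op (cutoff_symbol j) \<phi>)" by (intro mult_op_integrable symbol_cutoff i)
    show ?thesis
      unfolding multiplier_term_eq[OF g i] multiplier_term_eq[OF g' i]
        multiplier_term_eq[OF bounded_block_linear[OF g g'] i]
      using bounded_block_integrable[OF g[of j] h] bounded_block_integrable[OF g'[of j] h]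
      by (simp add: distrib_right mult.assoc)
  qed
  then show ?thesis
    unfolding multiplier_op_def
    using multiplier_term_summable[OF p q f(1) \<phi>] multiplier_term_summable[OF p q f(2) \<phi>]
    by (simp add: suminf_add[symmetric] suminf_mult summable_mult)
qed

text \<open>Block by block the image is a convolution with the kernel of
  \<open>wide_symbol k\<close>, which Young's inequality and \<open>kernel_bound\<close> control;
  the growth 2^(\<alpha> k) is exactly the shift of the weight from s + \<alpha> to s.\<close>

lemma multiplier_besov_norm:
  assumes p: "1 \<le> p" and q: "1 \<le> q" and f: "f \<in> besov \<psi> (s + \<alpha>) p q"
  shows "besov_norm \<psi> s p q (multiplier_op \<psi> \<psi>' a f) \<le> ennreal C\<^sub>a * besov_norm \<psi> (s + \<alpha>) p q f"
proof -
  obtain g where g: "\<And>j. bounded_block f j (g j)" using besov_blocks[OF p q f] by metis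
  have t: "tempered f" using f by (simp add: besov_def)
  have block: "dist_Lp_norm p (lp_block \<psi> k (multiplier_op \<psi> \<psi>' a f))
      \<le> ennreal (C\<^sub>a * 2 powr (\<alpha> * real k)) * dist_Lp_norm p (lp_block \<psi> k f)" for k
  proof -
    let ?K = "inv_fourier (wide_symbol k)"
    have gm: "g k \<in> borel_measurable borel" and gr: "represents (g k) (lp_block \<psi> k f)"
      using g[of k] by (auto simp: bounded_block_def)
    have "represents (conv ?K (g k)) (lp_block \<psi> k (multiplier_op \<psi> \<psi>' a f))"
      unfolding represents_def
    proof (intro conjI ballI)
      show "conv ?K (g k) \<in> borel_measurable borel" by (rule conv_measurable_symbol[OF symbol_wide_symbol gm])
      fix \<phi> :: "real \<Rightarrow> complex" assume \<phi>: "\<phi> \<in> schwartz"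
      note i = schwartz_integrable[OF \<phi>]
      show "integrable lborel (\<lambda>x. conv ?K (g k) x * \<phi> x)"
        by (rule bounded_block_conv(1)[OF g symbol_wide_symbol i])
      show "lp_block \<psi> k (multiplier_op \<psi> \<psi>' a f) \<phi> = (CLINT x|lborel. conv ?K (g k) x * \<phi> x)"
        unfolding block_of_multiplier[OF t g \<phi>] pairing_cutoff_eq_wide[OF g i] bounded_block_conv(2)[OF g symbol_wide_symbol i] ..
    qed
    then have "dist_Lp_norm p (lp_block \<psi> k (multiplier_op \<psi> \<psi>' a f)) = Lp_norm p lborel (\<lambda>x. ennreal (cmod (conv ?K (g k) x)))"
      by (rule dist_Lp_norm_eq[OF _ p])
    also have "\<dots> \<le> ennreal (C\<^sub>a * 2 powr (\<alpha> * real k)) * Lp_norm p lborel (\<lambda>x. ennreal (cmod (g k x)))"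
      using C\<^sub>a by (intro conv_Lp_norm_le fourier_symbolD symbol_wide_symbol kernel_bound gm p) auto
    also have "Lp_norm p lborel (\<lambda>x. ennreal (cmod (g k x))) = dist_Lp_norm p (lp_block \<psi> k f)"
      by (rule dist_Lp_norm_eq[OF gr p, symmetric])
    finally show ?thesis .
  qed
  show ?thesis
    unfolding besov_norm_def
  proof (rule Lp_norm_mono_cmult_AE[OF q])
    show "AE k in count_space UNIV. ennreal (2 powr (s * real k)) * dist_Lp_norm p (lp_block \<psi> k (multiplier_op \<psi> \<psi>' a f))
        \<le> ennreal C\<^sub>a * (ennreal (2 powr ((s + \<alpha>) * real k)) * dist_Lp_norm p (lp_block \<psi> k f))"
    proof (rule AE_I2)
      fix k
      have "ennreal (2 powr (s * real k)) * dist_Lp_norm p (lp_block \<psi> k (multiplier_op \<psi> \<psi>' a f))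
        \<le> ennreal (2 powr (s * real k)) * (ennreal (C\<^sub>a * 2 powr (\<alpha> * real k)) * dist_Lp_norm p (lp_block \<psi> k f))"
        by (intro mult_left_mono block) auto
      also have "\<dots> = (ennreal (2 powr (s * real k)) * ennreal (C\<^sub>a * 2 powr (\<alpha> * real k))) * dist_Lp_norm p (lp_block \<psi> k f)"
        by (simp only: mult.assoc)
      also have "ennreal (2 powr (s * real k)) * ennreal (C\<^sub>a * 2 powr (\<alpha> * real k)) = ennreal C\<^sub>a * ennreal (2 powr ((s + \<alpha>) * real k))"
      proof -
        have "2 powr (s * real k) * (C\<^sub>a * 2 powr (\<alpha> * real k)) = C\<^sub>a * 2 powr ((s + \<alpha>) * real k)"
          by (simp add: distrib_right powr_add)
        then show ?thesis using C\<^sub>a by (simp add: ennreal_mult[symmetric])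
      qed
      finally show "ennreal (2 powr (s * real k)) * dist_Lp_norm p (lp_block \<psi> k (multiplier_op \<psi> \<psi>' a f))
        \<le> ennreal C\<^sub>a * (ennreal (2 powr ((s + \<alpha>) * real k)) * dist_Lp_norm p (lp_block \<psi> k f))"
        by (simp only: mult.assoc)
    qed
  qed (use C\<^sub>a in auto)
qed

theorem bounded_multiplier:
  assumes p: "1 \<le> p" and q: "1 \<le> q"
  shows "bounded_multiplier \<psi> \<psi>' a (s + \<alpha>) s p q"
  unfolding bounded_multiplier_def
proof (intro conjI allI ballI)
  show "integrable lborel (multiplier_kernel \<psi>' a j)" for j
    unfolding multiplier_kernel_def by (rule fourier_symbolD(3)[OF symbol_cutoff])
  show "summable (\<lambda>j. multiplier_term \<psi> \<psi>' a f j \<phi>)" if "f \<in> besov \<psi> (s + \<alpha>) p q" "\<phi> \<in> schwartz" for f \<phi>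
    by (rule multiplier_term_summable[OF p q that])
  show "multiplier_op \<psi> \<psi>' a (\<lambda>\<eta>. b * f \<eta> + c * g \<eta>) \<phi> = b * multiplier_op \<psi> \<psi>' a f \<phi> + c * multiplier_op \<psi> \<psi>' a g \<phi>"
    if "f \<in> besov \<psi> (s + \<alpha>) p q" "g \<in> besov \<psi> (s + \<alpha>) p q" "\<phi> \<in> schwartz" for f g b c \<phi>
    by (rule multiplier_op_linear[OF p q that])
  show "multiplier_op \<psi> \<psi>' a f \<in> besov \<psi> s p q" if f: "f \<in> besov \<psi> (s + \<alpha>) p q" for f
  proof -
    have "ennreal C\<^sub>a * besov_norm \<psi> (s + \<alpha>) p q f < \<infinity>"
      using f by (simp add: besov_def ennreal_mult_less_top)
    then show ?thesis
      using multiplier_op_tempered[OF p q f] multiplier_besov_norm[OF p q f] by (simp add: besov_def)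
  qed
  show "\<exists>C\<ge>0. \<forall>f\<in>besov \<psi> (s + \<alpha>) p q. besov_norm \<psi> s p q (multiplier_op \<psi> \<psi>' a f) \<le> ennreal C * besov_norm \<psi> (s + \<alpha>) p q f"
    using multiplier_besov_norm[OF p q] C\<^sub>a by (intro exI[of _ C\<^sub>a]) auto
qed

end

section \<open>Multipliers tested on exponentials\<close>

text \<open>The minus sign makes the pairing with \<phi> evaluate \<open>inv_fourier \<phi>\<close>
  at \<open>u\<close>, up to 2 \<pi>: the distribution is concentrated at frequency
  \<open>u\<close>, and every symbol acts on it by its value there.\<close>

definition exp_dist :: "real \<Rightarrow> distribution" where
  "exp_dist u = (\<lambda>\<phi>. CLINT x|lborel. iexp (- (x * u)) * \<phi> x)"

lemma exp_dist_eq: "exp_dist u \<phi> = complex_of_real (2 * pi) * inv_fourier \<phi> u"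
  by (simp add: exp_dist_def inv_fourier_def)

lemma exp_dist_cmult: "(CLINT x|lborel. c * iexp (- (x * u)) * \<phi> x) = c * exp_dist u \<phi>"
proof -
  have "(CLINT x|lborel. c * iexp (- (x * u)) * \<phi> x) = (CLINT x|lborel. c * (iexp (- (x * u)) * \<phi> x))"
    by (simp only: mult.assoc)
  then show ?thesis unfolding exp_dist_def integral_mult_right_zero .
qed

lemma tempered_exp_dist: "tempered (exp_dist u)"
  unfolding tempered_def
proof (intro conjI ballI allI)
  have i: "integrable lborel (\<lambda>x. iexp (- (x * u)) * \<phi> x)" if "\<phi> \<in> schwartz" for \<phi>
    using integrable_iexp_mult[OF schwartz_integrable[OF that], of "- u"] by (simp add: mult.commute)
  show "exp_dist u (\<lambda>x. \<phi> x + \<eta> x) = exp_dist u \<phi> + exp_dist u \<eta>" if "\<phi> \<in> schwartz" "\<eta> \<in> schwartz" for \<phi> \<eta>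
    using i[OF that(1)] i[OF that(2)] by (simp add: exp_dist_def distrib_left)
  show "exp_dist u (\<lambda>x. c * \<phi> x) = c * exp_dist u \<phi>" for c \<phi>
    unfolding exp_dist_eq inv_fourier_cmult by simp
  have "cmod (exp_dist u \<phi>) \<le> (2 * pi) * schwartz_norm 2 \<phi>" if "\<phi> \<in> schwartz" for \<phi>
  proof -
    have "cmod (exp_dist u \<phi>) \<le> (LINT x|lborel. norm (iexp (- (x * u)) * \<phi> x))"
      unfolding exp_dist_def by (rule integral_norm_bound)
    also have "\<dots> = (LINT x|lborel. norm (\<phi> x))" by (simp add: norm_mult)
    also have "\<dots> \<le> 2 * pi * schwartz_norm 2 \<phi>"
      using schwartz_integrable_funpow(2)[OF that, of 0] by (simp add: numeral_2_eq_2)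
    finally show ?thesis .
  qed
  then show "\<exists>C N. \<forall>f\<in>schwartz. cmod (exp_dist u f) \<le> C * schwartz_norm N f" by blast
qed

lemma exp_dist_mult_op:
  assumes "fourier_symbol b" "\<phi> \<in> schwartz"
  shows "exp_dist u (mult_op b \<phi>) = b u * exp_dist u \<phi>"
  unfolding exp_dist_eq inv_fourier_mult_op[OF assms(1) schwartz_integrable[OF assms(2)]] by simp

lemma Lp_norm_infinity_exp:
  "Lp_norm \<infinity> lborel (\<lambda>x. ennreal (cmod (c * iexp (- (x * u))))) = ennreal (cmod c)"
  by (simp add: Lp_norm_def norm_mult esssup_const)

context dyadic
begin

lemma bounded_block_exp_dist: "bounded_block (exp_dist u) j (\<lambda>x. csym (\<psi> j) u * iexp (- (x * u)))"
  unfolding bounded_block_def represents_def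
proof (intro conjI ballI)
  show "(\<lambda>x. csym (\<psi> j) u * iexp (- (x * u))) \<in> borel_measurable borel"
    by (intro borel_measurable_continuous_onI continuous_intros)
  show "(\<lambda>x. csym (\<psi> j) u * iexp (- (x * u))) \<in> borel_measurable borel"
    by (intro borel_measurable_continuous_onI continuous_intros)
  show "\<exists>B. \<forall>x. norm (csym (\<psi> j) u * iexp (- (x * u))) \<le> B"
    by (intro exI[of _ "\<bar>\<psi> j u\<bar>"]) (simp add: norm_mult)
  fix \<phi> :: "real \<Rightarrow> complex" assume \<phi>: "\<phi> \<in> schwartz"
  have "integrable lborel (\<lambda>x. csym (\<psi> j) u * (iexp ((- u) * x) * \<phi> x))"
    by (intro integrable_mult_right integrable_iexp_mult schwartz_integrable \<phi>)
  then show "integrable lborel (\<lambda>x. csym (\<psi> j) u * iexp (- (x * u)) * \<phi> x)"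
    by (simp add: mult_ac)
  show "lp_block \<psi> j (exp_dist u) \<phi> = (CLINT x|lborel. csym (\<psi> j) u * iexp (- (x * u)) * \<phi> x)"
    unfolding lp_block_eq exp_dist_mult_op[OF symbol_block \<phi>] exp_dist_cmult ..
qed

lemma exp_dist_block_norm: "dist_Lp_norm \<infinity> (lp_block \<psi> j (exp_dist u)) = ennreal (\<psi> j u)"
proof -
  have "represents (\<lambda>x. csym (\<psi> j) u * iexp (- (x * u))) (lp_block \<psi> j (exp_dist u))"
    using bounded_block_exp_dist by (simp add: bounded_block_def)
  from dist_Lp_norm_eq[OF this, of \<infinity>] show ?thesis
    unfolding Lp_norm_infinity_exp by (simp add: block_nonneg)
qed

text \<open>Each term contributes \<open>\<psi> j u\<close> times the same eigenvalue, since
  \<open>\<psi>' j\<close> is 1 wherever \<open>\<psi> j\<close> is not 0; the partition sums to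
  1.\<close>

lemma multiplier_op_exp_dist:
  assumes c: "cutoffs \<psi> \<psi>'" and b: "\<And>j. fourier_symbol (\<lambda>u. complex_of_real (\<psi>' j u) * a u)" and \<phi>: "\<phi> \<in> schwartz"
  shows "multiplier_op \<psi> \<psi>' a (exp_dist u) \<phi> = a u * exp_dist u \<phi>"
proof -
  have "multiplier_term \<psi> \<psi>' a (exp_dist u) j \<phi> = csym (\<psi> j) u * (a u * exp_dist u \<phi>)" for j
  proof -
    have "multiplier_term \<psi> \<psi>' a (exp_dist u) j \<phi>
        = csym (\<psi> j) u * exp_dist u (mult_op (\<lambda>u. complex_of_real (\<psi>' j u) * a u) \<phi>)"
      unfolding multiplier_term_eq_symbol(2)[OF b bounded_block_exp_dist schwartz_integrable[OF \<phi>]]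
        exp_dist_cmult ..
    also have "\<dots> = (csym (\<psi> j) u * complex_of_real (\<psi>' j u)) * (a u * exp_dist u \<phi>)"
      unfolding exp_dist_mult_op[OF b \<phi>] by (simp only: mult.assoc)
    also have "csym (\<psi> j) u * complex_of_real (\<psi>' j u) = csym (\<psi> j) u"
      unfolding of_real_mult[symmetric] cutoffs_mult[OF c] ..
    finally show ?thesis .
  qed
  moreover have "(\<lambda>j. csym (\<psi> j) u * (a u * exp_dist u \<phi>)) sums (complex_of_real 1 * (a u * exp_dist u \<phi>))"
    by (intro sums_mult2 sums_of_real block_sums)
  ultimately show ?thesis by (simp add: multiplier_op_def sums_iff)
qed

text \<open>On exponentials the multiplier bound compares |a u| times sup_j
  \<open>\<psi> j u\<close> with the weighted supremum of the same numbers. The supremum cancels, so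
  only its positivity matters and no lower bound for it has to be known.\<close>

theorem bounded_multiplier_polynomial_growth:
  assumes c: "cutoffs \<psi> \<psi>'" and a: "continuous_on UNIV a" and \<alpha>: "0 < \<alpha>"
    and bm: "bounded_multiplier \<psi> \<psi>' a \<alpha> 0 \<infinity> \<infinity>"
  shows "\<exists>C>0. \<forall>u. cmod (a u) \<le> C * (1 + \<bar>u\<bar>) powr \<alpha>"
proof -
  have b: "fourier_symbol (\<lambda>u. complex_of_real (\<psi>' j u) * a u)" for j
  proof -
    have s: "smooth (\<psi>' j)" "compact (fsupport (\<psi>' j))" using c by (auto simp: cutoffs_def)
    obtain R where "\<And>x. R \<le> \<bar>x\<bar> \<Longrightarrow> \<psi>' j x = 0" using compact_fsupportD[OF s(2)] by metis
    then have "\<exists>R. \<forall>u. R \<le> \<bar>u\<bar> \<longrightarrow> complex_of_real (\<psi>' j u) * a u = 0" by auto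
    moreover have "continuous_on UNIV (\<lambda>u. complex_of_real (\<psi>' j u) * a u)"
      by (intro continuous_intros smooth_continuous_on[OF s(1)] a)
    ultimately show ?thesis
      using bm by (simp add: fourier_symbol_def bounded_multiplier_def multiplier_kernel_def)
  qed
  from bm obtain C where C: "0 \<le> C" "\<And>f. f \<in> besov \<psi> \<alpha> \<infinity> \<infinity> \<Longrightarrow>
      besov_norm \<psi> 0 \<infinity> \<infinity> (multiplier_op \<psi> \<psi>' a f) \<le> ennreal C * besov_norm \<psi> \<alpha> \<infinity> \<infinity> f"
    by (auto simp: bounded_multiplier_def)
  have "cmod (a u) \<le> (C * 2 powr \<alpha>) * (1 + \<bar>u\<bar>) powr \<alpha>" for u
  proof -
    \<comment> \<open>Where \<open>\<psi> j u\<close> is nonzero, 2^j is at most 2 (1 + |u|); this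
      bounds the weight of all contributing blocks.\<close>
    define X where "X = (2 * (1 + \<bar>u\<bar>)) powr \<alpha>"
    have X: "X = 2 powr \<alpha> * (1 + \<bar>u\<bar>) powr \<alpha>" unfolding X_def by (rule powr_mult)
    have X0: "0 \<le> X" by (simp add: X_def)
    let ?M = "Lp_norm \<infinity> (count_space UNIV) (\<lambda>j::nat. ennreal (\<psi> j u))"
    have Mle: "?M \<le> ennreal m" if "\<And>j. \<psi> j u \<le> m" for m
      using that by (simp add: Lp_norm_def) (intro esssup_I AE_I2 ennreal_leI, auto)
    have leM: "ennreal (\<psi> j u) \<le> ?M" for j
      by (rule le_Lp_norm_count_space[of \<infinity> "\<lambda>j. ennreal (\<psi> j u)" j]) simp
    have "?M \<le> ennreal 1" by (rule Mle[OF block_le_1])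
    then have "?M < \<infinity>" by (rule order.strict_trans1) simp
    then obtain M where M: "0 \<le> M" "?M = ennreal M" by (cases ?M) auto
    have psiM: "\<psi> j u \<le> M" for j using leM[of j] M by (simp add: ennreal_le_iff)
    have "\<exists>j. \<psi> j u \<noteq> 0"
    proof (rule ccontr)
      assume "\<nexists>j. \<psi> j u \<noteq> 0"
      then have "(\<lambda>j. \<psi> j u) = (\<lambda>j. 0)" by auto
      then show False using block_sums[of u] sums_unique2[OF sums_zero] by fastforce
    qed
    then have M0: "0 < M" using psiM block_nonneg by (metis order.strict_iff_order order.strict_trans1)
    have "besov_norm \<psi> \<alpha> \<infinity> \<infinity> (exp_dist u) \<le> ennreal X * ?M"
      unfolding besov_norm_def exp_dist_block_norm
    proof (rule Lp_norm_mono_cmult_AE)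
      show "AE j in count_space UNIV. ennreal (2 powr (\<alpha> * real j)) * ennreal (\<psi> j u) \<le> ennreal X * ennreal (\<psi> j u)"
      proof (rule AE_I2)
        fix j
        show "ennreal (2 powr (\<alpha> * real j)) * ennreal (\<psi> j u) \<le> ennreal X * ennreal (\<psi> j u)"
        proof (cases "\<psi> j u = 0")
          case False
          have "(2::real) ^ j \<le> 2 * (1 + \<bar>u\<bar>)" using block_support(2)[OF False] by auto
          then have "((2::real) ^ j) powr \<alpha> \<le> X" unfolding X_def using \<alpha> by (intro powr_mono2) auto
          moreover have "2 powr (\<alpha> * real j) = ((2::real) ^ j) powr \<alpha>"
            by (simp add: powr_realpow[symmetric] powr_powr mult.commute)
          ultimately have "2 powr (\<alpha> * real j) \<le> X" by simp
          then show ?thesis by (intro mult_right_mono ennreal_leI) auto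
        qed simp
      qed
    qed (use X0 in auto)
    then have N\<alpha>: "besov_norm \<psi> \<alpha> \<infinity> \<infinity> (exp_dist u) \<le> ennreal (X * M)"
      using M X0 by (simp add: ennreal_mult)
    then have mem: "exp_dist u \<in> besov \<psi> \<alpha> \<infinity> \<infinity>"
      using tempered_exp_dist order.strict_trans1[OF N\<alpha>, of \<infinity>] by (simp add: besov_def)
    have nrm: "dist_Lp_norm \<infinity> (lp_block \<psi> j (multiplier_op \<psi> \<psi>' a (exp_dist u))) = ennreal (cmod (a u) * \<psi> j u)" for j
    proof -
      let ?g = "\<lambda>x. (a u * csym (\<psi> j) u) * iexp (- (x * u))"
      have "represents ?g (lp_block \<psi> j (multiplier_op \<psi> \<psi>' a (exp_dist u)))"
        unfolding represents_def
      proof (intro conjI ballI)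
        show "?g \<in> borel_measurable borel"
          by (intro borel_measurable_continuous_onI continuous_intros)
        fix \<phi> :: "real \<Rightarrow> complex" assume \<phi>: "\<phi> \<in> schwartz"
        have "integrable lborel (\<lambda>x. (a u * csym (\<psi> j) u) * (iexp ((- u) * x) * \<phi> x))"
          by (intro integrable_mult_right integrable_iexp_mult schwartz_integrable \<phi>)
        then show "integrable lborel (\<lambda>x. ?g x * \<phi> x)" by (simp add: mult_ac)
        have "lp_block \<psi> j (multiplier_op \<psi> \<psi>' a (exp_dist u)) \<phi> = a u * exp_dist u (mult_op (csym (\<psi> j)) \<phi>)"
          unfolding lp_block_eq
          by (rule multiplier_op_exp_dist[OF c b mult_op_schwartz[OF smooth_block compact_block_support \<phi>]])
        also have "\<dots> = (a u * csym (\<psi> j) u) * exp_dist u \<phi>"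
          unfolding exp_dist_mult_op[OF symbol_block \<phi>] by (simp only: mult.assoc)
        also have "\<dots> = (CLINT x|lborel. ?g x * \<phi> x)"
          unfolding exp_dist_cmult ..
        finally show "lp_block \<psi> j (multiplier_op \<psi> \<psi>' a (exp_dist u)) \<phi> = (CLINT x|lborel. ?g x * \<phi> x)" .
      qed
      from dist_Lp_norm_eq[OF this, of \<infinity>] show ?thesis
        unfolding Lp_norm_infinity_exp by (simp add: norm_mult block_nonneg)
    qed
    have main: "cmod (a u) * \<psi> j u \<le> C * (X * M)" for j
    proof -
      have "ennreal (2 powr (0 * real j)) * ennreal (cmod (a u) * \<psi> j u) \<le> besov_norm \<psi> 0 \<infinity> \<infinity> (multiplier_op \<psi> \<psi>' a (exp_dist u))"
        unfolding besov_norm_def nrm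
        by (rule le_Lp_norm_count_space[of \<infinity> "\<lambda>j. ennreal (2 powr (0 * real j)) * ennreal (cmod (a u) * \<psi> j u)" j]) simp
      also have "\<dots> \<le> ennreal C * besov_norm \<psi> \<alpha> \<infinity> \<infinity> (exp_dist u)" by (rule C(2)[OF mem])
      also have "\<dots> \<le> ennreal C * ennreal (X * M)" by (intro mult_left_mono N\<alpha>) simp
      also have "\<dots> = ennreal (C * (X * M))" using C(1) X0 M(1) by (simp add: ennreal_mult)
      finally show ?thesis using C(1) X0 M(1) by (simp add: ennreal_le_iff)
    qed
    show ?thesis
    proof (cases "a u = 0")
      case True
      then show ?thesis using C(1) by simp
    next
      case False
      then have p: "0 < cmod (a u)" by simp
      have "\<psi> j u \<le> C * (X * M) / cmod (a u)" for j
        using main[of j] p by (simp add: field_simps)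
      then have "ennreal M \<le> ennreal (C * (X * M) / cmod (a u))" unfolding M(2)[symmetric] by (rule Mle)
      then have "M \<le> C * (X * M) / cmod (a u)" using C(1) X0 M(1) by (simp add: ennreal_le_iff)
      then have "cmod (a u) * M \<le> (C * X) * M" using p by (simp add: field_simps)
      then have "cmod (a u) \<le> C * X" using M0 by simp
      then show ?thesis by (simp add: X)
    qed
  qed
  \<comment> \<open>\<open>C\<close> may be 0; adding 1 makes the constant positive.\<close>
  then have "cmod (a u) \<le> (C * 2 powr \<alpha> + 1) * (1 + \<bar>u\<bar>) powr \<alpha>" for u
    by (rule order_trans) (simp add: distrib_right)
  moreover have "0 < C * 2 powr \<alpha> + 1" using C(1) by (simp add: add_nonneg_pos)
  ultimately show ?thesis by blast
qed

end

section \<open>Reciprocals of compound Poisson characteristic functions\<close>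

locale finite_borel_measure = finite_measure M for M :: "real measure" +
  assumes sets_borel[measurable_cong]: "sets M = sets borel"
begin

lemma space_UNIV: "space M = UNIV"
  using sets_eq_imp_space_eq[OF sets_borel] by simp

definition total_mass :: real where "total_mass = measure M UNIV"

definition ft :: "real \<Rightarrow> complex" where "ft u = (CLINT y|M. iexp (u * y))"

lemma norm_ft_le: "norm (ft u) \<le> total_mass"
proof -
  have "norm (ft u) \<le> (LINT y|M. norm (iexp (u * y)))" unfolding ft_def by (rule integral_norm_bound)
  then show ?thesis by (simp add: total_mass_def space_UNIV)
qed

lemma total_mass_nonneg: "0 \<le> total_mass"
  by (simp add: total_mass_def)

lemma ft_measurable[measurable]: "ft \<in> borel_measurable borel"
proof -
  have "(\<lambda>u. CLINT y|M. iexp (u * y)) \<in> borel_measurable borel" by measurable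
  then show ?thesis by (simp add: ft_def[abs_def])
qed

lemma integrable_mult_ft:
  assumes "integrable lborel h"
  shows "integrable lborel (\<lambda>u. h u * ft u)"
    "(LINT u|lborel. norm (h u * ft u)) \<le> total_mass * (LINT u|lborel. norm (h u))"
proof -
  have [measurable]: "h \<in> borel_measurable borel" using assms by simp
  have le: "norm (h u * ft u) \<le> total_mass * norm (h u)" for u
    using mult_left_mono[OF norm_ft_le, of "norm (h u)"] by (simp add: norm_mult mult.commute)
  have i: "integrable lborel (\<lambda>u. total_mass * norm (h u))" using assms by simp
  show 1: "integrable lborel (\<lambda>u. h u * ft u)"
    by (rule Bochner_Integration.integrable_bound[OF i]) (use le total_mass_nonneg in auto)
  have "(LINT u|lborel. norm (h u * ft u)) \<le> (LINT u|lborel. total_mass * norm (h u))"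
    by (intro integral_mono integrable_norm 1 i le)
  then show "(LINT u|lborel. norm (h u * ft u)) \<le> total_mass * (LINT u|lborel. norm (h u))" by simp
qed

lemma inv_fourier_mult_ft:
  assumes h: "integrable lborel h"
  shows "inv_fourier (\<lambda>u. h u * ft u) x = (CLINT y|M. inv_fourier h (x - y))"
proof -
  interpret pair_sigma_finite lborel M ..
  have [measurable]: "h \<in> borel_measurable borel" using h by simp
  let ?F = "\<lambda>u y. (iexp (- (u * x)) * h u) * iexp (u * y)"
  have prod: "integrable (lborel \<Otimes>\<^sub>M M) (\<lambda>(u, y). ?F u y)"
  proof (rule Bochner_Integration.integrable_bound)
    show "integrable (lborel \<Otimes>\<^sub>M M) (\<lambda>(u, y). norm (h u) * (1 :: real))"
      by (intro integrable_product_mult integrable_norm h) simp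
    show "AE z in lborel \<Otimes>\<^sub>M M. norm (case z of (u, y) \<Rightarrow> ?F u y) \<le> norm (case z of (u, y) \<Rightarrow> norm (h u) * (1 :: real))"
      by (rule AE_I2) (auto simp: norm_mult)
  qed measurable
  have "(CLINT u|lborel. iexp (- (u * x)) * (h u * ft u)) = (CLINT u|lborel. CLINT y|M. ?F u y)"
  proof (rule Bochner_Integration.integral_cong[OF refl])
    fix u
    have "(CLINT y|M. ?F u y) = (iexp (- (u * x)) * h u) * ft u"
      unfolding ft_def by (rule integral_mult_right_zero)
    then show "iexp (- (u * x)) * (h u * ft u) = (CLINT y|M. ?F u y)" by (simp only: mult.assoc)
  qed
  also have "\<dots> = (CLINT y|M. CLINT u|lborel. ?F u y)"
    using Fubini_integral[OF prod] by simp
  also have "\<dots> = (CLINT y|M. complex_of_real (2 * pi) * inv_fourier h (x - y))"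
  proof (rule Bochner_Integration.integral_cong[OF refl])
    fix y
    have "?F u y = iexp (- (u * (x - y))) * h u" for u
    proof -
      have "iexp (- (u * x)) * iexp (u * y) = iexp (- (u * (x - y)))"
        unfolding exp_add[symmetric] by (simp add: algebra_simps)
      then show ?thesis by (metis (no_types, lifting) mult.assoc mult.commute)
    qed
    then have "(CLINT u|lborel. ?F u y) = (CLINT u|lborel. iexp (- (u * (x - y))) * h u)" by (simp only:)
    then show "(CLINT u|lborel. ?F u y) = complex_of_real (2 * pi) * inv_fourier h (x - y)"
      by (simp add: inv_fourier_def)
  qed
  also have "\<dots> = complex_of_real (2 * pi) * (CLINT y|M. inv_fourier h (x - y))"
    by (rule integral_mult_right_zero)
  finally show ?thesis by (simp add: inv_fourier_def[of "\<lambda>u. h u * ft u"])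
qed

text \<open>Translates have the same L1 norm, so averaging them over the measure costs at most its
  mass.\<close>

lemma inv_fourier_mult_ft_L1:
  assumes h: "integrable lborel h" and K: "integrable lborel (inv_fourier h)"
  shows "integrable lborel (inv_fourier (\<lambda>u. h u * ft u))"
    "(LINT x|lborel. norm (inv_fourier (\<lambda>u. h u * ft u) x)) \<le> total_mass * (LINT x|lborel. norm (inv_fourier h x))"
proof -
  interpret MN: pair_sigma_finite M lborel ..
  have [measurable]: "inv_fourier h \<in> borel_measurable borel" using K by simp
  let ?k = "\<lambda>y x. inv_fourier h (x - y)"
  have prod: "integrable (M \<Otimes>\<^sub>M lborel) (\<lambda>(y, x). ?k y x)"
  proof (rule MN.Fubini_integrable)
    show "(\<lambda>(y, x). ?k y x) \<in> borel_measurable (M \<Otimes>\<^sub>M lborel)" by measurable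
    show "AE y in M. integrable lborel (\<lambda>x. case (y, x) of (y, x) \<Rightarrow> ?k y x)"
      using lborel_integrable_shift[OF K] by simp
    show "integrable M (\<lambda>y. LINT x|lborel. norm (case (y, x) of (y, x) \<Rightarrow> ?k y x))"
      using lborel_integral_shift[of "\<lambda>x. norm (inv_fourier h x)"] by simp
  qed
  have eq: "inv_fourier (\<lambda>u. h u * ft u) = (\<lambda>x. CLINT y|M. ?k y x)"
    using inv_fourier_mult_ft[OF h] by auto
  show i: "integrable lborel (inv_fourier (\<lambda>u. h u * ft u))"
    unfolding eq using MN.integrable_snd[OF prod] by simp
  have np: "integrable (M \<Otimes>\<^sub>M lborel) (\<lambda>(y, x). norm (?k y x))"
    using integrable_norm[OF prod] by (simp add: case_prod_beta')
  have "(LINT x|lborel. norm (inv_fourier (\<lambda>u. h u * ft u) x)) \<le> (LINT x|lborel. LINT y|M. norm (?k y x))"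
    unfolding eq using i MN.integrable_snd[OF np] unfolding eq
    by (intro integral_mono integrable_norm) auto
  also have "\<dots> = (LINT y|M. LINT x|lborel. norm (?k y x))"
    using MN.Fubini_integral[OF np] by simp
  also have "\<dots> = total_mass * (LINT x|lborel. norm (inv_fourier h x))"
    using lborel_integral_shift[of "\<lambda>x. norm (inv_fourier h x)"] by (simp add: total_mass_def space_UNIV)
  finally show "(LINT x|lborel. norm (inv_fourier (\<lambda>u. h u * ft u) x)) \<le> total_mass * (LINT x|lborel. norm (inv_fourier h x))" .
qed

text \<open>The exponential series in the algebra of measures: each multiplication by
  \<open>ft\<close> costs at most \<open>total_mass\<close>, so the n-th term costs mass^n / n! and
  the kernels sum to exp(mass). Working on kernels avoids convolution powers of \<open>M\<close>,
  and \<open>ft\<close> is never differentiated.\<close>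

lemma inv_fourier_exp_ft_L1:
  assumes h: "integrable lborel h" and K: "integrable lborel (inv_fourier h)"
  shows "integrable lborel (inv_fourier (\<lambda>u. h u * exp (- ft u)))"
    "(LINT x|lborel. norm (inv_fourier (\<lambda>u. h u * exp (- ft u)) x)) \<le> exp total_mass * (LINT x|lborel. norm (inv_fourier h x))"
proof -
  have [measurable]: "h \<in> borel_measurable borel" using h by simp
  define hn where "hn n u = h u * ((- ft u) ^ n / fact n)" for n u
  define c where "c n = total_mass ^ n / fact n" for n
  have c0: "0 \<le> c n" for n using total_mass_nonneg by (simp add: c_def)
  have c_sums: "c sums exp total_mass"
    using exp_converges[of total_mass] by (simp add: c_def[abs_def] divide_inverse mult.commute)
  have hn_Suc: "hn (Suc n) = (\<lambda>u. (- 1 / of_nat (Suc n)) * (hn n u * ft u))" for n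
    by (auto simp: hn_def field_simps simp del: of_nat_Suc)
  have cSuc: "c (Suc n) = (1 / real (Suc n)) * (total_mass * c n)" for n
    by (simp add: c_def field_simps del: of_nat_Suc)
  have step: "integrable lborel (hn n) \<and> integrable lborel (inv_fourier (hn n)) \<and>
      (LINT u|lborel. norm (hn n u)) \<le> c n * (LINT u|lborel. norm (h u)) \<and>
      (LINT x|lborel. norm (inv_fourier (hn n) x)) \<le> c n * (LINT x|lborel. norm (inv_fourier h x))" for n
  proof (induction n)
    case 0
    have "hn 0 = h" by (simp add: hn_def[abs_def])
    then show ?case using h K by (simp add: c_def)
  next
    case (Suc n)
    note IH = Suc.IH[THEN conjunct1] Suc.IH[THEN conjunct2, THEN conjunct1]
      Suc.IH[THEN conjunct2, THEN conjunct2, THEN conjunct1] Suc.IH[THEN conjunct2, THEN conjunct2, THEN conjunct2]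
    have K': "inv_fourier (hn (Suc n)) = (\<lambda>x. (- 1 / of_nat (Suc n)) * inv_fourier (\<lambda>u. hn n u * ft u) x)"
      unfolding hn_Suc by (rule ext, rule inv_fourier_cmult)
    have n: "norm (- 1 / of_nat (Suc n) :: complex) = 1 / real (Suc n)"
      by (simp add: norm_divide del: of_nat_Suc)
    have "integrable lborel (hn (Suc n))"
      unfolding hn_Suc by (intro integrable_mult_right integrable_mult_ft IH)
    moreover have "integrable lborel (inv_fourier (hn (Suc n)))"
      unfolding K' by (intro integrable_mult_right inv_fourier_mult_ft_L1 IH)
    moreover have "(LINT u|lborel. norm (hn (Suc n) u)) \<le> c (Suc n) * (LINT u|lborel. norm (h u))"
    proof -
      have "(LINT u|lborel. norm (hn (Suc n) u)) = (1 / real (Suc n)) * (LINT u|lborel. norm (hn n u * ft u))"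
        unfolding hn_Suc norm_mult[of "- 1 / of_nat (Suc n)"] n by (rule integral_mult_right_zero)
      also have "\<dots> \<le> (1 / real (Suc n)) * (total_mass * (c n * (LINT u|lborel. norm (h u))))"
        by (intro mult_left_mono order_trans[OF integrable_mult_ft(2)[OF IH(1)]] IH(3) total_mass_nonneg) simp
      also have "\<dots> = c (Suc n) * (LINT u|lborel. norm (h u))" unfolding cSuc by (simp only: mult.assoc)
      finally show ?thesis .
    qed
    moreover have "(LINT x|lborel. norm (inv_fourier (hn (Suc n)) x)) \<le> c (Suc n) * (LINT x|lborel. norm (inv_fourier h x))"
    proof -
      have "(LINT x|lborel. norm (inv_fourier (hn (Suc n)) x)) = (1 / real (Suc n)) * (LINT x|lborel. norm (inv_fourier (\<lambda>u. hn n u * ft u) x))"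
        unfolding K' norm_mult[of "- 1 / of_nat (Suc n)"] n by (rule integral_mult_right_zero)
      also have "\<dots> \<le> (1 / real (Suc n)) * (total_mass * (c n * (LINT x|lborel. norm (inv_fourier h x))))"
        by (intro mult_left_mono order_trans[OF inv_fourier_mult_ft_L1(2)[OF IH(1,2)]] IH(4) total_mass_nonneg) simp
      also have "\<dots> = c (Suc n) * (LINT x|lborel. norm (inv_fourier h x))" unfolding cSuc by (simp only: mult.assoc)
      finally show ?thesis .
    qed
    ultimately show ?case by blast
  qed
  have hs: "(\<lambda>n. hn n u) sums (h u * exp (- ft u))" for u
  proof -
    have "(\<lambda>n. (- ft u) ^ n / fact n) sums exp (- ft u)"
      using exp_converges[of "- ft u"] by (simp add: scaleR_conv_of_real field_simps)
    then show ?thesis unfolding hn_def by (rule sums_mult)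
  qed
  \<comment> \<open>For each x the series is exchanged with the frequency integral, which is
    legitimate because the bounds \<open>c n * norm (h u)\<close> are summable in n and integrable
    in u.\<close>
  have inner: "(\<lambda>n. inv_fourier (hn n) x) sums inv_fourier (\<lambda>u. h u * exp (- ft u)) x" for x
  proof -
    let ?f = "\<lambda>n u. iexp ((- x) * u) * hn n u"
    have "(\<lambda>n. integral\<^sup>L lborel (?f n)) sums (CLINT u|lborel. (\<Sum>n. ?f n u))"
    proof (rule sums_integral)
      show "integrable lborel (?f n)" for n using step by (intro integrable_iexp_mult) blast
      have nf: "norm (?f n u) = norm (hn n u)" for n u by (simp add: norm_mult)
      have hb: "norm (hn n u) \<le> c n * norm (h u)" for n u
      proof -
        have "norm (hn n u) = norm (ft u) ^ n / fact n * norm (h u)" by (simp add: hn_def norm_mult norm_divide norm_power)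
        also have "\<dots> \<le> total_mass ^ n / fact n * norm (h u)"
          by (intro mult_right_mono divide_right_mono power_mono norm_ft_le) auto
        finally show ?thesis by (simp add: c_def)
      qed
      show "AE u in lborel. summable (\<lambda>n. norm (?f n u))"
      proof (rule AE_I2)
        fix u
        show "summable (\<lambda>n. norm (?f n u))"
          unfolding nf
          by (rule summable_comparison_test'[of "\<lambda>n. c n * norm (h u)" 0])
             (use hb c_sums in \<open>auto intro!: summable_mult2 simp: sums_iff\<close>)
      qed
      show "summable (\<lambda>n. LINT u|lborel. norm (?f n u))"
        unfolding nf
        by (rule summable_comparison_test'[of "\<lambda>n. c n * (LINT u|lborel. norm (h u))" 0])
           (use step c_sums in \<open>auto intro!: summable_mult2 simp: sums_iff\<close>)
    qed
    moreover have "(\<Sum>n. ?f n u) = iexp ((- x) * u) * (h u * exp (- ft u))" for u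
      using sums_mult[OF hs[of u], of "iexp ((- x) * u)"] by (simp add: sums_iff)
    ultimately have "(\<lambda>n. fourier (hn n) (- x)) sums fourier (\<lambda>u. h u * exp (- ft u)) (- x)"
      by (simp add: fourier_def)
    then show ?thesis unfolding inv_fourier_eq by (rule sums_divide)
  qed
  have eq: "inv_fourier (\<lambda>u. h u * exp (- ft u)) = (\<lambda>x. \<Sum>n. inv_fourier (hn n) x)"
    using inner by (auto simp: sums_iff)
  have Ki: "integrable lborel (inv_fourier (hn n))" for n using step by blast
  have sN: "summable (\<lambda>n. norm (inv_fourier (hn n) x))" for x
  proof (rule summable_comparison_test'[of "\<lambda>n. c n * ((LINT u|lborel. norm (h u)) / (2 * pi))" 0])
    show "summable (\<lambda>n. c n * ((LINT u|lborel. norm (h u)) / (2 * pi)))"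
      using c_sums by (intro summable_mult2) (simp add: sums_iff)
    fix n
    have "norm (inv_fourier (hn n) x) \<le> (LINT u|lborel. norm (hn n u)) / (2 * pi)" by (rule norm_inv_fourier_le)
    also have "\<dots> \<le> (c n * (LINT u|lborel. norm (h u))) / (2 * pi)" using step by (intro divide_right_mono) auto
    finally show "norm (norm (inv_fourier (hn n) x)) \<le> c n * ((LINT u|lborel. norm (h u)) / (2 * pi))" by simp
  qed
  have cK: "(\<lambda>n. c n * (LINT x|lborel. norm (inv_fourier h x))) sums (exp total_mass * (LINT x|lborel. norm (inv_fourier h x)))"
    by (rule sums_mult2[OF c_sums])
  have sI: "summable (\<lambda>n. LINT x|lborel. norm (inv_fourier (hn n) x))"
    by (rule summable_comparison_test'[OF sums_summable[OF cK], of 0]) (use step in auto)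
  show int: "integrable lborel (inv_fourier (\<lambda>u. h u * exp (- ft u)))"
    unfolding eq by (rule integrable_suminf[OF Ki]) (use sN sI in auto)
  have nS: "integrable lborel (\<lambda>x. \<Sum>n. norm (inv_fourier (hn n) x))"
    "(LINT x|lborel. (\<Sum>n. norm (inv_fourier (hn n) x))) = (\<Sum>n. LINT x|lborel. norm (inv_fourier (hn n) x))"
    by (rule integrable_suminf integral_suminf; use Ki sN sI in auto)+
  have "(LINT x|lborel. norm (inv_fourier (\<lambda>u. h u * exp (- ft u)) x)) \<le> (LINT x|lborel. (\<Sum>n. norm (inv_fourier (hn n) x)))"
  proof (rule integral_mono[OF integrable_norm[OF int] nS(1)])
    show "norm (inv_fourier (\<lambda>u. h u * exp (- ft u)) x) \<le> (\<Sum>n. norm (inv_fourier (hn n) x))" for x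
      unfolding eq by (rule summable_norm[OF sN])
  qed
  also have "\<dots> = (\<Sum>n. LINT x|lborel. norm (inv_fourier (hn n) x))" by (rule nS(2))
  also have "\<dots> \<le> (\<Sum>n. c n * (LINT x|lborel. norm (inv_fourier h x)))"
    by (rule suminf_le[OF _ sI sums_summable[OF cK]]) (use step in blast)
  also have "\<dots> = exp total_mass * (LINT x|lborel. norm (inv_fourier h x))" using cK by (simp add: sums_iff)
  finally show "(LINT x|lborel. norm (inv_fourier (\<lambda>u. h u * exp (- ft u)) x)) \<le> exp total_mass * (LINT x|lborel. norm (inv_fourier h x))" .
qed

end

section \<open>Characteristic functions and Levy measures\<close>

lemma iexp_minus_1_minus: "cmod (iexp x - 1 - \<i> * complex_of_real x) \<le> x\<^sup>2 / 2"
  using iexp_approx1[of x 1] by (simp add: numeral_2_eq_2 diff_diff_eq)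

text \<open>Merges the bounds t^2 / 2 near 0 and 2 far away into one that, with t = u x, integrates
  against dx / x to a logarithm.\<close>

lemma one_minus_cos_le: "1 - cos t \<le> 4 * \<bar>t\<bar> / (1 + \<bar>t\<bar>)" for t :: real
proof -
  have 1: "1 - cos t \<le> t\<^sup>2 / 2"
    using abs_Re_le_cmod[of "iexp t - 1 - \<i> * complex_of_real t"] iexp_minus_1_minus[of t]
    by (simp add: Re_exp)
  show ?thesis
  proof (cases "\<bar>t\<bar> \<le> 1")
    case True
    have "\<bar>t\<bar> * (\<bar>t\<bar> * (1 + \<bar>t\<bar>)) \<le> \<bar>t\<bar> * (1 * 2)" using True by (intro mult_left_mono mult_mono) auto
    then have "t\<^sup>2 * (1 + \<bar>t\<bar>) \<le> 2 * \<bar>t\<bar>" by (simp add: power2_eq_square mult.assoc[symmetric])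
    then have "t\<^sup>2 / 2 \<le> 4 * \<bar>t\<bar> / (1 + \<bar>t\<bar>)" by (simp add: field_simps)
    then show ?thesis using 1 by linarith
  next
    case False
    have "1 - cos t \<le> 2" using cos_ge_minus_one[of t] by linarith
    also have "2 \<le> 4 * \<bar>t\<bar> / (1 + \<bar>t\<bar>)" using False by (simp add: field_simps)
    finally show ?thesis .
  qed
qed

locale levy_triplet = real_distribution \<mu> for \<mu> :: "real measure" +
  fixes v \<gamma> :: real and \<nu> :: "real measure"
  assumes triplet: "characteristic_triplet \<mu> v \<gamma> \<nu>"
begin

lemma v_nonneg: "0 \<le> v" and sets_nu[measurable_cong]: "sets \<nu> = sets borel" and nu_0: "emeasure \<nu> {0} = 0"
  and nu_min: "(\<integral>\<^sup>+x. ennreal (min 1 (x\<^sup>2)) \<partial>\<nu>) < \<infinity>"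
  using triplet by (auto simp: characteristic_triplet_def levy_measure_def)

lemma space_nu: "space \<nu> = UNIV"
  using sets_eq_imp_space_eq[OF sets_nu] by simp

lemma integrable_min: "integrable \<nu> (\<lambda>x. min 1 (x\<^sup>2))"
  by (rule integrableI_nonneg) (use nu_min in auto)

lemma integrable_levy:
  fixes f :: "real \<Rightarrow> 'a::{banach, second_countable_topology}"
  assumes [measurable]: "f \<in> borel_measurable borel" and "\<And>x. norm (f x) \<le> C * min 1 (x\<^sup>2)" 
  shows "integrable \<nu> f"
proof (rule Bochner_Integration.integrable_bound)
  show "integrable \<nu> (\<lambda>x. C * min 1 (x\<^sup>2))" by (intro integrable_mult_right integrable_min)
  show "AE x in \<nu>. norm (f x) \<le> norm (C * min 1 (x\<^sup>2))"
    by (rule AE_I2) (use assms(2) in \<open>auto intro: order_trans[OF _ abs_ge_self]\<close>)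
qed measurable

definition exponent :: "real \<Rightarrow> real \<Rightarrow> complex" where
  "exponent u x = iexp (u * x) - 1 - \<i> * complex_of_real (u * x * indicator {-1..1} x)"

lemma char_eq: "char \<mu> u = exp (- complex_of_real (v / 2 * u\<^sup>2) + \<i> * complex_of_real (\<gamma> * u) + (CLINT x|\<nu>. exponent u x))"
  using triplet by (simp add: characteristic_triplet_def exponent_def)

text \<open>Of second order near 0 thanks to the compensator, at most 2 outside [-1, 1]; the two
  constants are simply added.\<close>

lemma exponent_bound: "cmod (exponent u x) \<le> (u\<^sup>2 / 2 + 2) * min 1 (x\<^sup>2)"
proof (cases "x \<in> {-1..1}")
  case True
  then have "x\<^sup>2 \<le> 1" by (simp add: abs_le_iff abs_square_le_1)
  have "cmod (exponent u x) \<le> (u * x)\<^sup>2 / 2"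
    using iexp_minus_1_minus[of "u * x"] True by (simp add: exponent_def)
  then have "cmod (exponent u x) \<le> u\<^sup>2 / 2 * x\<^sup>2" by (simp add: power_mult_distrib)
  also have "\<dots> \<le> (u\<^sup>2 / 2 + 2) * x\<^sup>2" by (intro mult_right_mono) auto
  finally show ?thesis using \<open>x\<^sup>2 \<le> 1\<close> by simp
next
  case False
  then have "1 \<le> \<bar>x\<bar>" by auto
  then have "1 \<le> x\<^sup>2" by (simp add: one_le_power abs_le_square_iff[of 1 x, simplified])
  moreover have "cmod (exponent u x) \<le> 2"
    using False norm_triangle_ineq4[of "iexp (u * x)" 1] by (simp add: exponent_def)
  ultimately show ?thesis by (simp add: add_increasing)
qed

lemma exponent_measurable[measurable]: "exponent u \<in> borel_measurable borel"
  unfolding exponent_def[abs_def] by measurable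

lemma exponent_integrable: "integrable \<nu> (exponent u)"
  by (rule integrable_levy[OF exponent_measurable exponent_bound])

section \<open>Modulus of the characteristic function\<close>

lemma one_minus_cos_integrable: "integrable \<nu> (\<lambda>x. 1 - cos (u * x))"
proof -
  have "integrable \<nu> (\<lambda>x. - Re (exponent u x))"
    by (intro integrable_minus integrable_Re exponent_integrable)
  then show ?thesis by (simp add: exponent_def Re_exp)
qed

lemma norm_char: "cmod (char \<mu> u) = exp (- v / 2 * u\<^sup>2 - (LINT x|\<nu>. 1 - cos (u * x)))"
proof -
  have "Re (CLINT x|\<nu>. exponent u x) = (LINT x|\<nu>. Re (exponent u x))"
    by (rule integral_Re[OF exponent_integrable, symmetric])
  also have "\<dots> = - (LINT x|\<nu>. - Re (exponent u x))" by simp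
  also have "(LINT x|\<nu>. - Re (exponent u x)) = (LINT x|\<nu>. 1 - cos (u * x))"
    by (simp add: exponent_def Re_exp)
  finally show ?thesis unfolding char_eq norm_exp_eq_Re by (simp del: of_real_power)
qed

lemma char_nonzero: "char \<mu> u \<noteq> 0"
  unfolding char_eq by simp

lemma char_continuous: "continuous_on UNIV (char \<mu>)"
  using isCont_char by (simp add: continuous_at_imp_continuous_on)

lemma sets_tail: "{x. r < \<bar>x\<bar>} \<in> sets borel" for r :: real
  by measurable

text \<open>Markov's inequality for min(1, x^2), which is at least r^2 on the tail.\<close>

lemma tail_finite:
  assumes "0 < r" "r \<le> 1"
  shows "emeasure \<nu> {x. r < \<bar>x\<bar>} < \<infinity>"
proof -
  have "ennreal (r\<^sup>2) * emeasure \<nu> {x. r < \<bar>x\<bar>} = (\<integral>\<^sup>+x. ennreal (r\<^sup>2) * indicator {x. r < \<bar>x\<bar>} x \<partial>\<nu>)"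
    using sets_tail sets_nu by (simp add: nn_integral_cmult_indicator)
  also have "\<dots> \<le> (\<integral>\<^sup>+x. ennreal (min 1 (x\<^sup>2)) \<partial>\<nu>)"
  proof (rule nn_integral_mono)
    fix x
    show "ennreal (r\<^sup>2) * indicator {x. r < \<bar>x\<bar>} x \<le> ennreal (min 1 (x\<^sup>2))"
    proof (cases "r < \<bar>x\<bar>")
      case True
      then have "r\<^sup>2 \<le> \<bar>x\<bar>\<^sup>2" using assms by (intro power_mono) auto
      moreover have "r\<^sup>2 \<le> 1" using assms by (simp add: power_le_one)
      ultimately show ?thesis using True by (simp add: ennreal_leI)
    qed simp
  qed
  also have "\<dots> < \<infinity>" by (rule nu_min)
  finally have "ennreal (r\<^sup>2) * emeasure \<nu> {x. r < \<bar>x\<bar>} < \<infinity>" .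
  then show ?thesis using assms by (auto simp: ennreal_mult_less_top)
qed

text \<open>The jumps can only decrease the modulus, so it is at most exp(-v u^2 / 2), which for
  positive \<open>v\<close> falls below every power.\<close>

lemma polynomial_decay_imp_no_gaussian:
  assumes "0 < c" "\<And>u. c * (1 + \<bar>u\<bar>) powr (- \<alpha>) \<le> cmod (char \<mu> u)"
  shows "v = 0"
proof (rule ccontr)
  assume "v \<noteq> 0"
  then have v: "0 < v" using v_nonneg by simp
  have "((\<lambda>u::real. exp (- v / 2 * u\<^sup>2) * (1 + u) powr \<alpha>) \<longlongrightarrow> 0) at_top"
    using v by real_asymp
  then have "\<forall>\<^sub>F u in at_top. exp (- v / 2 * u\<^sup>2) * (1 + u) powr \<alpha> < c"
    using assms(1) by (rule order_tendstoD(2))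
  moreover have "\<forall>\<^sub>F u::real in at_top. 0 \<le> u" by (rule eventually_ge_at_top)
  ultimately have "\<forall>\<^sub>F u::real in at_top. 0 \<le> u \<and> exp (- v / 2 * u\<^sup>2) * (1 + u) powr \<alpha> < c"
    by eventually_elim simp
  then obtain u :: real where u: "0 \<le> u" "exp (- v / 2 * u\<^sup>2) * (1 + u) powr \<alpha> < c"
    by (metis (mono_tags, lifting) eventually_at_top_linorder order_refl)
  have "cmod (char \<mu> u) \<le> exp (- v / 2 * u\<^sup>2)"
    unfolding norm_char by (simp add: integral_nonneg_AE)
  with assms(2)[of u] u(1) have "c * (1 + u) powr (- \<alpha>) \<le> exp (- v / 2 * u\<^sup>2)" by simp
  then have "c * (1 + u) powr (- \<alpha>) * (1 + u) powr \<alpha> \<le> exp (- v / 2 * u\<^sup>2) * (1 + u) powr \<alpha>"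
    by (intro mult_right_mono) auto
  then show False using u by (simp add: mult.assoc powr_add[symmetric])
qed

end

section \<open>From the jump density near 0 to the growth of the exponent\<close>

locale levy_density = levy_triplet +
  fixes \<delta> :: real and k :: "real \<Rightarrow> real"
  assumes delta: "0 < \<delta>" "\<delta> < 1"
    and density: "lebesgue_density_on (density (sym_jump_measure \<nu>) (\<lambda>x. ennreal x)) {0<..\<delta>} k"
begin

text \<open>The hypothesis makes \<open>k\<close> measurable only after multiplication by the
  indicator of (0, \<delta>], so the indicator is carried along.\<close>

lemma density_measurable[measurable]: "(\<lambda>x. indicator {0<..\<delta>} x * k x) \<in> borel_measurable borel"
  using density by (simp add: lebesgue_density_on_def set_borel_measurable_def)

lemma density_emeasure:
  assumes A: "A \<in> sets borel" "A \<subseteq> {0<..\<delta>}"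
  shows "(\<integral>\<^sup>+x. ennreal x * indicator A x \<partial>sym_jump_measure \<nu>) = (\<integral>\<^sup>+x. ennreal (indicator {0<..\<delta>} x * k x) * indicator A x \<partial>lborel)"
proof -
  have AS: "A \<in> sets (sym_jump_measure \<nu>)"
    unfolding sets_sym_jump_measure using A by (auto simp: sets_restrict_space_iff)
  have m: "(\<lambda>x. ennreal x) \<in> borel_measurable (sym_jump_measure \<nu>)"
    unfolding measurable_cong_sets[OF sets_sym_jump_measure refl] by (rule measurable_restrict_space1) simp
  have "(\<integral>\<^sup>+x. ennreal x * indicator A x \<partial>sym_jump_measure \<nu>) = emeasure (density (sym_jump_measure \<nu>) (\<lambda>x. ennreal x)) A"
    by (rule emeasure_density[OF m AS, symmetric])
  also have "\<dots> = (\<integral>\<^sup>+x\<in>A. ennreal (k x) \<partial>lborel)" using density A by (simp add: lebesgue_density_on_def)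
  also have "\<dots> = (\<integral>\<^sup>+x. ennreal (indicator {0<..\<delta>} x * k x) * indicator A x \<partial>lborel)"
    using A(2) by (intro nn_integral_cong) (auto simp: indicator_def)
  finally show ?thesis .
qed

text \<open>Both sides are the mass of \<open>w\<close> under the image of the small jumps by the absolute value.\<close>

lemma small_jumps_integral:
  assumes w[measurable]: "w \<in> borel_measurable borel" and even: "\<And>x. w (- x) = w x"
  shows "(\<integral>\<^sup>+x. w x * indicator {x. 0 < \<bar>x\<bar> \<and> \<bar>x\<bar> \<le> \<delta>} x \<partial>\<nu>)
    = (\<integral>\<^sup>+x. w x * (ennreal (indicator {0<..\<delta>} x * k x) / ennreal x) * indicator {0<..\<delta>} x \<partial>lborel)"
proof -
  let ?s = "sym_jump_measure \<nu>"
  let ?I = "{0<..\<delta>}"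
  let ?J = "{x::real. 0 < \<bar>x\<bar> \<and> \<bar>x\<bar> \<le> \<delta>}"
  have IS: "A \<inter> ?I \<in> sets ?s" if "A \<in> sets borel" for A
    unfolding sets_sym_jump_measure using that by (auto simp: sets_restrict_space_iff)
  have Im: "?I \<in> sets ?s" using IS[of UNIV] by simp
  have idm: "(\<lambda>x. x) \<in> ?s \<rightarrow>\<^sub>M borel"
    unfolding measurable_cong_sets[OF sets_sym_jump_measure refl] by (rule measurable_restrict_space1) simp
  have sm: "f \<in> borel_measurable ?s" if "f \<in> borel_measurable borel" for f :: "real \<Rightarrow> ennreal"
    unfolding measurable_cong_sets[OF sets_sym_jump_measure refl] by (rule measurable_restrict_space1[OF that])
  have Jm[measurable]: "?J \<in> sets borel" by measurable
  \<comment> \<open>\<open>N\<close> is the image of the small jumps under the absolute value,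
    \<open>N'\<close> the symmetrised measure on (0, \<delta>]; they agree because the preimage of a
    set of positive numbers under the absolute value consists of the set and its mirror
    image.\<close>
  define N where "N = distr (density \<nu> (indicator ?J)) borel abs"
  define N' where "N' = distr (density ?s (indicator ?I)) borel (\<lambda>x. x)"
  have "N = N'"
  proof (rule measure_eqI)
    show "sets N = sets N'" by (simp add: N_def N'_def)
    fix A assume "A \<in> sets N"
    then have A[measurable]: "A \<in> sets borel" by (simp add: N_def)
    have absA: "abs -` A \<in> sets \<nu>"
      using measurable_sets[of abs borel borel A] A sets_nu by simp
    have "emeasure N A = emeasure (density \<nu> (indicator ?J)) (abs -` A)"
      unfolding N_def using absA by (subst emeasure_distr) (auto simp: space_nu)
    also have "\<dots> = (\<integral>\<^sup>+x. indicator ?J x * indicator (abs -` A) x \<partial>\<nu>)"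
      using absA by (intro emeasure_density) auto
    also have "\<dots> = (\<integral>\<^sup>+x. indicator (?J \<inter> abs -` A) x \<partial>\<nu>)"
      by (simp only: indicator_inter_arith)
    also have "\<dots> = emeasure \<nu> (?J \<inter> abs -` A)"
      using absA Jm sets_nu by (intro nn_integral_indicator) auto
    also have "?J \<inter> abs -` A = (A \<inter> ?I) \<union> uminus ` (A \<inter> ?I)"
    proof (intro equalityI subsetI)
      fix x assume x: "x \<in> ?J \<inter> abs -` A"
      show "x \<in> (A \<inter> ?I) \<union> uminus ` (A \<inter> ?I)"
      proof (cases "0 < x")
        case False
        then have "- x \<in> A \<inter> ?I" using x by auto
        then have "- (- x) \<in> uminus ` (A \<inter> ?I)" by (rule imageI)
        then show ?thesis by simp
      qed (use x in auto)
    qed auto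
    also have "emeasure \<nu> \<dots> = emeasure \<nu> (A \<inter> ?I) + emeasure \<nu> (uminus ` (A \<inter> ?I))"
    proof (rule plus_emeasure[symmetric])
      have "uminus ` (A \<inter> ?I) = uminus -` (A \<inter> ?I)" by (force simp: image_iff)
      moreover have "uminus -` (A \<inter> ?I) \<inter> space borel \<in> sets (borel :: real measure)" by measurable
      ultimately show "uminus ` (A \<inter> ?I) \<in> sets \<nu>" using sets_nu by simp
    qed (use sets_nu in auto)
    also have "\<dots> = emeasure ?s (A \<inter> ?I)"
      by (rule emeasure_sym_jump_measure[OF sets_nu, symmetric]) auto
    also have "\<dots> = emeasure N' A"
    proof -
      have "(\<lambda>x. x) -` A \<inter> space (density ?s (indicator ?I)) \<in> sets ?s"
        using measurable_sets[OF idm A] by simp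
      moreover have "(\<lambda>x. indicator ?I x :: ennreal) \<in> borel_measurable ?s" by (rule sm) simp
      moreover have "(\<integral>\<^sup>+x. indicator ?I x * indicator (A \<inter> space ?s) x \<partial>?s) = (\<integral>\<^sup>+x. indicator (A \<inter> ?I) x \<partial>?s)"
        by (intro nn_integral_cong) (auto simp: indicator_def)
      ultimately show ?thesis
        using idm IS[OF A] unfolding N'_def
        by (subst emeasure_distr) (auto simp: emeasure_density)
    qed
    finally show "emeasure N A = emeasure N' A" .
  qed
  \<comment> \<open>The hypothesis concerns the measure weighted by \<open>x\<close>, so the
    integrand is multiplied and divided by \<open>x\<close>, which is positive on the
    interval.\<close>
  define Q where "Q = density N' (\<lambda>x. ennreal x)"
  define Q' where "Q' = density lborel (\<lambda>x. ennreal (indicator ?I x * k x))"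
  have N'_nn: "(\<integral>\<^sup>+x. f x \<partial>N') = (\<integral>\<^sup>+x. f x * indicator ?I x \<partial>?s)" if [measurable]: "f \<in> borel_measurable borel" for f
  proof -
    have "(\<integral>\<^sup>+x. f x \<partial>N') = (\<integral>\<^sup>+x. f x \<partial>density ?s (indicator ?I))"
      unfolding N'_def by (rule nn_integral_distr) (use idm that in auto)
    also have "\<dots> = (\<integral>\<^sup>+x. indicator ?I x * f x \<partial>?s)"
      by (rule nn_integral_density) (auto intro: sm that)
    finally show ?thesis by (simp add: mult.commute)
  qed
  have "Q = Q'"
  proof (rule measure_eqI)
    show "sets Q = sets Q'" by (simp add: Q_def Q'_def N'_def)
    fix A assume "A \<in> sets Q"
    then have A[measurable]: "A \<in> sets borel" by (simp add: Q_def N'_def)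
    have "emeasure Q A = (\<integral>\<^sup>+x. ennreal x * indicator A x \<partial>N')"
      unfolding Q_def by (rule emeasure_density) (auto simp: N'_def)
    also have "\<dots> = (\<integral>\<^sup>+x. ennreal x * indicator (A \<inter> ?I) x \<partial>?s)"
      by (subst N'_nn) (auto intro!: nn_integral_cong simp: indicator_def)
    also have "\<dots> = (\<integral>\<^sup>+x. ennreal (indicator ?I x * k x) * indicator (A \<inter> ?I) x \<partial>lborel)"
      by (rule density_emeasure) auto
    also have "\<dots> = (\<integral>\<^sup>+x. ennreal (indicator ?I x * k x) * indicator A x \<partial>lborel)"
      by (intro nn_integral_cong) (auto simp: indicator_def)
    also have "\<dots> = emeasure Q' A" unfolding Q'_def by (rule emeasure_density[symmetric]) auto
    finally show "emeasure Q A = emeasure Q' A" .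
  qed
  have "(\<integral>\<^sup>+x. w x * indicator ?J x \<partial>\<nu>) = (\<integral>\<^sup>+x. w x \<partial>N)"
  proof -
    have "(\<integral>\<^sup>+x. w x \<partial>N) = (\<integral>\<^sup>+x. w \<bar>x\<bar> \<partial>density \<nu> (indicator ?J))"
      unfolding N_def by (rule nn_integral_distr) auto
    also have "\<dots> = (\<integral>\<^sup>+x. indicator ?J x * w \<bar>x\<bar> \<partial>\<nu>)" by (rule nn_integral_density) auto
    also have "\<dots> = (\<integral>\<^sup>+x. w x * indicator ?J x \<partial>\<nu>)"
      by (intro nn_integral_cong) (auto simp: abs_if even mult.commute)
    finally show ?thesis by simp
  qed
  also have "\<dots> = (\<integral>\<^sup>+x. w x * indicator ?I x \<partial>N')"
    unfolding \<open>N = N'\<close> by (subst (1 2) N'_nn) (auto intro!: nn_integral_cong simp: indicator_def)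
  also have "\<dots> = (\<integral>\<^sup>+x. ennreal x * (w x / ennreal x * indicator ?I x) \<partial>N')"
  proof (rule nn_integral_cong)
    fix x
    show "w x * indicator ?I x = ennreal x * (w x / ennreal x * indicator ?I x)"
    proof (cases "x \<in> ?I")
      case True
      then have "ennreal x * (w x / ennreal x) = w x"
        by (simp add: ennreal_times_divide mult_divide_eq_ennreal mult.commute[of "ennreal x"])
      then show ?thesis using True by simp
    qed simp
  qed
  also have "\<dots> = (\<integral>\<^sup>+x. w x / ennreal x * indicator ?I x \<partial>Q)"
    unfolding Q_def by (rule nn_integral_density[symmetric]) (auto simp: N'_def)
  also have "\<dots> = (\<integral>\<^sup>+x. ennreal (indicator ?I x * k x) * (w x / ennreal x * indicator ?I x) \<partial>lborel)"
    unfolding \<open>Q = Q'\<close> Q'_def by (rule nn_integral_density) auto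
  also have "\<dots> = (\<integral>\<^sup>+x. w x * (ennreal (indicator {0<..\<delta>} x * k x) / ennreal x) * indicator {0<..\<delta>} x \<partial>lborel)"
    by (intro nn_integral_cong) (simp add: divide_ennreal_def mult_ac)
  finally show ?thesis .
qed

lemma small_jumps_cos:
  "(\<integral>\<^sup>+x. ennreal (1 - cos (u * x)) * indicator {x. 0 < \<bar>x\<bar> \<and> \<bar>x\<bar> \<le> \<delta>} x \<partial>\<nu>)
    = (\<integral>\<^sup>+x. ennreal ((1 - cos (u * x)) / x * (indicator {0<..\<delta>} x * k x)) * indicator {0<..\<delta>} x \<partial>lborel)"
proof -
  have nn: "AE x in lborel. x \<in> {0<..\<delta>} \<longrightarrow> 0 \<le> k x" using density by (simp add: lebesgue_density_on_def)
  have "(\<integral>\<^sup>+x. ennreal (1 - cos (u * x)) * indicator {x. 0 < \<bar>x\<bar> \<and> \<bar>x\<bar> \<le> \<delta>} x \<partial>\<nu>)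
    = (\<integral>\<^sup>+x. ennreal (1 - cos (u * x)) * (ennreal (indicator {0<..\<delta>} x * k x) / ennreal x) * indicator {0<..\<delta>} x \<partial>lborel)"
    by (rule small_jumps_integral) auto
  also have "\<dots> = (\<integral>\<^sup>+x. ennreal ((1 - cos (u * x)) / x * (indicator {0<..\<delta>} x * k x)) * indicator {0<..\<delta>} x \<partial>lborel)"
    using nn
  proof (intro nn_integral_cong_AE, eventually_elim)
    fix x assume x: "x \<in> {0<..\<delta>} \<longrightarrow> 0 \<le> k x"
    show "ennreal (1 - cos (u * x)) * (ennreal (indicator {0<..\<delta>} x * k x) / ennreal x) * indicator {0<..\<delta>} x
      = ennreal ((1 - cos (u * x)) / x * (indicator {0<..\<delta>} x * k x)) * indicator {0<..\<delta>} x"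
    proof (cases "x \<in> {0<..\<delta>}")
      case True
      then show ?thesis using x by (simp add: divide_ennreal ennreal_mult[symmetric])
    qed simp
  qed
  finally show ?thesis .
qed


lemma nn_integral_one_minus_cos: "(\<integral>\<^sup>+x. ennreal (1 - cos (u * x)) \<partial>\<nu>) = ennreal (LINT x|\<nu>. 1 - cos (u * x))"
  by (rule nn_integral_eq_integral[OF one_minus_cos_integrable]) simp

text \<open>If the density is bounded near \<open>0\<close>, then \<open>1 - cos t \<le> 4 t / (1 + t)\<close> makes the exponent
  grow at most logarithmically.\<close>

lemma char_polynomial_lower_bound:
  assumes K: "0 < K" "AE x in lborel. x \<in> {0<..<\<delta>} \<longrightarrow> k x \<le> K" and v0: "v = 0"
  shows "\<exists>\<alpha>>0. \<exists>c>0. \<forall>u. c * (1 + \<bar>u\<bar>) powr (- \<alpha>) \<le> cmod (char \<mu> u)"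
proof -
  define T where "T = enn2real (emeasure \<nu> {x. \<delta> < \<bar>x\<bar>})"
  have T: "emeasure \<nu> {x. \<delta> < \<bar>x\<bar>} = ennreal T" "0 \<le> T"
    using tail_finite[of \<delta>] delta by (auto simp: T_def)
  have main: "(LINT x|\<nu>. 1 - cos (u * x)) \<le> 4 * K * ln (1 + \<bar>u\<bar>) + 2 * T" for u
  proof -
    let ?J = "{x::real. 0 < \<bar>x\<bar> \<and> \<bar>x\<bar> \<le> \<delta>}"
    have small: "(\<integral>\<^sup>+x. ennreal (1 - cos (u * x)) * indicator ?J x \<partial>\<nu>) \<le> ennreal (4 * K * ln (1 + \<bar>u\<bar>))"
    proof -
      have "(\<integral>\<^sup>+x. ennreal (1 - cos (u * x)) * indicator ?J x \<partial>\<nu>)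
        \<le> (\<integral>\<^sup>+x. ennreal (4 * K * \<bar>u\<bar> / (1 + \<bar>u\<bar> * x)) * indicator {0..\<delta>} x \<partial>lborel)"
        unfolding small_jumps_cos
      proof (rule nn_integral_mono_AE)
        \<comment> \<open>The bound on \<open>k\<close> is known on the open interval only; its
          right end point is a null set.\<close>
        have "AE x in lborel. x \<noteq> \<delta>" by (rule AE_lborel_singleton)
        then show "AE x in lborel. ennreal ((1 - cos (u * x)) / x * (indicator {0<..\<delta>} x * k x)) * indicator {0<..\<delta>} x
          \<le> ennreal (4 * K * \<bar>u\<bar> / (1 + \<bar>u\<bar> * x)) * indicator {0..\<delta>} x"
          using K(2)
        proof eventually_elim
          fix x assume "x \<noteq> \<delta>" "x \<in> {0<..<\<delta>} \<longrightarrow> k x \<le> K"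
          then have x: "x \<in> {0<..\<delta>} \<Longrightarrow> k x \<le> K" by auto
          show "ennreal ((1 - cos (u * x)) / x * (indicator {0<..\<delta>} x * k x)) * indicator {0<..\<delta>} x
            \<le> ennreal (4 * K * \<bar>u\<bar> / (1 + \<bar>u\<bar> * x)) * indicator {0..\<delta>} x"
          proof (cases "x \<in> {0<..\<delta>}")
            case True
            have "(1 - cos (u * x)) / x * k x \<le> (1 - cos (u * x)) / x * K"
              using True x[OF True] by (intro mult_left_mono) auto
            also have "\<dots> \<le> (4 * (\<bar>u\<bar> * x) / (1 + \<bar>u\<bar> * x)) / x * K"
              using one_minus_cos_le[of "u * x"] True K(1) by (intro mult_right_mono divide_right_mono) (auto simp: abs_mult)
            also have "\<dots> = 4 * K * \<bar>u\<bar> / (1 + \<bar>u\<bar> * x)" using True by simp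
            finally show ?thesis using True by (simp add: ennreal_leI)
          qed simp
        qed
      qed
      \<comment> \<open>The majorant is the derivative of 4 K ln(1 + |u| x), the source of the
        logarithm.\<close>
      also have "\<dots> = ennreal (4 * K * ln (1 + \<bar>u\<bar> * \<delta>) - 4 * K * ln (1 + \<bar>u\<bar> * 0))"
      proof (rule nn_integral_FTC_Icc)
        have p: "0 < 1 + \<bar>u\<bar> * x" if "0 \<le> x" for x using that by (simp add: add_pos_nonneg)
        show "((\<lambda>x. 4 * K * ln (1 + \<bar>u\<bar> * x)) has_real_derivative 4 * K * \<bar>u\<bar> / (1 + \<bar>u\<bar> * x)) (at x)"
          if "x \<in> {0..\<delta>}" for x
          using p[of x] that by (auto intro!: derivative_eq_intros)
        show "0 \<le> 4 * K * \<bar>u\<bar> / (1 + \<bar>u\<bar> * x)" if "x \<in> {0..\<delta>}" for x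
          using p[of x] that K(1) by simp
      qed (use delta in auto)
      also have "\<dots> \<le> ennreal (4 * K * ln (1 + \<bar>u\<bar>))"
      proof (rule ennreal_leI)
        have "\<bar>u\<bar> * \<delta> \<le> \<bar>u\<bar>" using delta by (simp add: mult_left_le)
        then have "ln (1 + \<bar>u\<bar> * \<delta>) \<le> ln (1 + \<bar>u\<bar>)" using delta by (simp add: add_pos_nonneg)
        then show "4 * K * ln (1 + \<bar>u\<bar> * \<delta>) - 4 * K * ln (1 + \<bar>u\<bar> * 0) \<le> 4 * K * ln (1 + \<bar>u\<bar>)"
          using K(1) by simp
      qed
      finally show ?thesis .
    qed
    \<comment> \<open>On jumps larger than \<delta> the integrand is at most 2, so they add at most
      2 T; at 0 it vanishes.\<close>
    have "(\<integral>\<^sup>+x. ennreal (1 - cos (u * x)) \<partial>\<nu>)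
      \<le> (\<integral>\<^sup>+x. ennreal (1 - cos (u * x)) * indicator ?J x + 2 * indicator {x. \<delta> < \<bar>x\<bar>} x \<partial>\<nu>)"
    proof (rule nn_integral_mono)
      fix x
      have "1 - cos (u * x) \<le> 2" using cos_ge_minus_one[of "u * x"] by linarith
      from ennreal_leI[OF this] have "ennreal (1 - cos (u * x)) \<le> 2" by simp
      then show "ennreal (1 - cos (u * x)) \<le> ennreal (1 - cos (u * x)) * indicator ?J x + 2 * indicator {x. \<delta> < \<bar>x\<bar>} x"
        by (cases "x = 0"; cases "\<delta> < \<bar>x\<bar>") (auto simp: indicator_def)
    qed
    also have "\<dots> = (\<integral>\<^sup>+x. ennreal (1 - cos (u * x)) * indicator ?J x \<partial>\<nu>) + (\<integral>\<^sup>+x. 2 * indicator {x. \<delta> < \<bar>x\<bar>} x \<partial>\<nu>)"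
      by (rule nn_integral_add) auto
    also have "(\<integral>\<^sup>+x. 2 * indicator {x. \<delta> < \<bar>x\<bar>} x \<partial>\<nu>) = 2 * ennreal T"
      using sets_tail[of \<delta>] sets_nu by (subst nn_integral_cmult_indicator) (auto simp: T(1))
    also have "(\<integral>\<^sup>+x. ennreal (1 - cos (u * x)) * indicator ?J x \<partial>\<nu>) + 2 * ennreal T
        \<le> ennreal (4 * K * ln (1 + \<bar>u\<bar>)) + 2 * ennreal T"
      by (rule add_right_mono[OF small])
    also have "\<dots> = ennreal (4 * K * ln (1 + \<bar>u\<bar>) + 2 * T)"
      using K(1) T(2) by (simp add: ennreal_plus ennreal_mult)
    finally have "ennreal (LINT x|\<nu>. 1 - cos (u * x)) \<le> ennreal (4 * K * ln (1 + \<bar>u\<bar>) + 2 * T)"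
      unfolding nn_integral_one_minus_cos .
    moreover have "0 \<le> 4 * K * ln (1 + \<bar>u\<bar>) + 2 * T" using K(1) T(2) by simp
    ultimately show ?thesis by (simp only: ennreal_le_iff)
  qed
  have "exp (- 2 * T) * (1 + \<bar>u\<bar>) powr (- (4 * K)) \<le> cmod (char \<mu> u)" for u
  proof -
    have "exp (- 2 * T) * (1 + \<bar>u\<bar>) powr (- (4 * K)) = exp (- (4 * K * ln (1 + \<bar>u\<bar>) + 2 * T))"
      by (simp add: powr_def exp_add[symmetric] algebra_simps)
    also have "\<dots> \<le> exp (- (LINT x|\<nu>. 1 - cos (u * x)))" using main[of u] by simp
    finally show ?thesis by (simp add: norm_char v0)
  qed
  then show ?thesis using K(1) by (intro exI[of _ "4 * K"] conjI exI[of _ "exp (- 2 * T)"]) auto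
qed

text \<open>The function \<open>A\<close> below satisfies \<open>A' x \<le> (1 - cos (u x)) / x\<close> and grows like \<open>ln x\<close>.\<close>

lemma char_upper_bound:
  assumes K: "0 < K" "AE x in lborel. x \<in> {0<..<\<epsilon>} \<longrightarrow> K \<le> k x" and e: "0 < \<epsilon>" "\<epsilon> < \<delta>" and u: "2 / \<epsilon> \<le> u"
  shows "cmod (char \<mu> u) \<le> exp (K * (1 - ln (u * (\<epsilon> / 2))))"
proof -
  \<comment> \<open>Half of \<epsilon>, so that the closed interval [1/u, \<eta>] lies in the open
    one where \<open>k\<close> is bounded below; it is nonempty because u \<ge> 2 /
    \<epsilon>.\<close>
  define \<eta> where "\<eta> = \<epsilon> / 2"
  have eta: "0 < \<eta>" "\<eta> < \<epsilon>" using e by (auto simp: \<eta>_def)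
  have u0: "0 < u" using u e by (meson divide_pos_pos less_le_trans zero_less_numeral)
  have ue: "1 / u \<le> \<eta>" using u u0 e by (simp add: \<eta>_def field_simps)
  \<comment> \<open>Integrating (1 - cos(u x)) / x once by parts gives ln x - sin(u x) / (u x) up to
    the error sin(u x) / (u x^2); the term 1 / (u x) is added because its derivative -1 / (u x^2)
    outweighs that error.\<close>
  define A where "A x = ln x - sin (u * x) / (u * x) + 1 / (u * x)" for x
  define A' where "A' x = 1 / x - (cos (u * x) / x - sin (u * x) / (u * x\<^sup>2)) - 1 / (u * x\<^sup>2)" for x
  let ?I = "{1 / u..\<eta>}"
  have xpos: "0 < x" if "x \<in> ?I" for x
    using that u0 by (auto intro: less_le_trans[of 0 "1 / u"])
  have dA: "(A has_real_derivative A' x) (at x)" if "x \<in> ?I" for x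
    unfolding A_def A'_def using xpos[OF that] u0
    by (auto intro!: derivative_eq_intros simp: power2_eq_square field_simps)
  have A'le: "A' x \<le> (1 - cos (u * x)) / x" if "x \<in> ?I" for x
  proof -
    have "sin (u * x) / (u * x\<^sup>2) \<le> 1 / (u * x\<^sup>2)" using u0 by (intro divide_right_mono) auto
    then show ?thesis by (simp add: A'_def diff_divide_distrib)
  qed
  have cA': "continuous_on ?I A'" and cf: "continuous_on ?I (\<lambda>x. (1 - cos (u * x)) / x)"
    unfolding A'_def using xpos u0 by (auto intro!: continuous_intros dest: xpos)
  have i: "integrable lborel (\<lambda>x. indicator ?I x *\<^sub>R A' x)" "integrable lborel (\<lambda>x. indicator ?I x *\<^sub>R ((1 - cos (u * x)) / x))"
    by (intro borel_integrable_compact compact_Icc cA' cf)+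
  have FTC: "(LINT x|lborel. indicator ?I x *\<^sub>R A' x) = A \<eta> - A (1 / u)"
    by (rule integral_FTC_Icc[OF ue _ cA'])
       (use dA in \<open>auto intro: has_field_derivative_at_within simp: has_real_derivative_iff_has_vector_derivative[symmetric]\<close>)
  \<comment> \<open>Only a constant is lost at the ends: sin \<le> 1 is used at \<eta>, and at 1 / u
    the value is 1 - sin 1 - ln u.\<close>
  have "ln \<eta> \<le> A \<eta>"
  proof -
    have "sin (u * \<eta>) / (u * \<eta>) \<le> 1 / (u * \<eta>)" using u0 eta by (intro divide_right_mono) auto
    then show ?thesis by (simp add: A_def)
  qed
  moreover have "A (1 / u) \<le> 1 - ln u"
    using u0 sin_ge_zero[of 1] pi_gt3 by (simp add: A_def ln_div)
  ultimately have "ln (u * \<eta>) - 1 \<le> (LINT x|lborel. indicator ?I x *\<^sub>R A' x)"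
    unfolding FTC using u0 eta by (simp add: ln_mult)
  also have "\<dots> \<le> (LINT x|lborel. indicator ?I x *\<^sub>R ((1 - cos (u * x)) / x))"
    by (rule integral_mono[OF i]) (use A'le in \<open>auto simp: indicator_def\<close>)
  finally have l: "ln (u * \<eta>) - 1 \<le> (LINT x|lborel. indicator ?I x *\<^sub>R ((1 - cos (u * x)) / x))" .
  let ?J = "{x::real. 0 < \<bar>x\<bar> \<and> \<bar>x\<bar> \<le> \<delta>}"
  have nn: "0 \<le> indicator ?I x *\<^sub>R ((1 - cos (u * x)) / x)" for x
    using xpos[of x] by (auto simp: indicator_def)
  have "ennreal (K * (LINT x|lborel. indicator ?I x *\<^sub>R ((1 - cos (u * x)) / x)))
      = (\<integral>\<^sup>+x. ennreal (K * (indicator ?I x *\<^sub>R ((1 - cos (u * x)) / x))) \<partial>lborel)"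
  proof -
    have "0 \<le> K * (indicator ?I x *\<^sub>R ((1 - cos (u * x)) / x))" for x
      using K(1) by (intro mult_nonneg_nonneg nn) simp
    from nn_integral_eq_integral[OF integrable_mult_right[OF i(2), of K] AE_I2[OF this]]
    show ?thesis by (simp only: integral_mult_right_zero)
  qed
  also have "\<dots> \<le> (\<integral>\<^sup>+x. ennreal ((1 - cos (u * x)) / x * (indicator {0<..\<delta>} x * k x)) * indicator {0<..\<delta>} x \<partial>lborel)"
  proof (rule nn_integral_mono_AE)
    show "AE x in lborel. ennreal (K * (indicator ?I x *\<^sub>R ((1 - cos (u * x)) / x)))
        \<le> ennreal ((1 - cos (u * x)) / x * (indicator {0<..\<delta>} x * k x)) * indicator {0<..\<delta>} x"
      using K(2)
    proof eventually_elim
      fix x assume x: "x \<in> {0<..<\<epsilon>} \<longrightarrow> K \<le> k x"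
      show "ennreal (K * (indicator ?I x *\<^sub>R ((1 - cos (u * x)) / x)))
        \<le> ennreal ((1 - cos (u * x)) / x * (indicator {0<..\<delta>} x * k x)) * indicator {0<..\<delta>} x"
      proof (cases "x \<in> ?I")
        case True
        then have "0 < x" "x < \<epsilon>" "x \<le> \<delta>" using xpos[OF True] eta e by auto
        moreover have "(1 - cos (u * x)) / x * K \<le> (1 - cos (u * x)) / x * k x"
          using x calculation by (intro mult_left_mono) auto
        ultimately show ?thesis using True by (simp add: ennreal_leI mult.commute)
      qed simp
    qed
  qed
  also have "\<dots> = (\<integral>\<^sup>+x. ennreal (1 - cos (u * x)) * indicator ?J x \<partial>\<nu>)" by (rule small_jumps_cos[symmetric])
  also have "\<dots> \<le> (\<integral>\<^sup>+x. ennreal (1 - cos (u * x)) \<partial>\<nu>)"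
    by (rule nn_integral_mono) (auto simp: indicator_def)
  also have "\<dots> = ennreal (LINT x|\<nu>. 1 - cos (u * x))" by (rule nn_integral_one_minus_cos)
  finally have "K * (LINT x|lborel. indicator ?I x *\<^sub>R ((1 - cos (u * x)) / x)) \<le> (LINT x|\<nu>. 1 - cos (u * x))"
    by (subst (asm) ennreal_le_iff) (auto intro!: integral_nonneg_AE)
  moreover have "K * (ln (u * \<eta>) - 1) \<le> K * (LINT x|lborel. indicator ?I x *\<^sub>R ((1 - cos (u * x)) / x))"
    using l K(1) by (intro mult_left_mono) auto
  ultimately have "K * (ln (u * \<eta>) - 1) \<le> (LINT x|\<nu>. 1 - cos (u * x))" by linarith
  moreover have "0 \<le> v / 2 * u\<^sup>2" using v_nonneg by simp
  ultimately have "- v / 2 * u\<^sup>2 - (LINT x|\<nu>. 1 - cos (u * x)) \<le> K * (1 - ln (u * \<eta>))"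
    by (simp add: algebra_simps)
  then show ?thesis unfolding norm_char \<eta>_def by simp
qed

text \<open>With \<open>k\<close> at least \<alpha> + 1 near 0 the modulus is at most of order
  u^(-\<alpha> - 1), one power less than the decay hypothesis allows.\<close>

lemma polynomial_decay_imp_not_large:
  assumes c: "0 < c" "\<And>u. c * (1 + \<bar>u\<bar>) powr (- \<alpha>) \<le> cmod (char \<mu> u)" and \<alpha>: "0 < \<alpha>"
    and e: "0 < \<epsilon>" "\<epsilon> < \<delta>" "AE x in lborel. x \<in> {0<..<\<epsilon>} \<longrightarrow> \<alpha> + 1 \<le> k x"
  shows False
proof -
  have "((\<lambda>u::real. exp ((\<alpha> + 1) * (1 - ln (u * (\<epsilon> / 2)))) * (1 + u) powr \<alpha>) \<longlongrightarrow> 0) at_top"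
    using \<alpha> e(1) by real_asymp
  then have "\<forall>\<^sub>F u in at_top. exp ((\<alpha> + 1) * (1 - ln (u * (\<epsilon> / 2)))) * (1 + u) powr \<alpha> < c"
    using c(1) by (rule order_tendstoD(2))
  moreover have "\<forall>\<^sub>F u::real in at_top. 2 / \<epsilon> \<le> u" by (rule eventually_ge_at_top)
  ultimately have "\<forall>\<^sub>F u in at_top. 2 / \<epsilon> \<le> u \<and> exp ((\<alpha> + 1) * (1 - ln (u * (\<epsilon> / 2)))) * (1 + u) powr \<alpha> < c"
    by eventually_elim simp
  then obtain u where u: "2 / \<epsilon> \<le> u" "exp ((\<alpha> + 1) * (1 - ln (u * (\<epsilon> / 2)))) * (1 + u) powr \<alpha> < c"
    by (metis (mono_tags, lifting) eventually_at_top_linorder order_refl)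
  have u0: "0 < u" using u(1) e(1) by (meson divide_pos_pos less_le_trans zero_less_numeral)
  have "c * (1 + u) powr (- \<alpha>) \<le> exp ((\<alpha> + 1) * (1 - ln (u * (\<epsilon> / 2))))"
    using c(2)[of u] char_upper_bound[OF _ e(3,1,2) u(1)] \<alpha> u0 by simp
  then have "c * (1 + u) powr (- \<alpha>) * (1 + u) powr \<alpha> \<le> exp ((\<alpha> + 1) * (1 - ln (u * (\<epsilon> / 2)))) * (1 + u) powr \<alpha>"
    by (intro mult_right_mono) auto
  then show False using u(2) u0 by (simp add: mult.assoc powr_add[symmetric])
qed

end

section \<open>Reciprocals of infinitely divisible characteristic functions as multipliers\<close>

context levy_triplet
begin

definition large_jumps :: "real measure" where
  "large_jumps = density \<nu> (\<lambda>x. ennreal (indicator (- {-1..1}) x))"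

lemma large_jumps_finite: "finite_borel_measure large_jumps"
proof -
  have s: "sets large_jumps = sets borel" by (simp add: large_jumps_def sets_nu)
  have e: "- {-1..1::real} = {x. 1 < \<bar>x\<bar>}" by auto
  have "emeasure large_jumps (space large_jumps) = (\<integral>\<^sup>+x. indicator (- {-1..1}) x \<partial>\<nu>)"
    unfolding large_jumps_def by (subst emeasure_density) (auto simp: space_nu sets_nu ennreal_indicator)
  also have "\<dots> = emeasure \<nu> (- {-1..1})" using sets_nu by (intro nn_integral_indicator) simp
  also have "\<dots> < \<infinity>" unfolding e by (rule tail_finite) auto
  finally have "finite_measure large_jumps" by (intro finite_measureI) simp
  then show ?thesis using s by (intro finite_borel_measure.intro finite_borel_measure_axioms.intro)
qed

sublocale J: finite_borel_measure large_jumps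
  by (rule large_jumps_finite)

definition small_exponent :: "real \<Rightarrow> real \<Rightarrow> complex" where
  "small_exponent u x = indicator {-1..1} x *\<^sub>R (iexp (u * x) - 1 - \<i> * complex_of_real (u * x))"

definition small_exponent' :: "real \<Rightarrow> real \<Rightarrow> complex" where
  "small_exponent' u x = indicator {-1..1} x *\<^sub>R (\<i> * complex_of_real x * (iexp (u * x) - 1))"

definition small_exponent'' :: "real \<Rightarrow> real \<Rightarrow> complex" where
  "small_exponent'' u x = indicator {-1..1} x *\<^sub>R (- complex_of_real (x\<^sup>2) * iexp (u * x))"

lemma small_exponent_measurable[measurable]:
  "small_exponent u \<in> borel_measurable borel" "small_exponent' u \<in> borel_measurable borel"
  "small_exponent'' u \<in> borel_measurable borel"
  unfolding small_exponent_def[abs_def] small_exponent'_def[abs_def] small_exponent''_def[abs_def] by measurable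

lemma square_le_min: "x \<in> {-1..1} \<Longrightarrow> x\<^sup>2 = min 1 (x\<^sup>2)" for x :: real
  by (simp add: abs_le_iff abs_square_le_1)

text \<open>Every derivative in u brings down a factor x; on [-1, 1] all three functions are of
  order x^2 and thus integrable for any Levy measure. On the large jumps the derivatives would
  require moments.\<close>

lemma small_exponent_bounds:
  "cmod (small_exponent u x) \<le> u\<^sup>2 / 2 * min 1 (x\<^sup>2)"
  "cmod (small_exponent' u x) \<le> \<bar>u\<bar> * min 1 (x\<^sup>2)"
  "cmod (small_exponent'' u x) \<le> 1 * min 1 (x\<^sup>2)"
proof -
  have 0: "0 \<le> min 1 (x\<^sup>2)" by simp
  show "cmod (small_exponent u x) \<le> u\<^sup>2 / 2 * min 1 (x\<^sup>2)"
  proof (cases "x \<in> {-1..1}")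
    case True
    have "cmod (small_exponent u x) \<le> (u * x)\<^sup>2 / 2"
      using iexp_minus_1_minus[of "u * x"] True by (simp add: small_exponent_def)
    also have "\<dots> = u\<^sup>2 / 2 * x\<^sup>2" by (simp add: power_mult_distrib)
    finally show ?thesis using square_le_min[OF True] by simp
  qed (use 0 in \<open>simp add: small_exponent_def\<close>)
  show "cmod (small_exponent' u x) \<le> \<bar>u\<bar> * min 1 (x\<^sup>2)"
  proof (cases "x \<in> {-1..1}")
    case True
    have "cmod (iexp (u * x) - 1) \<le> \<bar>u * x\<bar>" using iexp_approx1[of "u * x" 0] by simp
    then have "\<bar>x\<bar> * cmod (iexp (u * x) - 1) \<le> \<bar>x\<bar> * \<bar>u * x\<bar>" by (intro mult_left_mono) auto
    also have "\<dots> = \<bar>u\<bar> * x\<^sup>2" by (simp add: abs_mult power2_eq_square)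
    finally have "cmod (small_exponent' u x) \<le> \<bar>u\<bar> * x\<^sup>2"
      using True by (simp add: small_exponent'_def norm_mult)
    then show ?thesis using square_le_min[OF True] by simp
  qed (use 0 in \<open>simp add: small_exponent'_def\<close>)
  show "cmod (small_exponent'' u x) \<le> 1 * min 1 (x\<^sup>2)"
  proof (cases "x \<in> {-1..1}")
    case True
    then have "cmod (small_exponent'' u x) = x\<^sup>2" by (simp add: small_exponent''_def norm_mult norm_power)
    then show ?thesis using square_le_min[OF True] by simp
  qed (use 0 in \<open>simp add: small_exponent''_def\<close>)
qed

lemma small_exponent_integrable:
  "integrable \<nu> (small_exponent u)" "integrable \<nu> (small_exponent' u)" "integrable \<nu> (small_exponent'' u)"
  by (rule integrable_levy; rule small_exponent_measurable small_exponent_bounds)+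

lemma iexp_has_vector_derivative:
  "((\<lambda>u. iexp (u * x)) has_vector_derivative iexp (u * x) * (\<i> * of_real x)) (at u)"
  by (rule has_vector_derivative_real_field[of "\<lambda>u. exp (\<i> * (u * of_real x))", simplified of_real_mult[symmetric]])
     (auto intro!: derivative_eq_intros)

lemma small_exponent_has_derivative:
  "((\<lambda>u. CLINT x|\<nu>. small_exponent u x) has_vector_derivative (CLINT x|\<nu>. small_exponent' u x)) (at u)"
proof (rule has_vector_derivative_integral[OF small_exponent_integrable(1)])
  show "small_exponent' u \<in> borel_measurable \<nu>" by measurable
  show "integrable \<nu> (\<lambda>x. (\<bar>u\<bar> + 1) * min 1 (x\<^sup>2))" by (intro integrable_mult_right integrable_min)
  show "cmod (small_exponent' y x) \<le> (\<bar>u\<bar> + 1) * min 1 (x\<^sup>2)" if "\<bar>y - u\<bar> < 1" for y x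
  proof -
    have "\<bar>y\<bar> * min 1 (x\<^sup>2) \<le> (\<bar>u\<bar> + 1) * min 1 (x\<^sup>2)" using that by (intro mult_right_mono) auto
    then show ?thesis using small_exponent_bounds(2)[of y x] by linarith
  qed
  show "((\<lambda>u. small_exponent u x) has_vector_derivative small_exponent' u x) (at u)" for u x
  proof -
    have l: "((\<lambda>u. \<i> * complex_of_real (u * x)) has_vector_derivative \<i> * of_real x) (at u)"
      by (rule has_vector_derivative_real_field[of "\<lambda>u. \<i> * (u * of_real x)", simplified of_real_mult[symmetric]])
         (auto intro!: derivative_eq_intros)
    have "((\<lambda>u. iexp (u * x) - 1 - \<i> * complex_of_real (u * x)) has_vector_derivative
        iexp (u * x) * (\<i> * of_real x) - 0 - \<i> * of_real x) (at u)"
      by (intro has_vector_derivative_diff iexp_has_vector_derivative l has_vector_derivative_const)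
    from bounded_linear.has_vector_derivative[OF bounded_linear_scaleR_right this, of "indicator {-1..1} x"]
    show ?thesis by (simp add: small_exponent_def small_exponent'_def algebra_simps)
  qed
qed

lemma small_exponent'_has_derivative:
  "((\<lambda>u. CLINT x|\<nu>. small_exponent' u x) has_vector_derivative (CLINT x|\<nu>. small_exponent'' u x)) (at u)"
proof (rule has_vector_derivative_integral[OF small_exponent_integrable(2)])
  show "small_exponent'' u \<in> borel_measurable \<nu>" by measurable
  show "integrable \<nu> (\<lambda>x. 1 * min 1 (x\<^sup>2))" by (intro integrable_mult_right integrable_min)
  show "cmod (small_exponent'' y x) \<le> 1 * min 1 (x\<^sup>2)" for y x by (rule small_exponent_bounds(3))
  show "((\<lambda>u. small_exponent' u x) has_vector_derivative small_exponent'' u x) (at u)" for u x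
  proof -
    have "((\<lambda>u. \<i> * complex_of_real x * (iexp (u * x) - 1)) has_vector_derivative
        \<i> * complex_of_real x * (iexp (u * x) * (\<i> * of_real x) - 0)) (at u)"
      by (intro has_vector_derivative_mult_right has_vector_derivative_diff iexp_has_vector_derivative has_vector_derivative_const)
    from bounded_linear.has_vector_derivative[OF bounded_linear_scaleR_right this, of "indicator {-1..1} x"]
    show ?thesis by (simp add: small_exponent'_def small_exponent''_def algebra_simps power2_eq_square)
  qed
qed

lemma small_exponent''_continuous: "continuous_on UNIV (\<lambda>u. CLINT x|\<nu>. small_exponent'' u x)"
  unfolding continuous_on_eq_continuous_at[OF open_UNIV]
proof (intro ballI, unfold continuous_at_sequentially, intro allI impI)
  fix u :: real and X :: "nat \<Rightarrow> real" assume X: "X \<longlonglongrightarrow> u"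
  have "(\<lambda>n. CLINT x|\<nu>. small_exponent'' (X n) x) \<longlonglongrightarrow> (CLINT x|\<nu>. small_exponent'' u x)"
  proof (rule integral_dominated_convergence)
    show "integrable \<nu> (\<lambda>x. 1 * min 1 (x\<^sup>2))" by (intro integrable_mult_right integrable_min)
    show "AE x in \<nu>. (\<lambda>n. small_exponent'' (X n) x) \<longlonglongrightarrow> small_exponent'' u x"
      unfolding small_exponent''_def by (intro AE_I2 tendsto_intros X)
    show "AE x in \<nu>. cmod (small_exponent'' (X n) x) \<le> 1 * min 1 (x\<^sup>2)" for n
      by (intro AE_I2 small_exponent_bounds)
  qed measurable
  then show "((\<lambda>u. CLINT x|\<nu>. small_exponent'' u x) \<circ> X) \<longlonglongrightarrow> (CLINT x|\<nu>. small_exponent'' u x)"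
    by (simp add: o_def)
qed

definition local_exponent :: "real \<Rightarrow> complex" where
  "local_exponent u = - complex_of_real (v / 2 * u\<^sup>2) + \<i> * complex_of_real (\<gamma> * u) + (CLINT x|\<nu>. small_exponent u x)"

definition local_exponent' :: "real \<Rightarrow> complex" where
  "local_exponent' u = - complex_of_real (v * u) + \<i> * complex_of_real \<gamma> + (CLINT x|\<nu>. small_exponent' u x)"

definition local_exponent'' :: "real \<Rightarrow> complex" where
  "local_exponent'' u = - complex_of_real v + (CLINT x|\<nu>. small_exponent'' u x)"

lemma local_exponent_has_derivative:
  "(local_exponent has_vector_derivative local_exponent' u) (at u)"
  "(local_exponent' has_vector_derivative local_exponent'' u) (at u)"
proof -
  have 1: "((\<lambda>u. - complex_of_real (v / 2 * u\<^sup>2) + \<i> * complex_of_real (\<gamma> * u)) has_vector_derivative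
      - complex_of_real (v * u) + \<i> * complex_of_real \<gamma>) (at u)"
  proof -
    have a: "((\<lambda>u. v / 2 * u\<^sup>2) has_vector_derivative v * u) (at u)"
      unfolding has_real_derivative_iff_has_vector_derivative[symmetric] by (auto intro!: derivative_eq_intros)
    have b: "((\<lambda>u. \<gamma> * u) has_vector_derivative \<gamma>) (at u)"
      unfolding has_real_derivative_iff_has_vector_derivative[symmetric] by (auto intro!: derivative_eq_intros)
    show ?thesis
      by (intro has_vector_derivative_add has_vector_derivative_minus has_vector_derivative_mult_right
          bounded_linear.has_vector_derivative[OF bounded_linear_of_real] a b)
  qed
  show "(local_exponent has_vector_derivative local_exponent' u) (at u)"
    unfolding local_exponent_def[abs_def] local_exponent'_def
    by (rule has_vector_derivative_add[OF 1 small_exponent_has_derivative])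
  have 2: "((\<lambda>u. - complex_of_real (v * u) + \<i> * complex_of_real \<gamma>) has_vector_derivative - complex_of_real v) (at u)"
  proof -
    have "((\<lambda>u. v * u) has_vector_derivative v) (at u)"
      unfolding has_real_derivative_iff_has_vector_derivative[symmetric] by (auto intro!: derivative_eq_intros)
    from has_vector_derivative_add[OF has_vector_derivative_minus[OF
        bounded_linear.has_vector_derivative[OF bounded_linear_of_real this]] has_vector_derivative_const]
    show ?thesis by simp
  qed
  show "(local_exponent' has_vector_derivative local_exponent'' u) (at u)"
    unfolding local_exponent'_def[abs_def] local_exponent''_def
    by (rule has_vector_derivative_add[OF 2 small_exponent'_has_derivative])
qed

text \<open>Outside [-1, 1] the compensator is absent, so the large jumps contribute exactly their
  transform minus their mass. The cut at 1 is that of the characteristic exponent, hence no drift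
  correction arises.\<close>

lemma char_factorization:
  "char \<mu> u = exp (local_exponent u + (J.ft u - complex_of_real J.total_mass))"
proof -
  have tm: "complex_of_real J.total_mass = (CLINT x|\<nu>. indicator (- {-1..1}) x *\<^sub>R 1)"
  proof -
    have "complex_of_real J.total_mass = (CLINT x|large_jumps. 1)"
      by (simp add: J.total_mass_def J.space_UNIV scaleR_conv_of_real)
    also have "\<dots> = (CLINT x|\<nu>. (indicator (- {-1..1}) x :: real) *\<^sub>R 1)"
      unfolding large_jumps_def
      using integral_density[of "\<lambda>x. 1 :: complex" \<nu> "indicator (- {-1..1})"] sets_nu by simp
    finally show ?thesis .
  qed
  have ft: "J.ft u = (CLINT x|\<nu>. (indicator (- {-1..1}) x :: real) *\<^sub>R iexp (u * x))"
    unfolding J.ft_def unfolding large_jumps_def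
    using integral_density[of "\<lambda>x. iexp (u * x)" \<nu> "indicator (- {-1..1})"] sets_nu by simp
  have ind: "integrable \<nu> (\<lambda>x. (indicator (- {-1..1}) x :: real) *\<^sub>R g x)"
    if [measurable]: "g \<in> borel_measurable borel" and "\<And>x. cmod (g x) \<le> 1" for g :: "real \<Rightarrow> complex"
  proof (rule integrable_levy)
    show "norm ((indicator (- {-1..1}) x :: real) *\<^sub>R g x) \<le> 1 * min 1 (x\<^sup>2)" for x
    proof (cases "x \<in> {-1..1}")
      case False
      then have "1 \<le> \<bar>x\<bar>" by auto
      then have "1 \<le> x\<^sup>2" by (simp add: one_le_power abs_le_square_iff[of 1 x, simplified])
      then show ?thesis using that(2)[of x] False by simp
    qed simp
  qed measurable
  have ii: "integrable \<nu> (\<lambda>x. (indicator (- {-1..1}) x :: real) *\<^sub>R iexp (u * x))"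
    "integrable \<nu> (\<lambda>x. (indicator (- {-1..1}) x :: real) *\<^sub>R (1 :: complex))"
    by (rule ind; simp)+
  have "(CLINT x|\<nu>. exponent u x) = (CLINT x|\<nu>. small_exponent u x
      + ((indicator (- {-1..1}) x :: real) *\<^sub>R iexp (u * x) - (indicator (- {-1..1}) x :: real) *\<^sub>R 1))"
    by (intro Bochner_Integration.integral_cong refl) (auto simp: exponent_def small_exponent_def indicator_def)
  also have "\<dots> = (CLINT x|\<nu>. small_exponent u x) + (J.ft u - complex_of_real J.total_mass)"
    unfolding tm ft using ii small_exponent_integrable(1)[of u] by simp
  finally show ?thesis by (simp add: char_eq local_exponent_def add.assoc)
qed

section \<open>The twice differentiable factor of the reciprocal\<close>

definition local_recip :: "real \<Rightarrow> complex" where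
  "local_recip u = exp (- local_exponent u)"

definition local_recip' :: "real \<Rightarrow> complex" where
  "local_recip' u = - local_exponent' u * local_recip u"

definition local_recip'' :: "real \<Rightarrow> complex" where
  "local_recip'' u = ((local_exponent' u)\<^sup>2 - local_exponent'' u) * local_recip u"

lemma local_recip_has_derivative:
  "(local_recip has_vector_derivative local_recip' u) (at u)"
  "(local_recip' has_vector_derivative local_recip'' u) (at u)"
proof -
  have m: "((\<lambda>u. - local_exponent u) has_vector_derivative - local_exponent' u) (at u)" for u
    by (intro has_vector_derivative_minus local_exponent_has_derivative)
  have d: "(local_recip has_vector_derivative local_recip' u) (at u)" for u
    using field_vector_diff_chain_at[OF m[of u] DERIV_exp]
    by (simp add: local_recip_def[abs_def] local_recip'_def o_def)
  show "(local_recip has_vector_derivative local_recip' u) (at u)" by (rule d)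
  have "((\<lambda>u. - local_exponent' u) has_vector_derivative - local_exponent'' u) (at u)"
    by (intro has_vector_derivative_minus local_exponent_has_derivative)
  from has_vector_derivative_mult[OF this d]
  show "(local_recip' has_vector_derivative local_recip'' u) (at u)"
    by (simp add: local_recip'_def[abs_def] local_recip''_def algebra_simps power2_eq_square)
qed

lemma local_recip_continuous: "continuous_on UNIV local_recip" "continuous_on UNIV local_recip''"
proof -
  show c: "continuous_on UNIV local_recip"
    using local_recip_has_derivative(1) by (meson continuous_at_imp_continuous_on has_vector_derivative_continuous)
  have "continuous_on UNIV local_exponent'"
    using local_exponent_has_derivative(2) by (meson continuous_at_imp_continuous_on has_vector_derivative_continuous)
  moreover have "continuous_on UNIV local_exponent''"
    unfolding local_exponent''_def[abs_def] by (intro continuous_intros small_exponent''_continuous)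
  ultimately show "continuous_on UNIV local_recip''"
    unfolding local_recip''_def[abs_def] by (intro continuous_intros c)
qed

lemma recip_char_eq: "1 / char \<mu> u = exp (complex_of_real J.total_mass) * (local_recip u * exp (- J.ft u))"
  unfolding char_factorization local_recip_def
  by (simp add: exp_add exp_diff exp_minus field_simps)

text \<open>In \<open>char \<mu> u\<close> the factor of the large jumps has modulus at most 1, so
  omitting it can only enlarge the modulus, and the decay hypothesis passes to the remaining
  factor.\<close>

lemma norm_local_recip_le: "cmod (local_recip u) \<le> cmod (1 / char \<mu> u)"
proof -
  have "Re (J.ft u) \<le> J.total_mass" using complex_Re_le_cmod J.norm_ft_le order_trans by blast
  then have "1 \<le> exp (J.total_mass - Re (J.ft u))" by simp
  then have "cmod (local_recip u) * 1 \<le> cmod (local_recip u) * exp (J.total_mass - Re (J.ft u))"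
    by (intro mult_left_mono) auto
  also have "\<dots> = cmod (1 / char \<mu> u)"
  proof -
    have "cmod (1 / char \<mu> u) = exp J.total_mass * (cmod (local_recip u) * exp (- Re (J.ft u)))"
      unfolding recip_char_eq norm_mult norm_exp_eq_Re by simp
    also have "\<dots> = cmod (local_recip u) * (exp J.total_mass * exp (- Re (J.ft u)))" by (rule mult.left_commute)
    finally show ?thesis by (simp add: exp_add[symmetric])
  qed
  finally show ?thesis by simp
qed

text \<open>The logarithmic derivative grows at most linearly and its derivative is bounded, so the
  second derivative of the reciprocal gains at most two powers of u over the reciprocal itself; the
  same exponent serves for all three.\<close>

lemma local_recip_growth:
  assumes c: "0 < c" "\<And>u. c * (1 + \<bar>u\<bar>) powr (- \<alpha>) \<le> cmod (char \<mu> u)"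
  obtains D where "0 < D" "\<And>u. cmod (local_recip u) \<le> D * (1 + \<bar>u\<bar>) powr (\<alpha> + 2)"
    "\<And>u. cmod (local_recip' u) \<le> D * (1 + \<bar>u\<bar>) powr (\<alpha> + 2)"
    "\<And>u. cmod (local_recip'' u) \<le> D * (1 + \<bar>u\<bar>) powr (\<alpha> + 2)"
proof -
  define m where "m = (LINT x|\<nu>. min 1 (x\<^sup>2))"
  have m0: "0 \<le> m" unfolding m_def by (intro integral_nonneg_AE AE_I2) simp
  define B where "B = v + \<bar>\<gamma>\<bar> + m + 1"
  have B1: "1 \<le> B" using v_nonneg m0 by (simp add: B_def)
  have int: "cmod (CLINT x|\<nu>. f x) \<le> C * m" if "integrable \<nu> f" "\<And>x. cmod (f x) \<le> C * min 1 (x\<^sup>2)" for f C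
  proof -
    have "cmod (CLINT x|\<nu>. f x) \<le> (LINT x|\<nu>. cmod (f x))" by (rule integral_norm_bound)
    also have "\<dots> \<le> (LINT x|\<nu>. C * min 1 (x\<^sup>2))"
      by (intro integral_mono integrable_norm that integrable_mult_right integrable_min)
    finally show ?thesis by (simp add: m_def)
  qed
  have e1: "cmod (local_exponent' u) \<le> B * (1 + \<bar>u\<bar>)" for u
  proof -
    have "cmod (local_exponent' u) \<le> cmod (- complex_of_real (v * u)) + cmod (\<i> * complex_of_real \<gamma>) + cmod (CLINT x|\<nu>. small_exponent' u x)"
      unfolding local_exponent'_def by (meson add_right_mono norm_triangle_ineq order_trans)
    also have "\<dots> \<le> v * \<bar>u\<bar> + \<bar>\<gamma>\<bar> + \<bar>u\<bar> * m"
      using int[OF small_exponent_integrable(2) small_exponent_bounds(2), of u] v_nonneg by (simp add: norm_mult abs_mult)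
    also have "\<dots> \<le> B * (1 + \<bar>u\<bar>)"
    proof -
      have "0 \<le> v + m + 1 + \<bar>\<gamma>\<bar> * \<bar>u\<bar> + \<bar>u\<bar>" using v_nonneg m0 by simp
      then show ?thesis by (simp add: B_def algebra_simps)
    qed
    finally show ?thesis .
  qed
  have e2: "cmod (local_exponent'' u) \<le> B" for u
  proof -
    have "cmod (local_exponent'' u) \<le> cmod (- complex_of_real v) + cmod (CLINT x|\<nu>. small_exponent'' u x)"
      unfolding local_exponent''_def by (rule norm_triangle_ineq)
    also have "\<dots> \<le> v + 1 * m"
      using int[OF small_exponent_integrable(3) small_exponent_bounds(3), of u] v_nonneg by simp
    finally show ?thesis by (simp add: B_def)
  qed
  have r: "cmod (local_recip u) \<le> inverse c * (1 + \<bar>u\<bar>) powr \<alpha>" for u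
  proof -
    have p: "0 < c * (1 + \<bar>u\<bar>) powr (- \<alpha>)" using c(1) by simp
    have "cmod (local_recip u) \<le> 1 / cmod (char \<mu> u)" using norm_local_recip_le[of u] by (simp add: norm_divide)
    also have "\<dots> \<le> 1 / (c * (1 + \<bar>u\<bar>) powr (- \<alpha>))"
      using c(2)[of u] p by (intro divide_left_mono) (auto intro: mult_pos_pos less_le_trans)
    also have "\<dots> = inverse c * (1 + \<bar>u\<bar>) powr \<alpha>" by (simp add: powr_minus divide_inverse)
    finally show ?thesis .
  qed
  \<comment> \<open>The factor 2 B^2 covers the square of the first derivative of the exponent plus
    its second derivative.\<close>
  define D where "D = 2 * B\<^sup>2 * inverse c"
  have main: "X * cmod (local_recip u) \<le> D * (1 + \<bar>u\<bar>) powr (\<alpha> + 2)" if "0 \<le> X" "X \<le> 2 * B\<^sup>2 * (1 + \<bar>u\<bar>)\<^sup>2" for X u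
  proof -
    have "X * cmod (local_recip u) \<le> (2 * B\<^sup>2 * (1 + \<bar>u\<bar>)\<^sup>2) * (inverse c * (1 + \<bar>u\<bar>) powr \<alpha>)"
      using that r[of u] by (intro mult_mono) auto
    also have "\<dots> = D * ((1 + \<bar>u\<bar>) powr \<alpha> * (1 + \<bar>u\<bar>) powr 2)"
      by (simp add: D_def powr_numeral mult_ac)
    finally show ?thesis by (simp add: powr_add)
  qed
  have q: "1 \<le> B\<^sup>2" "1 \<le> (1 + \<bar>u\<bar>)\<^sup>2" "B \<le> B\<^sup>2" "1 + \<bar>u\<bar> \<le> (1 + \<bar>u\<bar>)\<^sup>2" for u :: real
    using B1 self_le_power[of B 2] self_le_power[of "1 + \<bar>u\<bar>" 2] one_le_power[of B 2] one_le_power[of "1 + \<bar>u\<bar>" 2] by auto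
  show ?thesis
  proof (rule that[of D])
    show "0 < D" using B1 c(1) by (simp add: D_def)
    show "cmod (local_recip u) \<le> D * (1 + \<bar>u\<bar>) powr (\<alpha> + 2)" for u
    proof -
      have "1 * 1 \<le> 2 * B\<^sup>2 * (1 + \<bar>u\<bar>)\<^sup>2" using q(1) q(2)[of u] by (intro mult_mono) auto
      then show ?thesis using main[of 1 u] by simp
    qed
    show "cmod (local_recip' u) \<le> D * (1 + \<bar>u\<bar>) powr (\<alpha> + 2)" for u
    proof -
      have "cmod (local_exponent' u) \<le> B * (1 + \<bar>u\<bar>)" by (rule e1)
      also have "\<dots> \<le> 2 * B\<^sup>2 * (1 + \<bar>u\<bar>)\<^sup>2" using q(3) q(4)[of u] q(1) B1 by (intro mult_mono) auto
      finally show ?thesis unfolding local_recip'_def by (simp add: norm_mult main)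
    qed
    show "cmod (local_recip'' u) \<le> D * (1 + \<bar>u\<bar>) powr (\<alpha> + 2)" for u
    proof -
      have "cmod ((local_exponent' u)\<^sup>2 - local_exponent'' u) \<le> (cmod (local_exponent' u))\<^sup>2 + cmod (local_exponent'' u)"
        by (rule order_trans[OF norm_triangle_ineq4]) (simp add: norm_power)
      also have "\<dots> \<le> (B * (1 + \<bar>u\<bar>))\<^sup>2 + B"
        by (intro add_mono power_mono e1 e2) auto
      also have "\<dots> \<le> B\<^sup>2 * (1 + \<bar>u\<bar>)\<^sup>2 + B\<^sup>2 * (1 + \<bar>u\<bar>)\<^sup>2"
      proof -
        have "B * 1 \<le> B\<^sup>2 * (1 + \<bar>u\<bar>)\<^sup>2" using q(3) q(2)[of u] B1 by (intro mult_mono) auto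
        then show ?thesis by (simp add: power_mult_distrib)
      qed
      finally show ?thesis unfolding local_recip''_def norm_mult by (intro main) auto
    qed
  qed
qed

text \<open>The order \<alpha> + 3 is the growth \<alpha> + 2 of the local factor plus 1 for the
  length of the frequency ring in \<open>wide_kernel_bound\<close>.\<close>

lemma recip_char_multiplier:
  assumes \<psi>: "dyadic_partition \<psi>" "cutoffs \<psi> \<psi>'"
    and c: "0 < \<alpha>" "0 < c" "\<And>u. c * (1 + \<bar>u\<bar>) powr (- \<alpha>) \<le> cmod (char \<mu> u)"
  shows "\<exists>\<beta>>0. \<forall>s p q. 1 \<le> p \<longrightarrow> 1 \<le> q \<longrightarrow> bounded_multiplier \<psi> \<psi>' (\<lambda>u. 1 / char \<mu> u) (s + \<beta>) s p q"
proof -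
  interpret dyadic \<psi> by unfold_locales (rule \<psi>(1))
  obtain D where D: "0 < D" "\<And>u. cmod (local_recip u) \<le> D * (1 + \<bar>u\<bar>) powr (\<alpha> + 2)"
    "\<And>u. cmod (local_recip' u) \<le> D * (1 + \<bar>u\<bar>) powr (\<alpha> + 2)"
    "\<And>u. cmod (local_recip'' u) \<le> D * (1 + \<bar>u\<bar>) powr (\<alpha> + 2)"
    using local_recip_growth[OF c(2,3)] by metis
  obtain C0 where C0: "0 < C0" "\<And>k e e1 e2 A.
     (\<And>u. (e has_vector_derivative e1 u) (at u)) \<Longrightarrow> (\<And>u. (e1 has_vector_derivative e2 u) (at u)) \<Longrightarrow>
     continuous_on UNIV e2 \<Longrightarrow>
     (\<And>u. \<bar>u\<bar> \<le> 8 * 2 ^ k \<Longrightarrow> k \<le> 2 \<or> 2 ^ k \<le> 8 * \<bar>u\<bar> \<Longrightarrow> norm (e u) \<le> A \<and> norm (e1 u) \<le> A \<and> norm (e2 u) \<le> (A::real)) \<Longrightarrow>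
     integrable lborel (inv_fourier (\<lambda>u. of_real (wide k u) * e u)) \<and>
     (LINT x|lborel. norm (inv_fourier (\<lambda>u. of_real (wide k u) * e u) x)) \<le> C0 * 2 ^ k * A"
    using wide_kernel_bound by blast
  let ?T = "exp (complex_of_real J.total_mass)"
  have nT: "norm ?T = exp J.total_mass" by (simp add: norm_exp_eq_Re)
  have sym: "inv_fourier (\<lambda>u. complex_of_real (\<rho> u) * (1 / char \<mu> u))
      = (\<lambda>x. ?T * inv_fourier (\<lambda>u. (complex_of_real (\<rho> u) * local_recip u) * exp (- J.ft u)) x)" for \<rho>
  proof -
    have "(\<lambda>u. complex_of_real (\<rho> u) * (1 / char \<mu> u)) = (\<lambda>u. ?T * ((complex_of_real (\<rho> u) * local_recip u) * exp (- J.ft u)))"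
      unfolding recip_char_eq by (simp only: mult_ac)
    then show ?thesis by (simp only:) (rule ext, rule inv_fourier_cmult)
  qed
  have int: "integrable lborel (\<lambda>u. complex_of_real (\<rho> u) * local_recip u)"
    "integrable lborel (inv_fourier (\<lambda>u. complex_of_real (\<rho> u) * local_recip u))"
    if \<rho>: "smooth \<rho>" "compact (fsupport \<rho>)" for \<rho>
  proof -
    obtain R where R: "\<And>x. R \<le> \<bar>x\<bar> \<Longrightarrow> \<rho> x = 0" using compact_fsupportD[OF \<rho>(2)] by metis
    show "integrable lborel (\<lambda>u. complex_of_real (\<rho> u) * local_recip u)"
    proof (rule continuous_compact_support_integrable)
      show "continuous_on UNIV (\<lambda>u. complex_of_real (\<rho> u) * local_recip u)"
        by (intro continuous_intros smooth_continuous_on[OF \<rho>(1)] local_recip_continuous)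
      show "complex_of_real (\<rho> u) * local_recip u = 0" if "u \<notin> {- R..R}" for u
        using that R[of u] by fastforce
    qed
    show "integrable lborel (inv_fourier (\<lambda>u. complex_of_real (\<rho> u) * local_recip u))"
      by (rule smooth_cutoff_symbol[OF \<rho> local_recip_has_derivative local_recip_continuous(2)])
  qed
  \<comment> \<open>One exponential of the mass is the normalising constant in
    \<open>recip_char_eq\<close>, the other the cost of \<open>exp (- J.ft u)\<close>; the 9 comes
    from 1 + 8 * 2^k \<le> 9 * 2^k.\<close>
  define C where "C = exp J.total_mass * (exp J.total_mass * (C0 * (D * 9 powr (\<alpha> + 2))))"
  have "polynomial_multiplier \<psi> \<psi>' (\<lambda>u. 1 / char \<mu> u) (\<alpha> + 3) C"
  proof unfold_locales
    show "cutoffs \<psi> \<psi>'" by (rule \<psi>(2))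
    show "continuous_on UNIV (\<lambda>u. 1 / char \<mu> u)" by (intro continuous_intros char_continuous) (simp add: char_nonzero)
    show "integrable lborel (inv_fourier (\<lambda>u. complex_of_real (\<rho> u) * (1 / char \<mu> u)))"
      if "smooth \<rho>" "compact (fsupport \<rho>)" for \<rho>
      unfolding sym by (intro integrable_mult_right J.inv_fourier_exp_ft_L1 int that)
    show "0 < C" using C0(1) D(1) by (simp add: C_def)
    fix k
    define A where "A = D * (9 * 2 ^ k) powr (\<alpha> + 2)"
    have "integrable lborel (inv_fourier (\<lambda>u. of_real (wide k u) * local_recip u)) \<and>
     (LINT x|lborel. norm (inv_fourier (\<lambda>u. of_real (wide k u) * local_recip u) x)) \<le> C0 * 2 ^ k * A"
    proof (rule C0(2)[OF local_recip_has_derivative local_recip_continuous(2)])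
      fix u :: real assume "\<bar>u\<bar> \<le> 8 * 2 ^ k"
      moreover have "(1::real) \<le> 2 ^ k" by simp
      ultimately have "1 + \<bar>u\<bar> \<le> 9 * 2 ^ k" by linarith
      then have "D * (1 + \<bar>u\<bar>) powr (\<alpha> + 2) \<le> A"
        unfolding A_def using D(1) c(1) by (intro mult_left_mono powr_mono2) auto
      then show "cmod (local_recip u) \<le> A \<and> cmod (local_recip' u) \<le> A \<and> cmod (local_recip'' u) \<le> A"
        using D(2-4)[of u] by linarith
    qed
    then have b: "(LINT x|lborel. norm (inv_fourier (\<lambda>u. of_real (wide k u) * local_recip u) x)) \<le> C0 * 2 ^ k * A" by blast
    note i = int[OF smooth_wide compact_wide_support, of k]
    have "(LINT x|lborel. norm (inv_fourier (\<lambda>u. complex_of_real (wide k u) * (1 / char \<mu> u)) x))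
        = exp J.total_mass * (LINT x|lborel. norm (inv_fourier (\<lambda>u. (complex_of_real (wide k u) * local_recip u) * exp (- J.ft u)) x))"
      unfolding sym norm_mult[of ?T] nT by (rule integral_mult_right_zero)
    also have "\<dots> \<le> exp J.total_mass * (exp J.total_mass * (C0 * 2 ^ k * A))"
      by (intro mult_left_mono order_trans[OF J.inv_fourier_exp_ft_L1(2)[OF i]] b) auto
    also have "\<dots> = C * 2 powr ((\<alpha> + 3) * real k)"
    proof -
      have "(9 * 2 ^ k :: real) powr (\<alpha> + 2) = 9 powr (\<alpha> + 2) * (2 ^ k) powr (\<alpha> + 2)" by (rule powr_mult)
      moreover have "(2 ^ k :: real) powr (\<alpha> + 2) = 2 powr ((\<alpha> + 2) * real k)"
        by (simp add: powr_realpow[symmetric] powr_powr mult.commute)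
      moreover have "(2::real) ^ k * 2 powr ((\<alpha> + 2) * real k) = 2 powr ((\<alpha> + 3) * real k)"
        by (simp add: powr_realpow[symmetric] powr_add[symmetric] algebra_simps)
      ultimately have "2 ^ k * (9 * 2 ^ k :: real) powr (\<alpha> + 2) = 9 powr (\<alpha> + 2) * 2 powr ((\<alpha> + 3) * real k)"
        by (simp add: mult.left_commute)
      moreover have "C0 * 2 ^ k * A = C0 * (D * (2 ^ k * (9 * 2 ^ k) powr (\<alpha> + 2)))"
        unfolding A_def by (simp only: mult_ac)
      ultimately show ?thesis unfolding C_def by (simp only: mult.assoc)
    qed
    finally show "(LINT x|lborel. norm (inv_fourier (\<lambda>u. complex_of_real (wide k u) * (1 / char \<mu> u)) x)) \<le> C * 2 powr ((\<alpha> + 3) * real k)" .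
  qed
  then interpret polynomial_multiplier \<psi> \<psi>' "\<lambda>u. 1 / char \<mu> u" "\<alpha> + 3" C .
  show ?thesis using bounded_multiplier c(1) by (intro exI[of _ "\<alpha> + 3"]) auto
qed

lemma multiplier_imp_polynomial_decay:
  assumes \<psi>: "dyadic_partition \<psi>" "cutoffs \<psi> \<psi>'" and \<alpha>: "0 < \<alpha>"
    and bm: "bounded_multiplier \<psi> \<psi>' (\<lambda>u. 1 / char \<mu> u) \<alpha> 0 \<infinity> \<infinity>"
  shows "\<exists>c>0. \<forall>u. c * (1 + \<bar>u\<bar>) powr (- \<alpha>) \<le> cmod (char \<mu> u)"
proof -
  interpret dyadic \<psi> by unfold_locales (rule \<psi>(1))
  have "continuous_on UNIV (\<lambda>u. 1 / char \<mu> u)" by (intro continuous_intros char_continuous) (simp add: char_nonzero)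
  from bounded_multiplier_polynomial_growth[OF \<psi>(2) this \<alpha> bm]
  obtain C where C: "0 < C" "\<And>u. cmod (1 / char \<mu> u) \<le> C * (1 + \<bar>u\<bar>) powr \<alpha>" by blast
  have "inverse C * (1 + \<bar>u\<bar>) powr (- \<alpha>) \<le> cmod (char \<mu> u)" for u
  proof -
    have p: "0 < cmod (char \<mu> u)" "0 < (1 + \<bar>u\<bar>) powr \<alpha>" using char_nonzero by auto
    have "1 \<le> C * (1 + \<bar>u\<bar>) powr \<alpha> * cmod (char \<mu> u)"
      using C(2)[of u] p(1) by (simp add: norm_divide field_simps)
    then show ?thesis using C(1) p by (simp add: powr_minus field_simps)
  qed
  then show ?thesis using C(1) by (intro exI[of _ "inverse C"]) auto
qed

end

theorem theorem5:
  fixes \<mu> \<nu> :: "real measure" and v \<gamma> \<delta> :: real and k\<^sub>s :: "real \<Rightarrow> real"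
    and \<psi> \<psi>' :: "nat \<Rightarrow> real \<Rightarrow> real"
  assumes "infinitely_divisible \<mu>"
    and "characteristic_triplet \<mu> v \<gamma> \<nu>"
    and "0 < \<delta>" and "\<delta> < 1"
    and "lebesgue_density_on (density (sym_jump_measure \<nu>) (\<lambda>x. ennreal x)) {0<..\<delta>} k\<^sub>s"
    and "\<And>\<epsilon>. 0 < \<epsilon> \<Longrightarrow> \<epsilon> < \<delta> \<Longrightarrow> k\<^sub>s \<in> BV \<epsilon> \<delta>"
    and "pos_variation0 \<delta> k\<^sub>s < \<infinity>"
    and "dyadic_partition \<psi>"
    and "cutoffs \<psi> \<psi>'"
  shows "let
      i = (v = 0 \<and> BV_norm0 \<delta> k\<^sub>s < \<infinity>);
      ii = (v = 0 \<and>
        (\<exists>g L. right_continuous_version \<delta> k\<^sub>s g \<and>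
           ((\<lambda>x. ereal (g x)) \<longlongrightarrow> L) (at_right 0) \<and> L < \<infinity>));
      iii = (\<exists>\<alpha>>0. \<exists>c>0. \<forall>u. cmod (char \<mu> u) \<ge> c * (1 + \<bar>u\<bar>) powr (- \<alpha>))
    in (i \<longleftrightarrow> ii) \<and> (ii \<longleftrightarrow> iii) \<and>
       ((i \<or> ii \<or> iii) \<longleftrightarrow>
          (\<exists>\<alpha>>0. \<forall>s p q. 1 \<le> p \<longrightarrow> 1 \<le> q \<longrightarrow>
             bounded_multiplier \<psi> \<psi>' (\<lambda>u. 1 / char \<mu> u) (s + \<alpha>) s p q))"
proof -
  have \<mu>: "real_distribution \<mu>" using assms(1) by (simp add: infinitely_divisible_def)
  interpret levy_density \<mu> v \<gamma> \<nu> \<delta> k\<^sub>s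
    by (intro levy_density.intro levy_triplet.intro levy_triplet_axioms.intro levy_density_axioms.intro \<mu> assms)
  interpret bv: BV_near_zero_pos_bounded \<delta> k\<^sub>s
    by (intro BV_near_zero_pos_bounded.intro BV_near_zero.intro BV_near_zero_pos_bounded_axioms.intro assms)
  \<comment> \<open>Conditions (i) and (ii) both unfold to \<open>v = 0 \<and> bdd\<close>, so each
    implication is proved once, with \<open>decay\<close> as the hub.\<close>
  define bdd where "bdd \<longleftrightarrow> (\<exists>B. \<forall>x\<in>{0<..<\<delta>}. bv.nv x \<le> B)"
  define decay where "decay \<longleftrightarrow> (\<exists>\<alpha>>0. \<exists>c>0. \<forall>u. cmod (char \<mu> u) \<ge> c * (1 + \<bar>u\<bar>) powr (- \<alpha>))"
  define mult where "mult \<longleftrightarrow> (\<exists>\<alpha>>0. \<forall>s p q. 1 \<le> p \<longrightarrow> 1 \<le> q \<longrightarrow>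
    bounded_multiplier \<psi> \<psi>' (\<lambda>u. 1 / char \<mu> u) (s + \<alpha>) s p q)"
  have decay if v0: "v = 0" and b: bdd
  proof -
    obtain K where "0 < K" "AE x in lborel. x \<in> {0<..<\<delta>} \<longrightarrow> k\<^sub>s x \<le> K"
      using bv.bounded_near_zero b unfolding bdd_def by metis
    from char_polynomial_lower_bound[OF this v0] show ?thesis unfolding decay_def .
  qed
  moreover have "v = 0 \<and> bdd" if decay
  proof -
    from that obtain \<alpha> c where c: "0 < \<alpha>" "0 < c" "\<And>u. c * (1 + \<bar>u\<bar>) powr (- \<alpha>) \<le> cmod (char \<mu> u)"
      unfolding decay_def by blast
    have "bdd"
    proof (rule ccontr)
      assume "\<not> bdd"
      then obtain \<epsilon> where "0 < \<epsilon>" "\<epsilon> < \<delta>" "AE x in lborel. x \<in> {0<..<\<epsilon>} \<longrightarrow> \<alpha> + 1 \<le> k\<^sub>s x"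
        using bv.unbounded_near_zero unfolding bdd_def by metis
      from polynomial_decay_imp_not_large[OF c(2,3,1) this] show False .
    qed
    then show ?thesis using polynomial_decay_imp_no_gaussian[OF c(2,3)] by blast
  qed
  moreover have mult if decay
    using that recip_char_multiplier[OF assms(8,9)] unfolding decay_def mult_def by blast
  moreover have decay if mult
  proof -
    from that obtain \<alpha> where \<alpha>: "0 < \<alpha>" "\<And>s p q. 1 \<le> p \<Longrightarrow> 1 \<le> q \<Longrightarrow>
        bounded_multiplier \<psi> \<psi>' (\<lambda>u. 1 / char \<mu> u) (s + \<alpha>) s p q"
      unfolding mult_def by blast
    have "bounded_multiplier \<psi> \<psi>' (\<lambda>u. 1 / char \<mu> u) \<alpha> 0 \<infinity> \<infinity>" using \<alpha>(2)[of \<infinity> \<infinity> 0] by simp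
    from multiplier_imp_polynomial_decay[OF assms(8,9) \<alpha>(1) this] \<alpha>(1) show ?thesis
      unfolding decay_def by blast
  qed
  ultimately have "(v = 0 \<and> bdd \<longleftrightarrow> decay) \<and> (decay \<longleftrightarrow> mult)" by blast
  then show ?thesis
    unfolding Let_def bv.BV_norm0_finite_iff bv.right_limit_finite_iff bdd_def[symmetric] decay_def[symmetric] mult_def[symmetric]
    by blast
qed

end
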